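(* Let $\alpha>0$ and let $D^\alpha$ be the operator on $\mathcal D(V)$ defined in the context. Then: (i) $D^\alpha$ is essentially selfadjoint on $L_2(V,\mu)$; its closure has purely discrete spectrum consisting of the eigenvalues $\varphi^{(\alpha)}_n=q^{\alpha nm_n}$ for $n\ge1$ and $\varphi^{(\alpha)}_0=0$, the eigenspace for $\varphi^{(\alpha)}_n$ being spanned by the characters in $V_n^\perp\setminus V_{n-1}^\perp$, $n=0,1,2,\dots$ (with $V_{-1}^\perp=\varnothing$). In particular $D^\alpha 1=0$. (ii) The semigroup $e^{-tD^\alpha}$, $t\ge0$, consists of integral operators $(e^{-tD^\alpha}u)(x)=\int_V G_\alpha(t,xy^{-1})u(y)\,\mu(dy)$ with kernel $$G_\alpha(t,z)=\sum_{n=0}^{l}\big[e^{-t\varphi^{(\alpha)}_n}-e^{-t\varphi^{(\alpha)}_{n+1}}\big]q^{nm_n},\qquad z\in V_l\setminus V_{l+1},\ l\ge0,$$ which is positive. The corresponding stochastic process $\xi_\alpha$ with independent increments on $V$ is stochastically continuous.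
   Context: Let $k$ be a non-Archimedean local field and $k=K_1\subset K_2\subset\cdots$ a strictly increasing sequence of finite separable Galois extensions, all totally and tamely ramified over $k$; $m_n=[K_n:K_1]$ ($m_0=0$, $m_1=1$), $q$ the common residue field cardinality, $|\cdot|_n$ the normalized absolute value on $K_n$, $U_{1,n}$ the principal units of $K_n$. For $\nu>n$, $\mathfrak N_{\nu,n}(x)=[N_{\nu,n}(x)]^{m_n/m_\nu}$ (unique root in $U_{1,n}$, $N_{\nu,n}$ the field norm) defines compatible epimorphisms $U_{1,\nu}\to U_{1,n}$, and $V=\varprojlim U_{1,n}$ is the compact group of sequences $x=(x_n)$, $x_n\in U_{1,n}$, $\mathfrak N_{\nu,n}(x_\nu)=x_n$, with product topology; $\mu$ is its normalized Haar measure. $V_0=V$, $V_n=\{x\in V:|1-x_n|_n\le q^{-nm_n-1}\}$ ($n\ge1$), a decreasing chain of open subgroups forming a neighbourhood base of $1$, with $\mu(V_n)=q^{-nm_n}$. $V'$ is the (discrete) dual group of $V$ and $V_n^\perp\subset V'$ the annihilator of $V_n$. $\mathcal D(V)$ is the space of locally constant functions $u$ on $V$, i.e. there is $l$ with $u(x)=u(y)$ whenever $xy^{-1}\in V_l$. For $\alpha>0$ and $u\in\mathcal D(V)$, $(D^\alpha u)(x)=\int_V F^{(\alpha)}(y)[u(xy^{-1})-u(x)]\,\mu(dy)$, where for $y\in V_l\setminus V_{l+1}$, $l\ge0$, $$F^{(\alpha)}(y)=-q^{\alpha}+\sum_{n=1}^{l}\big(q^{\alpha nm_n}-q^{\alpha(n+1)m_{n+1}}\big)q^{nm_n}$$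 (the sum is empty for $l=0$). Equivalently, $D^\alpha$ is the pseudo-differential operator with symbol $f^{(\alpha)}(\theta)=q^{\alpha nm_n}$ for $\theta\in V_n^\perp\setminus V_{n-1}^\perp$, $n\ge1$, and $f^{(\alpha)}(1)=0$.
   Formalization: The kernel formula and positivity of G_α are stated for t>0 only (at t=0 the semigroup is the identity while G_α(0,·)=0); only each step K_{n+1}/K_n is required to be Galois, since no infinite totally and tamely ramified tower is Galois over k. *)

theory Defs
  imports
    "HOL-Probability.Probability"
    "HOL-Algebra.Algebraic_Closure_Type"
    "Jordan_Normal_Form.Determinant"
begin

section \<open>Extensions inside an ambient field\<close>

text \<open>
  All fields are subfields of one ambient field, the type \<open>'a\<close>; for an increasing tower the union
  of its members is such an ambient field. Vector-space notions over a subfield are those of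
  \<open>HOL-Algebra.Embedded_Algebras\<close>, applied to the ring record of the type.
\<close>

abbreviation ambient :: "'a::field ring" where
  "ambient \<equiv> ring_of_type_algebra"

definition Gal :: "'a::field set \<Rightarrow> 'a set \<Rightarrow> ('a \<Rightarrow> 'a) set" where
  "Gal F L = {\<sigma> \<in> extensional L. bij_betw \<sigma> L L \<and>
     (\<forall>x\<in>L. \<forall>y\<in>L. \<sigma> (x + y) = \<sigma> x + \<sigma> y \<and> \<sigma> (x * y) = \<sigma> x * \<sigma> y) \<and> (\<forall>x\<in>F. \<sigma> x = x)}"

definition separable_extension :: "'a::field set \<Rightarrow> 'a set \<Rightarrow> bool" where
  "separable_extension F L \<longleftrightarrow>
     (\<forall>x\<in>L. \<exists>p. set (coeffs p) \<subseteq> F \<and> poly p x = 0 \<and> coprime p (pderiv p))"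

definition finite_galois_extension :: "'a::field set \<Rightarrow> 'a set \<Rightarrow> bool" where
  "finite_galois_extension F L \<longleftrightarrow>
     F \<subseteq> L \<and> ring.finite_dimension ambient F L \<and> separable_extension F L \<and>
     {x \<in> L. \<forall>\<sigma>\<in>Gal F L. \<sigma> x = x} = F"

text \<open>The norm is the determinant of multiplication by \<open>x\<close>, as an \<open>F\<close>-linear map of \<open>L\<close>, in any
  basis.\<close>

definition field_norm :: "'a::field set \<Rightarrow> 'a set \<Rightarrow> 'a \<Rightarrow> 'a" where
  "field_norm F L x = (THE c. \<exists>bs M.
     ring.independent ambient F bs \<and> ring.Span ambient F bs = L \<and>
     M \<in> carrier_mat (length bs) (length bs) \<and>
     (\<forall>i<length bs. \<forall>j<length bs. M $$ (i, j) \<in> F) \<and>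
     (\<forall>j<length bs. x * bs ! j = (\<Sum>i<length bs. M $$ (i, j) * bs ! i)) \<and>
     c = det M)"


section \<open>Non-Archimedean local fields\<close>

definition residue_field :: "'a::field set \<Rightarrow> ('a \<Rightarrow> real) \<Rightarrow> 'a set set" where
  "residue_field F v =
     {x \<in> F. v x \<le> 1} // {(x, y). x \<in> F \<and> y \<in> F \<and> v x \<le> 1 \<and> v y \<le> 1 \<and> v (x - y) < 1}"

abbreviation residue_card :: "'a::field set \<Rightarrow> ('a \<Rightarrow> real) \<Rightarrow> nat" where
  "residue_card F v \<equiv> card (residue_field F v)"

definition residue_char :: "'a::field set \<Rightarrow> ('a \<Rightarrow> real) \<Rightarrow> nat" where
  "residue_char F v = (LEAST p. 0 < p \<and> v (of_nat p) < 1)"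

text \<open>The cut-off outside \<open>F\<close> is needed because \<open>Metric_space\<close> requires nonnegativity and symmetry
  of the distance on the whole type, while \<open>v\<close> is only meaningful on \<open>F\<close>.\<close>

definition val_dist :: "'a::field set \<Rightarrow> ('a \<Rightarrow> real) \<Rightarrow> 'a \<Rightarrow> 'a \<Rightarrow> real" where
  "val_dist F v x y = (if x \<in> F \<and> y \<in> F then v (x - y) else 0)"

definition field_topology :: "'a::field set \<Rightarrow> ('a \<Rightarrow> real) \<Rightarrow> 'a topology" where
  "field_topology F v = Metric_space.mtopology F (val_dist F v)"

text \<open>\<open>v\<close> is the normalized absolute value of the local field \<open>F\<close>: its values on nonzero elements
  are the integer powers of the residue field cardinality.\<close>

definition nonarch_local_field :: "'a::field set \<Rightarrow> ('a \<Rightarrow> real) \<Rightarrow> bool" where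
  "nonarch_local_field F v \<longleftrightarrow>
     subfield F ambient \<and>
     (\<forall>x\<in>F. 0 \<le> v x \<and> (v x = 0 \<longleftrightarrow> x = 0)) \<and>
     (\<forall>x\<in>F. \<forall>y\<in>F. v (x * y) = v x * v y \<and> v (x + y) \<le> max (v x) (v y)) \<and>
     finite (residue_field F v) \<and>
     v ` (F - {0}) = range (\<lambda>j::int. real (residue_card F v) powi j) \<and>
     Metric_space.mcomplete F (val_dist F v)"

definition ord_val :: "'a::field set \<Rightarrow> ('a \<Rightarrow> real) \<Rightarrow> 'a \<Rightarrow> int" where
  "ord_val F v x = (THE j. v x = real (residue_card F v) powi (- j))"

text \<open>The normalized absolute value of \<open>L\<close> restricts to one equivalent to that of \<open>F\<close>.\<close>

definition local_field_extension ::
    "'a::field set \<Rightarrow> ('a \<Rightarrow> real) \<Rightarrow> 'a set \<Rightarrow> ('a \<Rightarrow> real) \<Rightarrow> bool" where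
  "local_field_extension F v L w \<longleftrightarrow>
     nonarch_local_field F v \<and> nonarch_local_field L w \<and> F \<subseteq> L \<and>
     (\<exists>s>0. \<forall>x\<in>F. w x = v x powr s)"

definition ramification_index ::
    "'a::field set \<Rightarrow> ('a \<Rightarrow> real) \<Rightarrow> 'a set \<Rightarrow> ('a \<Rightarrow> real) \<Rightarrow> nat" where
  "ramification_index F v L w =
     (THE e. \<forall>x\<in>F - {0}. ord_val L w x = int e * ord_val F v x)"

definition totally_ramified ::
    "'a::field set \<Rightarrow> ('a \<Rightarrow> real) \<Rightarrow> 'a set \<Rightarrow> ('a \<Rightarrow> real) \<Rightarrow> bool" where
  "totally_ramified F v L w \<longleftrightarrow> ramification_index F v L w = ring.dim ambient F L"

text \<open>Separability of the residue field extension is automatic, the residue fields being finite.\<close>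

definition tamely_ramified ::
    "'a::field set \<Rightarrow> ('a \<Rightarrow> real) \<Rightarrow> 'a set \<Rightarrow> ('a \<Rightarrow> real) \<Rightarrow> bool" where
  "tamely_ramified F v L w \<longleftrightarrow> \<not> residue_char F v dvd ramification_index F v L w"


section \<open>The tower and the group \<open>V\<close>\<close>

text \<open>
  The tower is \<open>K 1, K 2, \<dots>\<close>; \<open>K 0\<close> and \<open>v 0\<close> are not used. The extensions required to be Galois
  are the steps \<open>K (n + 1) / K n\<close>; this is implied by \<open>K n / K 1\<close> being Galois for all \<open>n\<close>. The
  latter could not hold in an infinite tower: the Galois group of a totally and tamely ramified
  Galois extension of \<open>K 1\<close> embeds into the multiplicative group of the residue field, so its
  order is at most \<open>q - 1\<close>.
\<close>

definition tame_tower :: "(nat \<Rightarrow> 'a::field set) \<Rightarrow> (nat \<Rightarrow> 'a \<Rightarrow> real) \<Rightarrow> bool" where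
  "tame_tower K v \<longleftrightarrow> (\<forall>n\<ge>1.
     K n \<subset> K (Suc n) \<and>
     finite_galois_extension (K n) (K (Suc n)) \<and>
     ring.finite_dimension ambient (K 1) (K n) \<and>
     separable_extension (K 1) (K n) \<and>
     local_field_extension (K 1) (v 1) (K n) (v n) \<and>
     totally_ramified (K 1) (v 1) (K n) (v n) \<and>
     tamely_ramified (K 1) (v 1) (K n) (v n) \<and>
     residue_card (K n) (v n) = residue_card (K 1) (v 1))"

definition deg :: "(nat \<Rightarrow> 'a::field set) \<Rightarrow> nat \<Rightarrow> nat" where
  "deg K n = (if n = 0 then 0 else ring.dim ambient (K 1) (K n))"

definition res_q :: "(nat \<Rightarrow> 'a::field set) \<Rightarrow> (nat \<Rightarrow> 'a \<Rightarrow> real) \<Rightarrow> nat" where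
  "res_q K v = residue_card (K 1) (v 1)"

definition U1 :: "(nat \<Rightarrow> 'a::field set) \<Rightarrow> (nat \<Rightarrow> 'a \<Rightarrow> real) \<Rightarrow> nat \<Rightarrow> 'a set" where
  "U1 K v n = {x \<in> K n. v n (1 - x) < 1}"

definition root_norm ::
    "(nat \<Rightarrow> 'a::field set) \<Rightarrow> (nat \<Rightarrow> 'a \<Rightarrow> real) \<Rightarrow> nat \<Rightarrow> nat \<Rightarrow> 'a \<Rightarrow> 'a" where
  "root_norm K v \<nu> n x =
     (THE y. y \<in> U1 K v n \<and> y ^ (deg K \<nu> div deg K n) = field_norm (K n) (K \<nu>) x)"

definition V :: "(nat \<Rightarrow> 'a::field set) \<Rightarrow> (nat \<Rightarrow> 'a \<Rightarrow> real) \<Rightarrow> (nat \<Rightarrow> 'a) set" where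
  "V K v = {x \<in> (\<Pi>\<^sub>E n\<in>{1..}. U1 K v n). \<forall>n\<ge>1. \<forall>\<nu>>n. root_norm K v \<nu> n (x \<nu>) = x n}"

definition V_one :: "nat \<Rightarrow> 'a::field" where
  "V_one = (\<lambda>n\<in>{1..}. 1)"

definition V_mult :: "(nat \<Rightarrow> 'a::field) \<Rightarrow> (nat \<Rightarrow> 'a) \<Rightarrow> (nat \<Rightarrow> 'a)" where
  "V_mult x y = (\<lambda>n\<in>{1..}. x n * y n)"

definition V_div :: "(nat \<Rightarrow> 'a::field) \<Rightarrow> (nat \<Rightarrow> 'a) \<Rightarrow> (nat \<Rightarrow> 'a)" where
  "V_div x y = (\<lambda>n\<in>{1..}. x n * inverse (y n))"

definition V_top ::
    "(nat \<Rightarrow> 'a::field set) \<Rightarrow> (nat \<Rightarrow> 'a \<Rightarrow> real) \<Rightarrow> (nat \<Rightarrow> 'a) topology" where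
  "V_top K v = subtopology (product_topology (\<lambda>n. field_topology (K n) (v n)) {1..}) (V K v)"

definition normalized_haar ::
    "(nat \<Rightarrow> 'a::field set) \<Rightarrow> (nat \<Rightarrow> 'a \<Rightarrow> real) \<Rightarrow> (nat \<Rightarrow> 'a) measure \<Rightarrow> bool" where
  "normalized_haar K v \<mu> \<longleftrightarrow>
     space \<mu> = V K v \<and> sets \<mu> = sigma_sets (V K v) {S. openin (V_top K v) S} \<and>
     emeasure \<mu> (V K v) = 1 \<and>
     (\<forall>a\<in>V K v. \<forall>S\<in>sets \<mu>. emeasure \<mu> (V_mult a ` S) = emeasure \<mu> S)"

definition V_sub ::
    "(nat \<Rightarrow> 'a::field set) \<Rightarrow> (nat \<Rightarrow> 'a \<Rightarrow> real) \<Rightarrow> nat \<Rightarrow> (nat \<Rightarrow> 'a) set" where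
  "V_sub K v n = (if n = 0 then V K v
     else {x \<in> V K v. v n (1 - x n) \<le> real (res_q K v) powi (- int (n * deg K n) - 1)})"

definition dual ::
    "(nat \<Rightarrow> 'a::field set) \<Rightarrow> (nat \<Rightarrow> 'a \<Rightarrow> real) \<Rightarrow> ((nat \<Rightarrow> 'a) \<Rightarrow> complex) set" where
  "dual K v = {\<theta> \<in> extensional (V K v).
     continuous_map (V_top K v) euclidean \<theta> \<and> (\<forall>x\<in>V K v. cmod (\<theta> x) = 1) \<and>
     (\<forall>x\<in>V K v. \<forall>y\<in>V K v. \<theta> (V_mult x y) = \<theta> x * \<theta> y)}"

definition V_ann ::
    "(nat \<Rightarrow> 'a::field set) \<Rightarrow> (nat \<Rightarrow> 'a \<Rightarrow> real) \<Rightarrow> nat \<Rightarrow> ((nat \<Rightarrow> 'a) \<Rightarrow> complex) set" where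
  "V_ann K v n = {\<theta> \<in> dual K v. \<forall>x\<in>V_sub K v n. \<theta> x = 1}"

definition level_chars ::
    "(nat \<Rightarrow> 'a::field set) \<Rightarrow> (nat \<Rightarrow> 'a \<Rightarrow> real) \<Rightarrow> nat \<Rightarrow> ((nat \<Rightarrow> 'a) \<Rightarrow> complex) set" where
  "level_chars K v n = V_ann K v n - (if n = 0 then {} else V_ann K v (n - 1))"


section \<open>The operator and its kernels\<close>

text \<open>The level, and hence each of the two kernels below, is unspecified at the unit of \<open>V\<close>, which
  is a null set.\<close>

definition level ::
    "(nat \<Rightarrow> 'a::field set) \<Rightarrow> (nat \<Rightarrow> 'a \<Rightarrow> real) \<Rightarrow> (nat \<Rightarrow> 'a) \<Rightarrow> nat" where
  "level K v y = (THE l. y \<in> V_sub K v l - V_sub K v (Suc l))"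

definition F_kernel ::
    "(nat \<Rightarrow> 'a::field set) \<Rightarrow> (nat \<Rightarrow> 'a \<Rightarrow> real) \<Rightarrow> real \<Rightarrow> (nat \<Rightarrow> 'a) \<Rightarrow> real" where
  "F_kernel K v \<alpha> y = (let q = real (res_q K v); m = deg K in
     - (q powr \<alpha>) +
     (\<Sum>n = 1..level K v y.
        (q powr (\<alpha> * real (n * m n)) - q powr (\<alpha> * real (Suc n * m (Suc n)))) * q ^ (n * m n)))"

definition loc_const ::
    "(nat \<Rightarrow> 'a::field set) \<Rightarrow> (nat \<Rightarrow> 'a \<Rightarrow> real) \<Rightarrow> ((nat \<Rightarrow> 'a) \<Rightarrow> complex) set" where
  "loc_const K v = {u. \<exists>l. \<forall>x\<in>V K v. \<forall>y\<in>V K v. V_div x y \<in> V_sub K v l \<longrightarrow> u x = u y}"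

definition D_op ::
    "(nat \<Rightarrow> 'a::field set) \<Rightarrow> (nat \<Rightarrow> 'a \<Rightarrow> real) \<Rightarrow> (nat \<Rightarrow> 'a) measure \<Rightarrow> real \<Rightarrow>
     ((nat \<Rightarrow> 'a) \<Rightarrow> complex) \<Rightarrow> (nat \<Rightarrow> 'a) \<Rightarrow> complex" where
  "D_op K v \<mu> \<alpha> u x =
     (\<integral>y. complex_of_real (F_kernel K v \<alpha> y) * (u (V_div x y) - u x) \<partial>\<mu>)"

definition D_graph ::
    "(nat \<Rightarrow> 'a::field set) \<Rightarrow> (nat \<Rightarrow> 'a \<Rightarrow> real) \<Rightarrow> (nat \<Rightarrow> 'a) measure \<Rightarrow> real \<Rightarrow>
     (((nat \<Rightarrow> 'a) \<Rightarrow> complex) \<times> ((nat \<Rightarrow> 'a) \<Rightarrow> complex)) set" where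
  "D_graph K v \<mu> \<alpha> = {(u, w). u \<in> loc_const K v \<and> (\<forall>x\<in>V K v. w x = D_op K v \<mu> \<alpha> u x)}"

definition phi ::
    "(nat \<Rightarrow> 'a::field set) \<Rightarrow> (nat \<Rightarrow> 'a \<Rightarrow> real) \<Rightarrow> real \<Rightarrow> nat \<Rightarrow> real" where
  "phi K v \<alpha> n = (if n = 0 then 0 else real (res_q K v) powr (\<alpha> * real (n * deg K n)))"

definition G_kernel ::
    "(nat \<Rightarrow> 'a::field set) \<Rightarrow> (nat \<Rightarrow> 'a \<Rightarrow> real) \<Rightarrow> real \<Rightarrow> real \<Rightarrow> (nat \<Rightarrow> 'a) \<Rightarrow> real" where
  "G_kernel K v \<alpha> t z =
     (\<Sum>n = 0..level K v z.
        (exp (- t * phi K v \<alpha> n) - exp (- t * phi K v \<alpha> (Suc n)))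
        * real (res_q K v) ^ (n * deg K n))"


section \<open>Unbounded operators in \<open>L\<^sub>2\<close>\<close>

text \<open>
  Elements of \<open>L\<^sub>2\<close> are represented by square-integrable functions, equality being almost everywhere.
  An operator is represented by its graph, a set of pairs of representatives.
\<close>

definition L2 :: "'x measure \<Rightarrow> ('x \<Rightarrow> complex) set" where
  "L2 M = {u \<in> borel_measurable M. integrable M (\<lambda>x. (cmod (u x))\<^sup>2)}"

definition l2_inner :: "'x measure \<Rightarrow> ('x \<Rightarrow> complex) \<Rightarrow> ('x \<Rightarrow> complex) \<Rightarrow> complex" where
  "l2_inner M u w = (\<integral>x. u x * cnj (w x) \<partial>M)"

definition l2_norm :: "'x measure \<Rightarrow> ('x \<Rightarrow> complex) \<Rightarrow> real" where
  "l2_norm M u = sqrt (\<integral>x. (cmod (u x))\<^sup>2 \<partial>M)"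

type_synonym 'x op_graph = "(('x \<Rightarrow> complex) \<times> ('x \<Rightarrow> complex)) set"

definition densely_defined_operator :: "'x measure \<Rightarrow> 'x op_graph \<Rightarrow> bool" where
  "densely_defined_operator M G \<longleftrightarrow>
     G \<subseteq> L2 M \<times> L2 M \<and>
     (\<forall>(u, w)\<in>G. \<forall>(u', w')\<in>G. \<forall>a b.
        ((\<lambda>x. a * u x + b * u' x), (\<lambda>x. a * w x + b * w' x)) \<in> G) \<and>
     (\<forall>(u, w)\<in>G. \<forall>(u', w')\<in>G. (AE x in M. u x = u' x) \<longrightarrow> (AE x in M. w x = w' x)) \<and>
     (\<forall>f\<in>L2 M. \<forall>\<epsilon>>0. \<exists>(u, w)\<in>G. l2_norm M (\<lambda>x. f x - u x) < \<epsilon>)"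

definition op_closure :: "'x measure \<Rightarrow> 'x op_graph \<Rightarrow> 'x op_graph" where
  "op_closure M G = {(u, w) \<in> L2 M \<times> L2 M. \<forall>\<epsilon>>0. \<exists>(u', w')\<in>G.
     l2_norm M (\<lambda>x. u x - u' x) < \<epsilon> \<and> l2_norm M (\<lambda>x. w x - w' x) < \<epsilon>}"

definition op_adjoint :: "'x measure \<Rightarrow> 'x op_graph \<Rightarrow> 'x op_graph" where
  "op_adjoint M G = {(f, g) \<in> L2 M \<times> L2 M. \<forall>(u, w)\<in>G. l2_inner M w f = l2_inner M u g}"

definition selfadjoint :: "'x measure \<Rightarrow> 'x op_graph \<Rightarrow> bool" where
  "selfadjoint M G \<longleftrightarrow> densely_defined_operator M G \<and> op_adjoint M G = G"

definition essentially_selfadjoint :: "'x measure \<Rightarrow> 'x op_graph \<Rightarrow> bool" where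
  "essentially_selfadjoint M G \<longleftrightarrow>
     densely_defined_operator M G \<and>
     (\<forall>(u, w)\<in>G. \<forall>(u', w')\<in>G. l2_inner M w u' = l2_inner M u w') \<and>
     selfadjoint M (op_closure M G)"

definition resolvent_set :: "'x measure \<Rightarrow> 'x op_graph \<Rightarrow> complex set" where
  "resolvent_set M G = {c.
     (\<forall>f\<in>L2 M. \<exists>(u, w)\<in>G. AE x in M. w x - c * u x = f x) \<and>
     (\<exists>C. \<forall>(u, w)\<in>G. l2_norm M u \<le> C * l2_norm M (\<lambda>x. w x - c * u x))}"

definition op_spectrum :: "'x measure \<Rightarrow> 'x op_graph \<Rightarrow> complex set" where
  "op_spectrum M G = - resolvent_set M G"

definition op_eigenspace :: "'x measure \<Rightarrow> 'x op_graph \<Rightarrow> complex \<Rightarrow> ('x \<Rightarrow> complex) set" where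
  "op_eigenspace M G c = {u. \<exists>w. (u, w) \<in> G \<and> (AE x in M. w x = c * u x)}"

definition op_eigenvalue :: "'x measure \<Rightarrow> 'x op_graph \<Rightarrow> complex \<Rightarrow> bool" where
  "op_eigenvalue M G c \<longleftrightarrow> (\<exists>u\<in>op_eigenspace M G c. \<not> (AE x in M. u x = 0))"

definition l2_span :: "'x measure \<Rightarrow> ('x \<Rightarrow> complex) set \<Rightarrow> ('x \<Rightarrow> complex) set" where
  "l2_span M B = {u \<in> L2 M. \<exists>S c. finite S \<and> S \<subseteq> B \<and>
     (AE x in M. u x = (\<Sum>f\<in>S. c f * f x))}"

text \<open>Every point of the spectrum is an isolated eigenvalue of finite multiplicity.\<close>

definition purely_discrete_spectrum :: "'x measure \<Rightarrow> 'x op_graph \<Rightarrow> bool" where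
  "purely_discrete_spectrum M G \<longleftrightarrow> (\<forall>c\<in>op_spectrum M G.
     c isolated_in op_spectrum M G \<and> op_eigenvalue M G c \<and>
     (\<exists>B. finite B \<and> B \<subseteq> L2 M \<and> op_eigenspace M G c \<subseteq> l2_span M B))"

definition c0_semigroup ::
    "'x measure \<Rightarrow> (real \<Rightarrow> ('x \<Rightarrow> complex) \<Rightarrow> ('x \<Rightarrow> complex)) \<Rightarrow> bool" where
  "c0_semigroup M T \<longleftrightarrow>
     (\<forall>t\<ge>0. \<forall>u\<in>L2 M. T t u \<in> L2 M) \<and>
     (\<forall>t\<ge>0. \<forall>u\<in>L2 M. \<forall>w\<in>L2 M. \<forall>a b.
        AE x in M. T t (\<lambda>x. a * u x + b * w x) x = a * T t u x + b * T t w x) \<and>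
     (\<forall>t\<ge>0. \<exists>C. \<forall>u\<in>L2 M. l2_norm M (T t u) \<le> C * l2_norm M u) \<and>
     (\<forall>u\<in>L2 M. AE x in M. T 0 u x = u x) \<and>
     (\<forall>s\<ge>0. \<forall>t\<ge>0. \<forall>u\<in>L2 M. AE x in M. T (s + t) u x = T s (T t u) x) \<and>
     (\<forall>u\<in>L2 M. ((\<lambda>t. l2_norm M (\<lambda>x. T t u x - u x)) \<longlongrightarrow> 0) (at_right 0))"

definition semigroup_generator ::
    "'x measure \<Rightarrow> (real \<Rightarrow> ('x \<Rightarrow> complex) \<Rightarrow> ('x \<Rightarrow> complex)) \<Rightarrow> 'x op_graph" where
  "semigroup_generator M T = {(u, w) \<in> L2 M \<times> L2 M.
     ((\<lambda>t. l2_norm M (\<lambda>x. (T t u x - u x) / complex_of_real t - w x)) \<longlongrightarrow> 0) (at_right 0)}"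

text \<open>\<open>T t = exp (- t A)\<close> for the operator \<open>A\<close> with graph \<open>G\<close>.\<close>

definition exp_semigroup ::
    "'x measure \<Rightarrow> 'x op_graph \<Rightarrow> (real \<Rightarrow> ('x \<Rightarrow> complex) \<Rightarrow> ('x \<Rightarrow> complex)) \<Rightarrow> bool" where
  "exp_semigroup M G T \<longleftrightarrow>
     c0_semigroup M T \<and> semigroup_generator M T = {(u, \<lambda>x. - w x) |u w. (u, w) \<in> G}"


section \<open>The process\<close>

text \<open>A process on \<open>V\<close> with independent increments, whose increment over \<open>[s, t]\<close> has the density
  \<open>G (t - s)\<close> with respect to \<open>\<mu>\<close>; the initial distribution is arbitrary.\<close>

definition indep_increments_process ::
    "(nat \<Rightarrow> 'a::field) measure \<Rightarrow> (real \<Rightarrow> (nat \<Rightarrow> 'a) \<Rightarrow> real) \<Rightarrow> 'w measure \<Rightarrow>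
     (real \<Rightarrow> 'w \<Rightarrow> (nat \<Rightarrow> 'a)) \<Rightarrow> bool" where
  "indep_increments_process \<mu> G P \<xi> \<longleftrightarrow>
     prob_space P \<and>
     (\<forall>t\<ge>0. \<xi> t \<in> measurable P \<mu>) \<and>
     (\<forall>(N::nat) \<tau>. 0 \<le> \<tau> 0 \<and> (\<forall>i<N. \<tau> i < \<tau> (Suc i)) \<longrightarrow>
        prob_space.indep_vars P (\<lambda>_. \<mu>)
          (\<lambda>i \<omega>. if i = 0 then \<xi> (\<tau> 0) \<omega> else V_div (\<xi> (\<tau> i) \<omega>) (\<xi> (\<tau> (i - 1)) \<omega>)) {..N}) \<and>
     (\<forall>s t. 0 \<le> s \<and> s < t \<longrightarrow>
        distributed P \<mu> (\<lambda>\<omega>. V_div (\<xi> t \<omega>) (\<xi> s \<omega>)) (\<lambda>z. ennreal (G (t - s) z)))"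

definition stochastically_continuous ::
    "(nat \<Rightarrow> 'a::field set) \<Rightarrow> (nat \<Rightarrow> 'a \<Rightarrow> real) \<Rightarrow> 'w measure \<Rightarrow>
     (real \<Rightarrow> 'w \<Rightarrow> (nat \<Rightarrow> 'a)) \<Rightarrow> bool" where
  "stochastically_continuous K v P \<xi> \<longleftrightarrow>
     (\<forall>t\<ge>0. \<forall>U. openin (V_top K v) U \<and> V_one \<in> U \<longrightarrow>
        ((\<lambda>s. measure P {\<omega> \<in> space P. V_div (\<xi> s \<omega>) (\<xi> t \<omega>) \<notin> U}) \<longlongrightarrow> 0) (at t within {0..}))"

end

theory Submission
  imports Defs
begin

text \<open>
  For \<open>\<nu> > n\<close> the root norm is a \<open>d\<close>-th root of a norm, where \<open>d = [K \<nu> : K n]\<close> is prime to the residue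
  characteristic; raising to the power \<open>d\<close> is bijective on principal units, and the powers of a
  uniformizer form an orthogonal basis, which makes the root norms non-expansive. So \<open>V\<close> is complete,
  its topology is given by the subgroups \<open>V_sub n\<close>, and these have index \<open>q ^ (n * m n)\<close>.

  Everything else depends only on such a chain \<open>W n\<close> of subgroups of index \<open>N n\<close>. Averaging over the
  cosets of \<open>W n\<close> gives an increasing sequence of projections \<open>E n\<close> with union dense in \<open>L2\<close>, and all
  operators are functions of the differences \<open>P n = E n - E (n - 1)\<close>: the closure of the operator is
  \<open>\<Sum> \<phi> n P n\<close>, and by Abel summation the semigroup is \<open>\<Sum> (exp (- t \<phi> n) - exp (- t \<phi> (n + 1))) E n\<close>,
  whose kernel is a mixture of the uniform distributions on the \<open>W n\<close>. The range of \<open>P n\<close> is spanned by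
  characters because translations act on functions on a finite abelian quotient by commuting
  operators of finite order. The process comes from Kolmogorov's theorem for the
  finite-dimensional densities given by products of transition densities.
\<close>

text \<open>Compatibility of the absolute values is given only over \<open>K 1\<close>; between
  \<open>K n\<close> and \<open>K \<nu>\<close> it is derived by divisibility: a principal unit has
  roots of arbitrarily high order, hence value 1 under a discrete valuation. The norm being a
  determinant, its transitivity, which makes the root norms compatible, becomes an identity for
  block matrices, proved by elimination. The growth of \<open>\<phi>\<close> enters through the
  summability of \<open>1 / \<phi> (Suc n)\<close>: resolvents, like the semigroup, become
  absolutely convergent series of the contractions \<open>E n\<close>. A semigroup is specified only
  by its generator, so the kernel formula needs uniqueness; this is shown on each finite-dimensional
  range of \<open>P n\<close> by composing many small time steps and controlling the accumulated
  error. The Chapman-Kolmogorov identity is read off from the mixture: convolving the uniform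
  distributions on \<open>W n\<close> and \<open>W m\<close> gives the one on
  \<open>W (min n m)\<close>, and the minimum of two independent indices has the product of the
  tails.\<close>

lemmas integral_cong_space = Bochner_Integration.integral_cong

lemmas at_right_pos = eventually_at_right_less[of "0::real"]

section \<open>Linear algebra in the ambient field and the norm as a determinant\<close>

lemma ambient_simps [simp]:
 "carrier (ambient :: 'a::field ring) = UNIV"
 "x \<otimes>\<^bsub>ambient\<^esub> y = (x * y :: 'a)"
 "x \<oplus>\<^bsub>ambient\<^esub> y = (x + y :: 'a)"
 "\<one>\<^bsub>ambient\<^esub> = (1 :: 'a)"
 "\<zero>\<^bsub>ambient\<^esub> = (0 :: 'a)" by (simp_all add: ring_of_type_algebra_def)

lemma ring_ambient: "ring (ambient :: 'a::field ring)" by (rule ring_from_type_algebra)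

lemma a_inv_ambient: "\<ominus>\<^bsub>ambient\<^esub> x = (- x :: 'a::field)" proof -
 interpret R: ring "ambient :: 'a ring" by (rule ring_ambient)
 show ?thesis by (rule R.minus_equality) simp_all
qed

lemma subfield_ambient: assumes "subfield F (ambient :: 'a::field ring)" shows "0 \<in> F" "1 \<in> F" and "x \<in> F ==> y \<in> F ==> x + y \<in> F"
  and "x \<in> F ==> y \<in> F ==> x * y \<in> F" and "x \<in> F ==> - x \<in> F" and "x \<in> F ==> y \<in> F ==> x - y \<in> F" and "x \<in> F ==> inverse x \<in> F"
  and "x \<in> F ==> y \<in> F ==> x / y \<in> F" and "x \<in> F ==> x ^ n \<in> F" and "of_nat n \<in> F" proof -
 interpret R: field "ambient :: 'a ring" by (rule field_from_type_algebra)
 note S = subringE[OF subfieldE(1)[OF assms]]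
 show z: "0 \<in> F" and o: "1 \<in> F" using S(2,3) by simp_all
 show a: "x + y \<in> F" if "x \<in> F" "y \<in> F" for x y using S(7)[OF that] by simp
 show m: "x * y \<in> F" if "x \<in> F" "y \<in> F" for x y using S(6)[OF that] by simp
 show n: "- x \<in> F" if "x \<in> F" for x using S(5)[OF that] by (simp add: a_inv_ambient)
 show "x - y \<in> F" if "x \<in> F" "y \<in> F" using a[OF that(1) n[OF that(2)]] by simp
 show i: "inverse x \<in> F" if "x \<in> F" for x proof (cases "x = 0")
  case False
  then have "inv\<^bsub>ambient\<^esub> x \<in> F" using R.subfield_m_inv(1)[OF assms, of x] that by simp
  moreover have "inv\<^bsub>ambient\<^esub> x = inverse x" by (rule R.comm_inv_char) (use False in simp_all)
  ultimately show ?thesis by simp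
 qed (use z in simp)
 show "x / y \<in> F" if "x \<in> F" "y \<in> F" using m[OF that(1) i[OF that(2)]] by (simp add: divide_inverse)
 show "x ^ n \<in> F" if "x \<in> F" by (induction n) (use that o m in auto)
 show "of_nat n \<in> F" by (induction n) (use z o a in auto)
qed

lemma subfield_sum: assumes "subfield F (ambient :: 'a::field ring)" "!!i. i \<in> A ==> f i \<in> F" shows "(\<Sum>i\<in>A. f i) \<in> F"
 using assms(2) by (induction A rule: infinite_finite_induct) (auto intro: subfield_ambient[OF assms(1)])

lemma subfield_prod: assumes "subfield F (ambient :: 'a::field ring)" "!!i. i \<in> A ==> f i \<in> F" shows "(\<Prod>i\<in>A. f i) \<in> F"
 using assms(2) by (induction A rule: infinite_finite_induct) (auto intro: subfield_ambient[OF assms(1)])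

lemma combine_ambient: assumes "length Ks = length Us" shows "ring.combine ambient Ks Us = (\<Sum>i<length Us. Ks ! i * (Us ! i :: 'a::field))" proof -
 interpret R: ring "ambient :: 'a ring" by (rule ring_ambient)
 show ?thesis using assms by (induction Ks Us rule: list_induct2) (auto simp: sum.lessThan_Suc_shift simp del: sum.lessThan_Suc)
qed

text \<open>Bases are families indexed by numbers rather than lists: the product basis of a tower
  can then be written with \<open>div\<close> and \<open>mod\<close>, and coordinates are plain
  functions.\<close>

definition is_basis :: "'a::field set => 'a set => nat => (nat => 'a) => bool" where
 "is_basis F L n b \<longleftrightarrow>
  (ALL c. (ALL i<n. c i \<in> F) --> (\<Sum>i<n. c i * b i) \<in> L) &
  (ALL x:L. EX c. (ALL i<n. c i \<in> F) & x = (\<Sum>i<n. c i * b i)) &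
  (ALL c. (ALL i<n. c i \<in> F) --> (\<Sum>i<n. c i * b i) = 0 --> (ALL i<n. c i = 0))"

lemma is_basis_in: assumes "is_basis F L n b" "!!i. i < n ==> c i \<in> F" shows "(\<Sum>i<n. c i * b i) \<in> L" using assms unfolding is_basis_def by blast

lemma is_basis_repr: assumes "is_basis F L n b" "x \<in> L" obtains c where "!!i. i < n ==> c i \<in> F" "x = (\<Sum>i<n. c i * b i)"
 using assms unfolding is_basis_def by blast

lemma is_basis_eq: assumes "is_basis F L n b" "subfield F ambient" and "!!i. i < n ==> c i \<in> F" "!!i. i < n ==> d i \<in> F"
  and "(\<Sum>i<n. c i * b i) = (\<Sum>i<n. d i * b i)" "i < n" shows "c i = d i" proof -
 have "(\<Sum>i<n. (c i - d i) * b i) = 0" using assms(5) by (simp add: left_diff_distrib sum_subtractf)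
 moreover have "ALL i<n. c i - d i \<in> F" using assms(3,4) subfield_ambient(6)[OF assms(2)] by simp
 moreover have "ALL c. (ALL i<n. c i \<in> F) --> (\<Sum>i<n. c i * b i) = 0 --> (ALL i<n. c i = 0)" using assms(1) unfolding is_basis_def by (elim conjE)
 ultimately have "ALL i<n. c i - d i = 0" by (elim allE[of _ "%i. c i - d i"] impE)
 then show ?thesis using assms(6) by simp
qed

lemma is_basis_mem: assumes "is_basis F L n b" "subfield F ambient" "i < n" shows "b i \<in> L" proof -
 have "(\<Sum>j<n. (if j = i then 1 else 0) * b j) \<in> L" by (rule is_basis_in[OF assms(1)]) (simp add: subfield_ambient(1,2)[OF assms(2)])
 also have "(\<Sum>j<n. (if j = i then 1 else 0) * b j) = (\<Sum>j<n. if j = i then b j else 0)" by (rule sum.cong) auto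
 finally show ?thesis using assms(3) by simp
qed

text \<open>The bridge to the list-based notions: coefficient lists and coefficient functions on the
  indices below \<open>length bs\<close> correspond, so spans and linear relations are the
  same.\<close>

lemma is_basis_iff: assumes F: "subfield F (ambient :: 'a::field ring)" shows "ring.independent ambient F bs & ring.Span ambient F bs = L
  \<longleftrightarrow> is_basis F L (length bs) (%i. bs ! i)" proof -
 interpret R: ring "ambient :: 'a ring" by (rule ring_ambient)
 note R.Span.simps [simp del]
 have ex_list: "EX Ks. length Ks = length bs & set Ks <= F & (ALL i<length bs. Ks ! i = c i)" if "ALL i<length bs. c i \<in> F" for c
  by (rule exI[of _ "map c [0..<length bs]"]) (use that in auto)
 have sp: "R.Span F bs = {R.combine Ks bs | Ks. length Ks = length bs & set Ks <= F}" using R.Span_eq_combine_set_length_version[OF F, of bs] by simp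
 have sp': "R.Span F bs = {\<Sum>i<length bs. c i * bs ! i | c. ALL i<length bs. c i \<in> F}" proof (intro equalityI subsetI)
  fix x assume "x \<in> R.Span F bs"
  then obtain Ks where "x = R.combine Ks bs" "length Ks = length bs" "set Ks <= F" using sp by auto
  then show "x \<in> {\<Sum>i<length bs. c i * bs ! i | c. ALL i<length bs. c i \<in> F}" by (auto simp: combine_ambient intro!: exI[of _ "%i. Ks ! i"])
 next
  fix x assume "x \<in> {\<Sum>i<length bs. c i * bs ! i | c. ALL i<length bs. c i \<in> F}"
  then obtain c where c: "x = (\<Sum>i<length bs. c i * bs ! i)" "ALL i<length bs. c i \<in> F" by auto
  obtain Ks where "length Ks = length bs" "set Ks <= F" "ALL i<length bs. Ks ! i = c i" using ex_list[OF c(2)] by auto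
  then show "x \<in> R.Span F bs" unfolding sp using c(1) by (auto simp: combine_ambient intro!: exI[of _ Ks])
 qed
 have ind: "R.independent F bs \<longleftrightarrow>
   (ALL c. (ALL i<length bs. c i \<in> F) --> (\<Sum>i<length bs. c i * bs ! i) = 0 --> (ALL i<length bs. c i = 0))" proof (intro iffI allI impI)
  fix c i assume ind: "R.independent F bs" and c: "ALL i<length bs. c i \<in> F" and s: "(\<Sum>i<length bs. c i * bs ! i) = 0" and i: "i < length bs"
  obtain Ks where K: "length Ks = length bs" "set Ks <= F" "ALL i<length bs. Ks ! i = c i" using ex_list[OF c] by auto
  have "R.combine Ks bs = \<zero>\<^bsub>ambient\<^esub>" using s K by (simp add: combine_ambient)
  from R.independent_imp_trivial_combine[OF F ind K(2) this]
  have "set Ks <= {0}" using K(1) by simp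
  then show "c i = 0" using K i by (metis nth_mem singletonD subsetD)
 next
  assume A: "ALL c. (ALL i<length bs. c i \<in> F) --> (\<Sum>i<length bs. c i * bs ! i) = 0 --> (ALL i<length bs. c i = 0)"
  show "R.independent F bs" proof (rule ccontr)
   assume "~ R.independent F bs"
   then obtain Ks where K: "length Ks = length bs" "R.combine Ks bs = 0" "set Ks <= F" "set Ks ~= {0}"
    using R.dependent_imp_non_trivial_combine[OF F, of bs] by (metis ambient_simps(1,5) top_greatest)
   have z: "ALL i<length bs. Ks ! i = 0" using spec[OF A, of "%i. Ks ! i"] K by (auto simp: combine_ambient)
   have "set Ks <= {0}" using z K(1) by (auto simp: in_set_conv_nth)
   then have "set Ks = {}" using K(4) by (simp add: subset_singleton_iff)
   then have "bs = []" using K(1) by simp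
   then show False using \<open>~ R.independent F bs\<close> by simp
  qed
 qed
 let ?S = "{\<Sum>i<length bs. c i * bs ! i | c. ALL i<length bs. c i \<in> F}"
 have "?S <= L \<longleftrightarrow> (ALL c. (ALL i<length bs. c i \<in> F) --> (\<Sum>i<length bs. c i * bs ! i) \<in> L)" by auto
 moreover have "L <= ?S \<longleftrightarrow> (ALL x:L. EX c. (ALL i<length bs. c i \<in> F) & x = (\<Sum>i<length bs. c i * bs ! i))" by (simp add: subset_eq conj_commute)
 ultimately show ?thesis unfolding is_basis_def ind sp' by (simp only: set_eq_subset conj_ac)
qed

lemma is_basis_length: assumes F: "subfield F (ambient :: 'a::field ring)" and b: "is_basis F L n b" and c: "is_basis F L m c" shows "n = m" proof -
 interpret R: ring "ambient :: 'a ring" by (rule ring_ambient)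
 have *: "R.dimension n F L" if b: "is_basis F L n b" for n b proof -
  have "is_basis F L (length (map b [0..<n])) (%i. map b [0..<n] ! i)" using b unfolding is_basis_def by simp
  then have "R.independent F (map b [0..<n]) & R.Span F (map b [0..<n]) = L" using is_basis_iff[OF F] by metis
  from R.dimensionI[OF F conjunct1[OF this] conjunct2[OF this]] show ?thesis by simp
 qed
 show ?thesis using R.dimension_is_inj[OF F *[OF b] *[OF c]] .
qed

lemma finite_dimension_basis: assumes F: "subfield F (ambient :: 'a::field ring)" and "ring.finite_dimension ambient F L"
 obtains b where "is_basis F L (ring.dim ambient F L) b" proof -
 interpret R: ring "ambient :: 'a ring" by (rule ring_ambient)
 have "R.dimension (R.dim F L) F L" using R.finite_dimensionE[OF F assms(2)] by (simp add: over_def)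
 from R.exists_base[OF F this] obtain Vs where
  "R.independent F Vs" "length Vs = R.dim F L" "R.Span F Vs = L" by blast
 then have "is_basis F L (R.dim F L) (%i. Vs ! i)" using is_basis_iff[OF F, of Vs L] by metis
 then show ?thesis by (rule that)
qed

definition rep_mat :: "'a::field set => nat => (nat => 'a) => 'a => 'a mat => bool" where
 "rep_mat F n b x M \<longleftrightarrow> M \<in> carrier_mat n n & (ALL i<n. ALL j<n. M $$ (i, j) \<in> F) &
  (ALL j<n. x * b j = (\<Sum>i<n. M $$ (i, j) * b i))"

lemma field_norm_altdef: assumes F: "subfield F (ambient :: 'a::field ring)" shows "field_norm F L x = (THE c. EX n b M. is_basis F L n b & rep_mat F n b x M & c = det M)"
proof -
 have "(EX bs M. ring.independent ambient F bs & ring.Span ambient F bs = L &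
  M \<in> carrier_mat (length bs) (length bs) &
  (ALL i<length bs. ALL j<length bs. M $$ (i, j) \<in> F) &
  (ALL j<length bs. x * bs ! j = (\<Sum>i<length bs. M $$ (i, j) * bs ! i)) &
  c = det M) \<longleftrightarrow> (EX n b M. is_basis F L n b & rep_mat F n b x M & c = det M)" (is "?A \<longleftrightarrow> ?B") for c proof
  assume ?A
  then obtain bs M where *: "ring.independent ambient F bs & ring.Span ambient F bs = L"
   "rep_mat F (length bs) (%i. bs ! i) x M" "c = det M" unfolding rep_mat_def by (elim exE conjE) (rule that, unfold rep_mat_def, (rule conjI | assumption)+)
  have "is_basis F L (length bs) (%i. bs ! i)" using *(1) is_basis_iff[OF F, of bs L] by simp
  then show ?B using *(2,3) by blast
 next
  assume ?B
  then obtain n b M where *: "is_basis F L n b" "rep_mat F n b x M" "c = det M" by blast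
  define bs where "bs = map b [0..<n]"
  have "is_basis F L (length bs) (%i. bs ! i)" using * unfolding is_basis_def bs_def by simp
  moreover have "rep_mat F (length bs) (%i. bs ! i) x M" using * unfolding rep_mat_def bs_def by simp
  ultimately have **: "ring.independent ambient F bs & ring.Span ambient F bs = L"
   "rep_mat F (length bs) (%i. bs ! i) x M" using is_basis_iff[OF F, of bs L] by metis+
  show ?A by (rule exI[of _ bs], rule exI[of _ M])
   (use **(1) **(2)[unfolded rep_mat_def] *(3) in simp)
 qed
 then show ?thesis unfolding field_norm_def by simp
qed

lemma coeff_matrix_exists: assumes b: "is_basis F L n b" and y: "!!j. j < m ==> y j \<in> L"
 obtains P where "P \<in> carrier_mat n m" "!!i j. i < n ==> j < m ==> P $$ (i, j) \<in> F"
  "!!j. j < m ==> y j = (\<Sum>i<n. P $$ (i, j) * b i)" proof -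
 have "EX c. ALL j<m. (ALL i<n. c j i \<in> F) & y j = (\<Sum>i<n. c j i * b i)" proof -
  have "ALL j. EX c. j < m --> (ALL i<n. c i \<in> F) & y j = (\<Sum>i<n. c i * b i)" using is_basis_repr[OF b y] by metis
  then show ?thesis by metis
 qed
 then obtain c where c: "ALL j<m. (ALL i<n. c j i \<in> F) & y j = (\<Sum>i<n. c j i * b i)" by blast
 show ?thesis by (rule that[of "mat n m (%(i, j). c j i)"]) (use c in auto)
qed

text \<open>Associativity of coordinates: if the columns of \<open>A\<close> are coordinates in
  \<open>b\<close> and \<open>B\<close> holds the coefficients of further combinations, the product
  matrix gives the coordinates of the combined vectors. It turns composition and change of basis
  into matrix identities.\<close>

lemma sum_coeff_assoc:
 fixes b :: "nat => 'a::field" assumes "A \<in> carrier_mat n m" "B \<in> carrier_mat m k" "j < k"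
 shows "(\<Sum>l<m. B $$ (l, j) * (\<Sum>i<n. A $$ (i, l) * b i)) = (\<Sum>i<n. (A * B) $$ (i, j) * b i)" proof -
 have "(\<Sum>l<m. B $$ (l, j) * (\<Sum>i<n. A $$ (i, l) * b i)) = (\<Sum>i<n. \<Sum>l<m. B $$ (l, j) * (A $$ (i, l) * b i))" by (subst sum.swap) (simp add: sum_distrib_left)
 also have "... = (\<Sum>i<n. (A * B) $$ (i, j) * b i)" using assms by (intro sum.cong refl)
   (auto simp: scalar_prod_def sum_distrib_left sum_distrib_right mult_ac atLeast0LessThan intro!: sum.cong)
 finally show ?thesis .
qed

lemma mult_entries_in: assumes F: "subfield F (ambient :: 'a::field ring)" and "A \<in> carrier_mat n m" "B \<in> carrier_mat m k" "i < n" "j < k"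
  and "!!i j. i < n ==> j < m ==> A $$ (i, j) \<in> F" "!!i j. i < m ==> j < k ==> B $$ (i, j) \<in> F" shows "(A * B) $$ (i, j) \<in> F"
 using assms by (auto simp: scalar_prod_def intro!: subfield_sum[OF F] subfield_ambient[OF F])

lemma basis_matrix_eqI: assumes F: "subfield F (ambient :: 'a::field ring)" and b: "is_basis F L n b"
  and A: "A \<in> carrier_mat n m" "!!i j. i < n ==> j < m ==> A $$ (i, j) \<in> F" and B: "B \<in> carrier_mat n m" "!!i j. i < n ==> j < m ==> B $$ (i, j) \<in> F"
  and eq: "!!j. j < m ==> (\<Sum>i<n. A $$ (i, j) * b i) = (\<Sum>i<n. B $$ (i, j) * b i)" shows "A = B" proof (rule eq_matI)
 show "A $$ (i, j) = B $$ (i, j)" if "i < dim_row B" "j < dim_col B" for i j using that is_basis_eq[OF b F, of "%i. A $$ (i, j)" "%i. B $$ (i, j)" i] A B eq by auto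
qed (use A B in auto)

lemma rep_mat_exists: assumes F: "subfield F (ambient :: 'a::field ring)" and b: "is_basis F L n b" and L: "subfield L ambient" and x: "x \<in> L"
 obtains M where "rep_mat F n b x M" proof -
 have "x * b j \<in> L" if "j < n" for j using subfield_ambient(4)[OF L x is_basis_mem[OF b F that]] .
 then obtain P where "P \<in> carrier_mat n n" "!!i j. i < n ==> j < n ==> P $$ (i, j) \<in> F"
  "!!j. j < n ==> x * b j = (\<Sum>i<n. P $$ (i, j) * b i)" using coeff_matrix_exists[OF b, of n "%j. x * b j"] by metis
 then show ?thesis by (intro that) (auto simp: rep_mat_def)
qed

lemma rep_mat_mult: assumes F: "subfield F (ambient :: 'a::field ring)" and M: "rep_mat F n b x M" and M': "rep_mat F n b y M'" shows "rep_mat F n b (x * y) (M * M')"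
 unfolding rep_mat_def proof (intro conjI allI impI)
 show "M * M' \<in> carrier_mat n n" using M M' unfolding rep_mat_def by auto
 show "(M * M') $$ (i, j) \<in> F" if "i < n" "j < n" for i j using M M' that unfolding rep_mat_def by (intro mult_entries_in[OF F, of _ n n _ n]) auto
 fix j assume j: "j < n"
 have "x * y * b j = (\<Sum>l<n. M' $$ (l, j) * (x * b l))" using M' j unfolding rep_mat_def by (simp add: mult.assoc sum_distrib_left mult.left_commute)
 also have "... = (\<Sum>l<n. M' $$ (l, j) * (\<Sum>i<n. M $$ (i, l) * b i))" using M unfolding rep_mat_def by simp
 also have "... = (\<Sum>i<n. (M * M') $$ (i, j) * b i)" using M M' j unfolding rep_mat_def by (intro sum_coeff_assoc) auto
 finally show "x * y * b j = (\<Sum>i<n. (M * M') $$ (i, j) * b i)" .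
qed

text \<open>With \<open>P\<close> and \<open>Q\<close> the matrices expressing each basis in the
  other, uniqueness of coordinates gives \<open>P * Q = 1\<^sub>m n\<close> and
  \<open>M * P = P * M'\<close>, so the determinants agree. This is what makes the description in
  \<open>field_norm\<close> well defined.\<close>

lemma rep_mat_det_unique: assumes F: "subfield F (ambient :: 'a::field ring)" and b: "is_basis F L n b" and M: "rep_mat F n b x M"
  and b': "is_basis F L n' b'" and M': "rep_mat F n' b' x M'" shows "det M = det M'" proof -
 have n: "n' = n" using is_basis_length[OF F b' b] .
 obtain P where P: "P \<in> carrier_mat n n" "!!i j. i < n ==> j < n ==> P $$ (i, j) \<in> F"
  "!!j. j < n ==> b' j = (\<Sum>i<n. P $$ (i, j) * b i)" using coeff_matrix_exists[OF b, of n b'] is_basis_mem[OF b' F] n by metis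
 obtain Q where Q: "Q \<in> carrier_mat n n" "!!i j. i < n ==> j < n ==> Q $$ (i, j) \<in> F"
  "!!j. j < n ==> b j = (\<Sum>i<n. Q $$ (i, j) * b' i)" using coeff_matrix_exists[OF b', of n b] is_basis_mem[OF b F] n by metis
 note MM = M[unfolded rep_mat_def] M'[unfolded rep_mat_def n]
 have PQ: "P * Q = 1\<^sub>m n" proof (rule basis_matrix_eqI[OF F b, of _ n])
  show "(P * Q) $$ (i, j) \<in> F" if "i < n" "j < n" for i j using that P Q by (intro mult_entries_in[OF F P(1) Q(1)]) auto
  show "1\<^sub>m n $$ (i, j) \<in> F" if "i < n" "j < n" for i j using that by (auto intro: subfield_ambient[OF F])
  show "(\<Sum>i<n. (P * Q) $$ (i, j) * b i) = (\<Sum>i<n. 1\<^sub>m n $$ (i, j) * b i)" if j: "j < n" for j proof -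
   have "(\<Sum>i<n. (P * Q) $$ (i, j) * b i) = (\<Sum>l<n. Q $$ (l, j) * b' l)" using sum_coeff_assoc[OF P(1) Q(1) j, of b] P(3) by simp
   also have "... = (\<Sum>i<n. (if i = j then b i else 0))" using Q(3)[OF j] j by simp
   also have "... = (\<Sum>i<n. 1\<^sub>m n $$ (i, j) * b i)" using j by (intro sum.cong) auto
   finally show ?thesis .
  qed
 qed (use P Q in auto)
 have MP: "M * P = P * M'" proof (rule basis_matrix_eqI[OF F b, of _ n])
  show "(M * P) $$ (i, j) \<in> F" if "i < n" "j < n" for i j by (rule mult_entries_in[OF F _ P(1), where n = n]) (simp_all add: that P(2) MM)
  show "(P * M') $$ (i, j) \<in> F" if "i < n" "j < n" for i j by (rule mult_entries_in[OF F P(1), where k = n]) (simp_all add: that P(2) MM)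
  show "(\<Sum>i<n. (M * P) $$ (i, j) * b i) = (\<Sum>i<n. (P * M') $$ (i, j) * b i)" if j: "j < n" for j proof -
   have "(\<Sum>i<n. (M * P) $$ (i, j) * b i) = (\<Sum>l<n. P $$ (l, j) * (x * b l))" using sum_coeff_assoc[of M n n P n j b] P(1) MM j by simp
   also have "... = x * b' j" using P(3)[OF j] by (simp add: sum_distrib_left mult.left_commute)
   also have "... = (\<Sum>l<n. M' $$ (l, j) * b' l)" using MM j by simp
   also have "... = (\<Sum>l<n. M' $$ (l, j) * (\<Sum>i<n. P $$ (i, l) * b i))" using P(3) by simp
   also have "... = (\<Sum>i<n. (P * M') $$ (i, j) * b i)" using P(1) MM j by (intro sum_coeff_assoc) auto
   finally show ?thesis .
  qed
 qed (use P MM in auto)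
 have "det P * det Q = 1" using det_mult[OF P(1) Q(1)] PQ by simp
 then have "det P ~= 0" by auto
 moreover have "det M * det P = det P * det M'" using arg_cong[OF MP, of det] det_mult[of M n P] det_mult[OF P(1), of M'] P(1) conjunct1[OF MM(1)] conjunct1[OF MM(2)] by simp
 ultimately show ?thesis by (simp add: mult.commute)
qed

lemma field_norm_eq: assumes F: "subfield F (ambient :: 'a::field ring)" and b: "is_basis F L n b" and M: "rep_mat F n b x M" shows "field_norm F L x = det M"
 unfolding field_norm_altdef[OF F] proof (rule the_equality)
 show "EX n b M'. is_basis F L n b & rep_mat F n b x M' & det M = det M'" using b M by blast
 fix c assume "EX n b M. is_basis F L n b & rep_mat F n b x M & c = det M"
 then show "c = det M" using rep_mat_det_unique[OF F b M] by metis
qed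

lemma det_in_subfield: assumes F: "subfield F (ambient :: 'a::field ring)" and "M \<in> carrier_mat n n" "!!i j. i < n ==> j < n ==> M $$ (i, j) \<in> F" shows "det M \<in> F"
proof -
 have s: "signof p \<in> F" for p using subfield_ambient(2)[OF F] subfield_ambient(5)[OF F, of 1] by (simp add: sign_def)
 show ?thesis unfolding det_def'[OF assms(2)] proof (rule subfield_sum[OF F], rule subfield_ambient(4)[OF F s], rule subfield_prod[OF F])
  fix p i assume "p \<in> {p. p permutes {0..<n}}" "i \<in> {0..<n}"
  then show "M $$ (i, p i) \<in> F" using permutes_in_image[of p "{0..<n}" i] by (intro assms(3)) auto
 qed
qed

section \<open>Block matrices and transitivity of the norm\<close>

lemma sum_lessThan_times:
 fixes f :: "nat => 'b::comm_monoid_add" shows "(\<Sum>k<d * e. f k) = (\<Sum>I<d. \<Sum>i<e. f (I * e + i))" proof -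
 have "(\<Sum>i<e. f (I * e + i)) = sum f {I * e..<I * e + e}" for I using sum.shift_bounds_nat_ivl[of f 0 "I * e" e] by (simp add: atLeast0LessThan add.commute)
 then show ?thesis by (simp add: sum.nat_group)
qed

text \<open>Restriction of scalars: if \<open>\<rho>\<close> is the regular representation of
  \<open>L\<close> over a subfield, this is the matrix over the subfield of the map that
  \<open>B\<close> represents over \<open>L\<close>. An index \<open>k\<close> stands for the pair
  \<open>(k div e, k mod e)\<close>.\<close>

definition blow :: "nat => ('a => 'a mat) => 'a mat => 'a mat" where
 "blow e \<rho> B = mat (dim_row B * e) (dim_col B * e)
  (%(i, j). \<rho> (B $$ (i div e, j div e)) $$ (i mod e, j mod e))"

lemma block_index_less: "i < n * e ==> i div e < n" "i < n * e ==> i mod e < (e::nat)" by (simp add: less_mult_imp_div_less, cases e) auto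

locale block_hom =
 fixes L :: "'a::field set" and e :: nat and \<rho> :: "'a => 'a mat" assumes L: "subfield L ambient" and e: "0 < e"
  and \<rho>_carrier: "x \<in> L ==> \<rho> x \<in> carrier_mat e e" and \<rho>_add: "x \<in> L ==> y \<in> L ==> \<rho> (x + y) = \<rho> x + \<rho> y"
  and \<rho>_mult: "x \<in> L ==> y \<in> L ==> \<rho> (x * y) = \<rho> x * \<rho> y" and \<rho>_one: "\<rho> 1 = 1\<^sub>m e"
begin

lemma \<rho>_zero: "i < e ==> j < e ==> \<rho> 0 $$ (i, j) = 0" proof -
 assume ij: "i < e" "j < e"
 have c: "\<rho> 0 \<in> carrier_mat e e" using \<rho>_carrier subfield_ambient(1)[OF L] by simp
 have "\<rho> 0 = \<rho> 0 + \<rho> 0" using \<rho>_add[of 0 0] subfield_ambient(1)[OF L] by simp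
 then have "\<rho> 0 $$ (i, j) = (\<rho> 0 + \<rho> 0) $$ (i, j)" by simp
 also have "... = \<rho> 0 $$ (i, j) + \<rho> 0 $$ (i, j)" using c ij by simp
 finally show "\<rho> 0 $$ (i, j) = 0" by (metis add_cancel_right_right)
qed

lemma \<rho>_sum: assumes "!!t. t \<in> S ==> f t \<in> L" "i < e" "j < e" shows "\<rho> (\<Sum>t\<in>S. f t) $$ (i, j) = (\<Sum>t\<in>S. \<rho> (f t) $$ (i, j))"
 using assms(1) proof (induction S rule: infinite_finite_induct)
 case (insert t S)
 have "(\<Sum>t\<in>S. f t) \<in> L" using insert by (intro subfield_sum[OF L]) auto
 then have "\<rho> (f t + (\<Sum>t\<in>S. f t)) $$ (i, j) = \<rho> (f t) $$ (i, j) + \<rho> (\<Sum>t\<in>S. f t) $$ (i, j)"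
  using \<rho>_add[of "f t" "\<Sum>t\<in>S. f t"] \<rho>_carrier[of "f t"] \<rho>_carrier[of "\<Sum>t\<in>S. f t"] insert.prems assms by simp
 then show ?case using insert by simp
qed (use \<rho>_zero assms in auto)

lemma \<rho>_det_nonzero: assumes "x \<in> L" "x ~= 0" shows "det (\<rho> x) ~= 0" proof -
 have i: "inverse x \<in> L" using subfield_ambient(7)[OF L assms(1)] .
 have "\<rho> x * \<rho> (inverse x) = 1\<^sub>m e" using \<rho>_mult[OF assms(1) i] assms(2) \<rho>_one by simp
 then have "det (\<rho> x) * det (\<rho> (inverse x)) = 1" using det_mult[OF \<rho>_carrier[OF assms(1)] \<rho>_carrier[OF i]] by simp
 then show ?thesis by auto
qed

definition over_L :: "nat => nat => 'a mat => bool" where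
 "over_L n m B \<longleftrightarrow> B \<in> carrier_mat n m & (ALL i<n. ALL j<m. B $$ (i, j) \<in> L)"

lemma over_L_entry: "over_L n m B ==> i < n ==> j < m ==> B $$ (i, j) \<in> L" by (simp add: over_L_def)

lemma over_L_carrier: "over_L n m B ==> B \<in> carrier_mat n m" by (simp add: over_L_def)

lemma over_L_mult: "over_L n m A ==> over_L m k B ==> over_L n k (A * B)" unfolding over_L_def using mult_entries_in[OF L, of A n m B k] by auto

lemma over_L_det: "over_L n n B ==> det B \<in> L" unfolding over_L_def by (intro det_in_subfield[OF L]) auto

lemma blow_carrier: "B \<in> carrier_mat n m ==> blow e \<rho> B \<in> carrier_mat (n * e) (m * e)" by (simp add: blow_def)

lemma blow_mult: assumes A: "over_L n m A" and B: "over_L m k B" shows "blow e \<rho> (A * B) = blow e \<rho> A * blow e \<rho> B" proof (rule eq_matI)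
 note c = over_L_carrier[OF A] over_L_carrier[OF B]
 fix i j assume "i < dim_row (blow e \<rho> A * blow e \<rho> B)" "j < dim_col (blow e \<rho> A * blow e \<rho> B)"
 then have ij: "i < n * e" "j < k * e" using c by (simp_all add: blow_def)
 note b = block_index_less[OF ij(1)] block_index_less[OF ij(2)]
 let ?I = "i div e" and ?i = "i mod e" and ?J = "j div e" and ?j = "j mod e"
 have *: "\<rho> (A $$ (?I, T) * B $$ (T, ?J)) $$ (?i, ?j) =
   (\<Sum>t<e. \<rho> (A $$ (?I, T)) $$ (?i, t) * \<rho> (B $$ (T, ?J)) $$ (t, ?j))" if "T < m" for T proof -
  have AB: "A $$ (?I, T) \<in> L" "B $$ (T, ?J) \<in> L" using A B b that by (auto intro: over_L_entry)
  show ?thesis unfolding \<rho>_mult[OF AB] using \<rho>_carrier[OF AB(1)] \<rho>_carrier[OF AB(2)] b by (simp add: scalar_prod_def atLeast0LessThan)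
 qed
 have "blow e \<rho> (A * B) $$ (i, j) = \<rho> ((A * B) $$ (?I, ?J)) $$ (?i, ?j)" using c ij by (simp add: blow_def)
 also have "(A * B) $$ (?I, ?J) = (\<Sum>T<m. A $$ (?I, T) * B $$ (T, ?J))" using c b by (simp add: scalar_prod_def atLeast0LessThan)
 also have "\<rho> ... $$ (?i, ?j) = (\<Sum>T<m. \<rho> (A $$ (?I, T) * B $$ (T, ?J)) $$ (?i, ?j))"
  using b A B by (intro \<rho>_sum) (auto intro!: subfield_ambient(4)[OF L] dest: over_L_entry)
 also have "... = (\<Sum>T<m. \<Sum>t<e. \<rho> (A $$ (?I, T)) $$ (?i, t) * \<rho> (B $$ (T, ?J)) $$ (t, ?j))" using * by simp
 also have "... = (\<Sum>s<m * e. \<rho> (A $$ (?I, s div e)) $$ (?i, s mod e) * \<rho> (B $$ (s div e, ?J)) $$ (s mod e, ?j))"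
  unfolding sum_lessThan_times using e by (intro sum.cong) auto
 also have "... = (blow e \<rho> A * blow e \<rho> B) $$ (i, j)" using c ij by (simp add: blow_def scalar_prod_def atLeast0LessThan)
 finally show "blow e \<rho> (A * B) $$ (i, j) = (blow e \<rho> A * blow e \<rho> B) $$ (i, j)" .
qed (use over_L_carrier[OF A] over_L_carrier[OF B] in \<open>auto simp: blow_def\<close>)

text \<open>For the regular representation this says that the determinant over the subfield is the
  norm of the determinant over \<open>L\<close>. It is named because elimination proves it by
  passing from one matrix to another.\<close>

definition norm_compat :: "'a mat => bool" where
 "norm_compat B \<longleftrightarrow> det (blow e \<rho> B) = det (\<rho> (det B))"

text \<open>Both sides of the identity are multiplicative in the matrix, and
  \<open>det (\<rho> (det A))\<close> can be cancelled because \<open>\<rho>\<close> maps nonzero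
  elements to invertible matrices. This permits row operations from the left.\<close>

lemma norm_compat_cancel: assumes A: "over_L n n A" and B: "over_L n n B" and "det A ~= 0" and "norm_compat A" "norm_compat (A * B)" shows "norm_compat B" proof -
 note c = over_L_carrier[OF A] over_L_carrier[OF B] and d = over_L_det[OF A] over_L_det[OF B]
 have "det (\<rho> (det A)) * det (blow e \<rho> B) = det (blow e \<rho> (A * B))" using assms(4) blow_mult[OF A B] det_mult[OF blow_carrier[OF c(1)] blow_carrier[OF c(2)]]
  by (simp add: norm_compat_def)
 also have "... = det (\<rho> (det A)) * det (\<rho> (det B))" using assms(5) det_mult[OF c] \<rho>_mult[OF d] det_mult[OF \<rho>_carrier[OF d(1)] \<rho>_carrier[OF d(2)]]
  by (simp add: norm_compat_def)
 finally show ?thesis using \<rho>_det_nonzero[OF d(1) assms(3)] by (simp add: norm_compat_def)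
qed

text \<open>The diagonal blocks \<open>\<rho> 1\<close> are identity matrices and zero entries
  become zero blocks, so a unitriangular matrix stays unitriangular after blowing up, and both
  determinants are 1. It covers the elementary matrices used in the elimination.\<close>

lemma norm_compat_unitriangular: assumes A: "over_L n n A" and diag: "!!i. i < n ==> A $$ (i, i) = 1"
  and tri: "(ALL i<n. ALL j<i. A $$ (i, j) = 0) \<or> (ALL j<n. ALL i<j. A $$ (i, j) = 0)" shows "norm_compat A" "det A = 1" proof -
 note c = over_L_carrier[OF A]
 have one: "det M = 1" if M: "M \<in> carrier_mat k k" and d: "!!i. i < k ==> M $$ (i, i) = 1"
  and t: "(ALL i<k. ALL j<i. M $$ (i, j) = 0) \<or> (ALL j<k. ALL i<j. M $$ (i, j) = 0)" for M :: "'a mat" and k proof -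
  have "prod_list (diag_mat M) = 1" using M d by (simp add: prod_list_diag_prod)
  moreover have "det M = prod_list (diag_mat M)" using t proof
   assume "ALL i<k. ALL j<i. M $$ (i, j) = 0"
   then show ?thesis using M by (intro det_upper_triangular) auto
  next
   assume "ALL j<k. ALL i<j. M $$ (i, j) = 0"
   then show ?thesis using M by (intro det_lower_triangular[of k]) auto
  qed
  ultimately show ?thesis by simp
 qed
 show detA: "det A = 1" using one[OF c diag tri] .
 have "det (blow e \<rho> A) = 1" proof (rule one[OF blow_carrier[OF c]])
  fix i assume i: "i < n * e"
  show "blow e \<rho> A $$ (i, i) = 1" using i block_index_less[OF i] diag[of "i div e"] c by (simp add: blow_def \<rho>_one)
 next
  have blk: "blow e \<rho> A $$ (i, j) = 0" if ij: "i < n * e" "j < n * e" "i ~= j" and z: "i div e ~= j div e ==> A $$ (i div e, j div e) = 0" for i j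
  proof (cases "i div e = j div e")
   case True
   then have "i mod e ~= j mod e" using ij(3) by (metis div_mult_mod_eq)
   then show ?thesis using True ij block_index_less[OF ij(1)] block_index_less[OF ij(2)] diag[of "j div e"] c by (simp add: blow_def \<rho>_one)
  next
   case False
   then show ?thesis using z ij block_index_less[OF ij(1)] block_index_less[OF ij(2)] c by (simp add: blow_def \<rho>_zero)
  qed
  show "(ALL i<n * e. ALL j<i. blow e \<rho> A $$ (i, j) = 0) \<or> (ALL j<n * e. ALL i<j. blow e \<rho> A $$ (i, j) = 0)" using tri proof
   assume t: "ALL i<n. ALL j<i. A $$ (i, j) = 0"
   have "blow e \<rho> A $$ (i, j) = 0" if "i < n * e" "j < i" for i j using that t block_index_less(1)[of i n e] div_le_mono[of j i e] by (intro blk) auto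
   then show ?thesis by blast
  next
   assume t: "ALL j<n. ALL i<j. A $$ (i, j) = 0"
   have "blow e \<rho> A $$ (i, j) = 0" if "j < n * e" "i < j" for i j using that t block_index_less(1)[of j n e] div_le_mono[of i j e] by (intro blk) auto
   then show ?thesis by blast
  qed
 qed
 then show "norm_compat A" by (simp add: norm_compat_def detA \<rho>_one)
qed

lemma blow_four_block: assumes A: "over_L n n A" "over_L n m B" "over_L m m D" shows "blow e \<rho> (four_block_mat A B (0\<^sub>m m n) D)
  = four_block_mat (blow e \<rho> A) (blow e \<rho> B) (0\<^sub>m (m * e) (n * e)) (blow e \<rho> D)" proof (rule eq_matI)
 note c = A[THEN over_L_carrier]
 have sub1: "(i - n * e) div e = i div e - n & (i - n * e) mod e = i mod e" if i: "~ i < n * e" for i proof -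
  obtain k where "i = n * e + k" using i le_Suc_ex[of "n * e" i] by auto
  then show ?thesis using e by simp
 qed
 have sub2: "i div e < n \<longleftrightarrow> i < n * e" for i :: nat using e by (simp add: div_less_iff_less_mult)
 fix i j assume "i < dim_row (four_block_mat (blow e \<rho> A) (blow e \<rho> B) (0\<^sub>m (m * e) (n * e)) (blow e \<rho> D))"
  "j < dim_col (four_block_mat (blow e \<rho> A) (blow e \<rho> B) (0\<^sub>m (m * e) (n * e)) (blow e \<rho> D))"
 then have ij: "i < (n + m) * e" "j < (n + m) * e" using c by (simp_all add: blow_def add_mult_distrib)
 note b = block_index_less[OF ij(1)] block_index_less[OF ij(2)]
 have ij': "i < n * e + m * e" "j < n * e + m * e" using ij by (simp_all add: add_mult_distrib)
 have less: "~ k < n * e ==> k < n * e + m * e ==> k - n * e < m * e" for k by linarith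
 show "blow e \<rho> (four_block_mat A B (0\<^sub>m m n) D) $$ (i, j) =
   four_block_mat (blow e \<rho> A) (blow e \<rho> B) (0\<^sub>m (m * e) (n * e)) (blow e \<rho> D) $$ (i, j)" proof (cases "i < n * e")
  case True
  then show ?thesis using c ij ij' b sub1[of j] sub2[of i] sub2[of j] by (cases "j < n * e") (simp_all add: blow_def)
 next
  case False
  then have "i div e - n < m" using block_index_less(1)[OF less[OF False ij'(1)]] sub1 by simp
  then show ?thesis using False c ij ij' b sub1[of i] sub1[of j] sub2[of i] sub2[of j] less[OF False ij'(1)]
    \<rho>_zero[of "i mod e" "j mod e"] by (cases "j < n * e") (simp_all add: blow_def)
 qed
qed (use A[THEN over_L_carrier] in \<open>auto simp: blow_def add_mult_distrib\<close>)

text \<open>Gaussian elimination by induction on the size: a first column that vanishes below its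
  top entry splits off a block; otherwise a unitriangular factor clears the column, after a
  preliminary row addition if the pivot is zero. Only unitriangular factors occur, so no sign of a
  row exchange has to be followed.\<close>

theorem det_blow: assumes "over_L d d B" shows "norm_compat B" using assms proof (induction d arbitrary: B)
 case 0
 have "blow e \<rho> B \<in> carrier_mat 0 0" "B \<in> carrier_mat 0 0" using blow_carrier[of B 0 0] 0 by (auto simp: over_L_def)
 then show ?case by (simp add: norm_compat_def \<rho>_one)
next
 case (Suc d)
 have block: "norm_compat C" if C: "over_L (Suc d) (Suc d) C" and z: "!!i. 0 < i ==> i < Suc d ==> C $$ (i, 0) = 0" for C proof -
  define C1 where "C1 = mat 1 1 (%_. C $$ (0, 0))"
  define C2 where "C2 = mat 1 d (%(i, j). C $$ (0, Suc j))"
  define C4 where "C4 = mat d d (%(i, j). C $$ (Suc i, Suc j))"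
  have o: "over_L 1 1 C1" "over_L 1 d C2" "over_L d d C4" using C by (auto simp: over_L_def C1_def C2_def C4_def)
  have eq: "C = four_block_mat C1 C2 (0\<^sub>m d 1) C4" using C z by (intro eq_matI) (auto simp: over_L_def C1_def C2_def C4_def)
  have d1: "det C1 = C $$ (0, 0)" by (simp add: det_single C1_def)
  have L1: "C $$ (0, 0) \<in> L" using C by (auto simp: over_L_def)
  have bl1: "blow e \<rho> C1 = \<rho> (C $$ (0, 0))" using \<rho>_carrier[OF L1] by (intro eq_matI) (auto simp: blow_def C1_def)
  have "det (blow e \<rho> C) = det (blow e \<rho> C1) * det (blow e \<rho> C4)" unfolding eq blow_four_block[OF o]
   by (rule det_four_block_mat_lower_left_zero[OF blow_carrier blow_carrier _ blow_carrier])
    (use o in \<open>auto simp: over_L_def\<close>)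
  also have "... = det (\<rho> (C $$ (0, 0))) * det (\<rho> (det C4))" using Suc.IH[OF o(3)] bl1 by (simp add: norm_compat_def)
  also have "... = det (\<rho> (C $$ (0, 0) * det C4))"
   using det_mult[OF \<rho>_carrier[OF L1] \<rho>_carrier[OF over_L_det[OF o(3)]]] \<rho>_mult[OF L1 over_L_det[OF o(3)]] by simp
  also have "C $$ (0, 0) * det C4 = det C" unfolding d1[symmetric]
   by (subst eq, rule det_four_block_mat_lower_left_zero[symmetric]) (use o in \<open>auto simp: over_L_def\<close>)
  finally show ?thesis by (simp add: norm_compat_def)
 qed
 have pivot: "norm_compat C" if C: "over_L (Suc d) (Suc d) C" and p: "C $$ (0, 0) ~= 0" for C proof -
  \<comment> \<open>Left multiplication by \<open>E\<close> subtracts from each row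
    \<open>i > 0\<close> the multiple of row 0 that annihilates the entry in column 0.\<close>
  define E where "E = mat (Suc d) (Suc d)
   (%(i, j). if i = j then 1 else if j = 0 then - (C $$ (i, 0) / C $$ (0, 0)) else 0)"
  have E: "over_L (Suc d) (Suc d) E" using C unfolding over_L_def E_def by (auto intro!: subfield_ambient(5,8)[OF L] simp: subfield_ambient(1,2)[OF L])
  have t: "norm_compat E" "det E = 1" using norm_compat_unitriangular[OF E] by (auto simp: E_def)
  have "norm_compat (E * C)" proof (rule block)
   show "over_L (Suc d) (Suc d) (E * C)" using over_L_mult[OF E C] .
   fix i assume i: "0 < i" "i < Suc d"
   have "(E * C) $$ (i, 0) = (\<Sum>j<Suc d. E $$ (i, j) * C $$ (j, 0))" using over_L_carrier[OF C] over_L_carrier[OF E] i by (simp add: scalar_prod_def atLeast0LessThan)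
   also have "... = (\<Sum>j<Suc d. (if j = i then C $$ (i, 0) else 0) + (if j = 0 then - C $$ (i, 0) else 0))" using i p by (intro sum.cong) (auto simp: E_def)
   also have "... = 0" using i by (subst sum.distrib) (simp add: sum.delta)
   finally show "(E * C) $$ (i, 0) = 0" .
  qed
  then show ?thesis using norm_compat_cancel[OF E C] t by simp
 qed
 show ?case proof (cases "EX i. 0 < i & i < Suc d & B $$ (i, 0) ~= 0")
  case True
  then obtain k where k: "0 < k" "k < Suc d" "B $$ (k, 0) ~= 0" by auto
  show ?thesis proof (cases "B $$ (0, 0) = 0")
   case True
   \<comment> \<open>Left multiplication by \<open>E\<close> adds row \<open>k\<close> to row 0,
     which puts the nonzero entry \<open>B $$ (k, 0)\<close> into the pivot position.\<close>
   define E :: "'a mat" where "E = mat (Suc d) (Suc d) (%(i, j). if i = j then 1 else if i = 0 & j = k then 1 else 0)"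
   have E: "over_L (Suc d) (Suc d) E" by (auto simp: over_L_def E_def subfield_ambient(1,2)[OF L])
   have t: "norm_compat E" "det E = 1" using norm_compat_unitriangular[OF E] by (auto simp: E_def)
   have "norm_compat (E * B)" proof (rule pivot)
    show "over_L (Suc d) (Suc d) (E * B)" using over_L_mult[OF E Suc.prems] .
    have "(E * B) $$ (0, 0) = (\<Sum>j<Suc d. E $$ (0, j) * B $$ (j, 0))"
     using over_L_carrier[OF Suc.prems] over_L_carrier[OF E] by (simp add: scalar_prod_def atLeast0LessThan)
    also have "... = (\<Sum>j<Suc d. if j = k then B $$ (k, 0) else 0)" using True by (intro sum.cong) (auto simp: E_def)
    also have "... = B $$ (k, 0)" using k by (simp add: sum.delta)
    finally show "(E * B) $$ (0, 0) ~= 0" using k by simp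
   qed
   then show ?thesis using norm_compat_cancel[OF E Suc.prems] t by simp
  qed (use pivot[OF Suc.prems] in simp)
 qed (use block[OF Suc.prems] in blast)
qed

end

lemma is_basis_tower: assumes F: "subfield F (ambient :: 'a::field ring)" and L: "subfield L ambient" and a: "is_basis F L e a" and b: "is_basis L M d b" and e: "0 < e"
 shows "is_basis F M (d * e) (%k. b (k div e) * a (k mod e))" proof -
 have sum: "(\<Sum>k<d * e. f k * (b (k div e) * a (k mod e))) = (\<Sum>I<d. (\<Sum>i<e. f (I * e + i) * a i) * b I)" for f unfolding sum_lessThan_times using e
  by (intro sum.cong refl) (simp add: sum_distrib_right sum_distrib_left mult_ac)
 have idx: "I * e + i < d * e" if "I < d" "i < e" for I i proof -
  have "I * e + i < Suc I * e" using that by simp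
  also have "... <= d * e" using that by (intro mult_le_mono1) simp
  finally show ?thesis .
 qed
 show ?thesis unfolding is_basis_def sum proof (intro conjI allI impI ballI)
  fix c assume c: "ALL i<d * e. c i \<in> F"
  show "(\<Sum>I<d. (\<Sum>i<e. c (I * e + i) * a i) * b I) \<in> M" using c idx by (intro is_basis_in[OF b] is_basis_in[OF a]) auto
  fix k assume z: "(\<Sum>I<d. (\<Sum>i<e. c (I * e + i) * a i) * b I) = 0" and k: "k < d * e"
  have "(\<Sum>i<e. c (I * e + i) * a i) = 0" if "I < d" for I using is_basis_eq[OF b L _ _ _ that, of "%I. \<Sum>i<e. c (I * e + i) * a i" "%_. 0"] z c idx
    is_basis_in[OF a] subfield_ambient(1)[OF L] by simp
  from this[OF block_index_less(1)[OF k]] have "(\<Sum>i<e. c (k div e * e + i) * a i) = (\<Sum>i<e. 0 * a i)" by simp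
  from is_basis_eq[OF a F _ _ this block_index_less(2)[OF k]] c idx[OF block_index_less(1)[OF k]]
  show "c k = 0" using subfield_ambient(1)[OF F] by simp
 next
  fix x assume "x \<in> M"
  then obtain g where g: "!!I. I < d ==> g I \<in> L" "x = (\<Sum>I<d. g I * b I)" using is_basis_repr[OF b] by blast
  obtain P where P: "!!i j. i < e ==> j < d ==> P $$ (i, j) \<in> F"
   "!!j. j < d ==> g j = (\<Sum>i<e. P $$ (i, j) * a i)" using coeff_matrix_exists[OF a, of d g] g(1) by metis
  show "EX c. (ALL i<d * e. c i \<in> F) & x = (\<Sum>I<d. (\<Sum>i<e. c (I * e + i) * a i) * b I)" using P g(2) e block_index_less[of _ d e]
   by (intro exI[of _ "%k. P $$ (k mod e, k div e)"]) auto
 qed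
qed

lemma rep_mat_unique: assumes "subfield F (ambient :: 'a::field ring)" "is_basis F L n b" "rep_mat F n b x A" "rep_mat F n b x B" shows "A = B"
proof (rule basis_matrix_eqI[OF assms(1,2)])
 show "(\<Sum>i<n. A $$ (i, j) * b i) = (\<Sum>i<n. B $$ (i, j) * b i)" if "j < n" for j using assms(3,4) that unfolding rep_mat_def by metis
qed (use assms(3,4) in \<open>auto simp: rep_mat_def\<close>)

lemma rep_mat_add: assumes F: "subfield F (ambient :: 'a::field ring)" and "rep_mat F n b x A" "rep_mat F n b y B" shows "rep_mat F n b (x + y) (A + B)" unfolding rep_mat_def
proof (intro conjI allI impI)
 note AB = assms(2,3)[unfolded rep_mat_def]
 show "A + B \<in> carrier_mat n n" using AB by auto
 show "(A + B) $$ (i, j) \<in> F" if "i < n" "j < n" for i j using AB that subfield_ambient(3)[OF F] by auto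
 show "(x + y) * b j = (\<Sum>i<n. (A + B) $$ (i, j) * b i)" if "j < n" for j proof -
  have "(\<Sum>i<n. (A + B) $$ (i, j) * b i) = (\<Sum>i<n. A $$ (i, j) * b i) + (\<Sum>i<n. B $$ (i, j) * b i)"
   unfolding sum.distrib[symmetric] using AB that by (intro sum.cong) (auto simp: distrib_right)
  then show ?thesis using AB that by (simp add: distrib_right)
 qed
qed

lemma rep_mat_scalar: assumes F: "subfield F (ambient :: 'a::field ring)" and "x \<in> F" shows "rep_mat F n b x (x \<cdot>\<^sub>m 1\<^sub>m n)" proof -
 have "(\<Sum>i<n. (x \<cdot>\<^sub>m 1\<^sub>m n) $$ (i, j) * b i) = x * b j" if "j < n" for j proof -
  have "(\<Sum>i<n. (x \<cdot>\<^sub>m 1\<^sub>m n) $$ (i, j) * b i) = (\<Sum>i<n. if i = j then x * b j else 0)" using that by (intro sum.cong) auto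
  then show ?thesis using that by simp
 qed
 then show ?thesis using assms subfield_ambient(1)[OF F] by (auto simp: rep_mat_def)
qed

lemma field_norm_mult: assumes F: "subfield F (ambient :: 'a::field ring)" and L: "subfield L ambient" and b: "is_basis F L n b" and x: "x \<in> L" and y: "y \<in> L"
 shows "field_norm F L (x * y) = field_norm F L x * field_norm F L y" proof -
 obtain M where M: "rep_mat F n b x M" using rep_mat_exists[OF F b L x] .
 obtain M' where M': "rep_mat F n b y M'" using rep_mat_exists[OF F b L y] .
 show ?thesis unfolding field_norm_eq[OF F b rep_mat_mult[OF F M M']] field_norm_eq[OF F b M] field_norm_eq[OF F b M'] using M M' by (intro det_mult) (auto simp: rep_mat_def)
qed

lemma field_norm_scalar: assumes F: "subfield F (ambient :: 'a::field ring)" and b: "is_basis F L n b" and "x \<in> F" shows "field_norm F L x = x ^ n"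
 unfolding field_norm_eq[OF F b rep_mat_scalar[OF F assms(3)]] by simp

text \<open>In the product basis, multiplication by \<open>x\<close> over \<open>F\<close> is
  represented by the matrix \<open>B\<close> of \<open>x\<close> over \<open>L\<close> with each
  entry replaced by its own regular representation matrix. \<open>det_blow\<close> then evaluates
  the determinant as the norm of \<open>det B\<close>.\<close>

theorem field_norm_tower: assumes F: "subfield F (ambient :: 'a::field ring)" and L: "subfield L ambient" and M: "subfield M ambient"
  and a: "is_basis F L e a" and b: "is_basis L M d b" and e: "0 < e" and x: "x \<in> M" shows "field_norm F M x = field_norm F L (field_norm L M x)" proof -
 \<comment> \<open>Any choice of a representing matrix will do: coordinates are unique, so the
   chosen map is automatically a ring homomorphism.\<close>
 define \<rho> where "\<rho> y = (SOME R. rep_mat F e a y R)" for y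
 have rho: "rep_mat F e a y (\<rho> y)" if "y \<in> L" for y unfolding \<rho>_def by (rule someI_ex) (use rep_mat_exists[OF F a L that] in blast)
 have rhoI: "\<rho> y = R" if "y \<in> L" "rep_mat F e a y R" for y R using rep_mat_unique[OF F a rho[OF that(1)] that(2)] .
 interpret block_hom L e \<rho> proof (rule block_hom.intro)
  show "subfield L ambient" "0 < e" by fact+
  show "\<rho> y \<in> carrier_mat e e" if "y \<in> L" for y using rho[OF that] by (simp add: rep_mat_def)
  show "\<rho> (y + z) = \<rho> y + \<rho> z" if "y \<in> L" "z \<in> L" for y z using that by (intro rhoI rep_mat_add[OF F] rho subfield_ambient(3)[OF L])
  show "\<rho> (y * z) = \<rho> y * \<rho> z" if "y \<in> L" "z \<in> L" for y z using that by (intro rhoI rep_mat_mult[OF F] rho subfield_ambient(4)[OF L])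
  show "\<rho> 1 = 1\<^sub>m e" proof (rule rhoI[OF subfield_ambient(2)[OF L]])
   have "(1 :: 'a) \<cdot>\<^sub>m 1\<^sub>m e = 1\<^sub>m e" by (rule eq_matI) auto
   then show "rep_mat F e a 1 (1\<^sub>m e)" using rep_mat_scalar[OF F subfield_ambient(2)[OF F], of e a] by simp
  qed
 qed
 obtain B where B: "rep_mat L d b x B" using rep_mat_exists[OF L b M x] .
 have oB: "over_L d d B" using B by (auto simp: over_L_def rep_mat_def)
 have "rep_mat F (d * e) (%k. b (k div e) * a (k mod e)) x (blow e \<rho> B)" unfolding rep_mat_def proof (intro conjI allI impI)
  show "blow e \<rho> B \<in> carrier_mat (d * e) (d * e)" using blow_carrier[OF over_L_carrier[OF oB]] .
  fix j assume j: "j < d * e"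
  note bj = block_index_less[OF j]
  show "blow e \<rho> B $$ (i, j) \<in> F" if i: "i < d * e" for i
   using i j block_index_less[OF i] bj over_L_carrier[OF oB] rho[OF over_L_entry[OF oB, of "i div e" "j div e"]] by (simp add: blow_def rep_mat_def)
  have "x * (b (j div e) * a (j mod e)) = (\<Sum>I<d. B $$ (I, j div e) * b I) * a (j mod e)" using B bj by (simp add: rep_mat_def mult.assoc[symmetric])
  also have "... = (\<Sum>I<d. b I * (B $$ (I, j div e) * a (j mod e)))" unfolding sum_distrib_right by (intro sum.cong refl) (simp only: mult_ac)
  also have "... = (\<Sum>I<d. b I * (\<Sum>i<e. \<rho> (B $$ (I, j div e)) $$ (i, j mod e) * a i))"
   using rho[OF over_L_entry[OF oB]] bj by (intro sum.cong refl) (simp add: rep_mat_def)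
  also have "... = (\<Sum>k<d * e. \<rho> (B $$ (k div e, j div e)) $$ (k mod e, j mod e) * (b (k div e) * a (k mod e)))"
   unfolding sum_lessThan_times using e by (intro sum.cong refl) (simp add: sum_distrib_left mult_ac)
  also have "... = (\<Sum>k<d * e. blow e \<rho> B $$ (k, j) * (b (k div e) * a (k mod e)))" using j over_L_carrier[OF oB] by (intro sum.cong refl) (simp add: blow_def)
  finally show "x * (b (j div e) * a (j mod e)) = (\<Sum>k<d * e. blow e \<rho> B $$ (k, j) * (b (k div e) * a (k mod e)))" .
 qed
 then have "field_norm F M x = det (blow e \<rho> B)" by (rule field_norm_eq[OF F is_basis_tower[OF F L a b e]])
 also have "... = det (\<rho> (det B))" using det_blow[OF oB] by (simp add: norm_compat_def)
 also have "... = field_norm F L (det B)" using field_norm_eq[OF F a rho[OF over_L_det[OF oB]]] by simp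
 also have "det B = field_norm L M x" using field_norm_eq[OF L b B] by simp
 finally show ?thesis .
qed

text \<open>An independent family with as many members as the dimension spans; the basis
  \<open>b0\<close> fixes that dimension.\<close>

lemma basis_of_independent: assumes F: "subfield F (ambient :: 'a::field ring)" and b0: "is_basis F L d b0" and mem: "!!i. i < d ==> b i \<in> L"
  and ind: "!!c. (!!i. i < d ==> c i \<in> F) ==> (\<Sum>i<d. c i * b i) = 0 ==> ALL i<d. c i = 0" shows "is_basis F L d b" proof -
 interpret R: ring "ambient :: 'a ring" by (rule ring_ambient)
 define bs where "bs = map b [0..<d]"
 have list: "is_basis F S (length bs) (%i. bs ! i) \<longleftrightarrow> is_basis F S d b" for S by (simp add: is_basis_def bs_def)
 have list0: "is_basis F L (length (map b0 [0..<d])) (%i. map b0 [0..<d] ! i)" using b0 by (simp add: is_basis_def)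
 have dim: "R.dimension d F L" using R.dimensionI[OF F, of "map b0 [0..<d]" L] is_basis_iff[OF F, of "map b0 [0..<d]" L] list0 by simp
 define S where "S = {\<Sum>i<d. c i * b i | c. ALL i<d. c i \<in> F}"
 have "is_basis F S d b" unfolding is_basis_def proof (intro conjI allI impI ballI)
  show "(\<Sum>i<d. c i * b i) \<in> S" if "ALL i<d. c i \<in> F" for c using that by (auto simp: S_def)
  show "EX c. (ALL i<d. c i \<in> F) & x = (\<Sum>i<d. c i * b i)" if "x \<in> S" for x using that by (auto simp: S_def)
  show "c i = 0" if "ALL i<d. c i \<in> F" "(\<Sum>i<d. c i * b i) = 0" "i < d" for c i using ind[of c] that by blast
 qed
 then have S: "R.independent F bs & R.Span F bs = S" using is_basis_iff[OF F, of bs S] list by simp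
 have "length bs = d" "set bs <= L" using mem by (auto simp: bs_def)
 then have "R.Span F bs = L" using R.independent_length_eq_dimension[OF F dim conjunct1[OF S]] by blast
 then show ?thesis using is_basis_iff[OF F, of bs L] S list by simp
qed

section \<open>Non-Archimedean local fields\<close>

locale local_field =
 fixes F :: "'a::field set" and v :: "'a => real" assumes local_field: "nonarch_local_field F v"
begin

abbreviation "q \<equiv> residue_card F v"

lemma sf: "subfield F ambient" using local_field by (simp add: nonarch_local_field_def)

lemmas sfI = subfield_ambient[OF sf]

lemma v_nonneg: "x \<in> F ==> 0 <= v x" and v_eq_0: "x \<in> F ==> v x = 0 \<longleftrightarrow> x = 0" and v_mult: "x \<in> F ==> y \<in> F ==> v (x * y) = v x * v y"
 and v_add: "x \<in> F ==> y \<in> F ==> v (x + y) <= max (v x) (v y)" and finite_residue: "finite (residue_field F v)"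
 and v_range: "v ` (F - {0}) = range (%j::int. real q powi j)" and complete: "Metric_space.mcomplete F (val_dist F v)"
 using local_field by (auto simp: nonarch_local_field_def)

lemma v_0: "v 0 = 0" using v_eq_0 sfI(1) by simp

lemma v_1: "v 1 = 1" using v_mult[of 1 1] v_eq_0[of 1] sfI(2) by simp

lemma v_pos: "x \<in> F ==> x ~= 0 ==> 0 < v x" using v_nonneg v_eq_0 by (simp add: less_le)

lemma v_minus: assumes "x \<in> F" shows "v (- x) = v x" proof -
 have "v (- 1) * v (- 1) = 1" using v_mult[of "- 1" "- 1"] sfI(2,5) v_1 by simp
 then have "v (- 1) = 1" using v_nonneg[of "- 1"] sfI(2,5) by (metis abs_of_nonneg real_sqrt_abs2 real_sqrt_one)
 then show ?thesis using v_mult[of "- 1" x] assms sfI(2,5) by simp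
qed

lemma v_diff: "x \<in> F ==> y \<in> F ==> v (x - y) <= max (v x) (v y)" using v_add[of x "- y"] v_minus sfI(5) by simp

lemma v_diff_commute: "x \<in> F ==> y \<in> F ==> v (x - y) = v (y - x)" using v_minus[of "x - y"] sfI(6) by simp

lemma v_diff_trans: "x \<in> F ==> y \<in> F ==> z \<in> F ==> v (x - z) <= max (v (x - y)) (v (y - z))" using v_add[of "x - y" "y - z"] sfI(6) by simp

lemma v_trans_less:
 "v (x - y) < t ==> v (y - z) < t ==> x \<in> F ==> y \<in> F ==> z \<in> F ==> v (x - z) < t" using v_diff_trans[of x y z] by linarith

lemma v_trans_le:
 "v (x - y) <= t ==> v (y - z) <= t ==> x \<in> F ==> y \<in> F ==> z \<in> F ==> v (x - z) <= t" using v_diff_trans[of x y z] by linarith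

lemma v_add_less: "v x < t ==> v y < t ==> x \<in> F ==> y \<in> F ==> v (x + y) < t" using v_add[of x y] by linarith

lemma v_power: "x \<in> F ==> v (x ^ n) = v x ^ n" by (induction n) (auto simp: v_1 v_mult sfI)

lemma v_inverse: assumes "x \<in> F" shows "v (inverse x) = inverse (v x)" proof (cases "x = 0")
 case False
 then have "v x * v (inverse x) = 1" using v_mult[of x "inverse x"] assms sfI(7) v_1 by simp
 then show ?thesis by (metis inverse_unique)
qed (simp add: v_0)

lemma v_divide: "x \<in> F ==> y \<in> F ==> v (x / y) = v x / v y" by (simp add: divide_inverse v_mult v_inverse sfI)

lemma v_sum: assumes "!!i. i \<in> A ==> f i \<in> F" "!!i. i \<in> A ==> v (f i) <= t" "0 <= t" shows "v (\<Sum>i\<in>A. f i) <= t" using assms(1,2)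
proof (induction A rule: infinite_finite_induct)
 case (insert a A)
 have "v (f a + (\<Sum>i\<in>A. f i)) <= max (v (f a)) (v (\<Sum>i\<in>A. f i))" using insert.prems by (intro v_add subfield_sum[OF sf]) auto
 moreover have "v (\<Sum>i\<in>A. f i) <= t" "v (f a) <= t" using insert by auto
 ultimately have "v (f a + (\<Sum>i\<in>A. f i)) <= t" by linarith
 then show ?case using insert.hyps by simp
qed (auto simp: v_0 assms(3))

lemma v_prod: assumes "!!i. i \<in> A ==> f i \<in> F" shows "v (\<Prod>i\<in>A. f i) = (\<Prod>i\<in>A. v (f i))"
 using assms by (induction A rule: infinite_finite_induct) (auto simp: v_1 v_mult subfield_prod[OF sf])

lemma v_of_nat: "v (of_nat n) <= 1" using v_sum[of "{..<n}" "%_. 1" 1] by (simp add: sfI v_1)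

lemma v_add_dominant: assumes "x \<in> F" "y \<in> F" "v y < v x" shows "v (x + y) = v x" proof -
 have "v x <= max (v (x + y)) (v y)" using v_diff[of "x + y" y] assms sfI(3) by simp
 then show ?thesis using v_add[OF assms(1,2)] assms(3) by simp
qed

lemma residue_equiv: "equiv {x \<in> F. v x <= 1} {(x, y). x \<in> F & y \<in> F & v x <= 1 & v y <= 1 & v (x - y) < 1}" proof (rule equivI)
 show "trans {(x, y). x \<in> F & y \<in> F & v x <= 1 & v y <= 1 & v (x - y) < 1}" by (rule transI) (auto intro: v_trans_less)
qed (auto simp: refl_on_def sym_def v_0 v_diff_commute)

text \<open>Choosing one element from each class replaces the quotient by a finite set of field
  elements, which serve as digits in \<open>ball_reps\<close> and as pigeonholes in
  \<open>unit_power_in_U\<close>.\<close>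

lemma residue_reps: obtains S where "finite S" "card S = q" "S <= {x \<in> F. v x <= 1}"
  "!!x. x \<in> F ==> v x <= 1 ==> EX! s. s \<in> S & v (x - s) < 1" proof -
 let ?O = "{x \<in> F. v x <= 1}" and ?r = "{(x, y). x \<in> F & y \<in> F & v x <= 1 & v y <= 1 & v (x - y) < 1}"
 define g where "g C = (SOME x. x \<in> C)" for C :: "'a set"
 have g: "g C \<in> C" if "C \<in> residue_field F v" for C proof -
  have "C ~= {}" using that in_quotient_imp_non_empty[OF residue_equiv] unfolding residue_field_def by auto
  then show ?thesis unfolding g_def by (simp add: some_in_eq)
 qed
 have sub: "C <= ?O" if "C \<in> residue_field F v" for C using that in_quotient_imp_subset[OF residue_equiv] unfolding residue_field_def by blast
 have same: "C = D" if "C \<in> residue_field F v" "D \<in> residue_field F v" "x \<in> C" "y \<in> D" "(x, y) \<in> ?r" for C D x y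
  using that quotient_eq_iff[OF residue_equiv] unfolding residue_field_def by blast
 show ?thesis proof (rule that[of "g ` residue_field F v"])
  show "finite (g ` residue_field F v)" using finite_residue by simp
  have "inj_on g (residue_field F v)" proof (rule inj_onI)
   fix C D assume *: "C \<in> residue_field F v" "D \<in> residue_field F v" "g C = g D"
   have "(g C, g D) \<in> ?r" using g[OF *(1)] sub[OF *(1)] *(3) by (auto simp: v_0)
   then show "C = D" using same g * by blast
  qed
  then show "card (g ` residue_field F v) = q" by (simp add: card_image)
  show "g ` residue_field F v <= ?O" using g sub by blast
  fix x assume x: "x \<in> F" "v x <= 1"
  define C where "C = ?r `` {x}"
  have C: "C \<in> residue_field F v" unfolding C_def residue_field_def using x by (intro quotientI) auto
  have gC: "v (x - g C) < 1" using g[OF C] unfolding C_def by auto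
  show "EX! s. s \<in> g ` residue_field F v & v (x - s) < 1" proof (rule ex1I[of _ "g C"])
   fix s assume s: "s \<in> g ` residue_field F v & v (x - s) < 1"
   then obtain D where D: "D \<in> residue_field F v" "s = g D" by auto
   have "x \<in> C" using x by (auto simp: C_def v_0)
   moreover have "(x, s) \<in> ?r" using s D g[OF D(1)] sub[OF D(1)] x by auto
   ultimately show "s = g C" using same[OF C D(1)] g[OF D(1)] D(2) by blast
  qed (use C gC in auto)
 qed
qed

lemma q_ge_2: "2 <= q" proof -
 obtain S where S: "finite S" "card S = q" "S <= {x \<in> F. v x <= 1}"
  "!!x. x \<in> F ==> v x <= 1 ==> EX! s. s \<in> S & v (x - s) < 1" by (rule residue_reps) (rule that)
 obtain s0 where s0: "s0 \<in> S" "v (0 - s0) < 1" using S(4)[of 0] sfI(1) v_0 by auto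
 obtain s1 where s1: "s1 \<in> S" "v (1 - s1) < 1" using S(4)[of 1] sfI(2) v_1 by auto
 have in_F: "s0 \<in> F" "s1 \<in> F" using S s0 s1 by auto
 have "s0 ~= s1" proof
  assume "s0 = s1"
  then have "v (1 - 0) < 1" using v_diff_trans[of 1 s0 0] s0 s1 in_F sfI(1,2) v_diff_commute[of 0 s0] by auto
  then show False by (simp add: v_1)
 qed
 then have "card {s0, s1} = 2" by simp
 then show ?thesis using card_mono[OF S(1), of "{s0, s1}"] s0 s1 S(2) by simp
qed

lemma q_gt_1: "1 < real q" using q_ge_2 by simp

lemma v_powi: assumes "x \<in> F" "x ~= 0" obtains j where "v x = real q powi j" using v_range assms by (metis DiffI image_eqI rangeE singletonD)

lemma powi_mono: "real q powi i <= real q powi j \<longleftrightarrow> i <= j" using q_gt_1 power_int_increasing[of i j "real q"] power_int_strict_increasing[of j i "real q"]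
 by (meson less_imp_le not_le order_less_irrefl order_less_le_trans)

lemma powi_less: "real q powi i < real q powi j \<longleftrightarrow> i < j" using powi_mono[of j i] by linarith

lemma powi_inj: "real q powi i = real q powi j \<longleftrightarrow> i = j" using powi_mono[of i j] powi_mono[of j i] by auto

text \<open>There is no value strictly between consecutive powers of \<open>q\<close>. This lets
  strict and weak bounds be exchanged at the cost of one in the exponent.\<close>

lemma v_discrete: assumes "x \<in> F" "v x < real q powi (j + 1)" shows "v x <= real q powi j" proof (cases "x = 0")
 case False
 then obtain i where "v x = real q powi i" using v_powi assms by blast
 then show ?thesis using assms(2) by (simp add: powi_less powi_mono)
qed (simp add: v_0)

lemma v_less_1: assumes "x \<in> F" "v x < 1" shows "v x <= 1 / real q" using v_discrete[OF assms(1), of "-1"] assms(2) by (simp add: power_int_minus_divide)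

lemma uniformizer: obtains \<pi> where "\<pi> \<in> F" "\<pi> ~= 0" "v \<pi> = 1 / real q" proof -
 have "real q powi (-1) \<in> v ` (F - {0})" unfolding v_range by (rule rangeI)
 then show ?thesis by (auto simp: power_int_minus_divide intro: that)
qed

lemma metric: "Metric_space F (val_dist F v)" proof
 show "0 <= val_dist F v x y" for x y by (simp add: val_dist_def v_nonneg sfI)
 show "val_dist F v x y = val_dist F v y x" for x y by (simp add: val_dist_def v_diff_commute)
 show "val_dist F v x y = 0 \<longleftrightarrow> x = y" if "x \<in> F" "y \<in> F" for x y using that by (simp add: val_dist_def v_eq_0 sfI)
 show "val_dist F v x z <= val_dist F v x y + val_dist F v y z" if "x \<in> F" "y \<in> F" "z \<in> F" for x y z
  using that v_diff_trans[of x y z] v_nonneg[of "x - y"] v_nonneg[of "y - z"] by (simp add: val_dist_def sfI)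
qed

text \<open>In an ultrametric the distances of all later terms from \<open>x k\<close> are bounded
  by the same \<open>B k\<close> as the next step, since \<open>B\<close> decreases, and the limit
  inherits the bound. Completeness of the fields is always used in this quantitative form.\<close>

lemma cauchy_converges: assumes x: "!!k. x k \<in> F" and step: "!!k. v (x (Suc k) - x k) <= B k" and B: "decseq B" "B \<longlonglongrightarrow> 0"
 obtains z where "z \<in> F" "!!k. v (z - x k) <= B k" proof -
 interpret M: Metric_space F "val_dist F v" by (rule metric)
 have Bnn: "0 <= B k" for k using step[of k] v_nonneg[of "x (Suc k) - x k"] x sfI(6) by (meson order_trans)
 have far: "v (x (k + n) - x k) <= B k" for k n proof (induction n)
  case (Suc n)
  have "v (x (k + Suc n) - x k) <= max (v (x (Suc (k + n)) - x (k + n))) (v (x (k + n) - x k))" using v_diff_trans[of "x (Suc (k + n))" "x (k + n)" "x k"] x by simp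
  moreover have "v (x (Suc (k + n)) - x (k + n)) <= B k" using step[of "k + n"] decseqD[OF B(1), of k "k + n"] by simp
  ultimately show ?case using Suc by simp
 qed (simp add: v_0 Bnn)
 have "M.MCauchy x" unfolding M.MCauchy_def proof (intro conjI allI impI)
  show "range x <= F" using x by auto
  fix \<epsilon> :: real assume "0 < \<epsilon>"
  then obtain k where k: "B k < \<epsilon>" using order_tendstoD(2)[OF B(2)] by (metis eventually_sequentially order_refl)
  have "val_dist F v (x n) (x n') < \<epsilon>" if "k <= n" "k <= n'" for n n' proof -
   have "v (x n - x k) <= B k" "v (x n' - x k) <= B k" using far[of k "n - k"] far[of k "n' - k"] that by auto
   then show ?thesis using v_diff_trans[of "x n" "x k" "x n'"] v_diff_commute[of "x k" "x n'"] x k by (simp add: val_dist_def)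
  qed
  then show "EX N. ALL n n'. N <= n --> N <= n' --> val_dist F v (x n) (x n') < \<epsilon>" by blast
 qed
 then obtain z where z: "limitin M.mtopology x z sequentially" using complete unfolding M.mcomplete_def by blast
 then have zF: "z \<in> F" and lim: "!!\<epsilon>. 0 < \<epsilon> ==> \<forall>\<^sub>F n in sequentially. val_dist F v (x n) z < \<epsilon>"
  by (auto simp: M.limitin_metric eventually_conj_iff)
 have "v (z - x k) <= B k" for k proof (rule field_le_epsilon)
  fix \<epsilon> :: real assume "0 < \<epsilon>"
  then obtain N where N: "ALL n>=N. val_dist F v (x n) z < \<epsilon>" using lim by (auto simp: eventually_sequentially)
  have "v (x (k + N) - z) < \<epsilon>" using N[rule_format, of "k + N"] x zF by (simp add: val_dist_def)
  then show "v (z - x k) <= B k + \<epsilon>"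
   using v_diff_trans[of z "x (k + N)" "x k"] far[of k N] v_diff_commute[of z "x (k + N)"] x zF Bnn[of k] \<open>0 < \<epsilon>\<close>
   by (auto simp: max_def split: if_splits)
 qed
 then show ?thesis using that zF by blast
qed

definition U :: "'a set" where "U = {x \<in> F. v (1 - x) < 1}"

lemma U_in: "x \<in> U ==> x \<in> F" by (simp add: U_def)

lemma U_lt: "x \<in> U ==> v (1 - x) < 1" by (simp add: U_def)

lemma U_1: "1 \<in> U" by (simp add: U_def v_0 sfI)

lemma v_U: assumes "x \<in> U" shows "v x = 1" using v_add_dominant[of 1 "- (1 - x)"] assms v_minus[of "1 - x"] by (simp add: U_def v_1 sfI)

lemma U_nonzero: "x \<in> U ==> x ~= 0" using v_U v_0 by force

lemma v_1_mult: assumes "x \<in> U" "y \<in> F" shows "v (1 - x * y) <= max (v (1 - x)) (v (1 - y))" proof -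
 have "v (1 - x * y) <= max (v (1 - x)) (v (x - x * y))" using assms U_in by (intro v_diff_trans) (auto intro: sfI)
 also have "v (x - x * y) = v (1 - y)" using v_mult[of x "1 - y"] assms U_in v_U by (simp add: right_diff_distrib sfI)
 finally show ?thesis .
qed

lemma U_mult: "x \<in> U ==> y \<in> U ==> x * y \<in> U" using v_1_mult[of x y] U_lt[of x] U_lt[of y] by (auto simp: U_def sfI)

lemma v_1_inverse: assumes "x \<in> U" shows "v (1 - inverse x) = v (1 - x)" proof -
 have "v x * v (1 - inverse x) = v (x - 1)" using v_mult[of x "1 - inverse x"] assms U_in U_nonzero by (simp add: right_diff_distrib sfI)
 then show ?thesis using v_U[OF assms] v_diff_commute[of 1 x] U_in[OF assms] sfI(2) by simp
qed

lemma U_inverse: "x \<in> U ==> inverse x \<in> U" using v_1_inverse[of x] by (simp add: U_def sfI(7))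

lemma U_power: "x \<in> U ==> x ^ n \<in> U" by (induction n) (auto intro: U_1 U_mult)

lemma v_diff_U: assumes "x \<in> U" "y \<in> U" shows "v (1 - x * inverse y) = v (x - y)" proof -
 have "v y * v (1 - x * inverse y) = v (y - x)" using v_mult[of y "1 - x * inverse y"] U_in[OF assms(1)] U_in[OF assms(2)] U_nonzero[OF assms(2)]
  by (simp add: right_diff_distrib sfI mult.left_commute)
 then show ?thesis using v_U[OF assms(2)] v_diff_commute[of x y] U_in assms by simp
qed

text \<open>The sum is the difference quotient of the power map between \<open>x\<close> and
  \<open>y\<close>; since all factors are within \<open>r\<close> of 1, it is within
  \<open>r\<close> of the derivative \<open>e\<close> of that map at 1.\<close>

lemma power_sum_close: assumes "x \<in> U" "y \<in> U" "0 < r" "!!z. z \<in> U ==> z = x \<or> z = y ==> v (1 - z) <= r"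
 shows "v (of_nat e - (\<Sum>i<e. y ^ (e - Suc i) * x ^ i)) <= r" proof -
 have p: "v (1 - z ^ n) <= r" if "z \<in> U" "v (1 - z) <= r" for z n proof (induction n)
  case (Suc n)
  then show ?case using v_1_mult[OF that(1), of "z ^ n"] U_in[OF U_power[OF that(1)]] that by auto
 qed (use assms(3) in \<open>simp add: v_0\<close>)
 have "of_nat e - (\<Sum>i<e. y ^ (e - Suc i) * x ^ i) = (\<Sum>i<e. 1 - y ^ (e - Suc i) * x ^ i)" by (simp add: sum_subtractf)
 moreover have "v ... <= r" proof (rule v_sum)
  fix i
  show "1 - y ^ (e - Suc i) * x ^ i \<in> F" using assms U_in by (intro sfI) auto
  show "v (1 - y ^ (e - Suc i) * x ^ i) <= r" using v_1_mult[OF U_power[OF assms(2), of "e - Suc i"] U_in[OF U_power[OF assms(1), of i]]]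
    p[OF assms(1), of i] p[OF assms(2), of "e - Suc i"] assms(4)[of x] assms(4)[of y] assms(1,2) by auto
 qed (use assms(3) in simp)
 ultimately show ?thesis by simp
qed

text \<open>Factor \<open>x ^ e - 1 = (x - 1) * s\<close>; the sum \<open>s\<close> is congruent to
  \<open>e\<close>, a unit, so it has value 1. Thus the power map preserves the distance to 1, which
  gives its injectivity and lets bounds pass from norms to their roots.\<close>

lemma v_power_minus_1: assumes e: "v (of_nat e) = 1" and x: "x \<in> U" shows "v (1 - x ^ e) = v (1 - x)" proof -
 define s where "s = (\<Sum>i<e. 1 ^ (e - Suc i) * x ^ i)"
 have s: "s \<in> F" unfolding s_def using x U_in by (intro subfield_sum[OF sf] sfI) auto
 have "v (of_nat e - s) <= 1 / real q" unfolding s_def by (rule power_sum_close[OF x U_1]) (use v_less_1 U_lt U_in sfI q_gt_1 in auto)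
 also have "... < 1" using q_gt_1 by simp
 finally have "v (- (of_nat e - s)) < v (of_nat e)" using v_minus[of "of_nat e - s"] e s sfI(6,10) by simp
 then have "v s = 1" using v_add_dominant[of "of_nat e" "- (of_nat e - s)"] e s sfI by simp
 moreover have "x ^ e - 1 = (x - 1) * s" using power_diff_sumr2[of x e 1] by (simp add: s_def)
 then have "v (x ^ e - 1) = v (x - 1) * v s" using v_mult[of "x - 1" s] s x U_in sfI by simp
 ultimately show ?thesis using v_diff_commute[of 1] x U_in sfI by simp
qed

lemma U_power_inj: assumes e: "v (of_nat e) = 1" and x: "x \<in> U" and y: "y \<in> U" and eq: "x ^ e = y ^ e" shows "x = y" proof -
 have "v (1 - x * inverse y) = v (1 - (x * inverse y) ^ e)" using v_power_minus_1[OF e U_mult[OF x U_inverse[OF y]]] by simp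
 also have "(x * inverse y) ^ e = 1" using eq U_nonzero[OF y] by (simp add: power_mult_distrib power_inverse)
 finally have "v (x - y) = 0" using v_diff_U[OF x y] by (simp add: v_0)
 then show ?thesis using v_eq_0[of "x - y"] x y U_in sfI by simp
qed

text \<open>Simplified Newton iteration: the map \<open>T\<close> divides by the constant derivative
  \<open>e\<close> instead of \<open>e * z ^ (e - 1)\<close>. By \<open>power_sum_close\<close> it
  contracts the principal units by the factor \<open>1 / real q\<close>, and its fixed point is the
  root.\<close>

lemma U_root: assumes e: "v (of_nat e) = 1" and a: "a \<in> U" obtains z where "z \<in> U" "z ^ e = a" proof -
 define T where "T z = z - (z ^ e - a) / of_nat e" for z
 have e0: "of_nat e ~= (0 :: 'a)" using e v_0 by force
 have TF: "T z \<in> F" if "z \<in> U" for z using that a U_in by (auto simp: T_def intro!: sfI)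
 have TU: "T z \<in> U" if z: "z \<in> U" for z proof -
  have d: "(z ^ e - a) / of_nat e \<in> F" using z a U_in by (auto intro!: sfI)
  have "v ((z ^ e - a) / of_nat e) = v (z ^ e - a)" using v_divide[of "z ^ e - a" "of_nat e"] e z a U_in sfI by simp
  also have "... < 1" using U_lt[OF U_power[OF z, of e]] U_lt[OF a] v_diff_commute[of "z ^ e" 1] U_in[OF z] U_in[OF a] sfI(2,9) by (rule_tac y = 1 in v_trans_less) auto
  finally have "v ((1 - z) + (z ^ e - a) / of_nat e) < 1" using U_lt[OF z] d U_in[OF z] sfI(2,6) by (rule_tac v_add_less) auto
  then show ?thesis using TF[OF z] by (simp add: U_def T_def algebra_simps)
 qed
 have contr: "v (T x - T y) <= v (x - y) / real q" if x: "x \<in> U" and y: "y \<in> U" for x y proof -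
  let ?s = "\<Sum>i<e. y ^ (e - Suc i) * x ^ i"
  have s: "?s \<in> F" using x y U_in by (intro subfield_sum[OF sf] sfI) auto
  have "T x - T y = (x - y) - (x ^ e - y ^ e) / of_nat e" by (simp add: T_def diff_divide_distrib)
  also have "... = (x - y) * ((of_nat e - ?s) / of_nat e)" using power_diff_sumr2[of x e y] e0 by (simp add: field_simps)
  finally have "v (T x - T y) = v (x - y) * v (of_nat e - ?s)"
   using v_mult[of "x - y" "(of_nat e - ?s) / of_nat e"] v_divide[of "of_nat e - ?s" "of_nat e"] e s x y U_in sfI by simp
  moreover have "v (of_nat e - ?s) <= 1 / real q" by (rule power_sum_close[OF x y]) (use v_less_1 U_lt U_in sfI q_gt_1 in auto)
  ultimately show ?thesis using mult_left_mono[of "v (of_nat e - ?s)" "1 / real q" "v (x - y)"] v_nonneg[of "x - y"] x y U_in sfI by simp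
 qed
 define z where "z k = (T ^^ k) 1" for k
 have zU: "z k \<in> U" for k by (induction k) (auto simp: z_def U_1 TU)
 have step: "v (z (Suc k) - z k) <= (1 / real q) ^ k" for k proof (induction k)
  case 0
  have "v (z 1 - z 0) = v (1 - z 1)" using v_diff_commute[of 1 "z 1"] U_in[OF zU[of 1]] sfI(2) by (simp add: z_def)
  then show ?case using U_lt[OF zU[of 1]] by simp
 next
  case (Suc k)
  have "v (z (Suc (Suc k)) - z (Suc k)) <= v (z (Suc k) - z k) / real q" using contr[OF zU[of "Suc k"] zU[of k]] by (simp add: z_def)
  also have "... <= (1 / real q) ^ k / real q" using Suc q_gt_1 by (simp add: divide_right_mono)
  finally show ?case by simp
 qed
 have B: "decseq (%k. (1 / real q) ^ k)" "(%k. (1 / real q) ^ k) \<longlonglongrightarrow> 0"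
  using q_gt_1 by (auto intro!: LIMSEQ_power_zero simp: decseq_def power_decreasing)
 obtain w where w: "w \<in> F" "!!k. v (w - z k) <= (1 / real q) ^ k" using cauchy_converges[OF U_in[OF zU] step B] by metis
 have wU: "w \<in> U" proof -
  have "v (w - z 1) < 1" using w(2)[of 1] q_gt_1 by (simp add: order_le_less_trans)
  then have "v (1 - w) < 1" using v_diff_commute[of w "z 1"] w(1) U_in[OF zU[of 1]] U_lt[OF zU[of 1]] sfI(2) by (rule_tac y = "z 1" in v_trans_less) auto
  then show ?thesis using w(1) by (simp add: U_def)
 qed
 \<comment> \<open>Insert \<open>T (z k) = z (Suc k)\<close> between \<open>T w\<close> and
   \<open>w\<close>: both are within the error of the \<open>k\<close>-th iterate, for every
   \<open>k\<close>, so \<open>w\<close> is fixed.\<close>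
 have "v (T w - w) <= (1 / real q) ^ k" for k proof -
  have "v (T w - T (z k)) <= v (w - z k)" proof -
   have "v (w - z k) / real q <= v (w - z k) / 1" using v_nonneg[of "w - z k"] w(1) U_in[OF zU[of k]] sfI(6) q_gt_1 by (intro divide_left_mono) auto
   then show ?thesis using contr[OF wU zU[of k]] by simp
  qed
  moreover have "v (T (z k) - w) <= (1 / real q) ^ k" using w(2)[of "Suc k"] v_diff_commute[OF w(1) U_in[OF zU[of "Suc k"]]] decseqD[OF B(1), of k "Suc k"]
   by (simp add: z_def)
  ultimately show ?thesis using v_diff_trans[OF TF[OF wU] TF[OF zU[of k]] w(1)] w(2)[of k] by simp
 qed
 then have "v (T w - w) <= 0" using LIMSEQ_le_const[OF B(2)] by blast
 then have "T w = w" using v_nonneg[of "T w - w"] v_eq_0[of "T w - w"] TF[OF wU] w(1) sfI by simp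
 then have "w ^ e = a" using e0 by (simp add: T_def)
 then show ?thesis using that wU by blast
qed

text \<open>If \<open>p\<close> is the residue characteristic, then \<open>e\<close> is congruent to
  \<open>e mod p\<close>, a positive number below \<open>p\<close>, which is a unit by minimality of
  \<open>p\<close>. If no positive integer had value below 1, the claim would hold for every
  positive \<open>e\<close>, and \<open>e\<close> is positive because 0 is divisible by
  everything.\<close>

lemma v_of_nat_tame: assumes "~ residue_char F v dvd e" shows "v (of_nat e) = 1" proof (cases "EX p>0. v (of_nat p) < 1")
 case True
 define p where "p = residue_char F v"
 have p: "0 < p" "v (of_nat p) < 1" using True unfolding p_def residue_char_def by (metis (mono_tags, lifting) LeastI)+
 have least: "v (of_nat r) = 1" if "0 < r" "r < p" for r proof -
  have "~ (0 < r & v (of_nat r) < 1)" using that(2) unfolding p_def residue_char_def by (rule not_less_Least)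
  then show ?thesis using v_of_nat[of r] that by simp
 qed
 have r: "v (of_nat (e mod p)) = 1" using least[of "e mod p"] assms p by (simp add: p_def dvd_eq_mod_eq_0)
 have "v (of_nat (p * (e div p))) < 1" using v_mult[of "of_nat p" "of_nat (e div p)"] v_of_nat[of "e div p"] p(2) v_nonneg[of "of_nat p"]
   v_nonneg[of "of_nat (e div p)"] sfI(10) by (simp add: mult_le_one order_le_less_trans[OF mult_left_mono[of "v (of_nat (e div p))" 1 "v (of_nat p)"]])
 then have "v (of_nat (e mod p) + of_nat (p * (e div p))) = 1" using v_add_dominant[OF sfI(10) sfI(10), of "p * (e div p)" "e mod p"] r by simp
 also have "of_nat (e mod p) + of_nat (p * (e div p)) = (of_nat (e mod p + p * (e div p)) :: 'a)" by (simp only: of_nat_add)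
 finally show ?thesis by simp
next
 case False
 moreover have "0 < e" using assms by (cases e) auto
 ultimately have "~ v (of_nat e) < 1" by blast
 then show ?thesis using v_of_nat[of e] by simp
qed

text \<open>If 2 is not a unit, then 3 = 1 + 2 is. Some such exponent is needed in every residue
  characteristic to take repeated roots in \<open>v_unit_U\<close>.\<close>

lemma unit_exponent: obtains N where "2 <= N" "v (of_nat N) = 1" proof (cases "v (of_nat 2) = 1")
 case False
 then have "v (of_nat 2) < 1" using v_of_nat[of 2] by simp
 then have "v (1 + of_nat 2) = 1" using v_add_dominant[OF sfI(2) sfI(10), of 2] v_1 by simp
 then have "v (of_nat 3) = 1" by simp
 then show ?thesis using that[of 3] by simp
qed (use that[of 2] in simp)

text \<open>Among the infinitely many powers of \<open>x\<close> two have the same residue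
  representative, and their quotient is a principal unit. This is the finite order of residue
  classes in elementary form.\<close>

lemma unit_power_in_U: assumes "x \<in> F" "v x = 1" obtains n where "0 < n" "x ^ n \<in> U" proof -
 obtain S where S: "finite S" "card S = q" "S <= {x \<in> F. v x <= 1}"
  "!!x. x \<in> F ==> v x <= 1 ==> EX! s. s \<in> S & v (x - s) < 1" by (rule residue_reps) (rule that)
 have "ALL i. EX s. s \<in> S & v (x ^ i - s) < 1" proof
  fix i
  have "v (x ^ i) <= 1" using v_power[OF assms(1), of i] assms(2) by simp
  from S(4)[OF sfI(9)[OF assms(1)] this] show "EX s. s \<in> S & v (x ^ i - s) < 1" by (rule ex1_implies_ex)
 qed
 then obtain s where s: "!!i. s i \<in> S" "!!i. v (x ^ i - s i) < 1" by metis
 have "finite (range s)" using S(1) s(1) by (meson finite_subset image_subsetI)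
 then have "~ inj s" using finite_imageD[of s UNIV] infinite_UNIV_nat by auto
 then obtain i j where ij: "i < j" "s i = s j" unfolding inj_def by (metis linorder_neqE_nat)
 have sF: "s i \<in> F" using S s by blast
 have "v (x ^ i - x ^ j) < 1" using s(2)[of i] s(2)[of j] ij(2) v_diff_commute[of "x ^ j" "s i"] sF sfI(9)[OF assms(1)] by (rule_tac y = "s i" in v_trans_less) auto
 also have "x ^ i - x ^ j = x ^ i * (1 - x ^ (j - i))" using ij(1) by (simp add: right_diff_distrib power_add[symmetric])
 finally have "v (1 - x ^ (j - i)) < 1" using v_mult[of "x ^ i" "1 - x ^ (j - i)"] v_power[OF assms(1), of i] assms sfI by simp
 then show ?thesis using that[of "j - i"] ij(1) assms sfI by (simp add: U_def)
qed

text \<open>The representatives are truncated expansions in powers of a uniformizer without constant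
  term: each step appends a digit times \<open>\<pi> ^ Suc k\<close> and multiplies the number by
  \<open>q\<close>. The count starts at radius \<open>1 / real q\<close>, that of the maximal ideal
  itself, which explains the \<open>- 1\<close> in the exponent.\<close>

lemma ball_reps: obtains R where "finite R" "card R = q ^ k" "R <= {x \<in> F. v x < 1}"
  "ALL x:F. v x < 1 --> (EX! r. r \<in> R & v (x - r) <= real q powi (- int k - 1))" proof -
 obtain S where S: "finite S" "card S = q" "S <= {x \<in> F. v x <= 1}"
  "!!x. x \<in> F ==> v x <= 1 ==> EX! s. s \<in> S & v (x - s) < 1" by (rule residue_reps) (rule that)
 obtain \<pi> where \<pi>: "\<pi> \<in> F" "\<pi> ~= 0" "v \<pi> = 1 / real q" using uniformizer .
 have "EX R. finite R & card R = q ^ k & R <= {x \<in> F. v x < 1} &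
  (ALL x:F. v x < 1 --> (EX! r. r \<in> R & v (x - r) <= real q powi (- int k - 1)))" proof (induction k)
  case 0
  show ?case using v_less_1 sfI(1) v_0 by (intro exI[of _ "{0}"]) (auto simp: power_int_minus_divide)
 next
  case (Suc k)
  then obtain R where R: "finite R" "card R = q ^ k" "R <= {x \<in> F. v x < 1}" and R4: "ALL x:F. v x < 1 --> (EX! r. r \<in> R & v (x - r) <= real q powi (- int k - 1))"
   by (elim exE conjE) (rule that)
  note R = R R4[rule_format]
  have vp: "v (\<pi> ^ Suc k) = real q powi (- int k - 1)" proof -
   have "- int k - 1 = - int (Suc k)" by simp
   then have "real q powi (- int k - 1) = inverse (real q ^ Suc k)" by (simp only: power_int_minus power_int_of_nat)
   then show ?thesis using v_power[OF \<pi>(1), of "Suc k"] \<pi>(3) by (simp add: power_one_over inverse_eq_divide)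
  qed
  have pF: "\<pi> ^ Suc k \<in> F" using \<pi> sfI(9) by blast
  define P where "P = \<pi> ^ Suc k"
  note vp = vp[folded P_def] and pF = pF[folded P_def]
  have P0: "P ~= 0" using \<pi>(2) by (simp add: P_def)
  have p0: "0 < real q powi (- int k - 1)" using q_gt_1 by simp
  let ?f = "%(r, s). r + P * s"
  \<comment> \<open>Approximation by \<open>r + P * s\<close> to the next order splits into two
    conditions: \<open>r\<close> approximates to the present order, and \<open>s\<close> is the
    residue of the remainder divided by \<open>P\<close>. Existence, uniqueness and injectivity all
    rest on this equivalence.\<close>
  have close: "v (x - ?f (r, s)) <= real q powi (- int (Suc k) - 1) \<longleftrightarrow>
    v (x - r) <= real q powi (- int k - 1) & v ((x - r) / P - s) < 1" if x: "x \<in> F" and r: "r \<in> R" and s: "s \<in> S" for x r s proof -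
   have rF: "r \<in> F" and sF: "s \<in> F" "v s <= 1" using r s R S by auto
   have ps: "P * s \<in> F" using pF sF sfI(4) by blast
   have yF: "x - r - P * s \<in> F" using x rF ps sfI(6) by blast
   have e2: "x - ?f (r, s) = x - r - P * s" by simp
   have eq: "x - ?f (r, s) = P * ((x - r) / P - s)" using P0 by (simp add: field_simps)
   have quF: "(x - r) / P - s \<in> F" by (rule sfI(6)[OF sfI(8)[OF sfI(6)[OF x rF] pF] sF(1)])
   have ve: "v (x - ?f (r, s)) = real q powi (- int k - 1) * v ((x - r) / P - s)" unfolding eq v_mult[OF pF quF] vp ..
   have lt: "v (x - ?f (r, s)) <= real q powi (- int (Suc k) - 1) \<longleftrightarrow> v (x - ?f (r, s)) < real q powi (- int k - 1)" proof
    assume "v (x - ?f (r, s)) <= real q powi (- int (Suc k) - 1)"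
    also have "... < real q powi (- int k - 1)" by (subst powi_less) simp
    finally show "v (x - ?f (r, s)) < real q powi (- int k - 1)" .
   next
    assume "v (x - ?f (r, s)) < real q powi (- int k - 1)"
    moreover have "- int k - 1 = (- int (Suc k) - 1) + 1" by simp
    ultimately have "v (x - r - P * s) < real q powi ((- int (Suc k) - 1) + 1)" unfolding e2 by simp
    from v_discrete[OF yF this] show "v (x - ?f (r, s)) <= real q powi (- int (Suc k) - 1)" unfolding e2 .
   qed
   have "v (P * s) <= real q powi (- int k - 1)" using v_mult[OF pF sF(1)] vp sF(2) p0 v_nonneg[OF sF(1)] mult_left_le[of "v s" "real q powi (- int k - 1)"] by simp
   then have "v (x - r) <= real q powi (- int k - 1)" if "v (x - ?f (r, s)) < real q powi (- int k - 1)" proof -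
    have "v (x - r - P * s) < real q powi (- int k - 1)" using that unfolding e2 .
    then have "v ((x - r - P * s) + P * s) <= real q powi (- int k - 1)" using v_add[OF yF ps] \<open>v (P * s) <= _\<close> by linarith
    then show ?thesis by simp
   qed
   then show ?thesis unfolding lt using ve p0 by (auto simp: mult_less_cancel_left2)
  qed
  have ex: "EX! rs. rs \<in> R \<times> S & v (x - ?f rs) <= real q powi (- int (Suc k) - 1)" if x: "x \<in> F" "v x < 1" for x proof -
   obtain r where r: "r \<in> R" "v (x - r) <= real q powi (- int k - 1)" and r': "!!r'. r' \<in> R ==> v (x - r') <= real q powi (- int k - 1) ==> r' = r"
    using R(4)[OF x] by blast
   have rF: "r \<in> F" using r R by auto
   have q1: "(x - r) / P \<in> F" by (rule sfI(8)[OF sfI(6)[OF x(1) rF] pF])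
   have q2: "v ((x - r) / P) <= 1" using v_divide[of "x - r" "P"] vp r(2) p0 x rF pF sfI by simp
   obtain s where s: "s \<in> S" "v ((x - r) / P - s) < 1" and s': "!!s'. s' \<in> S ==> v ((x - r) / P - s') < 1 ==> s' = s" using S(4)[OF q1 q2] by blast
   show ?thesis proof (rule ex1I[of _ "(r, s)"])
    show "(r, s) \<in> R \<times> S & v (x - ?f (r, s)) <= real q powi (- int (Suc k) - 1)" using close[OF x(1) r(1) s(1)] r s by blast
    fix rs assume a: "rs \<in> R \<times> S & v (x - ?f rs) <= real q powi (- int (Suc k) - 1)"
    obtain r1 s1 where rs: "rs = (r1, s1)" by (cases rs)
    have m: "r1 \<in> R" "s1 \<in> S" using a rs by auto
    have c: "v (x - r1) <= real q powi (- int k - 1)" "v ((x - r1) / P - s1) < 1" using a close[OF x(1) m] rs by blast+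
    have "r1 = r" using r'[OF m(1) c(1)] .
    moreover have "s1 = s" using s'[OF m(2)] c(2) \<open>r1 = r\<close> by blast
    ultimately show "rs = (r, s)" using rs by simp
   qed
  qed
  have in_ball: "?f rs \<in> F & v (?f rs) < 1" if "rs \<in> R \<times> S" for rs proof -
   obtain r s where rs: "r \<in> R" "s \<in> S" "rs = (r, s)" using \<open>rs \<in> R \<times> S\<close> by (rule SigmaE)
   have rF: "r \<in> F" "v r < 1" and sF: "s \<in> F" "v s <= 1" using rs(1,2) R(3) S(3) by auto
   have "real q powi (- int k - 1) < 1" using powi_less[of "- int k - 1" 0] by simp
   moreover have "real q powi (- int k - 1) * v s <= real q powi (- int k - 1)" using sF(2) p0 by (intro mult_left_le) auto
   ultimately have "v (P * s) < 1" unfolding v_mult[OF pF sF(1)] vp by linarith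
   moreover have ps: "P * s \<in> F" using pF sF sfI(4) by blast
   ultimately show ?thesis using v_add[OF rF(1) ps] rF sfI(3)[OF rF(1) ps] rs(3) by simp
  qed
  have inj: "inj_on ?f (R \<times> S)" proof (rule inj_onI)
   fix a b assume ab: "a \<in> R \<times> S" "b \<in> R \<times> S" "?f a = ?f b"
   have "v (?f a - ?f a) <= real q powi (- int (Suc k) - 1)" using q_gt_1 by (simp add: v_0)
   moreover have "v (?f a - ?f b) <= real q powi (- int (Suc k) - 1)" using ab(3) q_gt_1 by (simp add: v_0)
   ultimately show "a = b" using ex[of "?f a"] in_ball[OF ab(1)] ab(1,2) by blast
  qed
  show ?case proof (intro exI[of _ "?f ` (R \<times> S)"] conjI ballI impI)
   show "finite (?f ` (R \<times> S))" using R S by simp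
   show "card (?f ` (R \<times> S)) = q ^ Suc k" using card_image[OF inj] R S by (simp add: card_cartesian_product)
   show "?f ` (R \<times> S) <= {x \<in> F. v x < 1}" using in_ball by blast
   fix x assume "x \<in> F" "v x < 1"
   from ex[OF this] obtain rs where rs: "rs \<in> R \<times> S" "v (x - ?f rs) <= real q powi (- int (Suc k) - 1)"
    and un: "!!rs'. rs' \<in> R \<times> S ==> v (x - ?f rs') <= real q powi (- int (Suc k) - 1) ==> rs' = rs" by blast
   show "EX! r. r \<in> ?f ` (R \<times> S) & v (x - r) <= real q powi (- int (Suc k) - 1)" proof (rule ex1I[of _ "?f rs"])
    show "?f rs \<in> ?f ` (R \<times> S) & v (x - ?f rs) <= real q powi (- int (Suc k) - 1)" using rs by blast
    fix y assume y: "y \<in> ?f ` (R \<times> S) & v (x - y) <= real q powi (- int (Suc k) - 1)"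
    then obtain rs' where rs': "rs' \<in> R \<times> S" "y = ?f rs'" by blast
    then show "y = ?f rs" using un[OF rs'(1)] y by simp
   qed
  qed
 qed
 then show ?thesis by (elim exE conjE) (rule that)
qed

text \<open>When all nonzero terms have different values no cancellation can occur, and the sum has
  the largest value among its terms. This is the orthogonality that the powers of a uniformizer will
  have.\<close>

lemma v_sum_distinct: assumes "finite A" "!!i. i \<in> A ==> f i \<in> F" and "!!i j. i \<in> A ==> j \<in> A ==> i ~= j ==> v (f i) = v (f j) ==> f i = 0" and "j \<in> A"
 shows "v (f j) <= v (\<Sum>i\<in>A. f i)" proof -
 \<comment> \<open>The induction also carries that the value of a nonzero sum is attained by one of
   its terms; otherwise the new term could not be told apart from the partial sum by its
   value.\<close>
 have "(ALL j:A. v (f j) <= v (\<Sum>i\<in>A. f i)) & ((\<Sum>i\<in>A. f i) = 0 \<or> (EX j:A. v (\<Sum>i\<in>A. f i) = v (f j)))" using assms(1-3)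
 proof (induction A rule: finite_induct)
  case (insert a A)
  let ?s = "\<Sum>i\<in>A. f i"
  have "(ALL j:A. v (f j) <= v ?s) & (?s = 0 \<or> (EX j:A. v ?s = v (f j)))" by (rule insert.IH) (use insert.prems in blast)+
  then have IH: "ALL j:A. v (f j) <= v ?s" "?s = 0 \<or> (EX j:A. v ?s = v (f j))" by blast+
  have F: "f a \<in> F" "?s \<in> F" using insert.prems by (auto intro: subfield_sum[OF sf])
  have eq: "f a = 0" if "v (f a) = v ?s" proof (cases "?s = 0")
   case True then show ?thesis using that v_0 v_eq_0[OF F(1)] by simp
  next
   case False
   then obtain j where "j \<in> A" "v ?s = v (f j)" using IH by blast
   then show ?thesis using insert.prems(2)[of a j] insert.hyps(2) that by auto
  qed
  consider "f a = 0" | "v (f a) < v ?s" | "v ?s < v (f a)" using eq by fastforce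
  then show ?case proof cases
   case 1 then show ?thesis using insert.hyps IH v_nonneg[OF F(2)] by (auto simp: v_0)
  next
   case 2
   then have "v (f a + ?s) = v ?s" using v_add_dominant[OF F(2,1)] by (simp add: add.commute)
   then show ?thesis using insert.hyps IH 2 v_nonneg[OF F(1)] v_0 by auto
  next
   case 3
   then have "v (f a + ?s) = v (f a)" using v_add_dominant[OF F] by simp
   then show ?thesis using insert.hyps IH 3 by force
  qed
 qed (simp add: v_0)
 then show ?thesis using assms(4) by blast
qed

text \<open>Leibniz expansion. Along any permutation the weights \<open>r ^ i / r ^ j\<close>
  multiply to 1, so a product over a permutation different from the identity is at most
  \<open>t\<close>, an off-diagonal factor being present; the diagonal product is within
  \<open>t\<close> of 1. The weights are those of a basis of powers of a uniformizer.\<close>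

lemma det_close: assumes A: "A \<in> carrier_mat d d" "!!i j. i < d ==> j < d ==> A $$ (i, j) \<in> F" and t: "0 <= t" "t < 1" and r: "0 < r"
  and close: "!!i j. i < d ==> j < d ==> v (A $$ (i, j) - (if i = j then 1 else 0)) <= t * r ^ i / r ^ j" shows "v (det A - 1) <= t" proof -
 have diag: "v (A $$ (i, i) - 1) <= t" if "i < d" for i using close[OF that that] r by simp
 have diag1: "v (A $$ (i, i)) = 1" if "i < d" for i using v_add_dominant[of 1 "A $$ (i, i) - 1"] diag[OF that] t A(2)[OF that that] sfI v_1 by simp
 have prodF: "(\<Prod>i<k. A $$ (i, i)) \<in> F" if "k <= d" for k using A(2) that by (intro subfield_prod[OF sf]) auto
 have prod_close: "v ((\<Prod>i<k. A $$ (i, i)) - 1) <= t" if "k <= d" for k using that proof (induction k)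
  case (Suc k)
  let ?P = "\<Prod>i<k. A $$ (i, i)"
  have F: "?P \<in> F" "A $$ (k, k) \<in> F" using prodF[of k] A(2) Suc.prems by auto
  have eq: "(\<Prod>i<Suc k. A $$ (i, i)) - 1 = ?P * (A $$ (k, k) - 1) + (?P - 1)" by (simp add: algebra_simps)
  have "v (?P * (A $$ (k, k) - 1)) <= t" proof -
   have "v ?P = 1" using v_prod[of "{..<k}" "%i. A $$ (i, i)"] diag1 A(2) Suc.prems by simp
   then show ?thesis using v_mult[of ?P "A $$ (k, k) - 1"] diag[of k] F Suc.prems sfI by simp
  qed
  moreover have "v (?P - 1) <= t" using Suc by simp
  moreover have "v (?P * (A $$ (k, k) - 1) + (?P - 1)) <= max (v (?P * (A $$ (k, k) - 1))) (v (?P - 1))"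
   by (rule v_add[OF sfI(4)[OF F(1) sfI(6)[OF F(2) sfI(2)]] sfI(6)[OF F(1) sfI(2)]])
  ultimately show ?case unfolding eq by linarith
 qed (simp add: v_0 t)
 have off: "v (\<Prod>i=0..<d. A $$ (i, p i)) <= t" if p: "p permutes {0..<d}" "p ~= id" for p proof -
  have pi: "p i < d" if "i < d" for i using permutes_in_image[OF p(1), of i] that by simp
  obtain k where k: "k < d" "p k ~= k" proof -
   obtain k where "p k ~= k" using p(2) by fastforce
   moreover have "k < d" using permutes_not_in[OF p(1), of k] calculation by fastforce
   ultimately show ?thesis using that by blast
  qed
  \<comment> \<open>Diagonal entries have value 1 and the others are bounded by \<open>t\<close>
    times the weight; the factor \<open>t\<close> is kept only at the position \<open>k\<close>
    moved by \<open>p\<close>.\<close>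
  define c where "c i = (if p i = i then 1 else t)" for i
  have "v (\<Prod>i=0..<d. A $$ (i, p i)) = (\<Prod>i=0..<d. v (A $$ (i, p i)))" using A(2) pi by (intro v_prod) auto
  also have "... <= (\<Prod>i=0..<d. c i * (r ^ i / r ^ p i))" proof (rule prod_mono)
   fix i assume "i \<in> {0..<d}"
   then have i: "i < d" by simp
   show "0 <= v (A $$ (i, p i)) & v (A $$ (i, p i)) <= c i * (r ^ i / r ^ p i)" using close[OF i pi[OF i]] diag1[OF i] v_nonneg[OF A(2)[OF i pi[OF i]]] r by (auto simp: c_def)
  qed
  also have "... = (\<Prod>i=0..<d. c i) * ((\<Prod>i=0..<d. r ^ i) / (\<Prod>i=0..<d. r ^ p i))" by (simp add: prod.distrib prod_dividef)
  also have "(\<Prod>i=0..<d. r ^ p i) = (\<Prod>i=0..<d. r ^ i)" using prod.permute[OF p(1), of "%i. r ^ i"] by (simp add: comp_def)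
  also have "(\<Prod>i=0..<d. r ^ i) / (\<Prod>i=0..<d. r ^ i) = 1" using r by simp
  also have "(\<Prod>i=0..<d. c i) = c k * (\<Prod>i\<in>{0..<d} - {k}. c i)" using k by (intro prod.remove) auto
  also have "... <= t * 1" using k t by (intro mult_mono prod_le_1 prod_nonneg) (auto simp: c_def)
  finally show ?thesis by simp
 qed
 let ?P = "{p. p permutes {0..<d}}"
 have fin: "finite ?P" by (simp add: finite_permutations)
 have "det A = (\<Sum>p\<in>?P. signof p * (\<Prod>i=0..<d. A $$ (i, p i)))" using det_def'[OF A(1)] .
 also have "... = (\<Prod>i<d. A $$ (i, i)) + (\<Sum>p\<in>?P - {id}. signof p * (\<Prod>i=0..<d. A $$ (i, p i)))"
  using fin by (subst sum.remove[of _ id]) (auto simp: permutes_id atLeast0LessThan)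
 finally have eq: "det A - 1 = ((\<Prod>i<d. A $$ (i, i)) - 1) + (\<Sum>p\<in>?P - {id}. signof p * (\<Prod>i=0..<d. A $$ (i, p i)))" by simp
 have sg: "signof p \<in> F & v (signof p) = 1" for p using sfI(2) sfI(5)[of 1] v_1 v_minus[of 1] by (simp add: sign_def)
 have prF: "(\<Prod>i=0..<d. A $$ (i, p i)) \<in> F" if "p \<in> ?P" for p using that permutes_in_image[of p "{0..<d}"] by (intro subfield_prod[OF sf] A(2)) auto
 have "v (\<Sum>p\<in>?P - {id}. signof p * (\<Prod>i=0..<d. A $$ (i, p i))) <= t" proof (rule v_sum)
  fix p assume p: "p \<in> ?P - {id}"
  show "signof p * (\<Prod>i=0..<d. A $$ (i, p i)) \<in> F" using sg prF p sfI(4) by simp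
  show "v (signof p * (\<Prod>i=0..<d. A $$ (i, p i))) <= t" using v_mult[of "signof p" "\<Prod>i=0..<d. A $$ (i, p i)"] sg[of p] prF[of p] off[of p] p by simp
 qed (use t in simp)
 moreover have "(\<Sum>p\<in>?P - {id}. signof p * (\<Prod>i=0..<d. A $$ (i, p i))) \<in> F" using sg prF by (intro subfield_sum[OF sf] sfI(4)) auto
 ultimately show ?thesis unfolding eq using v_add[of "(\<Prod>i<d. A $$ (i, i)) - 1"] prod_close[of d] prodF[of d] sfI by fastforce
qed

end

section \<open>Degrees and absolute values in the tower\<close>

lemma finite_dimension_refl: assumes "subfield F (ambient :: 'a::field ring)" shows "ring.finite_dimension ambient F F" "ring.dim ambient F F = 1" proof -
 interpret R: ring "ambient :: 'a ring" by (rule ring_ambient)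
 show "R.finite_dimension F F" by (rule R.finite_dimensionI[OF R.dimension_one[OF assms]])
 show "R.dim F F = 1" using R.dimI[OF assms R.dimension_one[OF assms]] by (simp add: over_def)
qed

lemma finite_dimension_tower: assumes "subfield F (ambient :: 'a::field ring)" "subfield L ambient" and "ring.finite_dimension ambient F L" "ring.finite_dimension ambient L M"
 shows "ring.finite_dimension ambient F M"
  "ring.dim ambient F M = ring.dim ambient F L * ring.dim ambient L M" proof -
 interpret R: ring "ambient :: 'a ring" by (rule ring_ambient)
 show "R.finite_dimension F M" "R.dim F M = R.dim F L * R.dim L M" using R.telescopic_base_dim[OF assms] by (simp_all add: over_def)
qed

locale tower =
 fixes K :: "nat => 'a::field set" and v :: "nat => 'a => real" assumes tower: "tame_tower K v"
begin

abbreviation "q \<equiv> res_q K v"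
abbreviation "m \<equiv> deg K"

declare One_nat_def [simp del]

lemma assumes "1 <= n" shows ext_K: "local_field_extension (K 1) (v 1) (K n) (v n)" and fin_step: "ring.finite_dimension ambient (K n) (K (Suc n))"
 and K_step: "K n \<subset> K (Suc n)" and fin_1: "ring.finite_dimension ambient (K 1) (K n)" and ramified: "ramification_index (K 1) (v 1) (K n) (v n) = m n"
 and tame: "~ residue_char (K 1) (v 1) dvd ramification_index (K 1) (v 1) (K n) (v n)" and res_card: "residue_card (K n) (v n) = q"
 using tower[unfolded tame_tower_def finite_galois_extension_def totally_ramified_def tamely_ramified_def,
   rule_format, OF assms] assms by (auto simp: deg_def res_q_def)

lemma lf: "1 <= n ==> local_field (K n) (v n)" using ext_K unfolding local_field_def local_field_extension_def by blast

lemma K_mono: assumes "1 <= n" "n <= \<nu>" shows "K n <= K \<nu>" using assms(2) proof (induction \<nu> rule: dec_induct)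
 case (step \<nu>)
 then show ?case using K_step[of \<nu>] assms(1) by auto
qed simp

lemma sf: "1 <= n ==> subfield (K n) ambient" using local_field.sf[OF lf] .

lemma finite_dim: assumes "1 <= n" "n <= \<nu>" shows "ring.finite_dimension ambient (K n) (K \<nu>)" using assms(2) proof (induction \<nu> rule: dec_induct)
 case base
 show ?case using finite_dimension_refl(1)[OF sf[OF assms(1)]] .
next
 case (step \<nu>)
 have "1 <= \<nu>" using step assms(1) by simp
 then show ?case using finite_dimension_tower(1)[OF sf[OF assms(1)] sf[of \<nu>] step.IH fin_step[of \<nu>]] by simp
qed

lemma m_mult: assumes "1 <= n" "n <= \<nu>" shows "m \<nu> = m n * ring.dim ambient (K n) (K \<nu>)" proof -
 have "m k = ring.dim ambient (K 1) (K k)" if "1 <= k" for k using that by (simp add: deg_def)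
 then show ?thesis using finite_dimension_tower(2)[OF sf[of 1] sf[OF assms(1)] finite_dim[of 1 n] finite_dim[OF assms]] assms by simp
qed

lemma m_1: "m 1 = 1" using finite_dimension_refl(2)[OF sf[of 1]] by (simp add: deg_def)

lemma m_pos: assumes "1 <= n" shows "0 < m n" proof (rule ccontr)
 assume "~ 0 < m n"
 moreover obtain b where "is_basis (K 1) (K n) (ring.dim ambient (K 1) (K n)) b" using finite_dimension_basis[OF sf[of 1] finite_dim[of 1 n]] assms by auto
 ultimately have b: "is_basis (K 1) (K n) 0 b" using assms by (simp add: deg_def)
 have "1 \<in> K n" using subfield_ambient(2)[OF sf[OF assms]] .
 then show False using is_basis_repr[OF b] by force
qed

text \<open>The degree of \<open>K \<nu>\<close> over \<open>K n\<close>, written as the quotient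
  that occurs in \<open>root_norm\<close>; \<open>m_d\<close> identifies it with the
  dimension.\<close>

definition d :: "nat => nat => nat" where "d n \<nu> = m \<nu> div m n"

lemma m_d: assumes "1 <= n" "n <= \<nu>" shows "m \<nu> = m n * d n \<nu>" "d n \<nu> = ring.dim ambient (K n) (K \<nu>)"
 using m_mult[OF assms] m_pos[OF assms(1)] by (auto simp: d_def)

lemma d_pos: assumes "1 <= n" "n <= \<nu>" shows "0 < d n \<nu>" using m_d(1)[OF assms] m_pos[of \<nu>] assms by (auto intro: gr0I)

lemma d_mult: assumes "1 <= k" "k <= n" "n <= \<nu>" shows "d k \<nu> = d k n * d n \<nu>" proof -
 have "m k * d k \<nu> = m k * (d k n * d n \<nu>)" using m_d(1)[of k \<nu>] m_d(1)[of k n] m_d(1)[of n \<nu>] assms by (metis mult.assoc order_trans)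
 then show ?thesis using m_pos[OF assms(1)] by (metis nat_mult_eq_cancel1)
qed

lemma m_le: assumes "1 <= n" "n <= \<nu>" shows "m n <= m \<nu>" using m_d(1)[OF assms] d_pos[OF assms] by simp

lemma basis: assumes "1 <= n" "n <= \<nu>" obtains b where "is_basis (K n) (K \<nu>) (d n \<nu>) b"
 using finite_dimension_basis[OF sf[OF assms(1)] finite_dim[OF assms]] m_d(2)[OF assms] by metis

lemma q_gt_1: "1 < real q" using local_field.q_gt_1[OF lf[of 1]] by (simp add: res_q_def)

text \<open>The extension is known to raise \<open>v 1\<close> to some positive real power
  \<open>s\<close>. Evaluation at a uniformizer of \<open>K 1\<close>, whose value in
  \<open>K n\<close> is an integral power of \<open>q\<close>, shows that \<open>s\<close> is a
  natural number; by definition it is the ramification index, hence \<open>m n\<close>.\<close>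

lemma v_K1: assumes n: "1 <= n" and x: "x \<in> K 1" shows "v n x = v 1 x ^ m n" proof -
 interpret F: local_field "K 1" "v 1" by (rule lf) simp
 interpret L: local_field "K n" "v n" by (rule lf[OF n])
 have qs: "residue_card (K 1) (v 1) = q" "residue_card (K n) (v n) = q" using res_card n by auto
 obtain s where s: "s > 0" "ALL x:K 1. v n x = v 1 x powr s" using ext_K[OF n] unfolding local_field_extension_def by blast
 obtain c where c: "c \<in> K 1" "c ~= 0" "v 1 c = 1 / real q" using F.uniformizer qs by metis
 have cn: "c \<in> K n" using c K_mono[of 1 n] n by auto
 obtain j where j: "v n c = real q powi j" using L.v_powi[OF cn c(2)] qs by metis
 have "real q powr (- s) = real q powr (of_int j)" proof -
  have "real q powr (- s) = (1 / real q) powr s" by (simp add: powr_divide powr_minus_divide)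
  also have "... = real q powi j" using s(2)[rule_format, OF c(1)] j c(3) by simp
  also have "... = real q powr (of_int j)" using q_gt_1 by (intro powr_real_of_int'[symmetric]) auto
  finally show ?thesis .
 qed
 then have sj: "- s = of_int j" using q_gt_1 by (simp add: powr_inj)
 define e where "e = nat (- j)"
 have se: "s = real e" using sj s(1) by (simp add: e_def)
 have pw: "v n x = v 1 x ^ e" if "x \<in> K 1" for x proof (cases "x = 0")
  case False
  then show ?thesis using s(2)[rule_format, OF that] F.v_pos[OF that] se by (simp add: powr_realpow)
 next
  case True
  have "0 < e" using se s(1) by simp
  then show ?thesis using True F.v_0 L.v_0 by simp
 qed
 have ordF: "ord_val (K 1) (v 1) x = - j" if "v 1 x = real q powi j" for x j unfolding ord_val_def qs using that F.powi_inj qs by (intro the_equality) auto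
 have ordL: "ord_val (K n) (v n) x = - j" if "v n x = real q powi j" for x j unfolding ord_val_def qs using that L.powi_inj qs by (intro the_equality) auto
 have "ramification_index (K 1) (v 1) (K n) (v n) = e" unfolding ramification_index_def proof (rule the_equality)
  have ord: "ord_val (K n) (v n) x = int e * ord_val (K 1) (v 1) x" if x: "x \<in> K 1" "x ~= 0" for x proof -
   obtain i where i: "v 1 x = real q powi i" using F.v_powi[OF x] qs by metis
   then have "v n x = real q powi (i * int e)" using pw[OF x(1)] by (simp add: power_int_mult)
   then show ?thesis using ordF[OF i] ordL by simp
  qed
  then show "ALL x:K 1 - {0}. ord_val (K n) (v n) x = int e * ord_val (K 1) (v 1) x" by blast
  fix e' assume "ALL x:K 1 - {0}. ord_val (K n) (v n) x = int e' * ord_val (K 1) (v 1) x"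
  then have "int e' * ord_val (K 1) (v 1) c = int e * ord_val (K 1) (v 1) c" using ord c by auto
  moreover have "ord_val (K 1) (v 1) c = 1" using ordF[of c "-1"] c(3) by (simp add: power_int_minus_divide)
  ultimately show "e' = e" by simp
 qed
 then show ?thesis using ramified[OF n] pw[OF x] by simp
qed

text \<open>There is no direct hypothesis relating \<open>v n\<close> and \<open>v \<nu>\<close>
  when \<open>n > 1\<close>, so the argument is algebraic: \<open>u\<close> has roots of every order
  \<open>N ^ k\<close> in \<open>K n\<close>, hence the exponent of its value in
  \<open>K \<nu>\<close> is divisible by all of them and must be 0.\<close>

lemma v_unit_U: assumes n: "1 <= n" "n <= \<nu>" and u: "u \<in> local_field.U (K n) (v n)" shows "v \<nu> u = 1" proof -
 interpret L: local_field "K n" "v n" by (rule lf[OF n(1)])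
 interpret M: local_field "K \<nu>" "v \<nu>" by (rule lf) (use n in simp)
 have qs: "residue_card (K \<nu>) (v \<nu>) = q" using res_card n by auto
 obtain N where N: "2 <= N" "v n (of_nat N) = 1" using L.unit_exponent .
 have uM: "u \<in> K \<nu>" "u ~= 0" using L.U_in[OF u] K_mono[OF n] L.U_nonzero[OF u] by auto
 obtain b where b: "v \<nu> u = real q powi b" using M.v_powi[OF uM] qs by metis
 \<comment> \<open>With \<open>k\<close> the absolute value of the exponent, \<open>N ^ k\<close>
   exceeds it, so divisibility by this single number already forces 0.\<close>
 define k where "k = nat \<bar>b\<bar>"
 have "v n (of_nat (N ^ k)) = 1" using L.v_power[OF L.sfI(10), of N k] N(2) by simp
 then obtain y where y: "y \<in> L.U" "y ^ (N ^ k) = u" using L.U_root u by metis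
 have yM: "y \<in> K \<nu>" "y ~= 0" using L.U_in[OF y(1)] K_mono[OF n] L.U_nonzero[OF y(1)] by auto
 obtain a where a: "v \<nu> y = real q powi a" using M.v_powi[OF yM] qs by metis
 have "real q powi b = real q powi (a * int (N ^ k))" using M.v_power[OF yM(1), of "N ^ k"] unfolding y(2) a b by (simp only: power_int_mult power_int_of_nat)
 then have ab: "b = a * int (N ^ k)" using M.powi_inj qs by metis
 have "k < 2 ^ k" by (rule less_exp)
 also have "(2::nat) ^ k <= N ^ k" using N(1) by (rule power_mono) simp
 finally have "int k < int (N ^ k)" by (simp only: of_nat_less_iff)
 then have "\<bar>b\<bar> < int (N ^ k)" by (simp add: k_def)
 then have "\<bar>a\<bar> * int (N ^ k) < 1 * int (N ^ k)" unfolding ab by (simp add: abs_mult)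
 then have "\<bar>a\<bar> < 1" by (rule mult_right_less_imp_less) simp
 then have "a = 0" by simp
 then show ?thesis using b ab by simp
qed

lemma v_unit: assumes n: "1 <= n" "n <= \<nu>" and x: "x \<in> K n" "v n x = 1" shows "v \<nu> x = 1" proof -
 interpret L: local_field "K n" "v n" by (rule lf[OF n(1)])
 interpret M: local_field "K \<nu>" "v \<nu>" by (rule lf) (use n in simp)
 obtain k where k: "0 < k" "x ^ k \<in> L.U" using L.unit_power_in_U[OF x] .
 have xM: "x \<in> K \<nu>" using x K_mono[OF n] by auto
 have "v \<nu> x ^ k = 1" using v_unit_U[OF n k(2)] M.v_power[OF xM] by simp
 then show ?thesis using M.v_nonneg[OF xM] k(1) power_eq_imp_eq_base[of "v \<nu> x" k 1] by simp
qed

text \<open>Compare \<open>x ^ m n\<close> with an element \<open>c\<close> of \<open>K 1\<close>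
  such that \<open>v 1 c = v n x\<close>: the quotient is a unit of \<open>K n\<close>, hence of
  \<open>K \<nu>\<close>, and the values of \<open>c\<close> are known from \<open>v_K1\<close>.
  Taking roots of order \<open>m n\<close> leaves the exponent \<open>d n \<nu>\<close>.\<close>

lemma v_rel: assumes n: "1 <= n" "n <= \<nu>" and x: "x \<in> K n" shows "v \<nu> x = v n x ^ d n \<nu>" proof (cases "x = 0")
 case True
 then show ?thesis using local_field.v_0[OF lf[OF n(1)]] local_field.v_0[OF lf[of \<nu>]] d_pos[OF n] n by simp
next
 case False
 interpret F: local_field "K 1" "v 1" by (rule lf) simp
 interpret L: local_field "K n" "v n" by (rule lf[OF n(1)])
 interpret M: local_field "K \<nu>" "v \<nu>" by (rule lf) (use n in simp)
 have qs: "residue_card (K 1) (v 1) = q" "residue_card (K n) (v n) = q" using res_card n by auto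
 obtain j where j: "v n x = real q powi j" using L.v_powi[OF x False] qs by metis
 obtain c0 where c0: "c0 \<in> K 1" "c0 ~= 0" "v 1 c0 = 1 / real q" using F.uniformizer qs by metis
 have "real q powi j \<in> v 1 ` (K 1 - {0})" using F.v_range qs by auto
 then obtain c where c': "real q powi j = v 1 c" "c \<in> K 1 - {0}" by (rule imageE)
 then have c: "c \<in> K 1" "c ~= 0" "v 1 c = real q powi j" by auto
 have cn: "c \<in> K n" "c \<in> K \<nu>" using c K_mono[of 1 n] K_mono[of 1 \<nu>] n by auto
 have xM: "x \<in> K \<nu>" using x K_mono[OF n] by auto
 have v0: "0 < real q powi j" using q_gt_1 by simp
 have "v n (x ^ m n / c) = 1" using L.v_divide[OF L.sfI(9)[OF x] cn(1), of "m n"] L.v_power[OF x, of "m n"] v_K1[OF n(1) c(1)] j c(3) q_gt_1 by simp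
 then have "v \<nu> (x ^ m n / c) = 1" using v_unit[OF n L.sfI(8)[OF L.sfI(9)[OF x] cn(1)]] by simp
 then have "v \<nu> x ^ m n = v \<nu> c" using M.v_divide[OF M.sfI(9)[OF xM] cn(2), of "m n"] M.v_power[OF xM, of "m n"] M.v_pos[OF cn(2) c(2)] by (simp add: divide_eq_1_iff)
 also have "... = (v n x ^ d n \<nu>) ^ m n" using v_K1[of \<nu>, OF _ c(1)] n c(3) j m_d(1)[OF n] by (simp add: power_mult[symmetric] mult.commute)
 finally show ?thesis using power_eq_imp_eq_base[of "v \<nu> x" "m n" "v n x ^ d n \<nu>"] M.v_nonneg[OF xM] L.v_nonneg[OF x] m_pos[OF n(1)] by simp
qed

lemma v_m: assumes "1 <= n" "1 <= \<nu>" shows "v n (of_nat (m \<nu>)) = 1" proof -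
 interpret F: local_field "K 1" "v 1" by (rule lf) simp
 have "v 1 (of_nat (m \<nu>)) = 1" using F.v_of_nat_tame[of "m \<nu>"] tame[OF assms(2)] ramified[OF assms(2)] by simp
 then show ?thesis using v_K1[OF assms(1) F.sfI(10)] by simp
qed

lemma v_d: assumes "1 <= k" "1 <= n" "n <= \<nu>" shows "v k (of_nat (d n \<nu>)) = 1" proof -
 interpret L: local_field "K k" "v k" by (rule lf[OF assms(1)])
 have "v k (of_nat (m n)) * v k (of_nat (d n \<nu>)) = v k (of_nat (m \<nu>))" using L.v_mult[OF L.sfI(10) L.sfI(10), of "m n" "d n \<nu>"] m_d(1)[OF assms(2,3)] by simp
 then show ?thesis using v_m[OF assms(1), of n] v_m[OF assms(1), of \<nu>] assms by simp
qed

lemma U1_eq: "1 <= n ==> U1 K v n = local_field.U (K n) (v n)" using local_field.U_def[OF lf] by (simp add: U1_def)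

lemma U1_mono: assumes "1 <= n" "n <= \<nu>" shows "U1 K v n <= U1 K v \<nu>" proof
 interpret L: local_field "K n" "v n" by (rule lf[OF assms(1)])
 fix x assume x: "x \<in> U1 K v n"
 then have "1 - x \<in> K n" by (auto simp: U1_def intro!: L.sfI)
 then show "x \<in> U1 K v \<nu>" using x v_rel[OF assms, of "1 - x"] K_mono[OF assms] d_pos[OF assms] L.v_nonneg[of "1 - x"] by (auto simp: U1_def power_less_one_iff)
qed

context
 fixes n \<nu> \<pi> assumes n: "1 <= n" "n <= \<nu>" and \<pi>: "\<pi> \<in> K \<nu>" "\<pi> ~= 0" "v \<nu> \<pi> = 1 / real q"
begin

text \<open>Elements of \<open>K n\<close> have exponents divisible by \<open>d n \<nu>\<close> in
  \<open>K \<nu>\<close>, so the exponent of this product is congruent to \<open>- i\<close> modulo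
  the degree. Different powers below the degree therefore have different values, which is the
  orthogonality behind \<open>power_basis_bound\<close>.\<close>

lemma power_basis_values: assumes c: "c \<in> K n" "c ~= 0" shows "EX a. v \<nu> (c * \<pi> ^ i) = real q powi (a * int (d n \<nu>) - int i)" proof -
 interpret L: local_field "K n" "v n" by (rule lf[OF n(1)])
 interpret M: local_field "K \<nu>" "v \<nu>" by (rule lf) (use n in simp)
 obtain a where a: "v n c = real q powi a" using L.v_powi[OF c] res_card[OF n(1)] by metis
 have "v \<nu> (c * \<pi> ^ i) = (real q powi a) ^ d n \<nu> * (1 / real q) ^ i"
  using M.v_mult[of c "\<pi> ^ i"] M.v_power[OF \<pi>(1), of i] v_rel[OF n c(1)] a c K_mono[OF n] \<pi> M.sfI(9) by auto
 also have "(real q powi a) ^ d n \<nu> = real q powi (a * int (d n \<nu>))" by (simp only: power_int_mult power_int_of_nat)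
 also have "(1 / real q) ^ i = real q powi (- int i)" by (simp add: power_int_minus power_one_over inverse_eq_divide)
 also have "real q powi (a * int (d n \<nu>)) * real q powi (- int i) = real q powi (a * int (d n \<nu>) + - int i)" using q_gt_1 by (intro power_int_add[symmetric]) auto
 finally show ?thesis by auto
qed

lemma power_basis_distinct: assumes c: "c \<in> K n" "c' \<in> K n" and ij: "i < d n \<nu>" "j < d n \<nu>" "i ~= j"
  and eq: "v \<nu> (c * \<pi> ^ i) = v \<nu> (c' * \<pi> ^ j)" shows "c * \<pi> ^ i = 0" proof (rule ccontr)
 interpret M: local_field "K \<nu>" "v \<nu>" by (rule lf) (use n in simp)
 assume nz: "c * \<pi> ^ i ~= 0"
 have sub: "c \<in> K \<nu>" "c' \<in> K \<nu>" using c K_mono[OF n] by auto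
 have inM: "c * \<pi> ^ i \<in> K \<nu>" "c' * \<pi> ^ j \<in> K \<nu>" using M.sfI(4)[OF sub(1) M.sfI(9)[OF \<pi>(1)]] M.sfI(4)[OF sub(2) M.sfI(9)[OF \<pi>(1)]] by auto
 have "c' * \<pi> ^ j ~= 0" using eq nz M.v_eq_0[OF inM(1)] M.v_0 by metis
 with nz have cc: "c ~= 0" "c' ~= 0" by auto
 obtain a where a: "v \<nu> (c * \<pi> ^ i) = real q powi (a * int (d n \<nu>) - int i)" using power_basis_values[OF c(1) cc(1)] by blast
 obtain a' where a': "v \<nu> (c' * \<pi> ^ j) = real q powi (a' * int (d n \<nu>) - int j)" using power_basis_values[OF c(2) cc(2)] by blast
 have "a * int (d n \<nu>) - int i = a' * int (d n \<nu>) - int j" using eq a a' M.powi_inj res_card[of \<nu>] n by simp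
 then have "int i - int j = int (d n \<nu>) * (a - a')" by (simp add: algebra_simps)
 then have "int i mod int (d n \<nu>) = int j mod int (d n \<nu>)" by (simp add: mod_eq_dvd_iff)
 then show False using ij by simp
qed

lemma power_basis_bound: assumes c: "!!i. i < d n \<nu> ==> c i \<in> K n" and j: "j < d n \<nu>"
 shows "v \<nu> (c j * \<pi> ^ j) <= v \<nu> (\<Sum>i<d n \<nu>. c i * \<pi> ^ i)" proof -
 interpret M: local_field "K \<nu>" "v \<nu>" by (rule lf) (use n in simp)
 show ?thesis proof (rule M.v_sum_distinct[where f = "%i. c i * \<pi> ^ i"])
  fix i assume "i \<in> {..<d n \<nu>}"
  then have i: "i < d n \<nu>" by simp
  have "c i \<in> K \<nu>" using c[OF i] K_mono[OF n] by auto
  then show "c i * \<pi> ^ i \<in> K \<nu>" by (rule M.sfI(4)[OF _ M.sfI(9)[OF \<pi>(1)]])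
  fix k assume "k \<in> {..<d n \<nu>}" "i ~= k" "v \<nu> (c i * \<pi> ^ i) = v \<nu> (c k * \<pi> ^ k)"
  then show "c i * \<pi> ^ i = 0" using power_basis_distinct[OF c[OF i] c[of k] i, of k] by simp
 qed (use j in auto)
qed

text \<open>Orthogonality gives independence, and the number of powers is the degree. Total
  ramification enters through \<open>v_rel\<close>: there are just as many classes of exponents
  modulo \<open>d n \<nu>\<close> as powers to be separated.\<close>

lemma power_basis: "is_basis (K n) (K \<nu>) (d n \<nu>) (%i. \<pi> ^ i)" proof -
 interpret M: local_field "K \<nu>" "v \<nu>" by (rule lf) (use n in simp)
 obtain b where b: "is_basis (K n) (K \<nu>) (d n \<nu>) b" using basis[OF n] .
 show ?thesis proof (rule basis_of_independent[OF sf[OF n(1)] b])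
  show "\<pi> ^ i \<in> K \<nu>" for i using \<pi>(1) M.sfI(9) by blast
  fix c :: "nat => 'a" assume c: "!!i. i < d n \<nu> ==> c i \<in> K n" and z: "(\<Sum>i<d n \<nu>. c i * \<pi> ^ i) = 0"
  show "ALL i<d n \<nu>. c i = 0" proof (intro allI impI)
   fix i assume i: "i < d n \<nu>"
   have "c i \<in> K \<nu>" using c[OF i] K_mono[OF n] by auto
   then have ci: "c i * \<pi> ^ i \<in> K \<nu>" by (rule M.sfI(4)[OF _ M.sfI(9)[OF \<pi>(1)]])
   have "v \<nu> (c i * \<pi> ^ i) <= 0" using power_basis_bound[of c i, OF c i] z M.v_0 by simp
   then have "c i * \<pi> ^ i = 0" using M.v_nonneg[OF ci] M.v_eq_0[OF ci] by simp
   then show "c i = 0" using \<pi>(2) by simp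
  qed
 qed
qed

end

section \<open>Norms and root norms of principal units\<close>

text \<open>Column \<open>j\<close> of the representing matrix minus the identity holds the
  coordinates of \<open>(x - 1) * \<pi> ^ j\<close>; orthogonality bounds its entry in row
  \<open>i\<close> by \<open>v \<nu> (1 - x)\<close> times \<open>q ^ i / q ^ j\<close>, which is
  the hypothesis of \<open>det_close\<close>. The second claim is the first one read in
  \<open>K n\<close> through \<open>v_rel\<close>.\<close>

lemma norm_close: assumes n: "1 <= n" "n <= \<nu>" and x: "x \<in> U1 K v \<nu>"
 shows "v \<nu> (1 - field_norm (K n) (K \<nu>) x) <= v \<nu> (1 - x)" "field_norm (K n) (K \<nu>) x \<in> U1 K v n" proof -
 interpret L: local_field "K n" "v n" by (rule lf[OF n(1)])
 interpret M: local_field "K \<nu>" "v \<nu>" by (rule lf) (use n in simp)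
 have qs: "residue_card (K \<nu>) (v \<nu>) = q" using res_card n by auto
 have sub: "K n <= K \<nu>" by (rule K_mono[OF n])
 obtain \<pi> where \<pi>: "\<pi> \<in> K \<nu>" "\<pi> ~= 0" "v \<nu> \<pi> = 1 / real q" using M.uniformizer qs by metis
 note B = power_basis[OF n \<pi>] power_basis_bound[OF n \<pi>]
 have xM: "x \<in> K \<nu>" "v \<nu> (1 - x) < 1" using x by (auto simp: U1_def)
 obtain A where A: "rep_mat (K n) (d n \<nu>) (%i. \<pi> ^ i) x A" using rep_mat_exists[OF sf[OF n(1)] B(1) M.sf xM(1)] .
 have Ac: "A \<in> carrier_mat (d n \<nu>) (d n \<nu>)" and An: "!!i j. i < d n \<nu> ==> j < d n \<nu> ==> A $$ (i, j) \<in> K n" using A by (auto simp: rep_mat_def)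
 have N: "field_norm (K n) (K \<nu>) x = det A" by (rule field_norm_eq[OF sf[OF n(1)] B(1) A])
 have "v \<nu> (det A - 1) <= v \<nu> (1 - x)" proof (rule M.det_close[OF Ac])
  show "A $$ (i, j) \<in> K \<nu>" if "i < d n \<nu>" "j < d n \<nu>" for i j using An[OF that] sub by auto
  show "0 <= v \<nu> (1 - x)" "v \<nu> (1 - x) < 1" using M.v_nonneg xM M.sfI by auto
  show "0 < real q" using q_gt_1 by simp
  fix i j assume ij: "i < d n \<nu>" "j < d n \<nu>"
  define c where "c k = A $$ (k, j) - (if k = j then 1 else 0)" for k
  have cn: "c k \<in> K n" if "k < d n \<nu>" for k using An[OF that ij(2)] L.sfI(1,2,6) by (simp add: c_def)
  have "(\<Sum>k<d n \<nu>. c k * \<pi> ^ k) = (\<Sum>k<d n \<nu>. A $$ (k, j) * \<pi> ^ k) - (\<Sum>k<d n \<nu>. if k = j then \<pi> ^ j else 0)"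
   unfolding sum_subtractf[symmetric] by (intro sum.cong) (auto simp: c_def left_diff_distrib)
  also have "... = (x - 1) * \<pi> ^ j" using A ij by (simp add: rep_mat_def left_diff_distrib)
  finally have "v \<nu> (c i * \<pi> ^ i) <= v \<nu> ((x - 1) * \<pi> ^ j)" using B(2)[of c i] cn ij by simp
  moreover have "v \<nu> ((x - 1) * \<pi> ^ j) = v \<nu> (1 - x) / real q ^ j"
   using M.v_mult[of "x - 1" "\<pi> ^ j"] M.v_power[OF \<pi>(1), of j] \<pi> xM M.sfI M.v_diff_commute[of x 1] by (simp add: power_one_over divide_inverse power_inverse)
  moreover have "v \<nu> (c i * \<pi> ^ i) = v \<nu> (c i) / real q ^ i" using M.v_mult[of "c i" "\<pi> ^ i"] M.v_power[OF \<pi>(1), of i] \<pi> cn[OF ij(1)] sub M.sfI(9)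
   by (auto simp: power_one_over divide_inverse power_inverse)
  ultimately have "v \<nu> (c i) / real q ^ i <= v \<nu> (1 - x) / real q ^ j" by simp
  then have "v \<nu> (c i) <= v \<nu> (1 - x) * real q ^ i / real q ^ j" using q_gt_1 by (simp add: field_simps)
  then show "v \<nu> (A $$ (i, j) - (if i = j then 1 else 0)) <= v \<nu> (1 - x) * real q ^ i / real q ^ j" by (simp add: c_def)
 qed
 moreover have dn: "det A \<in> K n" by (rule det_in_subfield[OF sf[OF n(1)] Ac An])
 ultimately show c: "v \<nu> (1 - field_norm (K n) (K \<nu>) x) <= v \<nu> (1 - x)" unfolding N using M.v_diff_commute[of 1 "det A"] sub M.sfI(2) by auto
 have one: "1 - det A \<in> K n" using dn L.sfI by simp
 have "v n (1 - det A) ^ d n \<nu> < 1" using c xM(2) v_rel[OF n one] unfolding N by linarith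
 then have "v n (1 - det A) < 1" using L.v_nonneg[OF one] one_le_power[of "v n (1 - det A)" "d n \<nu>"] by linarith
 then show "field_norm (K n) (K \<nu>) x \<in> U1 K v n" using dn by (simp add: N U1_def)
qed

abbreviation "rn \<equiv> root_norm K v"

lemma U1_root_unique: assumes "1 <= k" "1 <= n" "n <= \<nu>" "x \<in> U1 K v k" "y \<in> U1 K v k" "x ^ d n \<nu> = y ^ d n \<nu>" shows "x = y"
 using local_field.U_power_inj[OF lf[OF assms(1)] v_d[OF assms(1-3)], of x y] assms U1_eq by simp

lemma rn_eqI: assumes n: "1 <= n" "n <= \<nu>" and "y \<in> U1 K v n" "y ^ d n \<nu> = field_norm (K n) (K \<nu>) x" shows "rn \<nu> n x = y"
 unfolding root_norm_def d_def[symmetric] proof (rule the_equality)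
 fix z assume "z \<in> U1 K v n & z ^ d n \<nu> = field_norm (K n) (K \<nu>) x"
 then show "z = y" using U1_root_unique[OF n(1) n, of z y] assms by simp
qed (use assms in simp)

lemma rn_props: assumes n: "1 <= n" "n <= \<nu>" and x: "x \<in> U1 K v \<nu>" shows "rn \<nu> n x \<in> U1 K v n" "rn \<nu> n x ^ d n \<nu> = field_norm (K n) (K \<nu>) x"
proof -
 interpret L: local_field "K n" "v n" by (rule lf[OF n(1)])
 obtain z where z: "z \<in> U1 K v n" "z ^ d n \<nu> = field_norm (K n) (K \<nu>) x"
  using L.U_root[OF v_d[OF n(1) n], of "field_norm (K n) (K \<nu>) x"] norm_close(2)[OF n x] U1_eq[OF n(1)] by metis
 then have "rn \<nu> n x = z" by (rule rn_eqI[OF n])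
 then show "rn \<nu> n x \<in> U1 K v n" "rn \<nu> n x ^ d n \<nu> = field_norm (K n) (K \<nu>) x" using z by auto
qed

text \<open>Inside \<open>K \<nu>\<close> the root norm is a principal unit, and raising it to the
  power \<open>d n \<nu>\<close> does not change its distance to 1 by
  \<open>v_power_minus_1\<close>; so the bound for the norm is a bound for its root.\<close>

lemma rn_nonexpansive: assumes n: "1 <= n" "n <= \<nu>" and x: "x \<in> U1 K v \<nu>" shows "v \<nu> (1 - rn \<nu> n x) <= v \<nu> (1 - x)" proof -
 have \<nu>: "1 <= \<nu>" using n by simp
 interpret M: local_field "K \<nu>" "v \<nu>" by (rule lf[OF \<nu>])
 have r: "rn \<nu> n x \<in> M.U" using rn_props(1)[OF n x] U1_mono[OF n] U1_eq[OF \<nu>] by auto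
 show ?thesis using M.v_power_minus_1[OF v_d[OF \<nu> n] r] rn_props(2)[OF n x] norm_close(1)[OF n x] by simp
qed

lemma rn_mult: assumes n: "1 <= n" "n <= \<nu>" and x: "x \<in> U1 K v \<nu>" and y: "y \<in> U1 K v \<nu>" shows "rn \<nu> n (x * y) = rn \<nu> n x * rn \<nu> n y"
proof (rule rn_eqI[OF n])
 have \<nu>: "1 <= \<nu>" using n by simp
 obtain b where b: "is_basis (K n) (K \<nu>) (d n \<nu>) b" using basis[OF n] .
 show "rn \<nu> n x * rn \<nu> n y \<in> U1 K v n" using rn_props(1)[OF n x] rn_props(1)[OF n y] local_field.U_mult[OF lf[OF n(1)]] U1_eq[OF n(1)] by simp
 show "(rn \<nu> n x * rn \<nu> n y) ^ d n \<nu> = field_norm (K n) (K \<nu>) (x * y)"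
  using rn_props(2)[OF n x] rn_props(2)[OF n y] field_norm_mult[OF sf[OF n(1)] sf[OF \<nu>] b, of x y] x y by (simp add: power_mult_distrib U1_def)
qed

text \<open>The norm of an element of the ground field is its power with the degree as exponent, and
  the root undoes this. Root norms are thus retractions onto the lower principal units, which makes
  the projections of \<open>V\<close> surjective.\<close>

lemma rn_id: assumes n: "1 <= n" "n <= \<nu>" and x: "x \<in> U1 K v n" shows "rn \<nu> n x = x" proof (rule rn_eqI[OF n x])
 obtain b where b: "is_basis (K n) (K \<nu>) (d n \<nu>) b" using basis[OF n] .
 show "x ^ d n \<nu> = field_norm (K n) (K \<nu>) x" using field_norm_scalar[OF sf[OF n(1)] b] x by (simp add: U1_def)
qed

lemma field_norm_power: assumes n: "1 <= n" "n <= \<nu>" and x: "x \<in> K \<nu>" shows "field_norm (K n) (K \<nu>) (x ^ e) = field_norm (K n) (K \<nu>) x ^ e"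
proof (induction e)
 have \<nu>: "1 <= \<nu>" using n by simp
 obtain b where b: "is_basis (K n) (K \<nu>) (d n \<nu>) b" using basis[OF n] .
 note sfn = subfield_ambient[OF sf[OF \<nu>]]
 case 0
 show ?case using field_norm_scalar[OF sf[OF n(1)] b, of 1] subfield_ambient(2)[OF sf[OF n(1)]] by simp
 case (Suc e)
 then show ?case using field_norm_mult[OF sf[OF n(1)] sf[OF \<nu>] b x sfn(9)[OF x, of e]] by simp
qed

text \<open>Raise to the power \<open>d k \<nu> = d k n * d n \<nu>\<close>: the outer root
  disappears, the norm commutes with the remaining power, the inner root disappears, and
  transitivity of the norm finishes.\<close>

lemma rn_tower: assumes k: "1 <= k" "k <= n" "n <= \<nu>" and x: "x \<in> U1 K v \<nu>" shows "rn n k (rn \<nu> n x) = rn \<nu> k x" proof (rule rn_eqI[symmetric])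
 have n: "1 <= n" and k\<nu>: "k <= \<nu>" and \<nu>: "1 <= \<nu>" using k by auto
 obtain a where a: "is_basis (K k) (K n) (d k n) a" using basis[OF k(1,2)] .
 obtain b where b: "is_basis (K n) (K \<nu>) (d n \<nu>) b" using basis[OF n k(3)] .
 note y = rn_props[OF n k(3) x]
 note z = rn_props[OF k(1,2) y(1)]
 show "1 <= k" "k <= \<nu>" using k by auto
 show "rn n k (rn \<nu> n x) \<in> U1 K v k" by (rule z(1))
 have "rn n k (rn \<nu> n x) ^ d k \<nu> = (field_norm (K k) (K n) (rn \<nu> n x)) ^ d n \<nu>" using z(2) d_mult[OF k] by (simp add: power_mult)
 also have "... = field_norm (K k) (K n) (rn \<nu> n x ^ d n \<nu>)" using field_norm_power[OF k(1,2)] y(1) by (simp add: U1_def)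
 also have "... = field_norm (K k) (K \<nu>) x" using field_norm_tower[OF sf[OF k(1)] sf[OF n] sf[OF \<nu>] a b d_pos[OF k(1,2)]] x y(2) by (simp add: U1_def)
 finally show "rn n k (rn \<nu> n x) ^ d k \<nu> = field_norm (K k) (K \<nu>) x" .
qed

section \<open>The projective limit and its chain of subgroups\<close>

abbreviation "VX \<equiv> V K v"
abbreviation "W \<equiv> V_sub K v"

lemma V_iff: "x \<in> VX \<longleftrightarrow> x \<in> extensional {1..} & (ALL n>=1. x n \<in> U1 K v n) & (ALL n>=1. ALL \<nu>>n. rn \<nu> n (x \<nu>) = x n)"
 by (auto simp: V_def PiE_def Pi_def)

lemma V_in: "x \<in> VX ==> 1 <= n ==> x n \<in> U1 K v n" and V_rn: "x \<in> VX ==> 1 <= n ==> n < \<nu> ==> rn \<nu> n (x \<nu>) = x n"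
 and V_ext: "x \<in> VX ==> x \<in> extensional {1..}" by (auto simp: V_iff)

lemma V_eqI: "x \<in> VX ==> y \<in> VX ==> (!!n. 1 <= n ==> x n = y n) ==> x = y" by (rule extensionalityI[of _ "{1..}"]) (auto simp: V_ext)

lemma V_one_in: "V_one \<in> VX" proof -
 have "1 \<in> U1 K v n" if "1 <= n" for n using local_field.U_1[OF lf[OF that]] U1_eq[OF that] by simp
 then show ?thesis using rn_id by (auto simp: V_iff V_one_def)
qed

lemma V_mult_in: assumes "x \<in> VX" "y \<in> VX" shows "V_mult x y \<in> VX" proof -
 have "x n * y n \<in> U1 K v n" if "1 <= n" for n using local_field.U_mult[OF lf[OF that]] V_in[OF assms(1) that] V_in[OF assms(2) that] U1_eq[OF that] by simp
 moreover have "rn \<nu> n (x \<nu> * y \<nu>) = x n * y n" if "1 <= n" "n < \<nu>" for n \<nu>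
  using rn_mult[of n \<nu> "x \<nu>" "y \<nu>"] V_in[of _ \<nu>] V_rn[OF _ that] assms that by simp
 ultimately show ?thesis by (auto simp: V_iff V_mult_def)
qed

lemma rn_inverse: assumes n: "1 <= n" "n <= \<nu>" and x: "x \<in> U1 K v \<nu>" shows "rn \<nu> n (inverse x) = inverse (rn \<nu> n x)" proof -
 have \<nu>: "1 <= \<nu>" using n by simp
 interpret L: local_field "K n" "v n" by (rule lf[OF n(1)])
 interpret M: local_field "K \<nu>" "v \<nu>" by (rule lf[OF \<nu>])
 have i: "inverse x \<in> U1 K v \<nu>" using M.U_inverse x U1_eq[OF \<nu>] by simp
 have "rn \<nu> n x * rn \<nu> n (inverse x) = rn \<nu> n (x * inverse x)" using rn_mult[OF n x i] by simp
 also have "x * inverse x = 1" using M.U_nonzero x U1_eq[OF \<nu>] by simp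
 also have "rn \<nu> n 1 = 1" using rn_id[OF n] L.U_1 U1_eq[OF n(1)] by simp
 finally show ?thesis by (metis inverse_unique)
qed

lemma V_inv_in: assumes "x \<in> VX" shows "V_div V_one x \<in> VX" proof -
 have "inverse (x n) \<in> U1 K v n" if "1 <= n" for n using local_field.U_inverse[OF lf[OF that]] V_in[OF assms that] U1_eq[OF that] by simp
 moreover have "rn \<nu> n (inverse (x \<nu>)) = inverse (x n)" if "1 <= n" "n < \<nu>" for n \<nu>
  using rn_inverse[of n \<nu> "x \<nu>"] V_in[OF assms, of \<nu>] V_rn[OF assms that] that by simp
 ultimately show ?thesis by (auto simp: V_iff V_div_def V_one_def)
qed

lemma V_nonzero: "x \<in> VX ==> 1 <= n ==> x n ~= 0" using V_in[of x n] U1_eq[of n] local_field.U_nonzero[OF lf, of n "x n"] by simp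

definition "\<V> = \<lparr>carrier = VX, mult = V_mult, one = V_one :: nat => 'a\<rparr>"

lemma \<V>_simps [simp]: "carrier \<V> = VX" "mult \<V> = V_mult" "one \<V> = V_one" by (simp_all add: \<V>_def)

lemma V_group: "comm_group \<V>" proof (rule comm_groupI)
 fix x y z assume *: "x \<in> carrier \<V>" "y \<in> carrier \<V>" "z \<in> carrier \<V>"
 show "x \<otimes>\<^bsub>\<V>\<^esub> y \<in> carrier \<V>" using * V_mult_in by simp
 show "x \<otimes>\<^bsub>\<V>\<^esub> y \<otimes>\<^bsub>\<V>\<^esub> z = x \<otimes>\<^bsub>\<V>\<^esub> (y \<otimes>\<^bsub>\<V>\<^esub> z)" "x \<otimes>\<^bsub>\<V>\<^esub> y = y \<otimes>\<^bsub>\<V>\<^esub> x"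
  by (auto simp: V_mult_def mult_ac)
next
 fix x assume x: "x \<in> carrier \<V>"
 have "V_mult V_one x = x" by (rule V_eqI[OF V_mult_in[OF V_one_in]]) (use x in \<open>auto simp: V_mult_def V_one_def\<close>)
 then show "\<one>\<^bsub>\<V>\<^esub> \<otimes>\<^bsub>\<V>\<^esub> x = x" by simp
 show "EX y:carrier \<V>. y \<otimes>\<^bsub>\<V>\<^esub> x = \<one>\<^bsub>\<V>\<^esub>" using x V_inv_in[of x] V_nonzero[of x] V_one_in
  by (intro bexI[of _ "V_div V_one x"]) (auto intro!: ext simp: V_mult_def V_div_def V_one_def)
qed (use V_one_in in simp)

lemma V_inv: assumes "x \<in> VX" shows "inv\<^bsub>\<V>\<^esub> x = V_div V_one x" proof -
 interpret comm_group \<V> by (rule V_group)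
 show ?thesis using assms V_inv_in[of x] V_nonzero[of x] by (intro inv_equality) (auto intro!: ext simp: V_mult_def V_div_def V_one_def)
qed

lemma V_div_eq: assumes "y \<in> VX" shows "x \<otimes>\<^bsub>\<V>\<^esub> inv\<^bsub>\<V>\<^esub> y = V_div x y"
 by (auto simp: V_inv[OF assms] V_mult_def V_div_def V_one_def)

lemma V_div_in: assumes "x \<in> VX" "y \<in> VX" shows "V_div x y \<in> VX"
 using V_mult_in[OF assms(1) V_inv_in[OF assms(2)]] V_div_eq[OF assms(2), of x] V_inv[OF assms(2)] by simp

lemma W_0: "W 0 = VX" by (simp add: V_sub_def)

lemma W_Suc: "1 <= n ==> W n = {x \<in> VX. v n (1 - x n) <= real q powi (- int (n * m n) - 1)}" by (simp add: V_sub_def)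

lemma v_V_div: assumes "1 <= n" "x \<in> VX" "y \<in> VX" shows "v n (1 - V_div x y n) = v n (x n - y n)"
 using local_field.v_diff_U[OF lf[OF assms(1)], of "x n" "y n"] V_in[of _ n] assms U1_eq by (simp add: V_div_def)

lemma W_div_iff: assumes "1 <= n" "x \<in> VX" "y \<in> VX" shows "V_div x y \<in> W n \<longleftrightarrow> v n (x n - y n) <= real q powi (- int (n * m n) - 1)"
 using W_Suc[OF assms(1)] v_V_div[OF assms] V_div_in[OF assms(2,3)] by simp

lemma W_subgroup: "subgroup (W n) \<V>" proof (cases "n = 0")
 case True
 interpret comm_group \<V> by (rule V_group)
 show ?thesis using subgroup_self True by (simp add: W_0)
next
 case False
 then have n: "1 <= n" by simp
 interpret comm_group \<V> by (rule V_group)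
 interpret L: local_field "K n" "v n" by (rule lf[OF n])
 show ?thesis proof (rule subgroupI)
  show "W n <= carrier \<V>" using W_Suc[OF n] by auto
  have "V_one \<in> W n" using V_one_in n q_gt_1 L.v_0 by (simp add: W_Suc V_one_def)
  then show "W n ~= {}" by blast
  fix x assume x: "x \<in> W n"
  then have xX: "x \<in> VX" using W_Suc[OF n] by simp
  have "v n (1 - V_div V_one x n) = v n (1 - x n)" using L.v_1_inverse[of "x n"] V_in[OF xX n] U1_eq[OF n] n by (simp add: V_div_def V_one_def)
  then show "inv\<^bsub>\<V>\<^esub> x \<in> W n" using x xX V_inv_in[OF xX] W_Suc[OF n] by (simp add: V_inv)
  fix y assume y: "y \<in> W n"
  then have yX: "y \<in> VX" using W_Suc[OF n] by simp
  have "v n (1 - x n * y n) <= max (v n (1 - x n)) (v n (1 - y n))" using L.v_1_mult V_in[OF xX n] V_in[OF yX n] U1_eq[OF n] L.U_in by simp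
  then show "x \<otimes>\<^bsub>\<V>\<^esub> y \<in> W n" using x y n V_mult_in[OF xX yX] by (auto simp: W_Suc V_mult_def)
 qed
qed

lemma W_X: "x \<in> W n ==> x \<in> VX" by (cases "n = 0") (auto simp: W_0 W_Suc)

text \<open>\<open>rn_nonexpansive\<close> bounds the distance of \<open>x n\<close> to 1 measured
  in \<open>K \<nu>\<close>, and \<open>v_rel\<close> turns this into a power of the value in
  \<open>K n\<close>. Deeper coordinates thus control all earlier ones.\<close>

lemma V_contract: assumes "1 <= n" "n <= \<nu>" "x \<in> VX" shows "v n (1 - x n) ^ d n \<nu> <= v \<nu> (1 - x \<nu>)" proof (cases "n = \<nu>")
 case True
 have "d n \<nu> = 1" using m_pos[of n] assms True by (simp add: d_def)
 then show ?thesis using True by simp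
next
 case False
 then have "rn \<nu> n (x \<nu>) = x n" using V_rn[OF assms(3,1)] assms(2) by simp
 moreover have "1 - x n \<in> K n" using V_in[OF assms(3,1)] subfield_ambient(2,6)[OF sf[OF assms(1)]] by (simp add: U1_def)
 ultimately show ?thesis using rn_nonexpansive[OF assms(1,2) V_in[OF assms(3)]] v_rel[OF assms(1,2)] assms by simp
qed

text \<open>The exponent \<open>n * m n + 1\<close> in \<open>V_sub\<close> is at least
  \<open>n * d k n\<close>, so \<open>V_contract\<close> and a root of order \<open>d k n\<close>
  leave a bound with exponent \<open>n\<close>, uniformly in \<open>k\<close>. This makes the chain
  a neighbourhood basis.\<close>

lemma W_coord: assumes "1 <= k" "k <= n" "x \<in> W n" shows "v k (1 - x k) <= (1 / real q) ^ n" proof -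
 have n: "1 <= n" using assms by simp
 interpret L: local_field "K k" "v k" by (rule lf[OF assms(1)])
 have one: "1 - x k \<in> K k" using V_in[OF W_X[OF assms(3)] assms(1)] L.sfI(2,6) by (simp add: U1_def)
 have "v k (1 - x k) ^ d k n <= real q powi (- int (n * m n) - 1)" using V_contract[OF assms(1,2) W_X[OF assms(3)]] assms(3) W_Suc[OF n] by simp
 also have "... <= real q powi (- int (n * d k n))" proof (rule power_int_increasing)
  have "n * d k n <= n * m n" using m_d(1)[OF assms(1,2)] m_pos[OF assms(1)] by simp
  then show "- int (n * m n) - 1 <= - int (n * d k n)" by linarith
 qed (use q_gt_1 in simp)
 also have "... = ((1 / real q) ^ n) ^ d k n" by (simp add: power_int_minus power_one_over inverse_eq_divide power_mult flip: of_nat_mult)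
 finally show ?thesis using power_le_imp_le_base[of "v k (1 - x k)" "d k n - 1" "(1 / real q) ^ n"] d_pos[OF assms(1,2)] by simp
qed

text \<open>By discreteness a violation means that \<open>v n (1 - x n)\<close> is at least
  \<open>q\<close> to the power \<open>- (n * m n)\<close>. Raised to \<open>d n (Suc n)\<close>
  this has exponent \<open>- (n * m (Suc n))\<close>, which \<open>V_contract\<close> forbids, the
  bound at level \<open>Suc n\<close> having exponent
  \<open>- (Suc n * m (Suc n)) - 1\<close>.\<close>

lemma W_decreasing: "W (Suc n) <= W n" proof (cases "n = 0")
 case True
 then show ?thesis using W_X W_0 by auto
next
 case False
 then have n: "1 <= n" by simp
 interpret L: local_field "K n" "v n" by (rule lf[OF n])
 show ?thesis proof
  fix x assume x: "x \<in> W (Suc n)"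
  have xX: "x \<in> VX" using W_X[OF x] .
  have one: "1 - x n \<in> K n" using V_in[OF xX n] L.sfI(2,6) by (simp add: U1_def)
  have "v n (1 - x n) < real q powi (- int (n * m n) - 1 + 1)" proof (rule ccontr)
   assume "~ ?thesis"
   then have "(real q powi (- int (n * m n))) ^ d n (Suc n) <= v n (1 - x n) ^ d n (Suc n)" using q_gt_1 by (intro power_mono) auto
   also have "... <= v (Suc n) (1 - x (Suc n))" by (rule V_contract[OF n _ xX]) simp
   also have "... <= real q powi (- int (Suc n * m (Suc n)) - 1)" using x W_Suc[of "Suc n"] by simp
   also have "(real q powi (- int (n * m n))) ^ d n (Suc n) = real q powi (- int (n * m n) * int (d n (Suc n)))" by (simp only: power_int_mult power_int_of_nat)
   also have "- int (n * m n) * int (d n (Suc n)) = - int (n * m (Suc n))" using m_d(1)[OF n, of "Suc n"] by simp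
   finally have "- int (n * m (Suc n)) <= - int (Suc n * m (Suc n)) - 1"
    using q_gt_1 power_int_strict_increasing[of "- int (Suc n * m (Suc n)) - 1" "- int (n * m (Suc n))" "real q"] by (meson not_le)
   then show False by (simp add: algebra_simps)
  qed
  then show "x \<in> W n" using L.v_discrete[OF one] xX W_Suc[OF n] res_card[OF n] by simp
 qed
qed

lemma pow_tendsto_0: "(%n. (1 / real q) ^ n) \<longlonglongrightarrow> 0" using q_gt_1 by (intro LIMSEQ_power_zero) auto

lemma W_separated: assumes "!!n. x \<in> W n" shows "x = V_one" proof (rule V_eqI[OF _ V_one_in])
 show "x \<in> VX" using assms[of 0] W_0 by simp
 fix k :: nat assume k: "1 <= k"
 interpret L: local_field "K k" "v k" by (rule lf[OF k])
 have one: "1 - x k \<in> K k" using V_in[OF \<open>x \<in> VX\<close> k] L.sfI(2,6) by (simp add: U1_def)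
 have "v k (1 - x k) <= 0" by (rule LIMSEQ_le_const[OF pow_tendsto_0]) (use W_coord[OF k] assms in auto)
 then have "1 - x k = 0" using L.v_nonneg[OF one] L.v_eq_0[OF one] by simp
 then show "x k = V_one k" using k by (simp add: V_one_def)
qed

text \<open>The witness repeats \<open>y\<close> from \<open>n\<close> on and takes root norms of
  \<open>y\<close> below. Compatibility in the constant part is \<open>rn_id\<close>, in the lower
  part \<open>rn_tower\<close>, and across \<open>n\<close> both together.\<close>

lemma V_surj: assumes n: "1 <= n" and y: "y \<in> U1 K v n" obtains x where "x \<in> VX" "x n = y" proof -
 define x where "x = (\<lambda>k\<in>{1..}. if n <= k then y else rn n k y)"
 have xn: "x n = y" using n by (simp add: x_def)
 have x1: "x k \<in> U1 K v k" if "1 <= k" for k using that U1_mono[OF n, of k] y rn_props(1)[OF that _ y] by (auto simp: x_def)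
 have "rn \<nu> k (x \<nu>) = x k" if k: "1 <= k" "k < \<nu>" for k \<nu> proof -
  consider "n <= k" | "k < n" "n <= \<nu>" | "\<nu> < n" by linarith
  then show ?thesis proof cases
   case 1
   then have "y \<in> U1 K v k" using U1_mono[OF n, of k] y by auto
   then show ?thesis using rn_id[of k \<nu> y] k 1 by (simp add: x_def)
  next
   case 2
   then have "y \<in> U1 K v \<nu>" using U1_mono[OF n, of \<nu>] y by auto
   then show ?thesis using rn_tower[of k n \<nu> y] rn_id[OF n 2(2) y] k 2 by (simp add: x_def)
  next
   case 3
   then show ?thesis using rn_tower[of k \<nu> n y] y k by (simp add: x_def)
  qed
 qed
 then have "x \<in> VX" using x1 by (auto simp: V_iff x_def)
 then show ?thesis using that xn by blast
qed

text \<open>A coset is determined by the ball of radius \<open>q\<close> to the power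
  \<open>- (n * m n) - 1\<close> around its \<open>n\<close>-th coordinate, and by
  \<open>V_surj\<close> every such ball in the principal units occurs. Writing the centres as
  \<open>1 - r\<close> with \<open>r\<close> in the maximal ideal, \<open>ball_reps\<close> counts
  them.\<close>

lemma W_index: "card ((%x. {y \<in> VX. V_div x y \<in> W n}) ` VX) = q ^ (n * m n)" proof (cases "n = 0")
 case True
 have "(%x. {y \<in> VX. V_div x y \<in> W n}) ` VX = {VX}" using V_div_in V_one_in True by (auto simp: W_0 image_def)
 then show ?thesis using True by simp
next
 case False
 then have n: "1 <= n" by simp
 interpret L: local_field "K n" "v n" by (rule lf[OF n])
 let ?t = "real q powi (- int (n * m n) - 1)"
 have qs: "residue_card (K n) (v n) = q" by (rule res_card[OF n])
 obtain R where R: "finite R" "card R = q ^ (n * m n)" "R <= {x \<in> K n. v n x < 1}" and R4: "ALL x:K n. v n x < 1 --> (EX! r. r \<in> R & v n (x - r) <= ?t)"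
  by (rule L.ball_reps[of "n * m n", unfolded qs]) (rule that)
 define C where "C r = {y \<in> VX. v n (1 - r - y n) <= ?t}" for r
 have cl: "{y \<in> VX. V_div x y \<in> W n} = {y \<in> VX. v n (x n - y n) <= ?t}" if "x \<in> VX" for x using W_div_iff[OF n that] by auto
 have coord: "x n \<in> K n" "1 - x n \<in> K n" "v n (1 - x n) < 1" if "x \<in> VX" for x using V_in[OF that n] L.sfI(2,6) by (auto simp: U1_def)
 have rK: "r \<in> K n" "v n r < 1" "1 - r \<in> K n" if "r \<in> R" for r using R(3) that L.sfI(2,6) by auto
 have ex: "EX x:VX. x n = 1 - r" if "r \<in> R" for r proof -
  have "1 - r \<in> U1 K v n" using rK[OF that] by (simp add: U1_def)
  then show ?thesis using V_surj[OF n] by metis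
 qed
 have same: "{y \<in> VX. V_div x y \<in> W n} = C r" if x: "x \<in> VX" and r: "r \<in> R" and xr: "v n (1 - x n - r) <= ?t" for x r proof -
  have a: "v n (x n - (1 - r)) <= ?t" proof -
   have "- (1 - x n - r) = x n - (1 - r)" by simp
   then show ?thesis using L.v_minus[OF L.sfI(6)[OF coord(2)[OF x] rK(1)[OF r]]] xr by metis
  qed
  then have b: "v n (1 - r - x n) <= ?t" using L.v_diff_commute[of "x n" "1 - r"] coord[OF x] rK[OF r] by simp
  show ?thesis unfolding cl[OF x] C_def using L.v_trans_le[OF a, of] L.v_trans_le[OF b] coord(1)[OF x] rK(3)[OF r] coord(1) by blast
 qed
 have "(%x. {y \<in> VX. V_div x y \<in> W n}) ` VX = C ` R" proof (intro equalityI subsetI)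
  fix S assume "S \<in> (%x. {y \<in> VX. V_div x y \<in> W n}) ` VX"
  then obtain x where x: "x \<in> VX" "S = {y \<in> VX. V_div x y \<in> W n}" by blast
  obtain r where r: "r \<in> R" "v n (1 - x n - r) <= ?t" using R4 coord[OF x(1)] by blast
  then show "S \<in> C ` R" using same[OF x(1) r] x(2) by blast
 next
  fix S assume "S \<in> C ` R"
  then obtain r where r: "r \<in> R" "S = C r" by blast
  obtain x where x: "x \<in> VX" "x n = 1 - r" using ex[OF r(1)] by blast
  have "v n (1 - x n - r) <= ?t" using x(2) L.v_0 q_gt_1 by simp
  from same[OF x(1) r(1) this] show "S \<in> (%x. {y \<in> VX. V_div x y \<in> W n}) ` VX" using r(2) x(1) by blast
 qed
 moreover have "inj_on C R" proof (rule inj_onI)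
  fix r s assume rs: "r \<in> R" "s \<in> R" "C r = C s"
  obtain x where x: "x \<in> VX" "x n = 1 - r" using ex[OF rs(1)] by blast
  have "x \<in> C r" using x L.v_0 q_gt_1 by (simp add: C_def)
  then have "x \<in> C s" using rs(3) by simp
  then have "v n (1 - s - x n) <= ?t" by (simp add: C_def)
  moreover have "1 - s - x n = r - s" using x(2) by simp
  ultimately have "v n (r - s) <= ?t" by metis
  moreover have "v n (r - r) <= ?t" using L.v_0 q_gt_1 by simp
  ultimately show "r = s" using R4[rule_format, OF rK(1,2)[OF rs(1)]] rs(1,2) by (metis (no_types, lifting))
 qed
 ultimately show ?thesis using R(2) by (simp add: card_image)
qed

lemma W_div_le: assumes "k <= n" "x \<in> W n" shows "x \<in> W k" using assms(1) assms(2) by (induction rule: dec_induct) (use W_decreasing in auto)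

text \<open>By \<open>W_coord\<close> each coordinate is a Cauchy sequence, so a coordinatewise
  limit exists; the root norms are non-expansive, so compatibility survives the limit. This is what
  later allows points of \<open>V\<close> to be recovered from sequences of cosets.\<close>

lemma V_complete: assumes x: "!!k. x k \<in> VX" and step: "!!k. V_div (x (Suc k)) (x k) \<in> W k" obtains y where "y \<in> VX" "!!k. V_div y (x k) \<in> W k" proof -
 interpret G: comm_group \<V> by (rule V_group)
 let ?B = "%k. (1 / real q) ^ k"
 have dec: "decseq ?B" using q_gt_1 by (auto simp: decseq_def intro!: power_decreasing)
 \<comment> \<open>The index is shifted by \<open>n\<close> because \<open>W_coord\<close> controls
   the \<open>n\<close>-th coordinate only from level \<open>n\<close> on.\<close>
 have conv: "EX z. z \<in> K n & (ALL k. v n (z - x (k + n) n) <= ?B (k + n))" if n: "1 <= n" for n proof -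
  interpret L: local_field "K n" "v n" by (rule lf[OF n])
  have "x (k + n) n \<in> K n" for k using V_in[OF x n] by (simp add: U1_def)
  moreover have "v n (x (Suc k + n) n - x (k + n) n) <= ?B (k + n)" for k using W_coord[OF n _ step[of "k + n"]] v_V_div[OF n x x] by simp
  moreover have "decseq (%k. ?B (k + n))" using dec by (simp add: decseq_def)
  moreover have "(%k. ?B (k + n)) \<longlonglongrightarrow> 0" by (rule LIMSEQ_ignore_initial_segment[OF pow_tendsto_0])
  ultimately obtain z where "z \<in> K n" "!!k. v n (z - x (k + n) n) <= ?B (k + n)" using L.cauchy_converges[of "%k. x (k + n) n" "%k. ?B (k + n)"] by metis
  then show ?thesis by blast
 qed
 then obtain z where z: "!!n. 1 <= n ==> z n \<in> K n" "!!n k. 1 <= n ==> v n (z n - x (k + n) n) <= ?B (k + n)" by metis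
 define y where "y = restrict z {1..}"
 have yz: "y n = z n" if "1 <= n" for n using that by (simp add: y_def)
 have lim: "v n (y n - x k n) <= ?B k" if "1 <= n" "n <= k" for n k using z(2)[OF that(1), of "k - n"] that yz by simp
 have xK: "x k n \<in> K n" "v n (1 - x k n) < 1" if "1 <= n" for k n using V_in[OF x that] by (auto simp: U1_def)
 have yU: "y n \<in> U1 K v n" if n: "1 <= n" for n proof -
  interpret L: local_field "K n" "v n" by (rule lf[OF n])
  have "v n (y n - x n n) <= ?B n" using lim[OF n] by simp
  also have "... < 1" using q_gt_1 n by (simp add: power_less_one_iff)
  finally have "v n (x n n - y n) < 1" using L.v_diff_commute[of "y n" "x n n"] z(1)[OF n] yz[OF n] xK[OF n] by simp
  then have "v n (1 - y n) < 1" using L.v_trans_less[OF xK(2)[OF n]] xK(1)[OF n] z(1)[OF n] yz[OF n] L.sfI(2) by simp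
  then show ?thesis using z(1)[OF n] yz[OF n] by (simp add: U1_def)
 qed
 have "rn \<nu> n (y \<nu>) = y n" if n: "1 <= n" "n < \<nu>" for n \<nu> proof -
  have \<nu>: "1 <= \<nu>" and n\<nu>: "n <= \<nu>" using n by auto
  interpret L: local_field "K n" "v n" by (rule lf[OF n(1)])
  interpret M: local_field "K \<nu>" "v \<nu>" by (rule lf[OF \<nu>])
  let ?r = "rn \<nu> n (y \<nu>)"
  have rU: "?r \<in> U1 K v n" by (rule rn_props(1)[OF n(1) n\<nu> yU[OF \<nu>]])
  have inK: "?r \<in> K n" "y n \<in> K n" "?r - y n \<in> K n" using rU yU[OF n(1)] L.sfI(6) by (auto simp: U1_def)
  \<comment> \<open>Both terms are compared with \<open>x k n\<close>, for which compatibility is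
    exact: the first distance is controlled after raising to the power \<open>d n \<nu>\<close> by
    non-expansiveness, the second directly.\<close>
  have "v n (?r - y n) ^ d n \<nu> <= ?B k" if k: "\<nu> <= k" for k proof -
   have xi: "inverse (x k \<nu>) \<in> U1 K v \<nu>" using M.U_inverse V_in[OF x \<nu>] U1_eq[OF \<nu>] by simp
   have yx: "y \<nu> * inverse (x k \<nu>) \<in> U1 K v \<nu>" using M.U_mult yU[OF \<nu>] xi U1_eq[OF \<nu>] by simp
   have e: "rn \<nu> n (y \<nu> * inverse (x k \<nu>)) = ?r * inverse (x k n)"
    using rn_mult[OF n(1) n\<nu> yU[OF \<nu>] xi] rn_inverse[OF n(1) n\<nu> V_in[OF x \<nu>]] V_rn[OF x n] by simp
   have inn: "1 - ?r * inverse (x k n) \<in> K n" using inK xK[OF n(1)] by (auto intro!: L.sfI)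
   have "v n (?r - x k n) ^ d n \<nu> = v n (1 - ?r * inverse (x k n)) ^ d n \<nu>" using L.v_diff_U[of ?r "x k n"] rU V_in[OF x n(1)] U1_eq[OF n(1)] by simp
   also have "... = v \<nu> (1 - ?r * inverse (x k n))" using v_rel[OF n(1) n\<nu> inn] by simp
   also have "... <= v \<nu> (1 - y \<nu> * inverse (x k \<nu>))" using rn_nonexpansive[OF n(1) n\<nu> yx] unfolding e .
   also have "... = v \<nu> (y \<nu> - x k \<nu>)" using M.v_diff_U[of "y \<nu>" "x k \<nu>"] yU[OF \<nu>] V_in[OF x \<nu>] U1_eq[OF \<nu>] by simp
   also have "... <= ?B k" by (rule lim[OF \<nu> k])
   finally have a: "v n (?r - x k n) ^ d n \<nu> <= ?B k" .
   have "v n (x k n - y n) <= ?B k" using lim[OF n(1), of k] n k L.v_diff_commute[of "y n" "x k n"] inK xK[OF n(1)] by simp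
   moreover have nn: "0 <= v n (x k n - y n)" using L.v_nonneg inK xK[OF n(1)] L.sfI(6) by simp
   moreover have "v n (x k n - y n) ^ d n \<nu> <= v n (x k n - y n) ^ 1" using calculation d_pos[OF n(1) n\<nu>] power_decreasing[of 1 "d n \<nu>" "v n (x k n - y n)"] q_gt_1
     power_le_one[of "1 / real q" k] by simp
   ultimately have b: "v n (x k n - y n) ^ d n \<nu> <= ?B k" by simp
   have "v n (?r - y n) <= max (v n (?r - x k n)) (v n (x k n - y n))" using L.v_diff_trans inK xK[OF n(1)] by simp
   then have "v n (?r - y n) ^ d n \<nu> <= max (v n (?r - x k n)) (v n (x k n - y n)) ^ d n \<nu>" using L.v_nonneg[OF inK(3)] by (rule power_mono)
   also have "... <= ?B k" using a b by (simp add: max_def)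
   finally show ?thesis .
  qed
  then have "v n (?r - y n) ^ d n \<nu> <= 0" by (intro LIMSEQ_le_const[OF pow_tendsto_0]) blast
  then have "v n (?r - y n) ^ d n \<nu> = 0" using zero_le_power[OF L.v_nonneg[OF inK(3)]] by (rule order_antisym)
  then have "?r - y n = 0" using L.v_eq_0[OF inK(3)] by simp
  then show ?thesis by simp
 qed
 then have yX: "y \<in> VX" using yU by (auto simp: V_iff y_def)
 have tel: "V_div (x (k + j)) (x k) \<in> W k" for k j proof (induction j)
  case 0
  show ?case using subgroup.one_closed[OF W_subgroup[of k]] G.r_inv[of "x k"] V_div_eq[OF x, of "x k"] x by simp
 next
  case (Suc j)
  have "V_div (x (Suc (k + j))) (x (k + j)) \<in> W k" using W_div_le[OF _ step[of "k + j"], of k] by simp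
  then have "V_div (x (Suc (k + j))) (x (k + j)) \<otimes>\<^bsub>\<V>\<^esub> V_div (x (k + j)) (x k) \<in> W k" using Suc subgroup.m_closed[OF W_subgroup] by blast
  also have "V_div (x (Suc (k + j))) (x (k + j)) \<otimes>\<^bsub>\<V>\<^esub> V_div (x (k + j)) (x k) = V_div (x (Suc (k + j))) (x k)"
   unfolding \<V>_simps by (rule ext) (use V_nonzero[OF x[of "k + j"]] in \<open>simp add: V_mult_def V_div_def\<close>)
  finally show ?case by simp
 qed
 have "V_div y (x k) \<in> W k" for k proof (cases "k = 0")
  case True
  then show ?thesis using V_div_in[OF yX x] by (simp add: W_0)
 next
  case False
  then have k: "1 <= k" by simp
  interpret L: local_field "K k" "v k" by (rule lf[OF k])
  let ?t = "real q powi (- int (k * m k) - 1)"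
  have t: "0 < ?t" using q_gt_1 by simp
  \<comment> \<open>A sufficiently late term of the sequence is closer to \<open>y\<close> in
    coordinate \<open>k\<close> than the radius of the coset, and telescoping puts that term into
    the coset of \<open>x k\<close>.\<close>
  obtain j where j: "?B j < ?t" using order_tendstoD(2)[OF pow_tendsto_0 t] by (auto simp: eventually_sequentially)
  have "v k (y k - x (k + j) k) <= ?B (k + j)" using lim[OF k] by simp
  also have "... <= ?B j" using dec by (simp add: decseq_def)
  finally have "v k (y k - x (k + j) k) <= ?t" using j by simp
  moreover have "v k (x (k + j) k - x k k) <= ?t" using tel[of k j] W_div_iff[OF k x x] by simp
  ultimately have "v k (y k - x k k) <= ?t" using yU[OF k] xK(1)[OF k] by (rule_tac y = "x (k + j) k" in L.v_trans_le) (auto simp: U1_def)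
  then show ?thesis using W_div_iff[OF k yX x] by simp
 qed
 then show ?thesis using that yX by blast
qed

lemma V_top_topspace: "topspace (V_top K v) = VX" proof -
 have "topspace (field_topology (K n) (v n)) = K n" if "1 <= n" for n
  unfolding field_topology_def by (rule Metric_space.topspace_mtopology[OF local_field.metric[OF lf[OF that]]])
 then have "VX <= (\<Pi>\<^sub>E n\<in>{1..}. topspace (field_topology (K n) (v n)))" by (auto simp: V_iff PiE_def Pi_def U1_def)
 then show ?thesis by (auto simp: V_top_def)
qed

text \<open>Values are discrete, so the closed ball describing the coset is the open ball whose
  radius is larger by the factor \<open>q\<close>; a coset is thus the preimage of an open set under
  one coordinate.\<close>

lemma openin_coset: assumes x: "x \<in> VX" shows "openin (V_top K v) {y \<in> VX. V_div y x \<in> W n}" proof (cases "n = 0")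
 case True
 have "{y \<in> VX. V_div y x \<in> W n} = topspace (V_top K v)" using V_div_in x True by (auto simp: W_0 V_top_topspace)
 then show ?thesis by simp
next
 case False
 then have n: "1 <= n" by simp
 interpret L: local_field "K n" "v n" by (rule lf[OF n])
 interpret M: Metric_space "K n" "val_dist (K n) (v n)" by (rule L.metric)
 let ?c = "real q powi (- int (n * m n))"
 have "continuous_map (V_top K v) (field_topology (K n) (v n)) (%y. y n)" unfolding V_top_def using n
  by (intro continuous_map_from_subtopology continuous_map_product_projection) auto
 moreover have "openin (field_topology (K n) (v n)) (M.mball (x n) ?c)" by (simp add: field_topology_def)
 ultimately have "openin (V_top K v) {y \<in> topspace (V_top K v). y n \<in> M.mball (x n) ?c}" by (rule openin_continuous_map_preimage)
 moreover have "{y \<in> topspace (V_top K v). y n \<in> M.mball (x n) ?c} = {y \<in> VX. V_div y x \<in> W n}" proof (rule Set.set_eqI)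
  fix y
  show "y \<in> {y \<in> topspace (V_top K v). y n \<in> M.mball (x n) ?c} \<longleftrightarrow> y \<in> {y \<in> VX. V_div y x \<in> W n}" proof (cases "y \<in> VX")
   case True
   have xy: "x n \<in> K n" "y n \<in> K n" using V_in[OF x n] V_in[OF True n] by (auto simp: U1_def)
   have "v n (y n - x n) < ?c \<longleftrightarrow> v n (y n - x n) <= real q powi (- int (n * m n) - 1)" using L.v_discrete[of "y n - x n" "- int (n * m n) - 1"] xy L.sfI(6)
     power_int_strict_increasing[of "- int (n * m n) - 1" "- int (n * m n)" "real q"] q_gt_1 unfolding res_card[OF n] by (auto simp del: of_nat_mult)
   then show ?thesis using True xy W_div_iff[OF n True x] L.v_diff_commute[OF xy] by (simp add: V_top_topspace val_dist_def)
  qed (simp add: V_top_topspace)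
 qed
 ultimately show ?thesis by simp
qed

text \<open>A basic open set of the product restricts finitely many coordinates, and by
  \<open>W_coord\<close> a sufficiently deep subgroup keeps each of them inside its ball. The
  description on the right is the one in which the abstract locale takes its topology.\<close>

lemma openin_V_top: "openin (V_top K v) S \<longleftrightarrow> S <= VX & (ALL x:S. EX n. ALL y:VX. V_div y x \<in> W n --> y \<in> S)" proof
 assume S: "openin (V_top K v) S"
 have SX: "S <= VX" using openin_subset[OF S] by (simp add: V_top_topspace)
 moreover have "EX n. ALL y:VX. V_div y x \<in> W n --> y \<in> S" if x: "x \<in> S" for x proof -
  have xX: "x \<in> VX" using SX x by auto
  obtain T where T: "openin (product_topology (%n. field_topology (K n) (v n)) {1..}) T" "S = T Int VX" using S unfolding V_top_def openin_subtopology by blast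
  then obtain U where U: "finite {i \<in> {1..}. U i ~= topspace (field_topology (K i) (v i))}"
   "!!i. i \<in> {1..} ==> openin (field_topology (K i) (v i)) (U i)" "x \<in> Pi\<^sub>E {1..} U" "Pi\<^sub>E {1..} U <= T"
   using bspec[OF T(1)[unfolded openin_product_topology_alt], of x] x by auto
  let ?I = "{i \<in> {1..}. U i ~= topspace (field_topology (K i) (v i))}"
  have ev: "\<forall>\<^sub>F n in sequentially. ALL y:VX. V_div y x \<in> W n --> y i \<in> U i" if i: "i \<in> ?I" for i proof -
   have i1: "1 <= i" using i by simp
   interpret L: local_field "K i" "v i" by (rule lf[OF i1])
   interpret M: Metric_space "K i" "val_dist (K i) (v i)" by (rule L.metric)
   have "openin M.mtopology (U i)" "x i \<in> U i" using U(2)[of i] U(3) i by (auto simp: field_topology_def)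
   then obtain r where r: "0 < r" "M.mball (x i) r <= U i" using M.openin_mtopology by blast
   have "\<forall>\<^sub>F n in sequentially. (1 / real q) ^ n < r & i <= n" using order_tendstoD(2)[OF pow_tendsto_0 r(1)] eventually_ge_at_top by (rule eventually_conj)
   then show ?thesis proof (rule eventually_mono)
    fix n assume n: "(1 / real q) ^ n < r & i <= n"
    show "ALL y:VX. V_div y x \<in> W n --> y i \<in> U i" proof (intro ballI impI)
     fix y assume y: "y \<in> VX" "V_div y x \<in> W n"
     have "v i (y i - x i) < r" using W_coord[OF i1 _ y(2)] n v_V_div[OF i1 y(1) xX] by simp
     moreover have xy: "x i \<in> K i" "y i \<in> K i" using V_in[OF xX i1] V_in[OF y(1) i1] by (auto simp: U1_def)
     ultimately have "y i \<in> M.mball (x i) r" using L.v_diff_commute[OF xy] by (simp add: val_dist_def)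
     then show "y i \<in> U i" using r(2) by auto
    qed
   qed
  qed
  have "\<forall>\<^sub>F n in sequentially. ALL i:?I. ALL y:VX. V_div y x \<in> W n --> y i \<in> U i" by (rule eventually_ball_finite[OF U(1)]) (use ev in blast)
  then obtain n where n: "ALL i:?I. ALL y:VX. V_div y x \<in> W n --> y i \<in> U i" by (auto simp: eventually_sequentially)
  have "y \<in> S" if y: "y \<in> VX" "V_div y x \<in> W n" for y proof -
   have "y i \<in> U i" if i: "1 <= i" for i proof (cases "i \<in> ?I")
    case False
    then have "U i = topspace (field_topology (K i) (v i))" using i by simp
    also have "... = K i" unfolding field_topology_def by (rule Metric_space.topspace_mtopology[OF local_field.metric[OF lf[OF i]]])
    finally show ?thesis using V_in[OF y(1) i] by (simp add: U1_def)
   qed (use n y in blast)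
   then have "y \<in> Pi\<^sub>E {1..} U" using V_ext[OF y(1)] by (auto simp: PiE_def)
   then show ?thesis using U(4) T(2) y by auto
  qed
  then show ?thesis by blast
 qed
 ultimately show "S <= VX & (ALL x:S. EX n. ALL y:VX. V_div y x \<in> W n --> y \<in> S)" by blast
next
 assume S: "S <= VX & (ALL x:S. EX n. ALL y:VX. V_div y x \<in> W n --> y \<in> S)"
 show "openin (V_top K v) S" proof (subst openin_subopen, intro ballI)
  fix x assume x: "x \<in> S"
  then obtain n where n: "ALL y:VX. V_div y x \<in> W n --> y \<in> S" using S by blast
  interpret G: comm_group \<V> by (rule V_group)
  have xX: "x \<in> VX" using x S by auto
  have "V_div x x \<in> W n" using subgroup.one_closed[OF W_subgroup[of n]] G.r_inv[of x] V_div_eq[OF xX, of x] xX by simp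
  then show "EX T. openin (V_top K v) T & x \<in> T & T <= S" using openin_coset[OF xX, of n] n xX by (intro exI[of _ "{y \<in> VX. V_div y x \<in> W n}"]) auto
 qed
qed

end

section \<open>Square-integrable functions, with equality almost everywhere\<close>

lemma L2_measurable: "u \<in> L2 M ==> u \<in> borel_measurable M" and L2_square: "u \<in> L2 M ==> integrable M (%x. (cmod (u x))^2)" by (auto simp: L2_def)

lemma cnj_measurable [measurable]: "f \<in> borel_measurable M ==> (%x. cnj (f x)) \<in> borel_measurable M"
 by (rule measurable_compose[of f M borel cnj]) (auto intro!: borel_measurable_continuous_onI continuous_intros)

lemma complex_of_real_measurable [measurable]:
 "f \<in> borel_measurable M ==> (%x. complex_of_real (f x)) \<in> borel_measurable M"
 by (rule measurable_compose[of f M borel complex_of_real]) (auto intro!: borel_measurable_continuous_onI continuous_intros)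

lemma L2_bound: assumes "u \<in> borel_measurable M" "integrable M g" "AE x in M. (cmod (u x))^2 <= g x" shows "u \<in> L2 M" proof -
 have "integrable M (%x. (cmod (u x))^2)" by (rule Bochner_Integration.integrable_bound[OF assms(2)]) (use assms in auto)
 then show ?thesis using assms(1) by (simp add: L2_def)
qed

lemma L2_scale: assumes "u \<in> L2 M" shows "(%x. c * u x) \<in> L2 M" using assms by (auto simp: L2_def norm_mult power_mult_distrib)

lemma L2_add: assumes "u \<in> L2 M" "w \<in> L2 M" shows "(%x. u x + w x) \<in> L2 M" proof (rule L2_bound)
 show "(%x. u x + w x) \<in> borel_measurable M" using assms L2_measurable by (intro borel_measurable_add)
 show "integrable M (%x. 2 * (cmod (u x))^2 + 2 * (cmod (w x))^2)" using assms L2_square by (intro Bochner_Integration.integrable_add integrable_mult_right)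
 have "(cmod (a + b))^2 <= 2 * (cmod a)^2 + 2 * (cmod b)^2" for a b proof -
  have "(cmod (a + b))^2 <= (cmod a + cmod b)^2" by (intro power_mono norm_triangle_ineq) simp
  also have "... <= 2 * (cmod a)^2 + 2 * (cmod b)^2" using zero_le_power2[of "cmod a - cmod b"] unfolding power2_sum power2_diff by linarith
  finally show ?thesis .
 qed
 then show "AE x in M. (cmod (u x + w x))^2 <= 2 * (cmod (u x))^2 + 2 * (cmod (w x))^2" by auto
qed

lemma L2_uminus: "u \<in> L2 M ==> (%x. - u x) \<in> L2 M" using L2_scale[of u M "-1"] by simp

lemma L2_diff: "u \<in> L2 M ==> w \<in> L2 M ==> (%x. u x - w x) \<in> L2 M" using L2_add[OF _ L2_uminus, of u M w] by simp

lemma L2_zero: "(%_. 0) \<in> L2 M" by (simp add: L2_def)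

lemma L2_sum: assumes "!!i. i \<in> A ==> f i \<in> L2 M" shows "(%x. \<Sum>i\<in>A. f i x) \<in> L2 M"
 using assms by (induction A rule: infinite_finite_induct) (auto intro: L2_add L2_zero)

lemma L2_cmod: "u \<in> L2 M ==> (%x. complex_of_real (cmod (u x))) \<in> L2 M" by (auto simp: L2_def)

lemma l2_inner_integrable: assumes "u \<in> L2 M" "w \<in> L2 M" shows "integrable M (%x. u x * cnj (w x))" proof (rule Bochner_Integration.integrable_bound)
 show "integrable M (%x. (cmod (u x))^2 + (cmod (w x))^2)" using assms L2_square by (intro Bochner_Integration.integrable_add)
 show "(%x. u x * cnj (w x)) \<in> borel_measurable M" using L2_measurable[OF assms(1)] L2_measurable[OF assms(2)] by measurable
 have "cmod (a * cnj b) <= norm ((cmod a)^2 + (cmod b)^2)" for a b proof -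
  have "2 * (cmod a * cmod b) <= (cmod a)^2 + (cmod b)^2" using zero_le_power2[of "cmod a - cmod b"] unfolding power2_diff by simp
  moreover have "0 <= cmod a * cmod b" by simp
  ultimately have "cmod a * cmod b <= (cmod a)^2 + (cmod b)^2" by linarith
  then show ?thesis by (simp add: norm_mult)
 qed
 then show "AE x in M. cmod (u x * cnj (w x)) <= norm ((cmod (u x))^2 + (cmod (w x))^2)" by auto
qed

lemma l2_norm_nonneg [simp]: "0 <= l2_norm M u" by (simp add: l2_norm_def)

lemma l2_norm_sq: "(l2_norm M u)^2 = (\<integral>x. (cmod (u x))^2 \<partial>M)" by (simp add: l2_norm_def)

lemma l2_inner_self: "l2_inner M u u = complex_of_real ((l2_norm M u)^2)" unfolding l2_norm_sq l2_inner_def integral_complex_of_real[symmetric]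
 by (simp only: complex_norm_square)

lemma l2_inner_sym: "l2_inner M w u = cnj (l2_inner M u w)" proof -
 have "cnj (\<integral>x. u x * cnj (w x) \<partial>M) = (\<integral>x. cnj (u x * cnj (w x)) \<partial>M)" by (rule Bochner_Integration.integral_cnj[symmetric])
 then show ?thesis by (simp add: l2_inner_def mult.commute)
qed

lemma l2_inner_add_left: assumes "u \<in> L2 M" "u' \<in> L2 M" "w \<in> L2 M" shows "l2_inner M (%x. u x + u' x) w = l2_inner M u w + l2_inner M u' w"
 unfolding l2_inner_def using l2_inner_integrable[OF assms(1,3)] l2_inner_integrable[OF assms(2,3)] by (simp add: distrib_right)

lemma l2_inner_diff_left: assumes "u \<in> L2 M" "u' \<in> L2 M" "w \<in> L2 M" shows "l2_inner M (%x. u x - u' x) w = l2_inner M u w - l2_inner M u' w"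
 unfolding l2_inner_def using l2_inner_integrable[OF assms(1,3)] l2_inner_integrable[OF assms(2,3)] by (simp add: left_diff_distrib)

lemma l2_inner_diff_right: assumes "u \<in> L2 M" "w \<in> L2 M" "w' \<in> L2 M" shows "l2_inner M u (%x. w x - w' x) = l2_inner M u w - l2_inner M u w'"
 using l2_inner_diff_left[OF assms(2,3,1)] l2_inner_sym by (metis complex_cnj_diff)

lemma l2_inner_scale_left: "l2_inner M (%x. c * u x) w = c * l2_inner M u w" unfolding l2_inner_def by (simp add: mult.assoc)

lemma l2_inner_scale_right: "l2_inner M u (%x. c * w x) = cnj c * l2_inner M u w" using l2_inner_scale_left[of M c w u] l2_inner_sym by (metis complex_cnj_mult)

lemma l2_inner_cong: "(!!x. x \<in> space M ==> u x = u' x) ==> (!!x. x \<in> space M ==> w x = w' x) ==>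
  l2_inner M u w = l2_inner M u' w'" unfolding l2_inner_def by (intro integral_cong_space) auto

lemma l2_norm_cong_AE: assumes "u \<in> borel_measurable M" "w \<in> borel_measurable M" "AE x in M. u x = w x" shows "l2_norm M u = l2_norm M w"
 unfolding l2_norm_def using assms by (intro arg_cong[where f = sqrt] integral_cong_AE) auto

lemma l2_norm_cong: "(!!x. x \<in> space M ==> u x = w x) ==> l2_norm M u = l2_norm M w"
 unfolding l2_norm_def by (intro arg_cong[where f = sqrt] integral_cong_space) auto

lemma l2_cauchy_schwarz: assumes "u \<in> L2 M" "w \<in> L2 M" shows "cmod (l2_inner M u w) <= l2_norm M u * l2_norm M w" proof -
 note m [measurable] = L2_measurable[OF assms(1)] L2_measurable[OF assms(2)]
 note i = l2_inner_integrable[OF assms]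
 have nn: "(\<integral>\<^sup>+x. ennreal (cmod (f x)) ^ 2 \<partial>M) = ennreal ((l2_norm M f)^2)" if "f \<in> L2 M" for f
  using L2_square[OF that] by (simp add: l2_norm_sq nn_integral_eq_integral ennreal_power)
 have "ennreal (\<integral>x. cmod (u x * cnj (w x)) \<partial>M) = (\<integral>\<^sup>+x. ennreal (cmod (u x)) * ennreal (cmod (w x)) \<partial>M)"
  using integrable_norm[OF i] by (subst nn_integral_eq_integral[symmetric]) (auto simp: norm_mult ennreal_mult)
 then have "ennreal (\<integral>x. cmod (u x * cnj (w x)) \<partial>M) ^ 2 <= ennreal ((l2_norm M u)^2) * ennreal ((l2_norm M w)^2)"
  using Cauchy_Schwarz_nn_integral[of "%x. ennreal (cmod (u x))" M "%x. ennreal (cmod (w x))"] unfolding nn[OF assms(1)] nn[OF assms(2)] by simp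
 then have "ennreal ((\<integral>x. cmod (u x * cnj (w x)) \<partial>M)^2) <= ennreal ((l2_norm M u * l2_norm M w)^2)"
  by (simp add: ennreal_power ennreal_mult' power_mult_distrib)
 then have "(\<integral>x. cmod (u x * cnj (w x)) \<partial>M)^2 <= (l2_norm M u * l2_norm M w)^2" by simp
 then have "(\<integral>x. cmod (u x * cnj (w x)) \<partial>M) <= l2_norm M u * l2_norm M w" by (rule power2_le_imp_le) simp
 then show ?thesis unfolding l2_inner_def by (rule order_trans[OF integral_norm_bound])
qed

lemma l2_norm_add_sq: assumes "u \<in> L2 M" "w \<in> L2 M" shows "(l2_norm M (%x. u x + w x))^2 = (l2_norm M u)^2 + (l2_norm M w)^2 + 2 * Re (l2_inner M u w)" proof -
 have "complex_of_real ((l2_norm M (%x. u x + w x))^2)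
   = l2_inner M u (%x. u x + w x) + l2_inner M w (%x. u x + w x)" unfolding l2_inner_self[symmetric] using assms by (intro l2_inner_add_left L2_add) auto
 also have "... = cnj (l2_inner M (%x. u x + w x) u) + cnj (l2_inner M (%x. u x + w x) w)" using l2_inner_sym by metis
 also have "... = cnj (l2_inner M u u + l2_inner M w u) + cnj (l2_inner M u w + l2_inner M w w)" using assms by (simp add: l2_inner_add_left)
 finally have "complex_of_real ((l2_norm M (%x. u x + w x))^2) =
   complex_of_real ((l2_norm M u)^2 + (l2_norm M w)^2) + (l2_inner M u w + cnj (l2_inner M u w))" using l2_inner_sym[of M w u] by (simp add: l2_inner_self)
 from arg_cong[OF this, of Re] show ?thesis by simp
qed

lemma l2_norm_triangle: assumes "u \<in> L2 M" "w \<in> L2 M" shows "l2_norm M (%x. u x + w x) <= l2_norm M u + l2_norm M w" proof (rule power2_le_imp_le)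
 have "Re (l2_inner M u w) <= l2_norm M u * l2_norm M w" using complex_Re_le_cmod[of "l2_inner M u w"] l2_cauchy_schwarz[OF assms] by linarith
 then show "(l2_norm M (%x. u x + w x))^2 <= (l2_norm M u + l2_norm M w)^2" unfolding l2_norm_add_sq[OF assms] power2_sum by (simp add: mult.assoc)
qed simp

lemma l2_norm_scale: "l2_norm M (%x. c * u x) = cmod c * l2_norm M u" by (simp add: l2_norm_def norm_mult power_mult_distrib real_sqrt_mult)

lemma l2_norm_diff_commute: "l2_norm M (%x. u x - w x) = l2_norm M (%x. w x - u x)" by (simp add: l2_norm_def norm_minus_commute)

lemma l2_norm_diff_triangle: assumes "u \<in> L2 M" "w \<in> L2 M" "z \<in> L2 M" shows "l2_norm M (%x. u x - z x) <= l2_norm M (%x. u x - w x) + l2_norm M (%x. w x - z x)"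
 using l2_norm_triangle[OF L2_diff[OF assms(1,2)] L2_diff[OF assms(2,3)]] by simp

lemma l2_norm_le_add_diff: assumes "u \<in> L2 M" "w \<in> L2 M" shows "l2_norm M u <= l2_norm M w + l2_norm M (%x. u x - w x)"
 using l2_norm_triangle[OF assms(2) L2_diff[OF assms(1,2)]] by simp

lemma l2_norm_sum: assumes "!!i. i \<in> A ==> f i \<in> L2 M" shows "l2_norm M (%x. \<Sum>i\<in>A. f i x) <= (\<Sum>i\<in>A. l2_norm M (f i))" using assms
proof (induction A rule: infinite_finite_induct)
 case (insert a A)
 have "l2_norm M (%x. f a x + (\<Sum>i\<in>A. f i x)) <= l2_norm M (f a) + l2_norm M (%x. \<Sum>i\<in>A. f i x)" using insert.prems by (intro l2_norm_triangle L2_sum) auto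
 then show ?case using insert by simp
qed (simp_all add: l2_norm_def)

lemma l2_norm_mono: assumes "u \<in> L2 M" "w \<in> L2 M" "AE x in M. cmod (u x) <= cmod (w x)" shows "l2_norm M u <= l2_norm M w" unfolding l2_norm_def using assms L2_square
 by (intro real_sqrt_le_mono integral_mono_AE) (auto elim!: eventually_mono intro!: power_mono)

lemma l2_norm_eq_0: assumes "u \<in> L2 M" shows "l2_norm M u = 0 \<longleftrightarrow> (AE x in M. u x = 0)"
 using integral_nonneg_eq_0_iff_AE[OF L2_square[OF assms]] by (simp add: l2_norm_def)

lemma l2_norm_diff_0: assumes "u \<in> L2 M" "w \<in> L2 M" "l2_norm M (%x. u x - w x) = 0" shows "AE x in M. u x = w x"
 using l2_norm_eq_0[OF L2_diff[OF assms(1,2)]] assms(3) by simp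

lemma l2_norm_limit_unique: assumes u: "u \<in> L2 M" and w: "w \<in> L2 M" and s: "!!n. s n \<in> L2 M"
  and "(%n. l2_norm M (%x. u x - s n x)) \<longlonglongrightarrow> 0" "(%n. l2_norm M (%x. w x - s n x)) \<longlonglongrightarrow> 0" shows "AE x in M. u x = w x"
proof (rule l2_norm_diff_0[OF u w])
 have "(%n. l2_norm M (%x. u x - s n x) + l2_norm M (%x. w x - s n x)) \<longlonglongrightarrow> 0" using tendsto_add[OF assms(4,5)] by simp
 moreover have "l2_norm M (%x. u x - w x) <= l2_norm M (%x. u x - s n x) + l2_norm M (%x. w x - s n x)" for n
  using l2_norm_diff_triangle[OF u s[of n] w] l2_norm_diff_commute[of M "s n" w] by simp
 ultimately have "l2_norm M (%x. u x - w x) <= 0" by (intro LIMSEQ_le_const) auto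
 then show "l2_norm M (%x. u x - w x) = 0" by (simp add: order_antisym)
qed

lemma (in finite_measure) L2_integrable: assumes "u \<in> L2 M" shows "integrable M u" proof (rule Bochner_Integration.integrable_bound)
 show "integrable M (%x. 1 + (cmod (u x))^2)" using L2_square[OF assms] by simp
 have "cmod a <= norm (1 + (cmod a)^2)" for a using zero_le_power2[of "cmod a - 1"] norm_ge_zero[of a] unfolding power2_diff by (simp del: zero_le_power2 norm_ge_zero)
 then show "AE x in M. norm (u x) <= norm (1 + (cmod (u x))^2)" by auto
qed (use L2_measurable[OF assms] in simp)

lemma (in finite_measure) L2_bounded: assumes "u \<in> borel_measurable M" "!!x. x \<in> space M ==> cmod (u x) <= C" shows "u \<in> L2 M" proof (rule L2_bound[OF assms(1)])
 show "AE x in M. (cmod (u x))^2 <= C^2" using assms(2) by (intro AE_I2 power_mono) auto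
qed simp

lemma l2_norm_dominated: assumes s: "!!i. s i \<in> borel_measurable M" and u: "u \<in> L2 M" and lim: "!!x. x \<in> space M ==> (%i. s i x) \<longlonglongrightarrow> u x"
  and bd: "!!i x. x \<in> space M ==> cmod (u x - s i x) <= c * cmod (u x)" shows "(%i. l2_norm M (%x. u x - s i x)) \<longlonglongrightarrow> 0" proof -
 have "(%i. \<integral>x. (cmod (u x - s i x))^2 \<partial>M) \<longlonglongrightarrow> (\<integral>x. 0 \<partial>M)" proof (rule integral_dominated_convergence)
  show "integrable M (%x. c^2 * (cmod (u x))^2)" using L2_square[OF u] by simp
  show "(%x. (cmod (u x - s i x))^2) \<in> borel_measurable M" for i using L2_measurable[OF u] s[of i] by measurable
  show "AE x in M. (%i. (cmod (u x - s i x))^2) \<longlonglongrightarrow> 0" proof (rule AE_I2)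
   fix x assume "x \<in> space M"
   have "(%i. (cmod (u x - s i x))^2) \<longlonglongrightarrow> (cmod (u x - u x))^2" by (intro tendsto_intros lim \<open>x \<in> space M\<close>)
   then show "(%i. (cmod (u x - s i x))^2) \<longlonglongrightarrow> 0" by simp
  qed
  show "AE x in M. norm ((cmod (u x - s i x))^2) <= c^2 * (cmod (u x))^2" for i proof (rule AE_I2)
   fix x assume "x \<in> space M"
   have "(cmod (u x - s i x))^2 <= (c * cmod (u x))^2" using bd[OF \<open>x \<in> space M\<close>] by (intro power_mono) auto
   then show "norm ((cmod (u x - s i x))^2) <= c^2 * (cmod (u x))^2" by (simp add: power_mult_distrib)
  qed
 qed simp
 from tendsto_real_sqrt[OF this] show ?thesis by (simp add: l2_norm_def)
qed

section \<open>Groups with a decreasing chain of subgroups of finite index\<close>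

text \<open>The sigma-algebra is generated by the sets that are open when the \<open>W n\<close> are
  the basic neighbourhoods of the unit; no separate topology is carried along. Strict growth of the
  indices makes the unit a null set and every increment of the averages nonzero.\<close>

locale subgroup_chain = comm_group G for G (structure) +
 fixes W :: "nat => 'a set" and N :: "nat => nat" and M :: "'a measure" assumes W_0: "W 0 = carrier G" and W_subgroup: "subgroup (W n) G" and W_Suc: "W (Suc n) <= W n"
  and W_separated: "(!!n. x \<in> W n) ==> x = \<one>" and index: "card ((%x. {y \<in> carrier G. x \<otimes> inv y \<in> W n}) ` carrier G) = N n"
  and N_mono: "N n < N (Suc n)" and space_M: "space M = carrier G" and sets_M: "sets M = sigma_sets (carrier G)
   {S. S <= carrier G & (ALL x:S. EX n. ALL y:carrier G. y \<otimes> inv x \<in> W n --> y \<in> S)}" and total: "emeasure M (carrier G) = 1"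
  and invariant: "a \<in> carrier G ==> S \<in> sets M ==> emeasure M ((\<otimes>) a ` S) = emeasure M S"
begin

abbreviation "C \<equiv> carrier G"

definition dv :: "'a => 'a => 'a" where "dv x y = x \<otimes> inv y"

definition cl :: "nat => 'a => 'a set" where "cl n x = {y \<in> C. dv x y \<in> W n}"

abbreviation "cls n \<equiv> cl n ` C"

lemma dv_closed [simp]: "x \<in> C ==> y \<in> C ==> dv x y \<in> C" by (simp add: dv_def)

lemma dv_self [simp]: "x \<in> C ==> dv x x = \<one>" by (simp add: dv_def)

lemma dv_one [simp]: "x \<in> C ==> dv x \<one> = x" by (simp add: dv_def)

lemma inv_dv: "x \<in> C ==> y \<in> C ==> inv (dv x y) = dv y x" by (simp add: dv_def inv_mult_group)

lemma dv_mult_dv: assumes "x \<in> C" "y \<in> C" "z \<in> C" shows "dv x y \<otimes> dv y z = dv x z" proof -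
 have "dv x y \<otimes> dv y z = x \<otimes> (inv y \<otimes> y) \<otimes> inv z" using assms by (simp only: dv_def m_assoc m_closed inv_closed)
 then show ?thesis using assms by (simp add: dv_def)
qed

lemma dv_dv: assumes "x \<in> C" "y \<in> C" "z \<in> C" shows "dv (dv x z) (dv y z) = dv x y" using dv_mult_dv[of x z y] assms inv_dv[of y z] by (simp add: dv_def)

lemma dv_dv_left: assumes "x \<in> C" "y \<in> C" shows "dv x (dv x y) = y" proof -
 have "dv x (dv x y) = x \<otimes> (y \<otimes> inv x)" using assms by (simp add: dv_def inv_mult_group)
 also have "... = y \<otimes> (x \<otimes> inv x)" using assms by (simp only: m_lcomm inv_closed)
 finally show ?thesis using assms by simp
qed

lemma dv_swap: assumes "x \<in> C" "y \<in> C" "z \<in> C" shows "dv (dv x y) z = dv (dv x z) y" using assms by (simp add: dv_def m_assoc m_comm m_lcomm)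

lemma dv_dv_dv: assumes "x \<in> C" "y \<in> C" "z \<in> C" shows "dv (dv x y) (dv x z) = dv z y" proof -
 have "dv (dv x y) (dv x z) = dv (dv x (dv x z)) y" using assms by (simp add: dv_swap)
 then show ?thesis using assms by (simp add: dv_dv_left)
qed

lemma W_closed: "x \<in> W n ==> x \<in> C" using subgroup.subset[OF W_subgroup] by blast

lemma W_mult: "x \<in> W n ==> y \<in> W n ==> x \<otimes> y \<in> W n" using subgroup.m_closed[OF W_subgroup] .

lemma W_inv: "x \<in> W n ==> inv x \<in> W n" using subgroup.m_inv_closed[OF W_subgroup] .

lemma W_one [simp]: "\<one> \<in> W n" using subgroup.one_closed[OF W_subgroup] .

lemma W_antimono: "m <= n ==> W n <= W m" by (induction rule: dec_induct) (use W_Suc in auto)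

lemma W_dv_commute: "x \<in> C ==> y \<in> C ==> dv x y \<in> W n \<longleftrightarrow> dv y x \<in> W n"
 using W_inv[of "dv x y" n] W_inv[of "dv y x" n] by (auto simp: inv_dv)

lemma W_dv_trans: "x \<in> C ==> y \<in> C ==> z \<in> C ==> dv x y \<in> W n ==> dv y z \<in> W n ==> dv x z \<in> W n"
 using W_mult[of "dv x y" n "dv y z"] by (simp add: dv_mult_dv)

lemma cl_sub: "cl n x <= C" by (auto simp: cl_def)

lemma cl_self: "x \<in> C ==> x \<in> cl n x" by (simp add: cl_def)

lemma cl_eq: assumes "x \<in> C" "y \<in> cl n x" shows "cl n y = cl n x" proof -
 have y: "y \<in> C" "dv x y \<in> W n" "dv y x \<in> W n" using assms by (auto simp: cl_def W_dv_commute)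
 show ?thesis using W_dv_trans[of x y _ n] W_dv_trans[of y x _ n] y assms(1) by (auto simp: cl_def)
qed

lemma cl_eq_iff: "x \<in> C ==> y \<in> C ==> cl n x = cl n y \<longleftrightarrow> dv x y \<in> W n" proof
 assume "x \<in> C" "y \<in> C" "cl n x = cl n y"
 then have "y \<in> cl n x" using cl_self[of y n] by simp
 then show "dv x y \<in> W n" by (simp add: cl_def)
next
 assume "x \<in> C" "y \<in> C" "dv x y \<in> W n"
 then show "cl n x = cl n y" using cl_eq[of x y n] by (simp add: cl_def)
qed

lemma cl_disjoint: "x \<in> C ==> y \<in> C ==> cl n x Int cl n y ~= {} ==> cl n x = cl n y" using cl_eq by (metis disjoint_iff)

lemma cl_antimono: "m <= n ==> cl n x <= cl m x" using W_antimono by (auto simp: cl_def)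

lemma cl_0: "x \<in> C ==> cl 0 x = C" by (auto simp: cl_def W_0)

lemma card_cls: "card (cls n) = N n" proof -
 have "cl n = (%x. {y \<in> C. x \<otimes> inv y \<in> W n})" by (rule ext) (simp add: cl_def dv_def)
 then show ?thesis using index[of n] by simp
qed

lemma N_0: "N 0 = 1" proof -
 have "cls 0 = {C}" using cl_0 one_closed by auto
 then show ?thesis using card_cls[of 0] by simp
qed

lemma N_pos: "0 < N n" by (cases n) (use N_0 N_mono in \<open>auto intro: gr_implies_not0 order_le_less_trans[OF le0]\<close>)

lemma N_real_pos [simp]: "0 < real (N n)" "real (N n) ~= 0" using N_pos[of n] by simp_all

lemma N_ge: "n < N n" proof (induction n)
 case (Suc n) then show ?case using N_mono[of n] by simp
qed (simp add: N_0)

lemma N_le: "m <= n ==> N m <= N n" by (induction rule: dec_induct) (use N_mono less_imp_le order_trans in blast)+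

lemma finite_cls: "finite (cls n)" by (rule card_ge_0_finite) (simp add: card_cls N_pos)

definition rep :: "'a set => 'a" where "rep S = (SOME x. x \<in> S)"

lemma rep_cl: assumes "S \<in> cls n" shows "rep S \<in> S" "rep S \<in> C" "cl n (rep S) = S" proof -
 obtain x where x: "x \<in> C" "S = cl n x" using assms by blast
 show r: "rep S \<in> S" unfolding rep_def using cl_self[OF x(1), of n] x(2) by (metis someI)
 then show "rep S \<in> C" "cl n (rep S) = S" using x cl_sub cl_eq[OF x(1)] by auto
qed

lemma cls_cover: "x \<in> C ==> S \<in> cls n ==> x \<in> S \<longleftrightarrow> S = cl n x" using cl_eq cl_self by blast

lemma sum_cls_indicator:
 fixes f :: "'a set => 'c::real_vector" assumes "x \<in> C" shows "(\<Sum>S\<in>cls n. indicator S x *\<^sub>R f S) = f (cl n x)" proof -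
 have "(\<Sum>S\<in>cls n. indicator S x *\<^sub>R f S) = (\<Sum>S\<in>cls n. if S = cl n x then f S else 0)"
  using cls_cover[OF assms, of _ n] by (intro sum.cong) (auto simp: indicator_def)
 then show ?thesis using assms finite_cls by (simp add: sum.delta)
qed

text \<open>Cosets of any two levels are nested or disjoint, so adding the empty set makes this
  countable generator stable under intersections, ready for uniqueness of measures and for Dynkin
  induction.\<close>

definition cosets :: "'a set set" where "cosets = insert {} (\<Union>n. cls n)"

lemma cosets_Pow: "cosets <= Pow C" using cl_sub by (auto simp: cosets_def)

lemma countable_cosets: "countable cosets" proof -
 have "countable (\<Union>n. cls n)" by (rule countable_UN) (auto intro: countable_finite[OF finite_cls])
 then show ?thesis by (simp add: cosets_def)
qed

lemma Int_stable_cosets: "Int_stable cosets" proof (rule Int_stableI)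
 fix A B assume AB: "A \<in> cosets" "B \<in> cosets"
 show "A Int B \<in> cosets" proof (cases "A Int B = {}")
  case False
  then obtain z where z: "z \<in> A" "z \<in> B" by blast
  obtain m x where x: "x \<in> C" "A = cl m x" using AB(1) z(1) by (auto simp: cosets_def)
  obtain n y where y: "y \<in> C" "B = cl n y" using AB(2) z(2) by (auto simp: cosets_def)
  have z: "z \<in> C" "A = cl m z" "B = cl n z" using cl_eq[OF x(1), of z m] cl_eq[OF y(1), of z n] z x y cl_sub[of m x] by auto
  have "A Int B = cl (max m n) z" using cl_antimono[of m "max m n" z] cl_antimono[of n "max m n" z] z by (cases "m <= n") (auto simp: max_def)
  then show ?thesis using z by (auto simp: cosets_def)
 qed (simp add: cosets_def)
qed

text \<open>An open set is the union of the cosets it contains, and there are only countably many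
  cosets.\<close>

lemma sets_cosets: "sets M = sigma_sets C cosets" proof -
 let ?O = "{S. S <= C & (ALL x:S. EX n. ALL y:C. y \<otimes> inv x \<in> W n --> y \<in> S)}"
 have "sigma_sets C ?O = sigma_sets C cosets" proof (rule sigma_sets_eqI)
  fix S assume S: "S \<in> ?O"
  have "S = \<Union>{A \<in> cosets. A <= S}" proof
   show "S <= \<Union>{A \<in> cosets. A <= S}" proof
    fix x assume x: "x \<in> S"
    then have xC: "x \<in> C" using S by auto
    obtain n where n: "ALL y:C. y \<otimes> inv x \<in> W n --> y \<in> S" using S x by blast
    then have "cl n x <= S" using xC W_dv_commute by (auto simp: cl_def dv_def)
    moreover have "cl n x \<in> cosets" using xC by (auto simp: cosets_def)
    ultimately show "x \<in> \<Union>{A \<in> cosets. A <= S}" using cl_self[OF xC, of n] by blast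
   qed
  qed blast
  moreover have "\<Union>{A \<in> cosets. A <= S} \<in> sigma_sets C cosets" using countable_cosets by (intro sigma_sets_UNION) (auto intro: countable_subset)
  ultimately show "S \<in> sigma_sets C cosets" by simp
 next
  fix A assume A: "A \<in> cosets"
  have "A \<in> ?O" proof (cases "A = {}")
   case False
   then obtain n x where x: "x \<in> C" "A = cl n x" using A by (auto simp: cosets_def)
   have "ALL y:C. y \<otimes> inv z \<in> W n --> y \<in> A" if "z \<in> A" for z using that x W_dv_trans[of x z _ n] W_dv_commute[of z] by (auto simp: cl_def dv_def)
   then show ?thesis using x cl_sub by auto
  qed simp
  then show "A \<in> sigma_sets C ?O" by (rule sigma_sets.Basic)
 qed
 then show ?thesis using sets_M by simp
qed

lemma cl_sets [measurable]: "x \<in> C ==> cl n x \<in> sets M" unfolding sets_cosets by (rule sigma_sets.Basic) (auto simp: cosets_def)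

lemma cls_sets: "S \<in> cls n ==> S \<in> sets M" using cl_sets by auto

sublocale prob_space M by (rule prob_spaceI) (simp add: space_M total)

lemma measurable_into: assumes "!!x. x \<in> space R ==> f x \<in> C" "!!n x. x \<in> C ==> f -` cl n x Int space R \<in> sets R" shows "f \<in> measurable R M"
 by (rule measurable_sigma_sets[OF sets_cosets cosets_Pow]) (use assms in \<open>auto simp: cosets_def\<close>)

lemma cl_translate: assumes "a \<in> C" "x \<in> C" shows "(\<otimes>) a ` cl n x = cl n (a \<otimes> x)" proof -
 have eq: "dv (a \<otimes> x) (a \<otimes> y) = dv x y" if "y \<in> C" for y proof -
  have "dv (a \<otimes> x) (a \<otimes> y) = dv (dv x (inv a)) (dv y (inv a))" using assms that by (simp add: dv_def m_comm)
  then show ?thesis using assms that by (simp add: dv_dv)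
 qed
 show ?thesis proof (intro equalityI subsetI)
  fix z assume "z \<in> (\<otimes>) a ` cl n x"
  then show "z \<in> cl n (a \<otimes> x)" using eq assms by (auto simp: cl_def)
 next
  fix z assume z: "z \<in> cl n (a \<otimes> x)"
  have zC: "z \<in> C" using z cl_sub by auto
  have "z = a \<otimes> (inv a \<otimes> z)" using assms zC by (simp add: m_assoc[symmetric])
  moreover have "inv a \<otimes> z \<in> cl n x" using z eq[of "inv a \<otimes> z"] calculation assms zC by (simp add: cl_def)
  ultimately show "z \<in> (\<otimes>) a ` cl n x" by blast
 qed
qed

lemma prob_cl: assumes "x \<in> C" shows "prob (cl n x) = 1 / real (N n)" proof -
 have same: "prob (cl n y) = prob (cl n \<one>)" if "y \<in> C" for y using invariant[OF that cl_sets[OF one_closed, of n]] cl_translate[OF that one_closed, of n] that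
  by (simp add: measure_def)
 have "1 = prob (\<Union>S\<in>cls n. S)" proof -
  have "(\<Union>S\<in>cls n. S) = C" using cl_self cl_sub by blast
  then show ?thesis using prob_space by (simp add: space_M)
 qed
 also have "... = (\<Sum>S\<in>cls n. prob S)" proof (rule finite_measure_finite_Union[OF finite_cls])
  show "(%S. S) ` cls n <= sets M" using cls_sets by auto
  show "disjoint_family_on (%S. S) (cls n)" using cl_disjoint by (auto simp: disjoint_family_on_def)
 qed
 also have "... = real (N n) * prob (cl n \<one>)" proof -
  have "(\<Sum>S\<in>cls n. prob S) = (\<Sum>S\<in>cls n. prob (cl n \<one>))" proof (rule sum.cong[OF refl])
   fix S assume "S \<in> cls n"
   then obtain y where "y \<in> C" "S = cl n y" by blast
   then show "prob S = prob (cl n \<one>)" by (simp only: same)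
  qed
  also have "... = real (N n) * prob (cl n \<one>)" by (simp only: sum_constant card_cls)
  finally show ?thesis .
 qed
 finally have "prob (cl n \<one>) * real (N n) = 1" by (simp add: mult.commute)
 then have "prob (cl n \<one>) = 1 / real (N n)" using N_pos[of n] by (subst nonzero_eq_divide_eq) simp_all
 then show ?thesis using same[OF assms] by simp
qed

lemma emeasure_cl: "x \<in> C ==> emeasure M (cl n x) = ennreal (1 / real (N n))" using prob_cl emeasure_eq_measure by simp

lemma haar_unique: assumes "sets R = sets M" "!!n x. x \<in> C ==> emeasure R (cl n x) = ennreal (1 / real (N n))" shows "R = M"
proof (rule measure_eqI_generator_eq[OF Int_stable_cosets cosets_Pow])
 show "emeasure R S = emeasure M S" if "S \<in> cosets" for S using that assms(2) emeasure_cl by (auto simp: cosets_def)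
 show "sets R = sigma_sets C cosets" "sets M = sigma_sets C cosets" using assms(1) sets_cosets by auto
 show "range (%_::nat. C) <= cosets" using cl_0[OF one_closed] by (auto simp: cosets_def)
 show "emeasure R C ~= \<infinity>" for i :: nat using assms(2)[OF one_closed, of 0] cl_0[OF one_closed] by simp
qed auto

text \<open>The cosets of level \<open>n\<close> all have mass \<open>1 / real (N n)\<close> and
  together generate the sigma-algebra, so a map that pulls cosets back to cosets of the same level
  preserves the measure.\<close>

lemma measure_preserving: assumes "!!x. x \<in> C ==> f x \<in> C" "!!n x. x \<in> C ==> g x \<in> C & f -` cl n x Int C = cl n (g x)"
 shows "f \<in> measurable M M" "distr M M f = M" proof -
 show m: "f \<in> measurable M M" using assms by (intro measurable_into) (auto simp: space_M)
 show "distr M M f = M" proof (rule haar_unique)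
  show "emeasure (distr M M f) (cl n x) = ennreal (1 / real (N n))" if "x \<in> C" for n x
   using assms(2)[OF that, of n] m that by (simp add: emeasure_distr space_M emeasure_cl)
 qed simp
qed

lemma dv_right: assumes "x \<in> C" shows "(%y. dv y x) \<in> measurable M M" "distr M M (%y. dv y x) = M" proof -
 have "z \<otimes> x \<in> C & (%y. dv y x) -` cl n z Int C = cl n (z \<otimes> x)" if "z \<in> C" for z n proof -
  have e: "dv (z \<otimes> x) y = dv z (dv y x)" if "y \<in> C" for y using assms \<open>z \<in> C\<close> that by (simp add: dv_def inv_mult_group m_assoc m_comm m_lcomm)
  show ?thesis using that assms e by (auto simp: cl_def)
 qed
 then show "(%y. dv y x) \<in> measurable M M" "distr M M (%y. dv y x) = M" using measure_preserving[of "%y. dv y x" "%z. z \<otimes> x"] assms by simp_all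
qed

lemma dv_left: assumes "x \<in> C" shows "dv x \<in> measurable M M" "distr M M (dv x) = M" proof -
 have "dv x z \<in> C & dv x -` cl n z Int C = cl n (dv x z)" if "z \<in> C" for z n proof -
  have "dv (dv x z) y = dv (dv x y) z" if "y \<in> C" for y using assms \<open>z \<in> C\<close> that by (rule dv_swap)
  moreover have "dv z (dv x y) \<in> W n \<longleftrightarrow> dv (dv x y) z \<in> W n" if "y \<in> C" for y
   using assms \<open>z \<in> C\<close> that by (simp add: W_dv_commute)
  ultimately show ?thesis using that assms by (auto simp: cl_def)
 qed
 then show "dv x \<in> measurable M M" "distr M M (dv x) = M" using measure_preserving[of "dv x" "dv x"] assms by simp_all
qed

text \<open>Modulo \<open>W n\<close>, the quotient depends only on the cosets of its two arguments,
  so the preimage of a coset is a finite union of rectangles of cosets.\<close>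

lemma dv_measurable: "(%(x, y). dv x y) \<in> measurable (M \<Otimes>\<^sub>M M) M" proof (rule measurable_into)
 fix n z assume z: "z \<in> C"
 have "(%(x, y). dv x y) -` cl n z Int space (M \<Otimes>\<^sub>M M) = (\<Union>S\<in>cls n. S \<times> cl n (dv (rep S) z))" proof (intro equalityI subsetI)
  fix p assume p: "p \<in> (%(x, y). dv x y) -` cl n z Int space (M \<Otimes>\<^sub>M M)"
  obtain x y where xy: "p = (x, y)" "x \<in> C" "y \<in> C" "dv x y \<in> cl n z" using p by (auto simp: space_pair_measure space_M)
  let ?S = "cl n x"
  have S: "?S \<in> cls n" using xy by blast
  have r: "rep ?S \<in> C" "dv (rep ?S) x \<in> W n" using rep_cl[OF S] cl_eq_iff[of "rep ?S" x n] xy by auto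
  have "dv x z \<in> C" "dv (dv x z) y \<in> W n" using xy z W_dv_commute[of z "dv x y" n] dv_swap[of x y z] by (auto simp: cl_def)
  moreover have "dv (dv (rep ?S) z) (dv x z) \<in> W n" using r xy z by (simp add: dv_dv)
  ultimately have "dv (dv (rep ?S) z) y \<in> W n" using W_dv_trans[of "dv (rep ?S) z" "dv x z" y n] r xy z by simp
  then have "y \<in> cl n (dv (rep ?S) z)" using xy by (simp add: cl_def)
  then show "p \<in> (\<Union>S\<in>cls n. S \<times> cl n (dv (rep S) z))" using xy S cl_self[OF xy(2), of n] by blast
 next
  fix p assume "p \<in> (\<Union>S\<in>cls n. S \<times> cl n (dv (rep S) z))"
  then obtain S x y where S: "S \<in> cls n" and p: "p = (x, y)" "x \<in> S" "y \<in> cl n (dv (rep S) z)" by blast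
  have xy: "x \<in> C" "y \<in> C" using p S cl_sub by auto
  have r: "rep S \<in> C" "dv x (rep S) \<in> W n" using rep_cl[OF S] p(2) W_dv_commute[of "rep S" x n] xy by (auto simp: cl_def)
  have "dv (dv x z) (dv (rep S) z) \<in> W n" using r xy z by (simp add: dv_dv)
  moreover have "dv (dv (rep S) z) y \<in> W n" using p(3) by (simp add: cl_def)
  ultimately have "dv (dv x z) y \<in> W n" using W_dv_trans[of "dv x z" "dv (rep S) z" y n] r xy z by simp
  then have "dv x y \<in> cl n z" using xy z W_dv_commute[of z "dv x y" n] dv_swap[of x y z] by (simp add: cl_def)
  then show "p \<in> (%(x, y). dv x y) -` cl n z Int space (M \<Otimes>\<^sub>M M)" using p xy by (simp add: space_pair_measure space_M)
 qed
 also have "... \<in> sets (M \<Otimes>\<^sub>M M)" using finite_cls z rep_cl(2) by (intro sets.finite_UN pair_measureI cls_sets cl_sets dv_closed) auto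
 finally show "(%(x, y). dv x y) -` cl n z Int space (M \<Otimes>\<^sub>M M) \<in> sets (M \<Otimes>\<^sub>M M)" .
qed (auto simp: space_pair_measure space_M)

lemma one_null: "{\<one>} \<in> sets M" "prob {\<one>} = 0" proof -
 have eq: "{\<one>} = (\<Inter>n. cl n \<one>)" proof
  show "(\<Inter>n. cl n \<one>) <= {\<one>}" proof
   fix x assume x: "x \<in> (\<Inter>n. cl n \<one>)"
   then have xC: "x \<in> C" using cl_sub by blast
   have "x \<in> W n" for n using x xC W_dv_commute[of \<one> x n] by (auto simp: cl_def)
   then show "x \<in> {\<one>}" using W_separated by blast
  qed
 qed (use cl_self[OF one_closed] in auto)
 show s: "{\<one>} \<in> sets M" unfolding eq using one_closed by (intro sets.countable_INT) auto
 have "prob {\<one>} <= 1 / real (Suc n)" for n proof -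
  have "prob {\<one>} <= prob (cl n \<one>)" using eq by (intro finite_measure_mono) auto
  also have "... <= 1 / real (Suc n)" unfolding prob_cl[OF one_closed] using N_ge[of n] by (intro divide_left_mono) auto
  finally show ?thesis .
 qed
 then have "prob {\<one>} <= 0" by (intro LIMSEQ_le_const[OF LIMSEQ_inverse_real_of_nat]) (auto simp: inverse_eq_divide)
 then show "prob {\<one>} = 0" by (simp add: measure_le_0_iff)
qed

lemma AE_not_one: "AE x in M. x ~= \<one>" proof -
 have "{\<one>} \<in> null_sets M" using one_null by (auto simp: null_sets_def emeasure_eq_measure)
 then show ?thesis by (intro AE_I'[of "{\<one>}"]) auto
qed

lemma level_exists: assumes "x \<in> C" "x ~= \<one>" shows "EX! l. x \<in> W l - W (Suc l)" proof -
 have ex: "EX n. x ~: W n" using W_separated assms(2) by blast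
 define k where "k = (LEAST n. x ~: W n)"
 have k: "x ~: W k" unfolding k_def using ex by (rule LeastI_ex)
 have lt: "x \<in> W n" if "n < k" for n using not_less_Least[of n "%n. x ~: W n"] that unfolding k_def by blast
 obtain l where l: "k = Suc l" using k W_0 assms(1) by (cases k) auto
 show ?thesis proof (rule ex1I[of _ l])
  show "x \<in> W l - W (Suc l)" using k l lt by auto
  fix j assume j: "x \<in> W j - W (Suc j)"
  have "j < k" using j k W_antimono[of k j] by (meson DiffE not_le subsetD)
  moreover have "~ Suc j < k" using j lt by blast
  ultimately show "j = l" using l by simp
 qed
qed

abbreviation "nrm \<equiv> l2_norm M"

subsection \<open>Averaging over cosets\<close>

text \<open>The conditional expectation for the finite partition into cosets of \<open>W n\<close>;
  the factor \<open>N n\<close> is the inverse of the mass of a coset.\<close>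

definition E :: "nat => ('a => complex) => 'a => complex" where
 "E n u x = of_nat (N n) * (\<integral>y. indicator (cl n x) y *\<^sub>R u y \<partial>M)"

definition P :: "nat => ('a => complex) => 'a => complex" where
 "P n u x = E n u x - (if n = 0 then 0 else E (n - 1) u x)"

definition lc :: "nat => ('a => 'c) => bool" where
 "lc n u \<longleftrightarrow> (ALL x:C. ALL y:C. dv x y \<in> W n --> u x = u y)"

lemma lc_cl: "lc n u ==> x \<in> C ==> y \<in> cl n x ==> u y = u x" unfolding lc_def cl_def by (rule sym) blast

lemma lcD: "lc n u ==> x \<in> C ==> y \<in> C ==> dv x y \<in> W n ==> u x = u y" unfolding lc_def by blast

lemma lc_mono: "lc m u ==> m <= n ==> lc n u" unfolding lc_def using W_antimono by blast

lemma lc_cong: "lc n u ==> (!!x. x \<in> C ==> u x = w x) ==> lc n w" unfolding lc_def by metis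

lemma lc_comp: "lc n u ==> lc n (%x. f (u x))" unfolding lc_def by metis

lemma lc_comp2: "lc n u ==> lc n w ==> lc n (%x. f (u x) (w x))" unfolding lc_def by metis

lemma lc_expand:
 fixes u :: "'a => 'c::real_vector" assumes "lc n u" "x \<in> C" shows "u x = (\<Sum>S\<in>cls n. indicator S x *\<^sub>R u (rep S))" proof -
 have "cl n x \<in> cls n" using assms(2) by simp
 from rep_cl[OF this] have "u (rep (cl n x)) = u x" using lc_cl[OF assms] by blast
 then show ?thesis using sum_cls_indicator[OF assms(2), of "%S. u (rep S)" n] by simp
qed

lemma lc_measurable: assumes "lc n (u :: 'a => complex)" shows "u \<in> borel_measurable M" proof (rule measurable_cong[THEN iffD2])
 show "(%x. \<Sum>S\<in>cls n. indicator S x *\<^sub>R u (rep S)) \<in> borel_measurable M"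
  using cls_sets by (intro borel_measurable_sum borel_measurable_scaleR borel_measurable_indicator) auto
qed (use lc_expand[OF assms] in \<open>simp add: space_M\<close>)

lemma lc_bounded: assumes "lc n (u :: 'a => complex)" obtains B where "!!x. x \<in> C ==> cmod (u x) <= B" proof -
 let ?B = "\<Sum>S\<in>cls n. cmod (u (rep S))"
 have "cmod (u x) <= ?B" if x: "x \<in> C" for x proof -
  have S: "cl n x \<in> cls n" using x by simp
  have "u x = u (rep (cl n x))" using lc_cl[OF assms x] rep_cl(1)[OF S] by simp
  also have "cmod ... <= ?B" using S finite_cls by (intro member_le_sum) auto
  finally show ?thesis .
 qed
 then show ?thesis using that by blast
qed

lemma lc_L2: assumes "lc n (u :: 'a => complex)" shows "u \<in> L2 M" proof -
 obtain B where "!!x. x \<in> C ==> cmod (u x) <= B" using lc_bounded[OF assms] by blast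
 then show ?thesis using lc_measurable[OF assms] by (intro L2_bounded) (auto simp: space_M)
qed

lemma lc_sum: assumes "!!i. i \<in> A ==> lc n (f i)" shows "lc n (%x. \<Sum>i\<in>A. f i x)" unfolding lc_def proof (intro ballI impI sum.cong refl)
 fix x y i assume "x \<in> C" "y \<in> C" "dv x y \<in> W n" "i \<in> A"
 then show "f i x = f i y" using assms[of i] unfolding lc_def by blast
qed

lemma integrable_ind: "integrable M u ==> x \<in> C ==> integrable M (%y. indicator (cl n x) y *\<^sub>R (u y :: complex))" by (intro integrable_mult_indicator cl_sets)

lemma integral_indicator_scaleR: assumes "S \<in> sets M" shows "(\<integral>y. indicator S y *\<^sub>R (c :: complex) \<partial>M) = prob S *\<^sub>R c" proof -
 have "integrable M (indicator S :: 'a => real)" using assms by (intro integrable_real_indicator) (auto simp: emeasure_eq_measure)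
 then show ?thesis using assms sets.Int_space_eq2[OF assms] by (subst integral_scaleR_left) simp_all
qed

lemma E_lc: "lc n (E n u)" using cl_eq_iff unfolding lc_def E_def by metis

lemma P_lc: "lc n (P n u)" unfolding P_def using lc_comp2[OF E_lc[of n u] lc_mono[OF E_lc[of "n - 1" u]], of "(-)"] by (cases "n = 0") (use E_lc[of n u] in auto)

lemmas E_L2 = lc_L2[OF E_lc] and P_L2 = lc_L2[OF P_lc]

lemma E_cong_AE: assumes "integrable M u" "integrable M w" "AE x in M. u x = w x" "x \<in> C" shows "E n u x = E n w x" proof -
 have "(\<integral>y. indicator (cl n x) y *\<^sub>R u y \<partial>M) = (\<integral>y. indicator (cl n x) y *\<^sub>R w y \<partial>M)" proof (rule integral_cong_AE)
  show "AE y in M. indicator (cl n x) y *\<^sub>R u y = indicator (cl n x) y *\<^sub>R w y" using assms(3) by auto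
 qed (use integrable_ind[OF assms(1,4)] integrable_ind[OF assms(2,4)] in auto)
 then show ?thesis by (simp add: E_def)
qed

lemma E_cong: assumes "!!y. y \<in> C ==> u y = w y" shows "E n u x = E n w x" proof -
 have "(\<integral>y. indicator (cl n x) y *\<^sub>R u y \<partial>M) = (\<integral>y. indicator (cl n x) y *\<^sub>R w y \<partial>M)"
  by (rule integral_cong_space) (use assms in \<open>auto simp: space_M\<close>)
 then show ?thesis by (simp add: E_def)
qed

lemma E_add: "integrable M u ==> integrable M w ==> x \<in> C ==> E n (%y. u y + w y) x = E n u x + E n w x" using integrable_ind[of u x n] integrable_ind[of w x n]
 by (simp add: E_def scaleR_add_right distrib_left)

lemma E_diff: "integrable M u ==> integrable M w ==> x \<in> C ==> E n (%y. u y - w y) x = E n u x - E n w x" using integrable_ind[of u x n] integrable_ind[of w x n]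
 by (simp add: E_def scaleR_diff_right right_diff_distrib)

lemma E_scale: "E n (%y. c * u y) x = c * E n u x" proof -
 have "(\<integral>y. indicator (cl n x) y *\<^sub>R (c * u y) \<partial>M) = (\<integral>y. c * (indicator (cl n x) y *\<^sub>R u y) \<partial>M)"
  by (simp only: mult_scaleR_right)
 also have "... = c * (\<integral>y. indicator (cl n x) y *\<^sub>R u y \<partial>M)" by (rule integral_mult_right_zero)
 finally show ?thesis by (simp add: E_def mult.left_commute)
qed

lemma E_sum: assumes "!!i. i \<in> A ==> integrable M (f i)" "x \<in> C" shows "E n (%y. \<Sum>i\<in>A. f i y) x = (\<Sum>i\<in>A. E n (f i) x)" using assms(1)
proof (induction A rule: infinite_finite_induct)
 case (insert i A)
 have "integrable M (%y. \<Sum>i\<in>A. f i y)" using insert.prems by (intro Bochner_Integration.integrable_sum) auto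
 then show ?case using insert E_add[of "f i" "%y. \<Sum>i\<in>A. f i y" x n] assms(2) by simp
qed (simp_all add: E_def)

lemma E_id: assumes "lc m u" "m <= n" "x \<in> C" shows "E n u x = u x" proof -
 have "(\<integral>y. indicator (cl n x) y *\<^sub>R u y \<partial>M) = (\<integral>y. indicator (cl n x) y *\<^sub>R u x \<partial>M)"
  using lc_cl[OF lc_mono[OF assms(1,2)] assms(3)] by (intro integral_cong_space) (auto simp: indicator_def)
 also have "... = prob (cl n x) *\<^sub>R u x" by (rule integral_indicator_scaleR[OF cl_sets[OF assms(3)]])
 finally show ?thesis using prob_cl[OF assms(3), of n] N_pos[of n] by (simp add: E_def scaleR_conv_of_real)
qed

lemma cl_partition:
 fixes f :: "'a set => 'c::real_vector" assumes "m <= n" "x \<in> C" "y \<in> C"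
 shows "indicator (cl m x) y *\<^sub>R f (cl n y) = (\<Sum>S\<in>{S \<in> cls n. S <= cl m x}. indicator S y *\<^sub>R f S)" proof (cases "y \<in> cl m x")
 case True
 have "cl m y = cl m x" using cl_eq[OF assms(2) True] .
 then have sub: "cl n y <= cl m x" using cl_antimono[OF assms(1), of y] by simp
 have "(\<Sum>S\<in>{S \<in> cls n. S <= cl m x}. indicator S y *\<^sub>R f S)
   = (\<Sum>S\<in>{S \<in> cls n. S <= cl m x}. if S = cl n y then f S else 0)" using cls_cover[OF assms(3), of _ n] by (intro sum.cong) (auto simp: indicator_def)
 also have "... = f (cl n y)" using sub assms(3) finite_cls[of n] by (simp add: sum.delta)
 finally show ?thesis using True by simp
next
 case False
 then have "(\<Sum>S\<in>{S \<in> cls n. S <= cl m x}. indicator S y *\<^sub>R f S) = 0" by (intro sum.neutral) (auto simp: indicator_def)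
 then show ?thesis using False by simp
qed

text \<open>A coset of \<open>W m\<close> is the disjoint union of the cosets of \<open>W n\<close>
  inside it; over each of these the averaged function has the same integral as
  \<open>u\<close>.\<close>

lemma E_tower: assumes "integrable M u" "m <= n" "x \<in> C" shows "E m (E n u) x = E m u x" proof -
 let ?F = "{S \<in> cls n. S <= cl m x}"
 have fin: "finite ?F" using finite_cls by simp
 have E_rep: "E n u (rep S) = of_nat (N n) * (\<integral>y. indicator S y *\<^sub>R u y \<partial>M)" if "S \<in> ?F" for S using rep_cl(3)[of S n] that by (simp add: E_def)
 have S1: "prob S = 1 / real (N n)" if "S \<in> ?F" for S using that prob_cl by auto
 have "(\<integral>y. indicator (cl m x) y *\<^sub>R E n u y \<partial>M) = (\<integral>y. (\<Sum>S\<in>?F. indicator S y *\<^sub>R E n u (rep S)) \<partial>M)"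
 proof (rule integral_cong_space[OF refl])
  fix y assume "y \<in> space M"
  then have y: "y \<in> C" by (simp add: space_M)
  then have S: "cl n y \<in> cls n" by simp
  have "E n u y = E n u (rep (cl n y))" using lc_cl[OF E_lc y] rep_cl(1)[OF S] by simp
  then show "indicator (cl m x) y *\<^sub>R E n u y = (\<Sum>S\<in>?F. indicator S y *\<^sub>R E n u (rep S))"
   using cl_partition[OF assms(2,3) y, of "%S. E n u (rep S)"] by simp
 qed
 also have "... = (\<Sum>S\<in>?F. (\<integral>y. indicator S y *\<^sub>R E n u (rep S) \<partial>M))"
  using cls_sets by (intro Bochner_Integration.integral_sum) (auto intro!: integrable_mult_indicator)
 also have "... = (\<Sum>S\<in>?F. (\<integral>y. indicator S y *\<^sub>R u y \<partial>M))" proof (rule sum.cong[OF refl])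
  fix S assume S: "S \<in> ?F"
  have "(\<integral>y. indicator S y *\<^sub>R E n u (rep S) \<partial>M) = prob S *\<^sub>R E n u (rep S)" using S cls_sets by (intro integral_indicator_scaleR) auto
  then show "(\<integral>y. indicator S y *\<^sub>R E n u (rep S) \<partial>M) = (\<integral>y. indicator S y *\<^sub>R u y \<partial>M)"
   unfolding E_rep[OF S] S1[OF S] using N_pos[of n] by (simp add: scaleR_conv_of_real)
 qed
 also have "... = (\<integral>y. (\<Sum>S\<in>?F. indicator S y *\<^sub>R u y) \<partial>M)"
  using cls_sets assms(1) by (intro Bochner_Integration.integral_sum[symmetric]) (auto intro!: integrable_mult_indicator)
 also have "... = (\<integral>y. indicator (cl m x) y *\<^sub>R u y \<partial>M)" proof (rule integral_cong_space[OF refl])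
  fix y assume "y \<in> space M"
  then have y: "y \<in> C" by (simp add: space_M)
  show "(\<Sum>S\<in>?F. indicator S y *\<^sub>R u y) = indicator (cl m x) y *\<^sub>R u y" using cl_partition[OF assms(2,3) y, of "%_. u y"] by simp
 qed
 finally show ?thesis by (simp add: E_def)
qed

lemma E_E: assumes "integrable M u" "x \<in> C" shows "E m (E n u) x = E (min m n) u x"
 using E_tower[OF assms(1) _ assms(2)] E_id[OF E_lc[of n u] _ assms(2), of m] by (cases "m <= n") (auto simp: min_def)

text \<open>The expression on the right is Hermitian in \<open>u\<close> and \<open>w\<close>, which
  is how selfadjointness of \<open>E n\<close> is obtained.\<close>

lemma l2_inner_E_expand: assumes u: "u \<in> L2 M" and w: "w \<in> L2 M"
 shows "l2_inner M (E n u) w = (\<Sum>S\<in>cls n. of_nat (N n) * (\<integral>y. indicator S y *\<^sub>R u y \<partial>M) * cnj (\<integral>y. indicator S y *\<^sub>R w y \<partial>M))"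
proof -
 have "l2_inner M (E n u) w = (\<integral>y. (\<Sum>S\<in>cls n. E n u (rep S) * cnj (indicator S y *\<^sub>R w y)) \<partial>M)" unfolding l2_inner_def
 proof (rule integral_cong_space[OF refl])
  fix y assume "y \<in> space M"
  then have "E n u y = (\<Sum>S\<in>cls n. indicator S y *\<^sub>R E n u (rep S))" using lc_expand[OF E_lc] by (simp add: space_M)
  then have "E n u y * cnj (w y) = (\<Sum>S\<in>cls n. indicator S y *\<^sub>R E n u (rep S)) * cnj (w y)" by simp
  also have "... = (\<Sum>S\<in>cls n. E n u (rep S) * cnj (indicator S y *\<^sub>R w y))" unfolding sum_distrib_right by (intro sum.cong refl) (simp add: indicator_def)
  finally show "E n u y * cnj (w y) = (\<Sum>S\<in>cls n. E n u (rep S) * cnj (indicator S y *\<^sub>R w y))" .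
 qed
 also have "... = (\<Sum>S\<in>cls n. (\<integral>y. E n u (rep S) * cnj (indicator S y *\<^sub>R w y) \<partial>M))" using L2_integrable[OF w] cls_sets
  by (intro Bochner_Integration.integral_sum integrable_mult_right integrable_cnj integrable_mult_indicator)
 also have "... = (\<Sum>S\<in>cls n. of_nat (N n) * (\<integral>y. indicator S y *\<^sub>R u y \<partial>M) * cnj (\<integral>y. indicator S y *\<^sub>R w y \<partial>M))"
 proof (rule sum.cong[OF refl])
  fix S assume S: "S \<in> cls n"
  have "(\<integral>y. E n u (rep S) * cnj (indicator S y *\<^sub>R w y) \<partial>M) = E n u (rep S) * (\<integral>y. cnj (indicator S y *\<^sub>R w y) \<partial>M)"
   by (rule integral_mult_right_zero)
  also have "(\<integral>y. cnj (indicator S y *\<^sub>R w y) \<partial>M) = cnj (\<integral>y. indicator S y *\<^sub>R w y \<partial>M)"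
   by (rule Bochner_Integration.integral_cnj)
  finally show "(\<integral>y. E n u (rep S) * cnj (indicator S y *\<^sub>R w y) \<partial>M) =
    of_nat (N n) * (\<integral>y. indicator S y *\<^sub>R u y \<partial>M) * cnj (\<integral>y. indicator S y *\<^sub>R w y \<partial>M)"
   using rep_cl(3)[OF S] by (simp add: E_def)
 qed
 finally show ?thesis .
qed

lemma E_selfadjoint: assumes u: "u \<in> L2 M" and w: "w \<in> L2 M" shows "l2_inner M (E n u) w = l2_inner M u (E n w)" proof -
 have "l2_inner M u (E n w) = cnj (l2_inner M (E n w) u)" by (rule l2_inner_sym)
 then show ?thesis unfolding l2_inner_E_expand[OF u w] l2_inner_E_expand[OF w u] by (simp add: mult_ac)
qed

lemma E_idem_inner: assumes u: "u \<in> L2 M" and w: "w \<in> L2 M" shows "l2_inner M (E n u) (E n w) = l2_inner M (E n u) w" proof -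
 have "l2_inner M (E n u) (E n w) = l2_inner M (E n (E n u)) w" using E_selfadjoint[OF E_L2 w, of n n u] by simp
 also have "... = l2_inner M (E n u) w" using E_id[OF E_lc] by (intro l2_inner_cong) (auto simp: space_M)
 finally show ?thesis .
qed

lemma E_contract: assumes u: "u \<in> L2 M" shows "nrm (E n u) <= nrm u" proof -
 have "(nrm (E n u))^2 = cmod (l2_inner M (E n u) (E n u))" unfolding l2_inner_self by (simp add: norm_power)
 also have "... = cmod (l2_inner M (E n u) u)" unfolding E_idem_inner[OF u u] ..
 also have "... <= nrm (E n u) * nrm u" by (rule l2_cauchy_schwarz[OF E_L2 u])
 finally show ?thesis using l2_norm_nonneg[of M "E n u"] l2_norm_nonneg[of M u] by (cases "nrm (E n u) = 0") (auto simp: power2_eq_square mult_le_cancel_left)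
qed

lemma E_L2_diff: "u \<in> L2 M ==> w \<in> L2 M ==> x \<in> C ==> E n (%y. u y - w y) x = E n u x - E n w x" by (intro E_diff L2_integrable)

lemma P_diff: "u \<in> L2 M ==> w \<in> L2 M ==> x \<in> C ==> P n (%y. u y - w y) x = P n u x - P n w x" by (auto simp: P_def E_L2_diff)

lemma P_add: "u \<in> L2 M ==> w \<in> L2 M ==> x \<in> C ==> P n (%y. u y + w y) x = P n u x + P n w x" by (auto simp: P_def E_add L2_integrable)

lemma P_scale: "P n (%y. c * u y) x = c * P n u x" by (auto simp: P_def E_scale right_diff_distrib)

lemma P_cong: "(!!y. y \<in> C ==> u y = w y) ==> P n u x = P n w x" proof -
 assume "!!y. y \<in> C ==> u y = w y"
 then have "E k u x = E k w x" for k by (rule E_cong)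
 then show ?thesis by (simp add: P_def)
qed

lemma P_cong_AE: "u \<in> L2 M ==> w \<in> L2 M ==> AE x in M. u x = w x ==> x \<in> C ==> P n u x = P n w x"
 using E_cong_AE[OF L2_integrable L2_integrable, of u w x] unfolding P_def by simp

lemma E_sum_P: "E n u x = (\<Sum>k\<le>n. P k u x)" by (induction n) (auto simp: P_def)

lemma P_P: assumes "u \<in> L2 M" "x \<in> C" shows "P m (P n u) x = (if m = n then P n u x else 0)" proof -
 have EP: "E k (P n u) x = E (min k n) u x - (if n = 0 then 0 else E (min k (n - 1)) u x)" for k proof (cases "n = 0")
  case True
  then have "E k (P n u) x = E k (E n u) x" by (intro E_cong) (simp add: P_def)
  then show ?thesis using True E_E[OF L2_integrable[OF assms(1)] assms(2)] by simp
 next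
  case False
  then have "E k (P n u) x = E k (%y. E n u y - E (n - 1) u y) x" by (intro E_cong) (simp add: P_def)
  then show ?thesis using False E_L2_diff[OF E_L2 E_L2 assms(2)] E_E[OF L2_integrable[OF assms(1)] assms(2)] by simp
 qed
 show ?thesis proof (cases m n rule: linorder_cases)
  case less
  then have "min m n = m" "min m (n - 1) = m" "min (m - 1) n = m - 1" "min (m - 1) (n - 1) = m - 1" "n ~= 0" by auto
  then show ?thesis using less by (simp add: P_def[of m "P n u" x] EP)
 next
  case equal
  have "min n (n - 1) = n - 1" "min (n - 1) n = n - 1" by auto
  then show ?thesis using equal by (simp add: P_def[of n "P n u" x] P_def[of n u x] EP)
 next
  case greater
  then have "min m n = n" "min m (n - 1) = n - 1" "min (m - 1) n = n" "min (m - 1) (n - 1) = n - 1" "m ~= 0" by auto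
  then show ?thesis using greater by (simp add: P_def[of m "P n u" x] EP)
 qed
qed

lemma E_Suc_orthogonal: assumes u: "u \<in> L2 M" shows "(nrm (E (Suc n) u))^2 = (nrm (E n u))^2 + (nrm (P (Suc n) u))^2" proof -
 have "l2_inner M (E n u) (P (Suc n) u) = l2_inner M (E n u) (E n (P (Suc n) u))" using E_idem_inner[OF u P_L2] by simp
 also have "... = l2_inner M (E n u) (%_. 0)" proof (rule l2_inner_cong)
  fix x assume "x \<in> space M"
  then have x: "x \<in> C" by (simp add: space_M)
  have "E n (P (Suc n) u) x = (\<Sum>k\<le>n. P k (P (Suc n) u) x)" by (rule E_sum_P)
  also have "... = 0" by (rule sum.neutral) (use P_P[OF u x] in auto)
  finally show "E n (P (Suc n) u) x = 0" .
 qed simp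
 also have "... = 0" by (simp add: l2_inner_def)
 finally have orth: "l2_inner M (E n u) (P (Suc n) u) = 0" .
 have "nrm (E (Suc n) u) = nrm (%x. E n u x + P (Suc n) u x)" by (simp add: P_def)
 then show ?thesis using l2_norm_add_sq[OF E_L2 P_L2, of n u "Suc n" u] orth by simp
qed

lemma E_parseval: assumes u: "u \<in> L2 M" shows "(nrm (E n u))^2 = (\<Sum>k\<le>n. (nrm (P k u))^2)" proof (induction n)
 case 0
 have "P 0 u = E 0 u" by (rule ext) (simp add: P_def)
 then show ?case by simp
next
 case (Suc n) then show ?case using E_Suc_orthogonal[OF u, of n] by simp
qed

lemma E_pos: assumes u: "integrable M u" and "x \<in> C" shows "cmod (E n u x) <= Re (E n (%y. complex_of_real (cmod (u y))) x)"
  "E n (%y. complex_of_real (cmod (u y))) x = complex_of_real (real (N n) * (\<integral>y. indicator (cl n x) y * cmod (u y) \<partial>M))" proof -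
 show eq: "E n (%y. complex_of_real (cmod (u y))) x = complex_of_real (real (N n) * (\<integral>y. indicator (cl n x) y * cmod (u y) \<partial>M))"
  unfolding E_def of_real_mult integral_complex_of_real[symmetric] by (simp add: scaleR_conv_of_real)
 have "cmod (E n u x) = real (N n) * cmod (\<integral>y. indicator (cl n x) y *\<^sub>R u y \<partial>M)" by (simp add: E_def norm_mult)
 also have "... <= real (N n) * (\<integral>y. cmod (indicator (cl n x) y *\<^sub>R u y) \<partial>M)" by (intro mult_left_mono integral_norm_bound) simp
 also have "... = Re (E n (%y. complex_of_real (cmod (u y))) x)" unfolding eq by simp
 finally show "cmod (E n u x) <= Re (E n (%y. complex_of_real (cmod (u y))) x)" .
qed

subsection \<open>Density of the locally constant functions\<close>

definition approximable :: "('a => complex) => bool" where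
 "approximable u \<longleftrightarrow> (ALL \<epsilon>>0. EX n w. lc n w & nrm (%x. u x - w x) < \<epsilon>)"

lemma lc_approximable: "lc n u ==> approximable u" unfolding approximable_def by (intro allI impI exI[of _ n] exI[of _ u]) (simp add: l2_norm_def)

lemma approximable_closed: assumes u: "u \<in> L2 M" and ex: "!!\<epsilon>. \<epsilon> > 0 ==> EX w:L2 M. approximable w & nrm (%x. u x - w x) < \<epsilon>"
 shows "approximable u" unfolding approximable_def proof (intro allI impI)
 fix \<epsilon> :: real assume "0 < \<epsilon>"
 then obtain w where w: "w \<in> L2 M" "approximable w" "nrm (%x. u x - w x) < \<epsilon> / 2" using ex[of "\<epsilon> / 2"] by auto
 then obtain n z where z: "lc n z" "nrm (%x. w x - z x) < \<epsilon> / 2" using \<open>0 < \<epsilon>\<close> unfolding approximable_def by (meson half_gt_zero)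
 have "nrm (%x. u x - z x) < \<epsilon>" using l2_norm_diff_triangle[OF u w(1) lc_L2[OF z(1)]] w(3) z(2) by linarith
 then show "EX n w. lc n w & nrm (%x. u x - w x) < \<epsilon>" using z(1) by blast
qed

lemma approximable_add: assumes u: "u \<in> L2 M" "approximable u" and w: "w \<in> L2 M" "approximable w" shows "approximable (%x. a * u x + b * w x)"
 unfolding approximable_def proof (intro allI impI)
 fix \<epsilon> :: real assume e: "0 < \<epsilon>"
 define \<delta> where "\<delta> = \<epsilon> / (cmod a + cmod b + 1)"
 have pos: "0 < cmod a + cmod b + 1" using norm_ge_zero[of a] norm_ge_zero[of b] by linarith
 have d: "0 < \<delta>" using e pos by (simp add: \<delta>_def)
 obtain n f where f: "lc n f" "nrm (%x. u x - f x) < \<delta>" using u(2) d unfolding approximable_def by blast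
 obtain k g where g: "lc k g" "nrm (%x. w x - g x) < \<delta>" using w(2) d unfolding approximable_def by blast
 have "lc (max n k) (%x. a * f x + b * g x)" by (rule lc_comp2[OF lc_mono[OF f(1)] lc_mono[OF g(1)]]) auto
 moreover have "nrm (%x. (a * u x + b * w x) - (a * f x + b * g x)) < \<epsilon>" proof -
  have "nrm (%x. (a * u x + b * w x) - (a * f x + b * g x)) = nrm (%x. a * (u x - f x) + b * (w x - g x))" by (simp add: algebra_simps)
  also have "... <= nrm (%x. a * (u x - f x)) + nrm (%x. b * (w x - g x))" using u w lc_L2[OF f(1)] lc_L2[OF g(1)] by (intro l2_norm_triangle L2_scale L2_diff)
  also have "... <= cmod a * \<delta> + cmod b * \<delta>" unfolding l2_norm_scale using f(2) g(2) by (intro add_mono mult_left_mono) auto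
  also have "... = (cmod a + cmod b) * \<delta>" by (simp add: distrib_right)
  also have "... < (cmod a + cmod b + 1) * \<delta>" using d by (intro mult_strict_right_mono) auto
  also have "... = \<epsilon>" using pos by (simp add: \<delta>_def)
  finally show ?thesis .
 qed
 ultimately show "EX n w'. lc n w' & nrm (%x. (a * u x + b * w x) - w' x) < \<epsilon>" by blast
qed

lemma indicator_L2: "A \<in> sets M ==> (%x. indicator A x :: complex) \<in> L2 M" by (rule L2_bounded[of _ 1]) (auto simp: indicator_def)

lemma l2_norm_indicator: "A \<in> sets M ==> nrm (indicator A :: 'a => complex) = sqrt (prob A)" proof -
 assume A: "A \<in> sets M"
 have "(\<integral>x. (cmod (indicator A x))^2 \<partial>M) = (\<integral>x. indicator A x \<partial>M)"
  by (intro integral_cong_space) (auto simp: indicator_def)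
 then show ?thesis using A by (simp add: l2_norm_def)
qed

text \<open>Dynkin induction over the intersection-stable generator: indicators of cosets are
  locally constant, complements are differences from the constant 1, and a disjoint union is
  approximated in norm by its finite subunions.\<close>

lemma approximable_indicator: assumes "A \<in> sets M" shows "approximable (indicator A)" proof -
 have "A \<in> sigma_sets C cosets" using assms sets_cosets by simp
 then show ?thesis proof (induction rule: sigma_sets_induct_disjoint[OF Int_stable_cosets cosets_Pow, consumes 1, case_names basic empty compl union])
  case (basic A)
  have "EX n. lc n (indicator A :: 'a => complex)" proof (cases "A = {}")
   case False
   then obtain n x where x: "x \<in> C" "A = cl n x" using basic by (auto simp: cosets_def)
   have "A \<in> cls n" using x by blast
   have mem: "y \<in> A \<longleftrightarrow> z \<in> A" if "y \<in> C" "z \<in> C" "dv y z \<in> W n" for y z proof -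
    note 1 = cls_cover[OF that(1) \<open>A \<in> cls n\<close>] and 2 = cls_cover[OF that(2) \<open>A \<in> cls n\<close>]
    have 3: "cl n y = cl n z" by (rule iffD2[OF cl_eq_iff[OF that(1,2)] that(3)])
    show ?thesis unfolding 1 2 3 ..
   qed
   have "lc n (indicator A :: 'a => complex)" unfolding lc_def indicator_def by (intro ballI impI arg_cong[of _ _ of_bool] mem)
   then show ?thesis ..
  qed (auto simp: lc_def)
  then obtain n where n: "lc n (indicator A :: 'a => complex)" ..
  then show ?case by (rule lc_approximable)
 next
  case empty
  have "lc 0 (indicator {} :: 'a => complex)" by (simp add: lc_def)
  then show ?case by (rule lc_approximable)
 next
  case (compl A)
  have A: "A \<in> sets M" using compl(1) sets_cosets by simp
  have one: "approximable (%_. 1)" by (rule lc_approximable[of 0]) (simp add: lc_def)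
  have "approximable (%x. 1 * 1 + (-1) * indicator A x)" using approximable_add[OF _ one indicator_L2[OF A] compl(2), of 1 "-1"] by (simp add: L2_def)
  moreover have "nrm (%x. indicator (C - A) x - w x) = nrm (%x. 1 * 1 + (-1) * indicator A x - w x)" for w by (rule l2_norm_cong) (auto simp: space_M indicator_def)
  ultimately show ?case by (simp add: approximable_def)
 next
  case (union A)
  have A: "!!i. A i \<in> sets M" using union(2) sets_cosets by auto
  have AU: "(\<Union>i. A i) \<in> sets M" using A by auto
  show ?case proof (rule approximable_closed[OF indicator_L2[OF AU]])
   fix \<epsilon> :: real assume e: "0 < \<epsilon>"
   define B where "B n = (\<Union>i<n. A i)" for n
   have B: "B n \<in> sets M" for n using A by (auto simp: B_def)
   have "(%n. prob (B n)) \<longlonglongrightarrow> prob (\<Union>n. B n)" proof (rule finite_Lim_measure_incseq)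
    show "range B <= events" using B by auto
    show "incseq B" unfolding incseq_def B_def by (intro allI impI UN_mono) auto
   qed
   moreover have "(\<Union>n. B n) = (\<Union>i. A i)" by (auto simp: B_def)
   ultimately have "(%n. prob (B n)) \<longlonglongrightarrow> prob (\<Union>i. A i)" by simp
   from tendsto_diff[OF tendsto_const[of "prob (\<Union>i. A i)"] this]
   have "(%n. prob (\<Union>i. A i) - prob (B n)) \<longlonglongrightarrow> 0" by simp
   from order_tendstoD(2)[OF this, of "\<epsilon>^2"] obtain n where n: "prob (\<Union>i. A i) - prob (B n) < \<epsilon>^2" using e by (auto simp: eventually_sequentially)
   have sub: "B n <= (\<Union>i. A i)" by (auto simp: B_def)
   have "prob ((\<Union>i. A i) - B n) < \<epsilon>^2" using n finite_measure_Diff[OF AU B sub] by simp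
   then have "sqrt (prob ((\<Union>i. A i) - B n)) < \<epsilon>" using e by (metis real_sqrt_less_iff real_sqrt_abs abs_of_pos)
   moreover have "nrm (%x. indicator (\<Union>i. A i) x - indicator (B n) x) = nrm (indicator ((\<Union>i. A i) - B n) :: 'a => complex)"
    using sub by (intro l2_norm_cong) (auto simp: indicator_def)
   moreover have "approximable (indicator (B n))" proof (induction n)
    case 0
    have "lc 0 (indicator {} :: 'a => complex)" by (simp add: lc_def)
    then show ?case unfolding B_def by (intro lc_approximable[of 0]) (simp add: lc_def)
   next
    case (Suc n)
    have "A n Int A i = {}" if "i < n" for i using union(1) that unfolding disjoint_family_on_def by simp
    then have "A n Int B n = {}" by (auto simp: B_def)
    then have "(indicator (B (Suc n)) :: 'a => complex) = (%x. 1 * indicator (B n) x + 1 * indicator (A n) x)" by (auto simp: B_def indicator_def lessThan_Suc fun_eq_iff)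
    then show ?case using approximable_add[OF indicator_L2[OF B[of n]] Suc indicator_L2[OF A[of n]] union(3)[of n], of 1 1] by simp
   qed
   ultimately show "EX w:L2 M. approximable w & nrm (%x. indicator (\<Union>i. A i) x - w x) < \<epsilon>" using indicator_L2[OF B[of n]] AU B
    by (intro bexI[of _ "indicator (B n)"]) (auto simp: l2_norm_indicator)
  qed
 qed
qed

lemma approximable_sum: assumes "!!i. i \<in> A ==> f i \<in> L2 M" "!!i. i \<in> A ==> approximable (f i)" shows "approximable (%x. \<Sum>i\<in>A. f i x)" using assms
proof (induction A rule: infinite_finite_induct)
 case (insert a A)
 have "approximable (%x. 1 * f a x + 1 * (\<Sum>i\<in>A. f i x))" using insert by (intro approximable_add L2_sum) auto
 then show ?case using insert by simp
qed (auto simp: approximable_def lc_def l2_norm_def intro!: exI[of _ "%_. 0"])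

lemma L2_approximable: assumes u: "u \<in> L2 M" shows "approximable u" proof (rule approximable_closed[OF u])
 fix \<epsilon> :: real assume e: "0 < \<epsilon>"
 obtain F where F: "!!i. simple_function M (F i)" "!!x. x \<in> space M ==> (%i. F i x) \<longlonglongrightarrow> u x"
  "!!i x. x \<in> space M ==> dist (F i x) 0 <= 2 * dist (u x) 0" using borel_measurable_implies_sequence_metric[OF L2_measurable[OF u], of 0] by blast
 have Fm: "F i \<in> borel_measurable M" for i using F(1) by (rule borel_measurable_simple_function)
 have bd: "cmod (u x - F i x) <= 3 * cmod (u x)" if "x \<in> space M" for i x using F(3)[OF that, of i] norm_triangle_ineq4[of "u x" "F i x"] by simp
 have "(%i. nrm (%x. u x - F i x)) \<longlonglongrightarrow> 0" by (rule l2_norm_dominated[OF Fm u F(2) bd])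
 from order_tendstoD(2)[OF this e] obtain i where i: "nrm (%x. u x - F i x) < \<epsilon>" by (auto simp: eventually_sequentially)
 have fin: "finite (F i ` space M)" using F(1) by (simp add: simple_function_def)
 define A where "A z = F i -` {z} Int space M" for z
 have A: "A z \<in> sets M" for z unfolding A_def using simple_functionD(2)[OF F(1)] .
 \<comment> \<open>The summand \<open>0 * 0\<close> gives each term the shape
   \<open>a * u x + b * w x\<close> to which \<open>approximable_add\<close> applies.\<close>
 have expand: "F i x = (\<Sum>z\<in>F i ` space M. z * indicator (A z) x + 0 * 0)" if x: "x \<in> space M" for x proof -
  have "(\<Sum>z\<in>F i ` space M. z * indicator (A z) x + 0 * 0) = (\<Sum>z\<in>F i ` space M. if z = F i x then z else 0)"
   using x by (intro sum.cong) (auto simp: A_def indicator_def)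
  also have "... = F i x" using fin x by (simp add: sum.delta')
  finally show ?thesis by simp
 qed
 have zero: "approximable (%_. 0)" by (rule lc_approximable[of 0]) (simp add: lc_def)
 have Aap: "approximable (%x. \<Sum>z\<in>F i ` space M. z * indicator (A z) x + 0 * 0)" using approximable_indicator[OF A] indicator_L2[OF A] zero L2_zero
  by (intro approximable_sum L2_add L2_scale approximable_add) auto
 have AL: "(%x. \<Sum>z\<in>F i ` space M. z * indicator (A z) x + 0 * 0) \<in> L2 M" using indicator_L2[OF A] L2_zero by (intro L2_sum L2_add L2_scale) auto
 have "nrm (%x. u x - F i x) = nrm (%x. u x - (\<Sum>z\<in>F i ` space M. z * indicator (A z) x + 0 * 0))" by (rule l2_norm_cong) (rule arg_cong[OF expand, of _ "%z. _ - z"])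
 then show "EX w:L2 M. approximable w & nrm (%x. u x - w x) < \<epsilon>" using Aap AL i by auto
qed

text \<open>If \<open>w\<close> is constant on the cosets of level \<open>k\<close> and close to
  \<open>u\<close>, then \<open>E n\<close> fixes \<open>w\<close> for \<open>n >= k\<close>, and as
  a contraction it keeps the other half of the error small.\<close>

lemma E_tendsto: assumes u: "u \<in> L2 M" shows "(%n. nrm (%x. u x - E n u x)) \<longlonglongrightarrow> 0" proof (rule LIMSEQ_I)
 fix \<epsilon> :: real assume e: "0 < \<epsilon>"
 then obtain k w where w: "lc k w" "nrm (%x. u x - w x) < \<epsilon> / 2" using L2_approximable[OF u] unfolding approximable_def by (meson half_gt_zero)
 note wL = lc_L2[OF w(1)]
 have "nrm (%x. u x - E n u x) < \<epsilon>" if n: "k <= n" for n proof -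
  have "nrm (%x. w x - E n u x) = nrm (E n (%x. w x - u x))" using E_L2_diff[OF wL u] E_id[OF w(1) n] by (intro l2_norm_cong) (auto simp: space_M)
  also have "... <= nrm (%x. w x - u x)" by (rule E_contract[OF L2_diff[OF wL u]])
  also have "... = nrm (%x. u x - w x)" by (rule l2_norm_diff_commute)
  finally show ?thesis using l2_norm_diff_triangle[OF u wL E_L2, of n u] w(2) by linarith
 qed
 then show "EX n0. ALL n>=n0. norm (nrm (%x. u x - E n u x) - 0) < \<epsilon>" by auto
qed

lemma l2_norm_E_tendsto: assumes u: "u \<in> L2 M" shows "(%n. nrm (E n u)) \<longlonglongrightarrow> nrm u"
proof (rule tendsto_sandwich[of "%n. nrm u - nrm (%x. u x - E n u x)" _ _ "%_. nrm u"])
 show "\<forall>\<^sub>F n in sequentially. nrm u - nrm (%x. u x - E n u x) <= nrm (E n u)"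
  using l2_norm_le_add_diff[OF u E_L2] by (intro always_eventually allI) (simp add: algebra_simps)
 show "(%n. nrm u - nrm (%x. u x - E n u x)) \<longlonglongrightarrow> nrm u" using tendsto_diff[OF tendsto_const E_tendsto[OF u], of "nrm u"] by simp
qed (use E_contract[OF u] in auto)

text \<open>By Parseval the squared norm of a truncation is the sum over its components, so a
  pointwise bound on components bounds the norm. Contractivity of the semigroup, resolvent bounds
  and uniqueness of components all come from this comparison.\<close>

lemma l2_norm_P_le: assumes g: "g \<in> L2 M" and w: "w \<in> L2 M" and c: "0 <= c" and le: "!!n x. x \<in> C ==> cmod (P n g x) <= c * cmod (P n w x)"
 shows "nrm g <= c * nrm w" proof (rule LIMSEQ_le_const2[OF l2_norm_E_tendsto[OF g]], intro exI allI impI)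
 fix n :: nat
 have k: "nrm (P k g) <= c * nrm (P k w)" for k proof -
  have "nrm (P k g) <= nrm (%x. complex_of_real c * P k w x)" using le c by (intro l2_norm_mono P_L2 L2_scale AE_I2) (auto simp: space_M norm_mult)
  then show ?thesis using c by (simp add: l2_norm_scale)
 qed
 have "(nrm (E n g))^2 <= (\<Sum>k\<le>n. (c * nrm (P k w))^2)" unfolding E_parseval[OF g] using k by (intro sum_mono power_mono) auto
 also have "... = (c * nrm (E n w))^2" unfolding power_mult_distrib E_parseval[OF w] sum_distrib_left ..
 finally have "nrm (E n g) <= c * nrm (E n w)" using c by (intro power2_le_imp_le[of "nrm (E n g)"]) auto
 also have "... <= c * nrm w" using c E_contract[OF w] by (intro mult_left_mono)
 finally show "nrm (E n g) <= c * nrm w" .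
qed

lemma P_determines: assumes u: "u \<in> L2 M" and w: "w \<in> L2 M" and eq: "!!n x. x \<in> C ==> P n u x = P n w x" shows "AE x in M. u x = w x"
proof (rule l2_norm_diff_0[OF u w])
 have "nrm (%x. u x - w x) <= 0 * nrm w" using eq by (intro l2_norm_P_le L2_diff u w) (auto simp: P_diff[OF u w])
 then show "nrm (%x. u x - w x) = 0" by (simp add: order_antisym)
qed

subsection \<open>Multipliers\<close>

lemma E_bound: assumes u: "u \<in> L2 M" and x: "x \<in> C" shows "cmod (E n u x) <= real (N n) * nrm u" proof -
 have "(\<integral>y. indicator (cl n x) y *\<^sub>R u y \<partial>M) = l2_inner M u (indicator (cl n x))"
  unfolding l2_inner_def by (intro integral_cong_space) (auto simp: indicator_def)
 then have "cmod (\<integral>y. indicator (cl n x) y *\<^sub>R u y \<partial>M) <= nrm u * nrm (indicator (cl n x) :: 'a => complex)"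
  using l2_cauchy_schwarz[OF u indicator_L2[OF cl_sets[OF x, of n]]] by simp
 also have "... <= nrm u * 1" using l2_norm_indicator[OF cl_sets[OF x, of n]] by (intro mult_left_mono) auto
 finally show ?thesis by (simp add: E_def norm_mult mult_left_mono)
qed

text \<open>Point evaluations of components are continuous in the norm, because cosets have positive
  mass. Identities between components therefore pass to norm limits without any choice of
  subsequences.\<close>

lemma P_bound: assumes u: "u \<in> L2 M" and x: "x \<in> C" shows "cmod (P n u x) <= 2 * real (N n) * nrm u" proof (cases "n = 0")
 case True
 have "real (N n) * nrm u <= 2 * real (N n) * nrm u" by (simp add: mult_right_mono)
 moreover have eq: "P n u x = E n u x" using True by (simp add: P_def)
 ultimately show ?thesis unfolding eq using E_bound[OF u x, of n] by (meson order_trans)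
next
 case False
 have "cmod (P n u x) <= cmod (E n u x) + cmod (E (n - 1) u x)" using False by (simp add: P_def norm_triangle_ineq4)
 also have "... <= real (N n) * nrm u + real (N (n - 1)) * nrm u" by (intro add_mono E_bound u x)
 also have "... <= real (N n) * nrm u + real (N n) * nrm u" using N_le[of "n - 1" n] by (intro add_left_mono mult_right_mono) auto
 finally show ?thesis by (simp add: algebra_simps)
qed

lemma lc_AE_zero: fixes z :: "'a => complex" assumes "lc n z" "AE x in M. z x = 0" "x \<in> C" shows "z x = 0" proof -
 have "z x = E n z x" using E_id[OF assms(1) order_refl assms(3)] by simp
 also have "... = E n (%_. 0) x" using assms by (intro E_cong_AE L2_integrable lc_L2[OF assms(1)] L2_zero) auto
 finally show ?thesis by (simp add: E_def)
qed

lemma P_selfadjoint: assumes u: "u \<in> L2 M" and w: "w \<in> L2 M" shows "l2_inner M (P n u) w = l2_inner M u (P n w)" proof (cases "n = 0")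
 case True
 then have "P n u = E n u" "P n w = E n w" by (auto simp: P_def fun_eq_iff)
 then show ?thesis using E_selfadjoint[OF u w] by simp
next
 case False
 then have "P n u = (%x. E n u x - E (n - 1) u x)" "P n w = (%x. E n w x - E (n - 1) w x)" by (auto simp: P_def fun_eq_iff)
 then show ?thesis using E_selfadjoint[OF u w] l2_inner_diff_left[OF E_L2 E_L2 w] l2_inner_diff_right[OF u E_L2 E_L2] by simp
qed

lemma E_abs_integral: assumes u: "u \<in> L2 M" shows "(\<integral>x. cmod (E n u x) \<partial>M) <= nrm u" proof -
 let ?f = "%x. complex_of_real (cmod (E n u x))"
 have f: "?f \<in> L2 M" by (rule L2_cmod[OF E_L2])
 have one: "(%_. 1) \<in> L2 M" by (simp add: L2_def)
 have "complex_of_real (\<integral>x. cmod (E n u x) \<partial>M) = l2_inner M ?f (%_. 1)" by (simp add: l2_inner_def)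
 then have "\<bar>\<integral>x. cmod (E n u x) \<partial>M\<bar> = cmod (l2_inner M ?f (%_. 1))" by (metis norm_of_real)
 also have "... <= nrm ?f * nrm (%_. 1)" by (rule l2_cauchy_schwarz[OF f one])
 also have "... = nrm (E n u)" by (simp add: l2_norm_def prob_space)
 also have "... <= nrm u" by (rule E_contract[OF u])
 finally show ?thesis by simp
qed

text \<open>The sum is taken pointwise; for absolutely summable \<open>b\<close> it converges off a
  null set, and the value of \<open>suminf\<close> elsewhere does not change the class in
  \<open>L2\<close>.\<close>

definition series :: "(nat => complex) => ('a => complex) => 'a => complex" where
 "series b u x = (\<Sum>n. b n * E n u x)"

text \<open>The integral of the modulus of \<open>E n u\<close> is at most the norm of
  \<open>u\<close>, so with summable coefficients the sum of the moduli has a finite integral and is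
  finite almost everywhere.\<close>

lemma series_AE_summable: assumes b: "summable (%n. cmod (b n))" and u: "u \<in> L2 M" shows "AE x in M. summable (%n. cmod (b n * E n u x))" proof -
 have int: "integrable M (%x. cmod (b n * E n u x))" for n using L2_integrable[OF E_L2] by (intro integrable_norm integrable_mult_right)
 have "(\<integral>\<^sup>+x. (\<Sum>n. ennreal (cmod (b n * E n u x))) \<partial>M) = (\<Sum>n. \<integral>\<^sup>+x. ennreal (cmod (b n * E n u x)) \<partial>M)"
  using borel_measurable_integrable[OF int] by (intro nn_integral_suminf) auto
 also have "... = (\<Sum>n. ennreal (\<integral>x. cmod (b n * E n u x) \<partial>M))" using int by (intro suminf_cong nn_integral_eq_integral) auto
 also have "... <= (\<Sum>n. ennreal (cmod (b n) * nrm u))" using E_abs_integral[OF u] by (intro suminf_le ennreal_leI) (auto simp: norm_mult intro: mult_left_mono)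
 also have "... = ennreal (\<Sum>n. cmod (b n) * nrm u)" using summable_mult2[OF b] by (intro suminf_ennreal2) auto
 finally have "(\<integral>\<^sup>+x. (\<Sum>n. ennreal (cmod (b n * E n u x))) \<partial>M) ~= \<infinity>" by (auto simp: top_unique)
 moreover have "(%x. \<Sum>n. ennreal (cmod (b n * E n u x))) \<in> borel_measurable M" using borel_measurable_integrable[OF int] by (intro borel_measurable_suminf_order) auto
 ultimately have "AE x in M. (\<Sum>n. ennreal (cmod (b n * E n u x))) ~= \<infinity>" by (intro nn_integral_PInf_AE)
 then show ?thesis by eventually_elim (auto intro!: summable_suminf_not_top)
qed

lemma series_AE_sums: assumes b: "summable (%n. cmod (b n))" and u: "u \<in> L2 M" shows "AE x in M. (%n. b n * E n u x) sums series b u x"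
 using series_AE_summable[OF assms] by eventually_elim (auto simp: series_def intro: summable_sums summable_norm_cancel)

lemma series_measurable: "series b u \<in> borel_measurable M"
 unfolding series_def[abs_def] using lc_measurable[OF E_lc] by (intro borel_measurable_suminf borel_measurable_times) auto

text \<open>Fatou's lemma for the partial sums, whose norms are bounded by the triangle inequality
  and contractivity of \<open>E n\<close>.\<close>

lemma series_L2: assumes b: "summable (%n. cmod (b n))" and u: "u \<in> L2 M" shows "series b u \<in> L2 M" "nrm (series b u) <= (\<Sum>n. cmod (b n)) * nrm u" proof -
 let ?B = "\<Sum>n. cmod (b n)"
 define S where "S k x = (\<Sum>n<k. b n * E n u x)" for k x
 have SL: "S k \<in> L2 M" for k unfolding S_def[abs_def] by (intro L2_sum L2_scale E_L2)
 have Sn: "nrm (S k) <= ?B * nrm u" for k proof -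
  have "nrm (S k) <= (\<Sum>n<k. nrm (%x. b n * E n u x))" unfolding S_def[abs_def] by (intro l2_norm_sum L2_scale E_L2)
  also have "... <= (\<Sum>n<k. cmod (b n) * nrm u)" unfolding l2_norm_scale using E_contract[OF u] by (intro sum_mono mult_left_mono) auto
  also have "... = (\<Sum>n<k. cmod (b n)) * nrm u" by (simp add: sum_distrib_right)
  also have "... <= ?B * nrm u" using b by (intro mult_right_mono sum_le_suminf) auto
  finally show ?thesis .
 qed
 have nn: "(\<integral>\<^sup>+x. ennreal ((cmod (S k x))^2) \<partial>M) <= ennreal ((?B * nrm u)^2)" for k proof -
  have "(\<integral>\<^sup>+x. ennreal ((cmod (S k x))^2) \<partial>M) = ennreal ((nrm (S k))^2)"
   unfolding l2_norm_sq using L2_square[OF SL] by (intro nn_integral_eq_integral) auto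
  also have "... <= ennreal ((?B * nrm u)^2)" using Sn by (intro ennreal_leI power_mono) auto
  finally show ?thesis .
 qed
 have "(\<integral>\<^sup>+x. ennreal ((cmod (series b u x))^2) \<partial>M) = (\<integral>\<^sup>+x. liminf (%k. ennreal ((cmod (S k x))^2)) \<partial>M)"
 proof (rule nn_integral_cong_AE)
  show "AE x in M. ennreal ((cmod (series b u x))^2) = liminf (%k. ennreal ((cmod (S k x))^2))" using series_AE_sums[OF b u] proof eventually_elim
   fix x assume "(%n. b n * E n u x) sums series b u x"
   then have "(%k. S k x) \<longlonglongrightarrow> series b u x" by (simp add: sums_def S_def)
   then have "(%k. ennreal ((cmod (S k x))^2)) \<longlonglongrightarrow> ennreal ((cmod (series b u x))^2)" by (intro tendsto_ennrealI tendsto_power tendsto_norm)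
   from lim_imp_Liminf[OF trivial_limit_sequentially this]
   show "ennreal ((cmod (series b u x))^2) = liminf (%k. ennreal ((cmod (S k x))^2))" by simp
  qed
 qed
 also have "... <= liminf (%k. \<integral>\<^sup>+x. ennreal ((cmod (S k x))^2) \<partial>M)" using L2_measurable[OF SL] by (intro nn_integral_liminf) measurable
 also have "... <= ennreal ((?B * nrm u)^2)" by (rule order_trans[OF Liminf_le_Limsup[OF trivial_limit_sequentially]], rule Limsup_bounded)
   (use nn in auto)
 finally have le: "(\<integral>\<^sup>+x. ennreal ((cmod (series b u x))^2) \<partial>M) <= ennreal ((?B * nrm u)^2)" .
 have int: "integrable M (%x. (cmod (series b u x))^2)" proof (rule integrableI_bounded)
  show "(%x. (cmod (series b u x))^2) \<in> borel_measurable M" using series_measurable[of b u] by measurable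
  show "(\<integral>\<^sup>+x. ennreal (norm ((cmod (series b u x))^2)) \<partial>M) < \<infinity>" using le by (simp add: order_le_less_trans)
 qed
 then show "series b u \<in> L2 M" using series_measurable by (simp add: L2_def)
 have "ennreal ((nrm (series b u))^2) <= ennreal ((?B * nrm u)^2)" unfolding l2_norm_sq using le nn_integral_eq_integral[OF int] by simp
 then have "(nrm (series b u))^2 <= (?B * nrm u)^2" by simp
 then show "nrm (series b u) <= ?B * nrm u" by (rule power2_le_imp_le) (intro mult_nonneg_nonneg suminf_nonneg b, auto)
qed

lemma E_series_sums: assumes b: "summable (%n. cmod (b n))" and u: "u \<in> L2 M" and x: "x \<in> C" shows "(%n. b n * E (min m n) u x) sums E m (series b u) x" proof -
 let ?f = "%n y. b n * (indicator (cl m x) y *\<^sub>R E n u y)"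
 have int: "integrable M (?f n)" for n by (intro integrable_mult_right integrable_ind L2_integrable E_L2 x)
 have le: "norm (?f n y) <= cmod (b n * E n u y)" for n y by (auto simp: indicator_def norm_mult)
 have sm: "AE y in M. summable (%n. norm (?f n y))" using series_AE_summable[OF b u] proof eventually_elim
  fix y assume *: "summable (%n. cmod (b n * E n u y))"
  show "summable (%n. norm (?f n y))" by (rule summable_comparison_test'[OF *, of 0]) (use le in simp)
 qed
 have sm2: "summable (%n. \<integral>y. norm (?f n y) \<partial>M)" proof (rule summable_comparison_test'[OF summable_mult2[OF b, of "nrm u"], of 0])
  fix n
  have "(\<integral>y. norm (?f n y) \<partial>M) <= (\<integral>y. cmod (b n * E n u y) \<partial>M)"
   by (rule integral_mono[OF integrable_norm[OF int] integrable_norm[OF integrable_mult_right[OF L2_integrable[OF E_L2]]]])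
    (rule le)
  also have "... <= cmod (b n) * nrm u" using E_abs_integral[OF u, of n] by (simp add: norm_mult mult_left_mono)
  finally show "norm (\<integral>y. norm (?f n y) \<partial>M) <= cmod (b n) * nrm u" by simp
 qed
 have "(%n. \<integral>y. ?f n y \<partial>M) sums (\<integral>y. (\<Sum>n. ?f n y) \<partial>M)" by (rule sums_integral[OF int sm sm2])
 also have "(\<integral>y. (\<Sum>n. ?f n y) \<partial>M) = (\<integral>y. indicator (cl m x) y *\<^sub>R series b u y \<partial>M)" proof -
  have "(\<Sum>n. ?f n y) = indicator (cl m x) y *\<^sub>R series b u y" for y by (auto simp: indicator_def series_def)
  then show ?thesis by simp
 qed
 finally have "(%n. of_nat (N m) * (\<integral>y. ?f n y \<partial>M)) sums E m (series b u) x" unfolding E_def by (rule sums_mult)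
 moreover have "of_nat (N m) * (\<integral>y. ?f n y \<partial>M) = b n * E (min m n) u x" for n proof -
  have "of_nat (N m) * (\<integral>y. ?f n y \<partial>M) = b n * E m (E n u) x" unfolding E_def[of m] by (subst integral_mult_right_zero) (simp add: mult.left_commute)
  then show ?thesis using E_E[OF L2_integrable[OF u] x] by simp
 qed
 ultimately show ?thesis by simp
qed

text \<open>What Abel summation needs: the sum of \<open>a n\<close> times \<open>P n\<close>
  becomes that of \<open>a n - a (Suc n)\<close> times \<open>E n\<close>, which converges
  absolutely, and convergence of \<open>a\<close> to 0 removes the boundary term.\<close>

definition admissible :: "(nat => complex) => bool" where
 "admissible a \<longleftrightarrow> a \<longlonglongrightarrow> 0 & summable (%n. cmod (a n - a (Suc n)))"

definition mult_op :: "(nat => complex) => ('a => complex) => 'a => complex" where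
 "mult_op a = series (%n. a n - a (Suc n))"

lemma mult_op_L2: "admissible a ==> u \<in> L2 M ==> mult_op a u \<in> L2 M" unfolding mult_op_def admissible_def by (intro series_L2) auto

text \<open>\<open>P m\<close> annihilates the terms with \<open>n < m\<close> and turns each
  \<open>E n u\<close> with \<open>n >= m\<close> into \<open>P m u\<close>; the remaining
  differences telescope to \<open>a m\<close>.\<close>

lemma P_mult_op: assumes a: "admissible a" and u: "u \<in> L2 M" and x: "x \<in> C" shows "P m (mult_op a u) x = a m * P m u x" proof -
 let ?b = "%n. a n - a (Suc n)"
 have b: "summable (%n. cmod (?b n))" and a0: "a \<longlonglongrightarrow> 0" using a by (auto simp: admissible_def)
 have tail: "(%n. ?b (n + m)) sums a m" using telescope_sums'[OF LIMSEQ_ignore_initial_segment[OF a0, of m]] by simp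
 have "(%n. ?b n * (if n < m then 0 else P m u x)) sums P m (mult_op a u) x" proof (cases "m = 0")
  case True
  then show ?thesis using E_series_sums[OF b u x, of 0] by (simp add: P_def mult_op_def)
 next
  case False
  have "(%n. ?b n * E (min m n) u x - ?b n * E (min (m - 1) n) u x) sums P m (mult_op a u) x"
   using sums_diff[OF E_series_sums[OF b u x, of m] E_series_sums[OF b u x, of "m - 1"]] False by (simp add: P_def mult_op_def)
  moreover have "?b n * E (min m n) u x - ?b n * E (min (m - 1) n) u x = ?b n * (if n < m then 0 else P m u x)" for n proof (cases "n < m")
   case True
   then have "min m n = n" "min (m - 1) n = n" using False by auto
   then show ?thesis using True by simp
  next
   case ge: False
   then have "min m n = m" "min (m - 1) n = m - 1" by auto
   then show ?thesis using False ge by (simp add: P_def right_diff_distrib)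
  qed
  ultimately show ?thesis by simp
 qed
 moreover have "(%n. ?b n * (if n < m then 0 else P m u x)) sums (a m * P m u x)" proof -
  have "(%n. ?b (n + m) * (if n + m < m then 0 else P m u x)) sums (a m * P m u x)" using sums_mult2[OF tail, of "P m u x"] by simp
  then have "(%n. ?b n * (if n < m then 0 else P m u x)) sums (a m * P m u x + (\<Sum>n<m. ?b n * (if n < m then 0 else P m u x)))" by (subst (asm) sums_iff_shift)
  then show ?thesis by simp
 qed
 ultimately show ?thesis by (rule sums_unique2)
qed

end

section \<open>The operator as a multiplier on the components\<close>

text \<open>The kernel is prescribed level by level and is thereby left free at the unit, a null
  set. Summability of the reciprocals is the growth condition that later yields the resolvents as
  absolutely convergent series.\<close>

locale spectral_chain = subgroup_chain +
 fixes \<phi> :: "nat => real" and F :: "'a => real"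
 assumes \<phi>_0: "\<phi> 0 = 0" and \<phi>_strict: "strict_mono \<phi>" and \<phi>_summable: "summable (%n. 1 / \<phi> (Suc n))"
  and F_level: "y \<in> W l - W (Suc l) ==> F y = (\<Sum>n\<le>l. (\<phi> n - \<phi> (Suc n)) * real (N n))"
begin

lemma \<phi>_pos: "0 < n ==> 0 < \<phi> n" using strict_monoD[OF \<phi>_strict, of 0 n] \<phi>_0 by simp

lemma \<phi>_nonneg: "0 <= \<phi> n" using \<phi>_pos[of n] \<phi>_0 by (cases "n = 0") auto

lemma \<phi>_less: "m < n ==> \<phi> m < \<phi> n" using strict_monoD[OF \<phi>_strict] .

lemma \<phi>_inj: "\<phi> m = \<phi> n \<longleftrightarrow> m = n" using strict_mono_eq[OF \<phi>_strict] .

lemma \<phi>_at_top: "filterlim \<phi> at_top sequentially" proof -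
 have "(%n. 1 / \<phi> (Suc n)) \<longlonglongrightarrow> 0" by (rule summable_LIMSEQ_zero[OF \<phi>_summable])
 then have "filterlim (%n. inverse (\<phi> (Suc n))) (at_right 0) sequentially" unfolding filterlim_at by (auto simp: inverse_eq_divide \<phi>_pos less_imp_neq[symmetric])
 then have "filterlim (%n. inverse (inverse (\<phi> (Suc n)))) at_top sequentially" by (rule filterlim_compose[OF filterlim_inverse_at_top_right])
 then have "filterlim (%n. \<phi> (Suc n)) at_top sequentially" by simp
 then show ?thesis by (rule filterlim_sequentially_Suc[THEN iffD1])
qed

definition Dop :: "('a => complex) => 'a => complex" where
 "Dop u x = (\<integral>y. complex_of_real (F y) * (u (dv x y) - u x) \<partial>M)"

text \<open>The map \<open>dv x\<close> preserves the measure and exchanges \<open>W n\<close> with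
  the coset of \<open>x\<close>; the average thereby becomes a convolution with the uniform
  distribution on \<open>W n\<close>.\<close>

lemma E_dv: assumes u: "u \<in> borel_measurable M" and x: "x \<in> C" shows "E n u x = of_nat (N n) * (\<integral>y. indicator (W n) y *\<^sub>R u (dv x y) \<partial>M)"
proof -
 have "(\<integral>y. indicator (cl n x) y *\<^sub>R u y \<partial>M) = (\<integral>y. indicator (cl n x) y *\<^sub>R u y \<partial>(distr M M (dv x)))"
  by (simp add: dv_left[OF x])
 also have "... = (\<integral>y. indicator (cl n x) (dv x y) *\<^sub>R u (dv x y) \<partial>M)"
  using u cl_sets[OF x, of n] by (intro integral_distr dv_left[OF x] borel_measurable_scaleR borel_measurable_indicator)
 also have "... = (\<integral>y. indicator (W n) y *\<^sub>R u (dv x y) \<partial>M)"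
  using x by (intro integral_cong_space) (auto simp: space_M cl_def dv_dv_left indicator_def)
 finally show ?thesis by (simp add: E_def)
qed

lemma W_sets: "W n \<in> sets M" and prob_W: "prob (W n) = 1 / real (N n)" proof -
 have "W n = cl n \<one>" using W_dv_commute[of \<one> _ n] W_closed[of _ n] by (auto simp: cl_def)
 then show "W n \<in> sets M" "prob (W n) = 1 / real (N n)" using cl_sets prob_cl one_closed by simp_all
qed

text \<open>Summation by parts: the term at the lower end vanishes because
  \<open>\<phi> 0 = 0\<close>, the one at the upper end because the partial sums are measured from
  the full sum up to \<open>l\<close>.\<close>

lemma abel_sum:
 fixes p :: "nat => complex"
 shows "(\<Sum>n<l. complex_of_real (\<phi> n - \<phi> (Suc n)) * ((\<Sum>k\<le>n. p k) - (\<Sum>k\<le>l. p k))) = (\<Sum>k\<le>l. complex_of_real (\<phi> k) * p k)"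
proof (induction l)
 case 0
 then show ?case by (simp add: \<phi>_0)
next
 case (Suc l)
 let ?d = "%n. complex_of_real (\<phi> n - \<phi> (Suc n))" and ?e = "%n. \<Sum>k\<le>n. p k"
 have tel: "(\<Sum>n<Suc l. ?d n) = - complex_of_real (\<phi> (Suc l))" unfolding of_real_sum[symmetric] sum_lessThan_telescope' by (simp add: \<phi>_0)
 have "(\<Sum>n<Suc l. ?d n * (?e n - ?e (Suc l))) = (\<Sum>n<Suc l. ?d n * (?e n - ?e l)) - (\<Sum>n<Suc l. ?d n) * p (Suc l)"
  unfolding sum_distrib_right sum_subtractf[symmetric] by (intro sum.cong refl) (simp add: algebra_simps)
 also have "(\<Sum>n<Suc l. ?d n * (?e n - ?e l)) = (\<Sum>k\<le>l. complex_of_real (\<phi> k) * p k)" using Suc by simp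
 finally show ?case unfolding tel by simp
qed

text \<open>Off the unit \<open>F\<close> is the sum of \<open>\<phi> n - \<phi> (Suc n)\<close>
  times \<open>N n\<close> times the indicator of \<open>W n\<close>. For \<open>u\<close> constant
  on cosets of \<open>W l\<close> the terms from \<open>l\<close> on do not contribute, each
  remaining one gives \<open>E n u x - u x\<close>, and Abel summation diagonalizes the
  result.\<close>

lemma Dop_eq: assumes u: "lc l u" and x: "x \<in> C" shows "Dop u x = (\<Sum>k\<le>l. complex_of_real (\<phi> k) * P k u x)" proof -
 let ?d = "%n. complex_of_real (\<phi> n - \<phi> (Suc n))"
 have um: "u \<in> borel_measurable M" by (rule lc_measurable[OF u])
 have lcx: "lc l (%y. u (dv x y))" proof -
  have "u (dv x y) = u (dv x z)" if "y \<in> C" "z \<in> C" "dv y z \<in> W l" for y z proof -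
   have "dv (dv x y) (dv x z) \<in> W l" using that x W_dv_commute[of y z l] by (simp add: dv_dv_dv)
   then show ?thesis using that x by (intro lcD[OF u]) auto
  qed
  then show ?thesis unfolding lc_def by blast
 qed
 have int1: "integrable M (%y. indicator (W n) y *\<^sub>R u (dv x y))" for n by (intro integrable_mult_indicator W_sets L2_integrable lc_L2[OF lcx])
 have int2: "integrable M (%y. indicator (W n) y *\<^sub>R u x)" for n by (intro integrable_mult_indicator W_sets) simp
 have pt: "complex_of_real (F y) * (u (dv x y) - u x) =
   (\<Sum>n<l. ?d n * of_nat (N n) * (indicator (W n) y *\<^sub>R u (dv x y) - indicator (W n) y *\<^sub>R u x))" if y: "y \<in> C" for y proof (cases "y \<in> W l")
  case True
  \<comment> \<open>On \<open>W l\<close> the difference of values of \<open>u\<close> vanishes.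
    This covers the unit, where \<open>F\<close> is not prescribed.\<close>
  have "dv x (dv x y) \<in> W l" using x y True by (simp add: dv_dv_left)
  then have "u x = u (dv x y)" using x y by (intro lcD[OF u]) auto
  then show ?thesis by simp
 next
  case False
  then have "y ~= \<one>" by auto
  then obtain j where j: "y \<in> W j - W (Suc j)" using level_exists[OF y] by blast
  have jl: "j < l" using j False W_antimono[of l j] by (meson DiffE not_le subsetD)
  have ind: "y \<in> W n \<longleftrightarrow> n <= j" for n using j W_antimono[of n j] W_antimono[of "Suc j" n] by (meson DiffE not_less_eq_eq subsetD)
  have "(\<Sum>n<l. ?d n * of_nat (N n) * (indicator (W n) y *\<^sub>R u (dv x y) - indicator (W n) y *\<^sub>R u x))
    = (\<Sum>n<l. if n \<in> {..j} then ?d n * of_nat (N n) * (u (dv x y) - u x) else 0)" by (intro sum.cong refl) (auto simp: ind indicator_def)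
  also have "... = (\<Sum>n\<in>{..<l} Int {..j}. ?d n * of_nat (N n) * (u (dv x y) - u x))" by (rule sum.inter_restrict[symmetric]) simp
  also have "{..<l} Int {..j} = {..j}" using jl by auto
  also have "(\<Sum>n\<le>j. ?d n * of_nat (N n) * (u (dv x y) - u x)) = complex_of_real (F y) * (u (dv x y) - u x)" unfolding F_level[OF j] by (simp add: sum_distrib_right)
  finally show ?thesis by simp
 qed
 have "Dop u x = (\<integral>y. (\<Sum>n<l. ?d n * of_nat (N n) * (indicator (W n) y *\<^sub>R u (dv x y) - indicator (W n) y *\<^sub>R u x)) \<partial>M)"
  unfolding Dop_def by (intro integral_cong_space refl pt) (simp add: space_M)
 also have "... = (\<Sum>n<l. \<integral>y. ?d n * of_nat (N n) * (indicator (W n) y *\<^sub>R u (dv x y) - indicator (W n) y *\<^sub>R u x) \<partial>M)"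
  using int1 int2 by (intro Bochner_Integration.integral_sum integrable_mult_right Bochner_Integration.integrable_diff)
 also have "... = (\<Sum>n<l. ?d n * ((\<Sum>k\<le>n. P k u x) - (\<Sum>k\<le>l. P k u x)))" proof (intro sum.cong refl)
  fix n
  have "of_nat (N n) * (\<integral>y. indicator (W n) y *\<^sub>R u (dv x y) - indicator (W n) y *\<^sub>R u x \<partial>M) = E n u x - u x"
   using int1[of n] int2[of n] integral_indicator_scaleR[OF W_sets, of n "u x"] prob_W[of n] N_pos[of n] E_dv[OF um x, of n]
   by (simp add: right_diff_distrib scaleR_conv_of_real)
  also have "... = (\<Sum>k\<le>n. P k u x) - (\<Sum>k\<le>l. P k u x)" using E_id[OF u order_refl x] E_sum_P[of n u x] E_sum_P[of l u x] by simp
  finally show "(\<integral>y. ?d n * of_nat (N n) * (indicator (W n) y *\<^sub>R u (dv x y) - indicator (W n) y *\<^sub>R u x) \<partial>M)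
    = ?d n * ((\<Sum>k\<le>n. P k u x) - (\<Sum>k\<le>l. P k u x))" by (subst integral_mult_right_zero) (simp only: mult.assoc)
 qed
 also have "... = (\<Sum>k\<le>l. complex_of_real (\<phi> k) * P k u x)" by (rule abel_sum)
 finally show ?thesis .
qed

definition Dg :: "'a op_graph" where
 "Dg = {(u, w). (EX l. lc l u) & (ALL x:C. w x = Dop u x)}"

text \<open>The maximal operator that acts on the \<open>n\<close>-th component as
  \<open>\<phi> n\<close>. Equations at every point are meaningful for classes in \<open>L2\<close>,
  since the components are integrals and do not see null sets.\<close>

definition A :: "'a op_graph" where
 "A = {(u, w). u \<in> L2 M & w \<in> L2 M & (ALL n. ALL x:C. P n w x = complex_of_real (\<phi> n) * P n u x)}"

lemma A_I: "u \<in> L2 M ==> w \<in> L2 M ==> (!!n x. x \<in> C ==> P n w x = complex_of_real (\<phi> n) * P n u x) ==> (u, w) \<in> A" by (simp add: A_def)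

lemma A_D: assumes "(u, w) \<in> A" shows "u \<in> L2 M" "w \<in> L2 M" "x \<in> C ==> P n w x = complex_of_real (\<phi> n) * P n u x" using assms by (auto simp: A_def)

lemma P_lc_zero: assumes u: "lc l u" and "l < n" "x \<in> C" shows "P n u x = 0" using E_id[OF u, of n x] E_id[OF u, of "n - 1" x] assms(2,3) by (auto simp: P_def)

lemma Dg_lc: assumes "(u, w) \<in> Dg" obtains l where "lc l u" "lc l w" "!!x. x \<in> C ==> w x = (\<Sum>k\<le>l. complex_of_real (\<phi> k) * P k u x)" proof -
 obtain l where l: "lc l u" using assms by (auto simp: Dg_def)
 have eq: "w x = (\<Sum>k\<le>l. complex_of_real (\<phi> k) * P k u x)" if "x \<in> C" for x using assms Dop_eq[OF l that] that by (auto simp: Dg_def)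
 have "lc l (%x. \<Sum>k\<le>l. complex_of_real (\<phi> k) * P k u x)" by (intro lc_sum lc_comp[of l _ "%z. _ * z"] lc_mono[OF P_lc]) auto
 then have "lc l w" by (rule lc_cong) (use eq in simp)
 then show ?thesis using that l eq by blast
qed

lemma Dg_A: assumes "(u, w) \<in> Dg" shows "(u, w) \<in> A" proof -
 obtain l where l: "lc l u" "lc l w" "!!x. x \<in> C ==> w x = (\<Sum>k\<le>l. complex_of_real (\<phi> k) * P k u x)" using Dg_lc[OF assms] by blast
 note uL = lc_L2[OF l(1)]
 show ?thesis proof (rule A_I[OF uL lc_L2[OF l(2)]])
  fix n x assume x: "x \<in> C"
  have "P n w x = P n (%x. \<Sum>k\<le>l. complex_of_real (\<phi> k) * P k u x) x" by (rule P_cong) (rule l(3))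
  also have "... = (\<Sum>k\<le>l. P n (%x. complex_of_real (\<phi> k) * P k u x) x)" proof -
   have "integrable M (%x. complex_of_real (\<phi> k) * P k u x)" for k by (intro integrable_mult_right L2_integrable[OF P_L2])
   then show ?thesis by (simp add: P_def[of n] E_sum[OF _ x] sum_subtractf)
  qed
  also have "... = (\<Sum>k\<le>l. if k = n then complex_of_real (\<phi> n) * P n u x else 0)" by (intro sum.cong refl) (auto simp: P_scale P_P[OF uL x])
  also have "... = complex_of_real (\<phi> n) * P n u x" using P_lc_zero[OF l(1) _ x, of n] by (auto simp: sum.delta)
  finally show "P n w x = complex_of_real (\<phi> n) * P n u x" .
 qed
qed

lemma P_E: assumes "u \<in> L2 M" "x \<in> C" shows "P k (E n u) x = (if k <= n then P k u x else 0)" proof (cases "k <= n")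
 case True
 then have "min k n = k" "min (k - 1) n = k - 1" by auto
 then show ?thesis using True by (simp add: P_def E_E[OF L2_integrable[OF assms(1)] assms(2)])
next
 case False
 then have "min k n = n" "min (k - 1) n = n" "k ~= 0" by auto
 then show ?thesis using False by (simp add: P_def E_E[OF L2_integrable[OF assms(1)] assms(2)])
qed

lemma E_in_Dg: assumes "(u, w) \<in> A" shows "(E n u, E n w) \<in> Dg" proof -
 note a = A_D[OF assms]
 have "E n w x = Dop (E n u) x" if x: "x \<in> C" for x unfolding Dop_eq[OF E_lc x] E_sum_P[of n w x] using a(3)[OF x] P_E[OF a(1) x] by simp
 then show ?thesis using E_lc by (auto simp: Dg_def)
qed

text \<open>Component identities are preserved by norm limits thanks to \<open>P_bound\<close>, so
  the closure lies in \<open>A\<close>. Conversely the truncations \<open>E n u\<close> and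
  \<open>E n w\<close> of a pair in \<open>A\<close> form pairs in the graph converging to
  it.\<close>

lemma closure_Dg: "op_closure M Dg = A" proof (intro equalityI subrelI)
 fix u w assume uw: "(u, w) \<in> op_closure M Dg"
 then have L: "u \<in> L2 M" "w \<in> L2 M" by (auto simp: op_closure_def)
 show "(u, w) \<in> A" proof (rule A_I[OF L])
  fix n x assume x: "x \<in> C"
  let ?c = "2 * real (N n) * (1 + \<phi> n)"
  have "cmod (P n w x - complex_of_real (\<phi> n) * P n u x) <= ?c * \<epsilon>" if e: "0 < \<epsilon>" for \<epsilon> proof -
   obtain u' w' where *: "(u', w') \<in> Dg" "nrm (%x. u x - u' x) < \<epsilon>" "nrm (%x. w x - w' x) < \<epsilon>" using uw e unfolding op_closure_def by blast
   note a = A_D[OF Dg_A[OF *(1)]]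
   have "P n w x - complex_of_real (\<phi> n) * P n u x
     = P n (%x. w x - w' x) x - complex_of_real (\<phi> n) * P n (%x. u x - u' x) x"
    using a(3)[OF x] by (simp add: P_diff[OF L(1) a(1) x] P_diff[OF L(2) a(2) x] algebra_simps)
   also have "cmod ... <= cmod (P n (%x. w x - w' x) x) + \<phi> n * cmod (P n (%x. u x - u' x) x)"
    by (rule order_trans[OF norm_triangle_ineq4]) (simp add: norm_mult \<phi>_nonneg)
   also have "... <= 2 * real (N n) * \<epsilon> + \<phi> n * (2 * real (N n) * \<epsilon>)" proof (intro add_mono mult_left_mono \<phi>_nonneg)
    show "cmod (P n (%x. w x - w' x) x) <= 2 * real (N n) * \<epsilon>"
     by (rule order_trans[OF P_bound[OF L2_diff[OF L(2) a(2)] x]]) (use *(3) in \<open>auto intro: mult_left_mono\<close>)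
    show "cmod (P n (%x. u x - u' x) x) <= 2 * real (N n) * \<epsilon>"
     by (rule order_trans[OF P_bound[OF L2_diff[OF L(1) a(1)] x]]) (use *(2) in \<open>auto intro: mult_left_mono\<close>)
   qed
   finally show ?thesis by (simp add: algebra_simps)
  qed
  moreover have c: "0 < ?c" using \<phi>_nonneg[of n] N_pos[of n] by (intro mult_pos_pos) auto
  ultimately have bd: "!!\<epsilon>. 0 < \<epsilon> ==> cmod (P n w x - complex_of_real (\<phi> n) * P n u x) <= ?c * \<epsilon>" by blast
  have "cmod (P n w x - complex_of_real (\<phi> n) * P n u x) <= 0" proof (rule field_le_epsilon)
   fix e :: real assume "0 < e"
   then have "cmod (P n w x - complex_of_real (\<phi> n) * P n u x) <= ?c * (e / ?c)" using c by (intro bd divide_pos_pos)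
   also have "?c * (e / ?c) = e" using c by (metis less_irrefl nonzero_mult_div_cancel_left times_divide_eq_right)
   finally show "cmod (P n w x - complex_of_real (\<phi> n) * P n u x) <= 0 + e" by simp
  qed
  then show "P n w x = complex_of_real (\<phi> n) * P n u x" by simp
 qed
next
 fix u w assume uw: "(u, w) \<in> A"
 note a = A_D[OF uw]
 have "EX (u', w'):Dg. nrm (%x. u x - u' x) < \<epsilon> & nrm (%x. w x - w' x) < \<epsilon>" if e: "0 < \<epsilon>" for \<epsilon> proof -
  have "\<forall>\<^sub>F n in sequentially. nrm (%x. u x - E n u x) < \<epsilon> & nrm (%x. w x - E n w x) < \<epsilon>"
   using order_tendstoD(2)[OF E_tendsto[OF a(1)] e] order_tendstoD(2)[OF E_tendsto[OF a(2)] e] by eventually_elim simp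
  then obtain n where "nrm (%x. u x - E n u x) < \<epsilon> & nrm (%x. w x - E n w x) < \<epsilon>" by (auto simp: eventually_sequentially)
  then show ?thesis using E_in_Dg[OF uw, of n] by blast
 qed
 then show "(u, w) \<in> op_closure M Dg" using a by (auto simp: op_closure_def)
qed

lemma A_linear: assumes "(u, w) \<in> A" "(u', w') \<in> A" shows "((%x. a * u x + b * u' x), (%x. a * w x + b * w' x)) \<in> A" proof (rule A_I)
 note h = A_D[OF assms(1)] A_D[OF assms(2)]
 show "(%x. a * u x + b * u' x) \<in> L2 M" "(%x. a * w x + b * w' x) \<in> L2 M" using h by (auto intro: L2_add L2_scale)
 fix n x assume x: "x \<in> C"
 have add: "P n (%x. a * f x + b * g x) x = a * P n f x + b * P n g x" if "f \<in> L2 M" "g \<in> L2 M" for f g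
  using P_add[OF L2_scale[OF that(1)] L2_scale[OF that(2)] x] by (simp add: P_scale)
 show "P n (%x. a * w x + b * w' x) x = complex_of_real (\<phi> n) * P n (%x. a * u x + b * u' x) x"
  unfolding add[OF h(1,4)] add[OF h(2,5)] using h(3)[OF x] h(6)[OF x] by (simp add: algebra_simps)
qed

lemma A_single_valued: assumes "(u, w) \<in> A" "(u', w') \<in> A" "AE x in M. u x = u' x" shows "AE x in M. w x = w' x" proof (rule P_determines)
 note h = A_D[OF assms(1)] A_D[OF assms(2)]
 show "w \<in> L2 M" "w' \<in> L2 M" using h by auto
 show "P n w x = P n w' x" if "x \<in> C" for n x using h(3)[OF that] h(6)[OF that] P_cong_AE[OF h(1,4) assms(3) that] by simp
qed

lemma Dg_dense: assumes f: "f \<in> L2 M" and e: "\<epsilon> > 0" shows "EX (u, w):Dg. nrm (%x. f x - u x) < \<epsilon>" proof -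
 obtain n u where "lc n u" "nrm (%x. f x - u x) < \<epsilon>" using L2_approximable[OF f] e unfolding approximable_def by blast
 then show ?thesis by (intro bexI[of _ "(u, Dop u)"]) (auto simp: Dg_def)
qed

lemma Dg_linear: assumes "(u, w) \<in> Dg" "(u', w') \<in> Dg" shows "((%x. a * u x + b * u' x), (%x. a * w x + b * w' x)) \<in> Dg" proof -
 obtain l where l: "lc l u" using assms(1) by (auto simp: Dg_def)
 obtain l' where l': "lc l' u'" using assms(2) by (auto simp: Dg_def)
 let ?k = "max l l'"
 have k: "lc ?k u" "lc ?k u'" "lc ?k (%x. a * u x + b * u' x)" using lc_mono[OF l, of ?k] lc_mono[OF l', of ?k] lc_comp2[of ?k u u' "%s t. a * s + b * t"] by auto
 have "a * w x + b * w' x = Dop (%x. a * u x + b * u' x) x" if x: "x \<in> C" for x proof -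
  have "P n (%x. a * u x + b * u' x) x = a * P n u x + b * P n u' x" for n using P_add[OF L2_scale[OF lc_L2[OF k(1)]] L2_scale[OF lc_L2[OF k(2)]] x] by (simp add: P_scale)
  then have "Dop (%x. a * u x + b * u' x) x = a * Dop u x + b * Dop u' x" unfolding Dop_eq[OF k(1) x] Dop_eq[OF k(2) x] Dop_eq[OF k(3) x]
   by (simp add: sum_distrib_left sum.distrib algebra_simps)
  then show ?thesis using assms x by (auto simp: Dg_def)
 qed
 then show ?thesis using k(3) by (auto simp: Dg_def)
qed

lemma densely_defined_Dg: "densely_defined_operator M Dg" unfolding densely_defined_operator_def proof (intro conjI)
 show "Dg <= L2 M \<times> L2 M" using Dg_A by (auto simp: A_def)
 show "ALL (u, w):Dg. ALL (u', w'):Dg. (AE x in M. u x = u' x) --> (AE x in M. w x = w' x)" using A_single_valued[OF Dg_A Dg_A] by blast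
qed (use Dg_linear Dg_dense in \<open>auto\<close>)

lemma densely_defined_A: "densely_defined_operator M A" unfolding densely_defined_operator_def proof (intro conjI)
 show "A <= L2 M \<times> L2 M" by (auto simp: A_def)
 show "ALL f:L2 M. ALL \<epsilon>>0. EX (u, w):A. nrm (%x. f x - u x) < \<epsilon>" using Dg_dense Dg_A by (metis (no_types, lifting) case_prodE case_prodI2 old.prod.case)
 show "ALL (u, w):A. ALL (u', w'):A. (AE x in M. u x = u' x) --> (AE x in M. w x = w' x)" using A_single_valued by blast
qed (use A_linear in \<open>auto\<close>)

lemma inner_E_tendsto: assumes u: "u \<in> L2 M" and w: "w \<in> L2 M" shows "(%n. l2_inner M (E n u) w) \<longlonglongrightarrow> l2_inner M u w" proof (rule LIMSEQ_I)
 fix \<epsilon> :: real assume e: "0 < \<epsilon>"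
 have "(%n. nrm (%x. u x - E n u x) * nrm w) \<longlonglongrightarrow> 0" using tendsto_mult_right[OF E_tendsto[OF u], of "nrm w"] by simp
 from order_tendstoD(2)[OF this e] obtain n0 where n0: "ALL n>=n0. nrm (%x. u x - E n u x) * nrm w < \<epsilon>" by (auto simp: eventually_sequentially)
 have "norm (l2_inner M (E n u) w - l2_inner M u w) <= nrm (%x. u x - E n u x) * nrm w" for n proof -
  have "norm (l2_inner M (E n u) w - l2_inner M u w) = cmod (l2_inner M (%x. u x - E n u x) w)" unfolding l2_inner_diff_left[OF u E_L2 w] by (rule norm_minus_commute)
  also have "... <= nrm (%x. u x - E n u x) * nrm w" by (rule l2_cauchy_schwarz[OF L2_diff[OF u E_L2] w])
  finally show ?thesis .
 qed
 then show "EX n0. ALL n>=n0. norm (l2_inner M (E n u) w - l2_inner M u w) < \<epsilon>" using n0 by (meson order_le_less_trans)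
qed

lemma inner_E_sum: assumes u: "u \<in> L2 M" and w: "w \<in> L2 M" shows "l2_inner M (E n u) w = (\<Sum>k\<le>n. l2_inner M (P k u) w)" proof (induction n)
 case 0
 have "P 0 u = E 0 u" by (rule ext) (simp add: P_def)
 then show ?case by simp
next
 case (Suc n)
 have "l2_inner M (E (Suc n) u) w = l2_inner M (%x. E n u x + P (Suc n) u x) w" by (rule l2_inner_cong) (auto simp: P_def)
 then show ?case using Suc l2_inner_add_left[OF E_L2 P_L2 w] by simp
qed

lemma A_symmetric: assumes "(u, w) \<in> A" "(u', w') \<in> A" shows "l2_inner M w u' = l2_inner M u w'" proof -
 note h = A_D[OF assms(1)] A_D[OF assms(2)]
 have k: "l2_inner M (P k w) u' = l2_inner M (P k u) w'" for k proof -
  have "l2_inner M (P k w) u' = l2_inner M (%x. complex_of_real (\<phi> k) * P k u x) u'" by (rule l2_inner_cong) (use h(3) in \<open>auto simp: space_M\<close>)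
  also have "... = complex_of_real (\<phi> k) * l2_inner M u (P k u')" unfolding l2_inner_scale_left P_selfadjoint[OF h(1,4)] ..
  also have "... = l2_inner M u (%x. complex_of_real (\<phi> k) * P k u' x)" unfolding l2_inner_scale_right by simp
  also have "... = l2_inner M u (P k w')" by (rule l2_inner_cong) (use h(6) in \<open>auto simp: space_M\<close>)
  also have "... = l2_inner M (P k u) w'" unfolding P_selfadjoint[OF h(1,5)] ..
  finally show ?thesis .
 qed
 have "(%n. l2_inner M (E n w) u') = (%n. l2_inner M (E n u) w')" unfolding inner_E_sum[OF h(2,4)] inner_E_sum[OF h(1,5)] k ..
 then show ?thesis using inner_E_tendsto[OF h(2,4)] inner_E_tendsto[OF h(1,5)] LIMSEQ_unique by metis
qed

lemma P_in_A: assumes "h \<in> L2 M" shows "(P n h, %x. complex_of_real (\<phi> n) * P n h x) \<in> A"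
 by (rule A_I[OF P_L2 L2_scale[OF P_L2]]) (simp add: P_scale P_P[OF assms])

text \<open>Testing against the range of \<open>P n\<close>, which lies in the domain, suffices: the
  test function is the defect of the component equation itself, so that its own norm is found to be
  zero.\<close>

lemma adjoint_A: "op_adjoint M A = A" proof (intro equalityI subrelI)
 fix f g assume fg: "(f, g) \<in> op_adjoint M A"
 then have L: "f \<in> L2 M" "g \<in> L2 M" and adj: "!!u w. (u, w) \<in> A ==> l2_inner M w f = l2_inner M u g" by (auto simp: op_adjoint_def)
 show "(f, g) \<in> A" proof (rule A_I[OF L])
  fix n x assume x: "x \<in> C"
  let ?z = "%x. complex_of_real (\<phi> n) * P n f x - P n g x"
  have zlc: "lc n ?z" by (rule lc_comp2[OF P_lc P_lc])
  note zL = lc_L2[OF zlc]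
  have "complex_of_real (\<phi> n) * l2_inner M (P n ?z) f = l2_inner M (P n ?z) g" using adj[OF P_in_A[OF zL]] by (simp add: l2_inner_scale_left)
  then have "complex_of_real (\<phi> n) * l2_inner M ?z (P n f) = l2_inner M ?z (P n g)" unfolding P_selfadjoint[OF zL L(1)] P_selfadjoint[OF zL L(2)] .
  then have "l2_inner M ?z ?z = 0" unfolding l2_inner_diff_right[OF zL L2_scale[OF P_L2] P_L2] by (simp add: l2_inner_scale_right)
  then have "nrm ?z = 0" unfolding l2_inner_self by simp
  then have "AE x in M. ?z x = 0" using l2_norm_eq_0[OF zL] by simp
  then have "?z x = 0" by (rule lc_AE_zero[OF zlc _ x])
  then show "P n g x = complex_of_real (\<phi> n) * P n f x" by simp
 qed
next
 fix f g assume "(f, g) \<in> A"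
 then show "(f, g) \<in> op_adjoint M A" using A_symmetric A_D by (auto simp: op_adjoint_def)
qed

theorem essentially_selfadjoint_Dg: "essentially_selfadjoint M Dg" unfolding essentially_selfadjoint_def selfadjoint_def closure_Dg
 using densely_defined_Dg densely_defined_A adjoint_A A_symmetric[OF Dg_A Dg_A] by auto

end

context subgroup_chain
begin

subsection \<open>Characters\<close>

text \<open>Triviality on \<open>W n\<close> makes these homomorphisms locally constant and hence
  continuous; \<open>V_ann_eq\<close> identifies the set with the annihilator in the dual.\<close>

definition ann :: "nat => ('a => complex) set" where
 "ann n = {\<theta> \<in> extensional C. (ALL x:C. cmod (\<theta> x) = 1) &
  (ALL x:C. ALL y:C. \<theta> (x \<otimes> y) = \<theta> x * \<theta> y) & (ALL x:W n. \<theta> x = 1)}"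

definition new_chars :: "nat => ('a => complex) set" where
 "new_chars n = ann n - (if n = 0 then {} else ann (n - 1))"

lemma ann_mult: "\<theta> \<in> ann n ==> x \<in> C ==> y \<in> C ==> \<theta> (x \<otimes> y) = \<theta> x * \<theta> y" by (simp add: ann_def)

lemma ann_lc: assumes "\<theta> \<in> ann n" shows "lc n \<theta>" unfolding lc_def proof (intro ballI impI)
 fix x y assume xy: "x \<in> C" "y \<in> C" "dv x y \<in> W n"
 have "dv x y \<otimes> y = x" using dv_mult_dv[of x y \<one>] xy by simp
 then have "\<theta> x = \<theta> (dv x y) * \<theta> y" using ann_mult[OF assms dv_closed[OF xy(1,2)] xy(2)] by simp
 then show "\<theta> x = \<theta> y" using assms xy(3) by (simp add: ann_def)
qed

text \<open>Translation by \<open>w\<close> maps each coset of \<open>W m\<close> to itself and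
  multiplies the average of the character by \<open>\<theta> w\<close>, which is not 1.\<close>

lemma E_char: assumes \<theta>: "\<theta> \<in> ann n" and w: "w \<in> W m" "\<theta> w ~= 1" and x: "x \<in> C" shows "E m \<theta> x = 0" proof -
 have wC: "w \<in> C" using W_closed[OF w(1)] .
 have trans: "E m \<theta> (w \<otimes> x) = \<theta> w * E m \<theta> x" proof -
  have "(\<integral>y. indicator (cl m (w \<otimes> x)) y *\<^sub>R \<theta> y \<partial>M) = (\<integral>y. indicator (cl m (w \<otimes> x)) y *\<^sub>R \<theta> y \<partial>(distr M M (%y. dv y (inv w))))"
   using dv_right(2)[OF inv_closed[OF wC]] by simp
  also have "... = (\<integral>y. indicator (cl m (w \<otimes> x)) (dv y (inv w)) *\<^sub>R \<theta> (dv y (inv w)) \<partial>M)"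
   using lc_measurable[OF ann_lc[OF \<theta>]] cl_sets[of "w \<otimes> x" m] wC x by (intro integral_distr dv_right borel_measurable_scaleR borel_measurable_indicator) auto
  also have "... = (\<integral>y. \<theta> w * (indicator (cl m x) y *\<^sub>R \<theta> y) \<partial>M)" proof (rule integral_cong_space[OF refl])
   fix y assume "y \<in> space M"
   then have y: "y \<in> C" by (simp add: space_M)
   have "dv y (inv w) = w \<otimes> y" using y wC by (simp add: dv_def m_comm)
   moreover have "dv (w \<otimes> x) (w \<otimes> y) = dv x y" using dv_dv[of x y "inv w"] x y wC by (simp add: dv_def m_comm)
   ultimately show "indicator (cl m (w \<otimes> x)) (dv y (inv w)) *\<^sub>R \<theta> (dv y (inv w)) = \<theta> w * (indicator (cl m x) y *\<^sub>R \<theta> y)"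
    using y wC ann_mult[OF \<theta> wC y] by (simp add: indicator_def cl_def)
  qed
  finally show ?thesis unfolding E_def by (subst (asm) integral_mult_right_zero) simp
 qed
 have "dv (w \<otimes> x) x \<in> W m" using w wC x by (simp add: dv_def m_assoc)
 then have "E m \<theta> (w \<otimes> x) = E m \<theta> x" using wC x by (intro lcD[OF E_lc]) auto
 then show ?thesis using trans w(2) by simp
qed

lemma P_char: assumes \<theta>: "\<theta> \<in> ann n" and x: "x \<in> C" shows "P n \<theta> x = (if \<theta> \<in> new_chars n then \<theta> x else 0)" proof (cases "n = 0")
 case True
 then show ?thesis using \<theta> E_id[OF ann_lc[OF \<theta>] order_refl x] by (simp add: P_def new_chars_def)
next
 case False
 note e = E_id[OF ann_lc[OF \<theta>] order_refl x]
 show ?thesis proof (cases "\<theta> \<in> ann (n - 1)")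
  case True
  then show ?thesis using e E_id[OF ann_lc[OF True] order_refl x] False by (simp add: P_def new_chars_def)
 next
  case nt: False
  then obtain w where "w \<in> W (n - 1)" "\<theta> w ~= 1" using \<theta> by (auto simp: ann_def)
  from E_char[OF \<theta> this x] show ?thesis using e False nt \<theta> by (simp add: P_def new_chars_def)
 qed
qed

text \<open>Pigeonhole in the finite quotient by \<open>W n\<close>.\<close>

lemma pow_in_W: assumes g: "g \<in> C" obtains m where "0 < m" "g [^] (m::nat) \<in> W n" proof -
 have "finite ((%i::nat. cl n (g [^] i)) ` UNIV)" by (rule finite_subset[OF _ finite_cls[of n]]) (use g in auto)
 then have "~ inj (%i::nat. cl n (g [^] i))" using finite_imageD[of "%i::nat. cl n (g [^] i)" UNIV] infinite_UNIV_nat by auto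
 then obtain i j :: nat where ij: "cl n (g [^] i) = cl n (g [^] j)" "i < j" unfolding inj_def by (metis linorder_neqE_nat)
 have "dv (g [^] j) (g [^] i) \<in> W n" using cl_eq_iff[of "g [^] j" "g [^] i" n] ij g by simp
 moreover have "g [^] j = g [^] (j - i) \<otimes> g [^] i" using ij(2) g by (simp add: nat_pow_mult)
 then have "dv (g [^] j) (g [^] i) = g [^] (j - i)" using g by (simp add: dv_def m_assoc)
 ultimately show ?thesis using that[of "j - i"] ij(2) by simp
qed

definition in_span :: "nat => ('a => complex) => bool" where
 "in_span n f \<longleftrightarrow> (EX T c. finite T & T <= ann n & (ALL x:C. f x = (\<Sum>\<theta>\<in>T. c \<theta> * \<theta> x)))"

lemma in_span_sum: assumes "finite I" "!!i. i \<in> I ==> in_span n (f i)" "!!x. x \<in> C ==> g x = (\<Sum>i\<in>I. f i x)" shows "in_span n g" proof -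
 let ?Q = "%i T c. finite T & T <= ann n & (ALL x:C. f i x = (\<Sum>\<theta>\<in>T. c \<theta> * \<theta> x))"
 have "ALL i:I. EX T c. ?Q i T c" using assms(2) unfolding in_span_def by blast
 from bchoice[OF this] obtain T where T: "ALL i:I. EX c. ?Q i (T i) c" ..
 from bchoice[OF this] obtain c where "ALL i:I. ?Q i (T i) (c i)" ..
 then have Tc: "!!i. i \<in> I ==> ?Q i (T i) (c i)" by blast
 let ?T = "\<Union>i\<in>I. T i"
 have fin: "finite ?T" using assms(1) Tc by auto
 have "g x = (\<Sum>\<theta>\<in>?T. (\<Sum>i\<in>I. if \<theta> \<in> T i then c i \<theta> else 0) * \<theta> x)" if x: "x \<in> C" for x proof -
  have "f i x = (\<Sum>\<theta>\<in>?T. (if \<theta> \<in> T i then c i \<theta> else 0) * \<theta> x)" if i: "i \<in> I" for i proof -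
   have "(\<Sum>\<theta>\<in>?T. (if \<theta> \<in> T i then c i \<theta> else 0) * \<theta> x) = (\<Sum>\<theta>\<in>T i. (if \<theta> \<in> T i then c i \<theta> else 0) * \<theta> x)"
    using fin i by (intro sum.mono_neutral_right) auto
   then show ?thesis using Tc[OF i] x by simp
  qed
  then have "g x = (\<Sum>i\<in>I. \<Sum>\<theta>\<in>?T. (if \<theta> \<in> T i then c i \<theta> else 0) * \<theta> x)" using assms(3)[OF x] by simp
  also have "... = (\<Sum>\<theta>\<in>?T. (\<Sum>i\<in>I. if \<theta> \<in> T i then c i \<theta> else 0) * \<theta> x)" by (subst sum.swap) (simp add: sum_distrib_right)
  finally show ?thesis .
 qed
 then show ?thesis unfolding in_span_def using fin Tc by (intro exI[of _ ?T] exI[of _ "%\<theta>. \<Sum>i\<in>I. if \<theta> \<in> T i then c i \<theta> else 0"]) auto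
qed

text \<open>Joint eigenfunctions of the translations by members of \<open>S\<close>; the set grows
  by one element at a time in the proof of \<open>lc_in_span\<close>.\<close>

definition eigen :: "nat => 'a set => ('a => complex) => bool" where
 "eigen n S f \<longleftrightarrow> lc n f & (ALL g:S. EX c. ALL x:C. f (g \<otimes> x) = c * f x)"

text \<open>Representatives account for all translations because \<open>f\<close> is constant on
  cosets. The eigenvalue of translation by \<open>g\<close> is multiplicative in \<open>g\<close>
  and a root of unity, hence a character, and evaluation at the unit shows that \<open>f\<close> is
  a multiple of it.\<close>

lemma eigen_all_in_span: assumes "eigen n (rep ` cls n) f" shows "in_span n f" proof -
 have f: "lc n f" using assms by (simp add: eigen_def)
 have "EX c. ALL x:C. f (g \<otimes> x) = c * f x" if g: "g \<in> C" for g proof -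
  let ?r = "rep (cl n g)"
  have S: "cl n g \<in> cls n" using g by simp
  note r = rep_cl[OF S]
  obtain c where c: "ALL x:C. f (?r \<otimes> x) = c * f x" using assms S unfolding eigen_def by blast
  have "f (g \<otimes> x) = f (?r \<otimes> x)" if x: "x \<in> C" for x proof (rule lcD[OF f])
   have "dv (g \<otimes> x) (?r \<otimes> x) = dv g ?r" using dv_dv[of g ?r "inv x"] g r(2) x by (simp add: dv_def)
   also have "... \<in> W n" by (rule iffD1[OF cl_eq_iff[OF g r(2)] r(3)[symmetric]])
   finally show "dv (g \<otimes> x) (?r \<otimes> x) \<in> W n" .
  qed (use g r x in auto)
  then show ?thesis using c by auto
 qed
 then obtain ev where ev: "!!g x. g \<in> C ==> x \<in> C ==> f (g \<otimes> x) = ev g * f x" by metis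
 have fl: "f g = ev g * f \<one>" if "g \<in> C" for g using ev[OF that one_closed] that by simp
 show ?thesis proof (cases "f \<one> = 0")
  case True
  then have "f x = 0" if "x \<in> C" for x using fl[OF that] by simp
  then show ?thesis unfolding in_span_def by (intro exI[of _ "{}"]) simp
 next
  case False
  define \<theta> where "\<theta> = restrict ev C"
  have mult: "ev (x \<otimes> y) = ev x * ev y" if "x \<in> C" "y \<in> C" for x y using ev[OF that] fl[of "x \<otimes> y"] fl[of y] that False by simp
  have one: "ev x = 1" if "x \<in> W n" for x proof -
   have "f x = f \<one>" using that W_closed[OF that] by (intro lcD[OF f]) auto
   then show ?thesis using fl[OF W_closed[OF that]] False by simp
  qed
  have pow: "ev (x [^] (k::nat)) = ev x ^ k" if "x \<in> C" for x k proof (induction k)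
   case 0 show ?case using one[OF W_one] by simp
  next
   case (Suc k)
   have "ev (x [^] Suc k) = ev (x [^] k) * ev x" using mult[OF nat_pow_closed[OF that, of k] that] by simp
   then show ?case using Suc by (simp add: mult.commute)
  qed
  have norm: "cmod (ev x) = 1" if x: "x \<in> C" for x proof -
   obtain m where m: "0 < m" "x [^] (m::nat) \<in> W n" using pow_in_W[OF x] .
   have "ev x ^ m = 1" using pow[OF x, of m] one[OF m(2)] by simp
   then have "cmod (ev x) ^ m = 1 ^ m" by (simp flip: norm_power)
   then show ?thesis by (rule power_eq_imp_eq_base) (use m(1) in auto)
  qed
  have "\<theta> \<in> ann n" unfolding ann_def proof (intro CollectI conjI ballI)
   show "\<theta> \<in> extensional C" by (simp add: \<theta>_def)
   show "cmod (\<theta> x) = 1" if "x \<in> C" for x using norm that by (simp add: \<theta>_def)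
   show "\<theta> (x \<otimes> y) = \<theta> x * \<theta> y" if "x \<in> C" "y \<in> C" for x y using mult that by (simp add: \<theta>_def)
   show "\<theta> x = 1" if "x \<in> W n" for x using one[OF that] W_closed[OF that] by (simp add: \<theta>_def)
  qed
  moreover have "f x = (\<Sum>\<theta>'\<in>{\<theta>}. f \<one> * \<theta>' x)" if "x \<in> C" for x using fl[OF that] that by (simp add: \<theta>_def)
  ultimately have "finite {\<theta>} & {\<theta>} <= ann n & (ALL x:C. f x = (\<Sum>\<theta>'\<in>{\<theta>}. f \<one> * \<theta>' x))" by blast
  then show ?thesis unfolding in_span_def by (intro exI)
 qed
qed

text \<open>Splitting along a root of unity: translation by \<open>g\<close> has finite order \<open>m\<close> on functions that are
 constant on the cosets of \<open>W n\<close>, and \<open>1/m * (\<Sum>i<m. \<zeta> ^ (i * j) * f (g ^ i x))\<close> are its eigencomponents.\<close>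

lemma eigen_split: assumes f: "eigen n S f" and g: "g \<in> C" and step: "!!h. eigen n (insert g S) h ==> in_span n h" and S: "S <= C" shows "in_span n f" proof -
 have fl: "lc n f" using f by (simp add: eigen_def)
 obtain m where m: "0 < m" "g [^] (m::nat) \<in> W n" using pow_in_W[OF g] .
 define \<zeta> where "\<zeta> = exp (2 * of_real pi * \<i> * (of_nat 1 / of_nat m))"
 have \<zeta>m: "\<zeta> ^ m = 1" unfolding \<zeta>_def using complex_root_unity[of m 1] m(1) by simp
 have \<zeta>0: "\<zeta> ~= 0" by (simp add: \<zeta>_def)
 have \<zeta>i: "\<zeta> ^ i ~= 1" if "0 < i" "i < m" for i proof -
  have "\<zeta> ^ i = exp (2 * of_real pi * \<i> * (of_nat i / of_nat m))" unfolding \<zeta>_def exp_of_nat_mult[symmetric] by (simp add: field_simps)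
  moreover have "~ m dvd i" using that by (simp add: nat_dvd_not_less)
  ultimately show ?thesis using complex_root_unity_eq_1[of m i] m(1) by simp
 qed
 define h where "h j x = (\<Sum>i<m. \<zeta> ^ (i * j) * f (g [^] i \<otimes> x)) / of_nat m" for j x
 have gi: "g [^] i \<in> C" for i :: nat using g by simp
 have periodic: "f (g [^] m \<otimes> x) = f x" if x: "x \<in> C" for x proof (rule lcD[OF fl])
  show "dv (g [^] m \<otimes> x) x \<in> W n" using m(2) gi x by (simp add: dv_def m_assoc)
 qed (use gi x in auto)
 have hlc: "lc n (h j)" for j unfolding lc_def proof (intro ballI impI)
  fix x y assume xy: "x \<in> C" "y \<in> C" "dv x y \<in> W n"
  have "f (g [^] i \<otimes> x) = f (g [^] i \<otimes> y)" for i :: nat proof (rule lcD[OF fl])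
   have "dv (g [^] i \<otimes> x) (g [^] i \<otimes> y) = dv x y" using dv_dv[of x y "inv (g [^] i)"] gi[of i] xy by (simp add: dv_def m_comm)
   then show "dv (g [^] i \<otimes> x) (g [^] i \<otimes> y) \<in> W n" using xy by simp
  qed (use gi xy in auto)
  then show "h j x = h j y" by (simp add: h_def)
 qed
 have "in_span n (h j)" for j proof (rule step)
  have "EX c. ALL x:C. h j (s \<otimes> x) = c * h j x" if s: "s \<in> S" for s proof -
   obtain c where c: "ALL x:C. f (s \<otimes> x) = c * f x" using f s unfolding eigen_def by blast
   have sC: "s \<in> C" using s S by auto
   have "f (g [^] i \<otimes> (s \<otimes> x)) = c * f (g [^] i \<otimes> x)" if "x \<in> C" for x and i :: nat using c gi[of i] that sC m_lcomm[of "g [^] i" s x] by simp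
   then have "h j (s \<otimes> x) = c * h j x" if "x \<in> C" for x using that by (simp add: h_def sum_distrib_left mult_ac)
   then show ?thesis by blast
  qed
  moreover have "h j (g \<otimes> x) = inverse (\<zeta> ^ j) * h j x" if x: "x \<in> C" for x proof -
   \<comment> \<open>Translation by \<open>g\<close> shifts the index of the summands by one; the
     shift is cyclic because the summand at \<open>m\<close> equals the one at 0.\<close>
   define e where "e i = \<zeta> ^ (i * j) * f (g [^] i \<otimes> x)" for i :: nat
   have em: "e m = e 0" using periodic[OF x] x \<zeta>m by (simp add: e_def power_mult)
   have "(\<Sum>i<m. e (Suc i)) = (\<Sum>i<m. e i)" using sum.lessThan_Suc_shift[of e m] em by simp
   moreover have "\<zeta> ^ j * (\<zeta> ^ (i * j) * f (g [^] i \<otimes> (g \<otimes> x))) = e (Suc i)" for i using gi[of i] g x by (simp add: e_def power_add m_assoc)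
   then have "\<zeta> ^ j * h j (g \<otimes> x) = (\<Sum>i<m. e (Suc i)) / of_nat m" by (simp add: h_def sum_distrib_left)
   ultimately have "\<zeta> ^ j * h j (g \<otimes> x) = h j x" by (simp add: h_def e_def)
   then show ?thesis using \<zeta>0 by (simp add: field_simps)
  qed
  ultimately show "eigen n (insert g S) (h j)" unfolding eigen_def using hlc by auto
 qed
 moreover have "f x = (\<Sum>j<m. h j x)" if x: "x \<in> C" for x proof -
  have "(\<Sum>j<m. h j x) = (\<Sum>i<m. (\<Sum>j<m. (\<zeta> ^ i) ^ j) * f (g [^] i \<otimes> x)) / of_nat m"
   unfolding h_def sum_divide_distrib[symmetric] by (subst sum.swap) (simp add: sum_distrib_right power_mult)
  also have "(\<Sum>i<m. (\<Sum>j<m. (\<zeta> ^ i) ^ j) * f (g [^] i \<otimes> x)) = (\<Sum>i<m. if i = 0 then of_nat m * f x else 0)" proof (intro sum.cong refl)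
   fix i assume "i \<in> {..<m}"
   then have i: "i < m" by simp
   show "(\<Sum>j<m. (\<zeta> ^ i) ^ j) * f (g [^] i \<otimes> x) = (if i = 0 then of_nat m * f x else 0)" proof (cases "i = 0")
    case False
    have "(\<zeta> ^ i) ^ m = 1" by (metis \<zeta>m power_mult mult.commute power_one)
    then have "(\<Sum>j<m. (\<zeta> ^ i) ^ j) = 0" using geometric_sum[OF \<zeta>i[of i], of m] False i by simp
    then show ?thesis using False by simp
   qed (use x in simp)
  qed
  also have "... / of_nat m = f x" using m(1) by (simp add: sum.delta)
  finally show ?thesis by simp
 qed
 ultimately show ?thesis by (intro in_span_sum[of "{..<m}" n h f]) auto
qed

text \<open>Induction over a finite set of representatives: translations commute, so splitting along
  one element preserves the eigenproperty for those already treated, until all are covered and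
  \<open>eigen_all_in_span\<close> applies.\<close>

lemma lc_in_span: assumes "lc n f" shows "in_span n f" proof -
 have *: "(ALL f. eigen n (T Un S) f --> in_span n f) ==> S <= C ==> T <= C ==> (ALL f. eigen n S f --> in_span n f)" if "finite T" for T S using that
 proof (induction T arbitrary: S rule: finite_induct)
  case (insert g T)
  have "ALL f. eigen n (insert g S) f --> in_span n f" using insert.IH[of "insert g S"] insert.prems by auto
  then show ?case using eigen_split[of n S _ g] insert.prems by auto
 qed simp
 have "finite (rep ` cls n)" "rep ` cls n <= C" using finite_cls rep_cl(2) by auto
 from *[OF this(1), of "{}"] this(2) eigen_all_in_span[of n]
 have "ALL f. eigen n {} f --> in_span n f" by simp
 then show ?thesis using assms by (simp add: eigen_def)
qed

end

context spectral_chain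
begin

subsection \<open>Spectrum and eigenspaces\<close>

text \<open>Since \<open>\<phi>\<close> is injective, the eigenvalue equation read on components
  annihilates all of them except the \<open>n\<close>-th.\<close>

lemma eigenspace_iff: "u \<in> op_eigenspace M A (complex_of_real (\<phi> n)) \<longleftrightarrow> u \<in> L2 M & (AE x in M. u x = P n u x)" proof
 assume "u \<in> op_eigenspace M A (complex_of_real (\<phi> n))"
 then obtain w where w: "(u, w) \<in> A" "AE x in M. w x = complex_of_real (\<phi> n) * u x" by (auto simp: op_eigenspace_def)
 note a = A_D[OF w(1)]
 have "AE x in M. u x = P n u x" proof (rule P_determines[OF a(1) P_L2])
  fix k x assume x: "x \<in> C"
  have "P k w x = complex_of_real (\<phi> n) * P k u x" using P_cong_AE[OF a(2) L2_scale[OF a(1)] w(2) x, of k] by (simp add: P_scale)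
  then have "complex_of_real (\<phi> k) * P k u x = complex_of_real (\<phi> n) * P k u x" unfolding a(3)[OF x, of k] .
  then have "k = n \<or> P k u x = 0" by (auto simp: \<phi>_inj)
  then show "P k u x = P k (P n u) x" using P_P[OF a(1) x, of k n] by auto
 qed
 then show "u \<in> L2 M & (AE x in M. u x = P n u x)" using a(1) by simp
next
 assume u: "u \<in> L2 M & (AE x in M. u x = P n u x)"
 have "(u, %x. complex_of_real (\<phi> n) * u x) \<in> A" proof (rule A_I)
  fix k x assume x: "x \<in> C"
  have "P k u x = (if k = n then P n u x else 0)" using P_cong_AE[OF _ P_L2 conjunct2[OF u] x, of k] P_P[OF conjunct1[OF u] x, of k n] u by simp
  then show "P k (%x. complex_of_real (\<phi> n) * u x) x = complex_of_real (\<phi> k) * P k u x" by (simp add: P_scale)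
 qed (use u L2_scale in auto)
 then show "u \<in> op_eigenspace M A (complex_of_real (\<phi> n))" unfolding op_eigenspace_def by auto
qed

text \<open>An eigenfunction is its own \<open>n\<close>-th component, hence a combination of
  characters trivial on \<open>W n\<close>; applying \<open>P n\<close> once more removes those
  already trivial on \<open>W (n - 1)\<close>.\<close>

theorem eigenspace_chars: "op_eigenspace M A (complex_of_real (\<phi> n)) = l2_span M (new_chars n)" proof (intro equalityI subsetI)
 fix u assume "u \<in> op_eigenspace M A (complex_of_real (\<phi> n))"
 then have u: "u \<in> L2 M" "AE x in M. u x = P n u x" by (auto simp: eigenspace_iff)
 obtain T c where T: "finite T" "T <= ann n" "!!x. x \<in> C ==> P n u x = (\<Sum>\<theta>\<in>T. c \<theta> * \<theta> x)"
  using lc_in_span[OF P_lc[of n u]] unfolding in_span_def by blast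
 have TL: "integrable M (%x. c \<theta> * \<theta> x)" if "\<theta> \<in> T" for \<theta> using that T(2) by (intro integrable_mult_right L2_integrable lc_L2[OF ann_lc]) auto
 have eq: "P n u x = (\<Sum>\<theta>\<in>T Int new_chars n. c \<theta> * \<theta> x)" if x: "x \<in> C" for x proof -
  have "P n u x = P n (P n u) x" using P_P[OF u(1) x] by simp
  also have "... = P n (%x. \<Sum>\<theta>\<in>T. c \<theta> * \<theta> x) x" by (rule P_cong) (rule T(3))
  also have "... = (\<Sum>\<theta>\<in>T. P n (%x. c \<theta> * \<theta> x) x)"
   using E_sum[of T "%\<theta> x. c \<theta> * \<theta> x", OF TL x] by (simp add: P_def sum_subtractf)
  also have "... = (\<Sum>\<theta>\<in>T. if \<theta> \<in> new_chars n then c \<theta> * \<theta> x else 0)"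
   using T(2) P_char[OF _ x, of _ n] by (intro sum.cong refl) (auto simp: P_scale)
  also have "... = (\<Sum>\<theta>\<in>T Int new_chars n. c \<theta> * \<theta> x)" by (rule sum.inter_restrict[OF T(1), symmetric])
  finally show ?thesis .
 qed
 have "AE x in M. u x = (\<Sum>\<theta>\<in>T Int new_chars n. c \<theta> * \<theta> x)" using u(2) AE_space by eventually_elim (use eq in \<open>simp add: space_M\<close>)
 then show "u \<in> l2_span M (new_chars n)" unfolding l2_span_def using u(1) T(1) by blast
next
 fix u assume "u \<in> l2_span M (new_chars n)"
 then obtain S c where S: "finite S" "S <= new_chars n" "u \<in> L2 M" "AE x in M. u x = (\<Sum>f\<in>S. c f * f x)" unfolding l2_span_def by blast
 have ann: "\<theta> \<in> ann n" if "\<theta> \<in> S" for \<theta> using S(2) that by (auto simp: new_chars_def)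
 have int: "integrable M (%x. c \<theta> * \<theta> x)" if "\<theta> \<in> S" for \<theta> using that by (intro integrable_mult_right L2_integrable lc_L2[OF ann_lc[OF ann]])
 have sL: "(%x. \<Sum>f\<in>S. c f * f x) \<in> L2 M" using lc_L2[OF ann_lc[OF ann]] by (intro L2_sum L2_scale)
 have "P n u x = (\<Sum>f\<in>S. c f * f x)" if x: "x \<in> C" for x proof -
  have "P n u x = P n (%x. \<Sum>f\<in>S. c f * f x) x" by (rule P_cong_AE[OF S(3) sL S(4) x])
  also have "... = (\<Sum>f\<in>S. P n (%x. c f * f x) x)" using E_sum[of S "%\<theta> x. c \<theta> * \<theta> x", OF int x] by (simp add: P_def sum_subtractf)
  also have "... = (\<Sum>f\<in>S. c f * f x)" using P_char[OF ann x] S(2) by (intro sum.cong refl) (auto simp: P_scale)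
  finally show ?thesis .
 qed
 then have "AE x in M. u x = P n u x" using S(4) AE_space by (auto simp: space_M elim: eventually_elim2)
 then show "u \<in> op_eigenspace M A (complex_of_real (\<phi> n))" using S(3) by (simp add: eigenspace_iff)
qed

text \<open>Test with the indicator of the coset of the unit: its average over that coset is 1, over
  the next larger one \<open>N (n - 1) / N n\<close>, which differs from 1 by strict growth. So
  every \<open>\<phi> n\<close> is an eigenvalue.\<close>

lemma P_nonzero: obtains h where "lc n h" "P n h \<one> ~= 0" proof -
 let ?h = "%x. indicator (cl n \<one>) x *\<^sub>R (1::complex)"
 have lc: "lc n ?h" unfolding lc_def proof (intro ballI impI)
  fix x y assume xy: "x \<in> C" "y \<in> C" "dv x y \<in> W n"
  have S: "cl n \<one> \<in> cls n" by simp
  note 1 = cls_cover[OF xy(1) S] and 2 = cls_cover[OF xy(2) S]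
  have 3: "cl n x = cl n y" by (rule iffD2[OF cl_eq_iff[OF xy(1,2)] xy(3)])
  have "x \<in> cl n \<one> \<longleftrightarrow> y \<in> cl n \<one>" unfolding 1 2 3 ..
  then show "?h x = ?h y" by (simp add: indicator_def)
 qed
 have one: "E n ?h \<one> = 1" using E_id[OF lc order_refl one_closed] cl_self[OF one_closed, of n] by simp
 have "E (n - 1) ?h \<one> ~= 1" if n: "n ~= 0" proof -
  have "indicator (cl (n - 1) \<one>) y *\<^sub>R ?h y = ?h y" for y using cl_antimono[of "n - 1" n \<one>] by (auto simp: indicator_def)
  then have "E (n - 1) ?h \<one> = of_nat (N (n - 1)) * (\<integral>y. ?h y \<partial>M)" unfolding E_def by (simp only:)
  also have "(\<integral>y. ?h y \<partial>M) = prob (cl n \<one>) *\<^sub>R 1" by (rule integral_indicator_scaleR[OF cl_sets[OF one_closed]])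
  finally have "E (n - 1) ?h \<one> = complex_of_real (real (N (n - 1)) / real (N n))" by (simp add: prob_cl scaleR_conv_of_real)
  moreover have "real (N (n - 1)) / real (N n) ~= 1" using N_mono[of "n - 1"] n by simp
  ultimately show ?thesis by (metis of_real_eq_1_iff)
 qed
 then have "P n ?h \<one> ~= 0" using one by (simp add: P_def)
 then show ?thesis using that lc by blast
qed

text \<open>As soon as \<open>\<phi> n >= 2 * cmod c + 1\<close> the coefficient is at most
  \<open>2 / \<phi> n\<close> in modulus, so the coefficients, and with them their successive
  differences, are absolutely summable.\<close>

lemma admissible_resolvent: assumes c: "c ~: range (%n. complex_of_real (\<phi> n))" shows "admissible (%n. 1 / (complex_of_real (\<phi> n) - c))" proof -
 let ?a = "%n. 1 / (complex_of_real (\<phi> n) - c)"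
 have "\<forall>\<^sub>F n in sequentially. 2 * cmod c + 1 <= \<phi> n" using \<phi>_at_top by (simp add: filterlim_at_top)
 then have bd: "\<forall>\<^sub>F n in sequentially. cmod (?a n) <= 2 * (1 / \<phi> n)" proof eventually_elim
  fix n assume n: "2 * cmod c + 1 <= \<phi> n"
  have "\<phi> n <= cmod (complex_of_real (\<phi> n) - c) + cmod c" using norm_triangle_ineq[of "complex_of_real (\<phi> n) - c" c] \<phi>_nonneg[of n] by simp
  then have "\<phi> n / 2 <= cmod (complex_of_real (\<phi> n) - c)" using n by simp
  moreover have p: "0 < \<phi> n" using n norm_ge_zero[of c] by linarith
  moreover have "0 < cmod (complex_of_real (\<phi> n) - c)" using calculation by linarith
  ultimately have "1 / cmod (complex_of_real (\<phi> n) - c) <= 1 / (\<phi> n / 2)" by (intro divide_left_mono) auto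
  then show "cmod (?a n) <= 2 * (1 / \<phi> n)" by (simp add: norm_divide)
 qed
 have s\<phi>: "summable (%n. 2 * (1 / \<phi> n))" using \<phi>_summable summable_Suc_iff[of "%n. 1 / \<phi> n"] by (intro summable_mult) simp
 have sa: "summable (%n. cmod (?a n))" by (rule summable_comparison_test_ev[OF _ s\<phi>]) (use bd in simp)
 have "summable (%n. cmod (?a (Suc n)))" using sa summable_Suc_iff[of "%n. cmod (?a n)"] by simp
 from summable_add[OF sa this] have "summable (%n. cmod (?a n - ?a (Suc n)))" by (rule summable_comparison_test'[of _ 0]) (use norm_triangle_ineq4 in simp)
 moreover have "?a \<longlonglongrightarrow> 0" using summable_LIMSEQ_zero[OF sa] by (rule tendsto_norm_zero_cancel)
 ultimately show ?thesis by (simp add: admissible_def)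
qed

text \<open>The solution has components \<open>a n * P n f\<close>. Taking \<open>f + c * u\<close>
  as the image of \<open>u\<close> makes the resolvent equation hold at every point, so that only
  membership in \<open>A\<close> remains; a bound for the coefficients bounds the inverse.\<close>

lemma resolvent_A: assumes c: "c ~: range (%n. complex_of_real (\<phi> n))" shows "c \<in> resolvent_set M A" proof -
 define a where "a n = 1 / (complex_of_real (\<phi> n) - c)" for n
 have a: "admissible a" unfolding a_def by (rule admissible_resolvent[OF c])
 have nz: "complex_of_real (\<phi> n) - c ~= 0" for n using c by auto
 have "EX (u, w):A. AE x in M. w x - c * u x = f x" if f: "f \<in> L2 M" for f proof -
  let ?u = "mult_op a f" and ?w = "%x. f x + c * mult_op a f x"
  note uL = mult_op_L2[OF a f]
  have "(?u, ?w) \<in> A" proof (rule A_I[OF uL L2_add[OF f L2_scale[OF uL]]])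
   fix n x assume x: "x \<in> C"
   have "P n ?w x = P n f x + c * (a n * P n f x)" using P_add[OF f L2_scale[OF uL] x] P_mult_op[OF a f x] by (simp add: P_scale)
   also have "... = complex_of_real (\<phi> n) * (a n * P n f x)" using nz[of n] by (simp add: a_def field_simps)
   finally show "P n ?w x = complex_of_real (\<phi> n) * P n ?u x" using P_mult_op[OF a f x] by simp
  qed
  then show ?thesis by (intro bexI[of _ "(?u, ?w)"]) auto
 qed
 moreover have "EX B. ALL (u, w):A. nrm u <= B * nrm (%x. w x - c * u x)" proof -
  have "convergent a" using a unfolding admissible_def convergent_def by blast
  then obtain B where B: "0 < B" "!!n. cmod (a n) <= B" using convergent_imp_Bseq BseqE by metis
  have "nrm u <= B * nrm (%x. w x - c * u x)" if uw: "(u, w) \<in> A" for u w proof -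
   note h = A_D[OF uw]
   show ?thesis proof (rule l2_norm_P_le[OF h(1) L2_diff[OF h(2) L2_scale[OF h(1)]]])
    fix n x assume x: "x \<in> C"
    have "P n (%x. w x - c * u x) x = (complex_of_real (\<phi> n) - c) * P n u x" using P_diff[OF h(2) L2_scale[OF h(1)] x] h(3)[OF x] by (simp add: P_scale left_diff_distrib)
    then have "P n u x = a n * P n (%x. w x - c * u x) x" using nz[of n] by (simp add: a_def)
    then show "cmod (P n u x) <= B * cmod (P n (%x. w x - c * u x) x)" using B(2)[of n] by (simp add: norm_mult mult_right_mono)
   qed (use B in simp)
  qed
  then show ?thesis by blast
 qed
 ultimately show ?thesis by (auto simp: resolvent_set_def)
qed

lemma eigenvalue_A: "op_eigenvalue M A (complex_of_real (\<phi> n))" "complex_of_real (\<phi> n) ~: resolvent_set M A" proof -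
 obtain h where h: "lc n h" "P n h \<one> ~= 0" using P_nonzero .
 note hL = lc_L2[OF h(1)]
 have nz: "~ (AE x in M. P n h x = 0)" using lc_AE_zero[OF P_lc _ one_closed, of n h] h(2) by blast
 have "AE x in M. P n h x = P n (P n h) x" using AE_space by eventually_elim (simp add: space_M P_P[OF hL])
 then have "P n h \<in> op_eigenspace M A (complex_of_real (\<phi> n))" using P_L2 by (simp add: eigenspace_iff)
 then show "op_eigenvalue M A (complex_of_real (\<phi> n))" using nz unfolding op_eigenvalue_def by blast
 show "complex_of_real (\<phi> n) ~: resolvent_set M A" proof
  assume "complex_of_real (\<phi> n) \<in> resolvent_set M A"
  then obtain B where "ALL (u, w):A. nrm u <= B * nrm (%x. w x - complex_of_real (\<phi> n) * u x)" by (auto simp: resolvent_set_def)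
  from bspec[OF this P_in_A[OF hL, of n]] have "nrm (P n h) <= 0" by (simp add: l2_norm_def)
  then have "nrm (P n h) = 0" by (simp add: order_antisym)
  then show False using nz l2_norm_eq_0[OF P_L2] by blast
 qed
qed

theorem spectrum_A: "op_spectrum M A = range (%n. complex_of_real (\<phi> n))" unfolding op_spectrum_def using resolvent_A eigenvalue_A(2) by auto

lemma isolated_\<phi>: "complex_of_real (\<phi> n) isolated_in range (%n. complex_of_real (\<phi> n))" unfolding isolated_in_dist_Ex_iff proof (intro conjI rangeI)
 define \<epsilon> where "\<epsilon> = min (\<phi> (Suc n) - \<phi> n) (if n = 0 then 1 else \<phi> n - \<phi> (n - 1))"
 have "0 < \<epsilon>" using \<phi>_less[of n "Suc n"] \<phi>_less[of "n - 1" n] by (auto simp: \<epsilon>_def)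
 moreover have "k = n" if "dist (complex_of_real (\<phi> n)) (complex_of_real (\<phi> k)) < \<epsilon>" for k proof (rule ccontr)
  assume "k ~= n"
  have d: "\<bar>\<phi> n - \<phi> k\<bar> < \<epsilon>" using that by (simp add: dist_norm norm_of_real flip: of_real_diff)
  show False proof (cases "k < n")
   case True
   then have "\<phi> k <= \<phi> (n - 1)" using strict_mono_less_eq[OF \<phi>_strict, of k "n - 1"] by simp
   then show False using d True by (auto simp: \<epsilon>_def)
  next
   case False
   then have "\<phi> (Suc n) <= \<phi> k" using strict_mono_less_eq[OF \<phi>_strict, of "Suc n" k] \<open>k ~= n\<close> by simp
   then show False using d by (auto simp: \<epsilon>_def)
  qed
 qed
 ultimately show "EX e>0. ALL y:range (%n. complex_of_real (\<phi> n)). dist (complex_of_real (\<phi> n)) y < e --> y = complex_of_real (\<phi> n)" by blast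
qed

text \<open>Multiplicities are finite because eigenfunctions for \<open>\<phi> n\<close> are
  constant on the finitely many cosets of level \<open>n\<close>, whose indicators therefore
  span.\<close>

theorem discrete_A: "purely_discrete_spectrum M A" unfolding purely_discrete_spectrum_def spectrum_A proof
 fix c assume "c \<in> range (%n. complex_of_real (\<phi> n))"
 then obtain n where c: "c = complex_of_real (\<phi> n)" by blast
 let ?i = "%S::'a set. indicator S :: 'a => complex"
 let ?B = "?i ` cls n"
 have inj: "inj ?i" by (rule injI) (metis (no_types) indicator_eq_1_iff subsetI subset_antisym)
 have BL: "?B <= L2 M" using indicator_L2[OF cls_sets] by auto
 have "u \<in> l2_span M ?B" if "u \<in> op_eigenspace M A c" for u proof -
  have u: "u \<in> L2 M" "AE x in M. u x = P n u x" using that by (auto simp: c eigenspace_iff)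
  let ?c = "%f. P n u (rep (the_inv ?i f))"
  have "P n u x = (\<Sum>f\<in>?B. ?c f * f x)" if x: "x \<in> C" for x proof -
   have "(\<Sum>f\<in>?B. ?c f * f x) = (\<Sum>S\<in>cls n. P n u (rep S) * indicator S x)"
    by (subst sum.reindex) (use inj in \<open>auto simp: inj_on_def the_inv_f_f[OF inj]\<close>)
   also have "... = (\<Sum>S\<in>cls n. indicator S x *\<^sub>R P n u (rep S))" by (intro sum.cong) (auto simp: indicator_def)
   finally show ?thesis using lc_expand[OF P_lc x, of n u] by simp
  qed
  then have "AE x in M. u x = (\<Sum>f\<in>?B. ?c f * f x)" using u(2) AE_space by (auto simp: space_M elim: eventually_elim2)
  moreover have "finite ?B" using finite_cls by simp
  ultimately show ?thesis unfolding l2_span_def using u(1) by (intro CollectI conjI exI[of _ ?B] exI[of _ ?c]) auto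
 qed
 then have "op_eigenspace M A c <= l2_span M ?B" ..
 then show "c isolated_in range (%n. complex_of_real (\<phi> n)) & op_eigenvalue M A c &
   (EX B. finite B & B <= L2 M & op_eigenspace M A c <= l2_span M B)"
  unfolding c using isolated_\<phi>[of n] eigenvalue_A(1)[of n] BL finite_cls[of n] by (intro conjI exI[of _ ?B]) auto
qed

end

subsection \<open>Semigroups\<close>

context
 fixes M :: "'a measure" and T :: "real => ('a => complex) => 'a => complex" assumes T: "c0_semigroup M T"
begin

lemma semigroup_L2: "0 <= t ==> u \<in> L2 M ==> T t u \<in> L2 M" using T by (simp add: c0_semigroup_def)

lemma semigroup_linear:
 "0 <= t ==> u \<in> L2 M ==> w \<in> L2 M ==> AE x in M. T t (%x. a * u x + b * w x) x = a * T t u x + b * T t w x" using T by (simp add: c0_semigroup_def)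

lemma semigroup_bound: assumes "0 <= t" obtains B where "0 <= B" "ALL u:L2 M. l2_norm M (T t u) <= B * l2_norm M u" proof -
 obtain B where B: "ALL u:L2 M. l2_norm M (T t u) <= B * l2_norm M u" proof -
  have "ALL t>=0. EX B. ALL u:L2 M. l2_norm M (T t u) <= B * l2_norm M u" using T unfolding c0_semigroup_def by (elim conjE)
  then show ?thesis using assms that by blast
 qed
 have "l2_norm M (T t u) <= max B 0 * l2_norm M u" if "u \<in> L2 M" for u proof -
  have "l2_norm M (T t u) <= B * l2_norm M u" using B that by blast
  also have "... <= max B 0 * l2_norm M u" by (rule mult_right_mono) auto
  finally show ?thesis .
 qed
 then show ?thesis by (intro that[of "max B 0"]) simp_all
qed

lemma semigroup_0: "u \<in> L2 M ==> AE x in M. T 0 u x = u x" using T by (simp add: c0_semigroup_def)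

lemma semigroup_plus: "0 <= s ==> 0 <= t ==> u \<in> L2 M ==> AE x in M. T (s + t) u x = T s (T t u) x" using T by (simp add: c0_semigroup_def)

lemma semigroup_diff: assumes "0 <= t" "u \<in> L2 M" "w \<in> L2 M" shows "AE x in M. T t (%x. u x - w x) x = T t u x - T t w x"
 using semigroup_linear[OF assms, of 1 "-1"] by simp

lemma semigroup_scale: assumes "0 <= t" "u \<in> L2 M" shows "AE x in M. T t (%x. a * u x) x = a * T t u x" using semigroup_linear[OF assms assms(2), of a 0] by simp

text \<open>\<open>T t\<close> acts on functions, not on classes; that it respects equality almost
  everywhere follows from linearity and boundedness.\<close>

lemma semigroup_cong: assumes "0 <= t" "u \<in> L2 M" "w \<in> L2 M" "AE x in M. u x = w x" shows "AE x in M. T t u x = T t w x" proof -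
 obtain B where B: "0 <= B" "ALL u:L2 M. l2_norm M (T t u) <= B * l2_norm M u" by (rule semigroup_bound[OF assms(1)])
 note d = L2_diff[OF assms(2,3)]
 have "l2_norm M (%x. u x - w x) = 0" using l2_norm_eq_0[OF d] assms(4) by simp
 then have "l2_norm M (T t (%x. u x - w x)) = 0" using bspec[OF B(2) d] by (simp add: order_antisym)
 then have "AE x in M. T t (%x. u x - w x) x = 0" using l2_norm_eq_0[OF semigroup_L2[OF assms(1) d]] by simp
 then show ?thesis using semigroup_diff[OF assms(1-3)] by (auto elim: eventually_elim2)
qed

lemma semigroup_sum: assumes t: "0 <= t" and "finite I" "!!i. i \<in> I ==> f i \<in> L2 M"
 shows "AE x in M. T t (%x. \<Sum>i\<in>I. c i * f i x) x = (\<Sum>i\<in>I. c i * T t (f i) x)" using assms(2,3) proof (induction I)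
 case empty
 show ?case using semigroup_scale[OF t L2_zero, of 0] by simp
next
 case (insert i I)
 have s: "(%x. \<Sum>i\<in>I. c i * f i x) \<in> L2 M" using insert by (intro L2_sum L2_scale) auto
 have i: "f i \<in> L2 M" using insert by simp
 have "AE x in M. T t (%x. \<Sum>i\<in>I. c i * f i x) x = (\<Sum>i\<in>I. c i * T t (f i) x)" using insert by simp
 then show ?case using semigroup_linear[OF t i s, of "c i" 1] insert(1,2) by (auto elim!: eventually_elim2)
qed

end

context spectral_chain
begin

text \<open>The weights of the mixture: for \<open>t > 0\<close> they are positive and their tail
  from \<open>m\<close> on sums to \<open>exp (- (t * \<phi> m))\<close>, so they form a probability
  distribution on the levels.\<close>

definition p :: "real => nat => real" where "p t n = exp (- (t * \<phi> n)) - exp (- (t * \<phi> (Suc n)))"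

abbreviation hm :: "real => nat => complex" where "hm t n \<equiv> complex_of_real (exp (- (t * \<phi> n)))"

definition heat :: "real => ('a => complex) => 'a => complex" where
 "heat t u = (if t = 0 then u else mult_op (hm t) u)"

lemma exp_\<phi>_tendsto: "0 < t ==> (%n. exp (- (t * \<phi> n))) \<longlonglongrightarrow> 0"
 using filterlim_compose[OF exp_at_bot filterlim_tendsto_neg_mult_at_bot[OF tendsto_const[of "- t"] _ \<phi>_at_top]] by simp

lemma p_pos: "0 < t ==> 0 < p t n" using \<phi>_less[of n "Suc n"] by (simp add: p_def)

lemma p_sums: assumes "0 < t" shows "(%n. p t (n + m)) sums exp (- (t * \<phi> m))"
 using telescope_sums'[OF LIMSEQ_ignore_initial_segment[OF exp_\<phi>_tendsto[OF assms], of m]] by (simp add: p_def)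

lemma p_summable: "0 < t ==> summable (p t)" using p_sums[of t 0] by (simp add: sums_iff)

lemma hm_diff: "hm t n - hm t (Suc n) = complex_of_real (p t n)" by (simp add: p_def)

lemma p_cmod: "0 < t ==> cmod (complex_of_real (p t n)) = p t n" using p_pos[of t n] by (simp del: of_real_diff)

lemma p_abs: "0 < t ==> \<bar>p t n\<bar> = p t n" using p_pos[of t n] by simp

lemma admissible_hm: assumes "0 < t" shows "admissible (hm t)" unfolding admissible_def hm_diff p_cmod[OF assms]
 using tendsto_of_real[OF exp_\<phi>_tendsto[OF assms]] p_summable[OF assms] by simp

lemma heat_L2: "0 <= t ==> u \<in> L2 M ==> heat t u \<in> L2 M" by (simp add: heat_def mult_op_L2 admissible_hm)

lemma P_heat: "0 <= t ==> u \<in> L2 M ==> x \<in> C ==> P m (heat t u) x = hm t m * P m u x" by (simp add: heat_def P_mult_op admissible_hm)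

lemma hm_le_1: "0 <= t ==> exp (- (t * \<phi> n)) <= 1" using \<phi>_nonneg[of n] by simp

text \<open>Dominated convergence over the components: beyond a cut-off the factors are at most 1
  and the tail of \<open>w\<close> is small, and the finitely many factors before it tend to
  0.\<close>

lemma tendsto_vanish:
 fixes c :: "nat => real => real" assumes c: "!!n t. 0 < t ==> 0 <= c n t & c n t <= 1" and lim: "!!n. (c n \<longlongrightarrow> 0) (at_right 0)"
  and g: "!!t. 0 < t ==> g t \<in> L2 M" and w: "w \<in> L2 M" and le: "!!t n x. 0 < t ==> x \<in> C ==> cmod (P n (g t) x) <= c n t * cmod (P n w x)"
 shows "((%t. nrm (g t)) \<longlongrightarrow> 0) (at_right 0)" proof (rule tendstoI)
 fix \<epsilon> :: real assume e: "0 < \<epsilon>"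
 have "\<forall>\<^sub>F k in sequentially. nrm (%x. w x - E k w x) < \<epsilon> / 2" using order_tendstoD(2)[OF E_tendsto[OF w], of "\<epsilon> / 2"] e by simp
 then obtain k where k: "nrm (%x. w x - E k w x) < \<epsilon> / 2" by (auto simp: eventually_sequentially)
 let ?c = "%t. \<Sum>n\<le>k. c n t"
 have bd: "nrm (g t) <= ?c t * nrm w + nrm (%x. w x - E k w x)" if t: "0 < t" for t proof -
  have 1: "nrm (E k (g t)) <= ?c t * nrm w" proof (rule l2_norm_P_le[OF E_L2 w])
   show "0 <= ?c t" using c[OF t] by (intro sum_nonneg) auto
   fix n x assume x: "x \<in> C"
   show "cmod (P n (E k (g t)) x) <= ?c t * cmod (P n w x)" proof (cases "n <= k")
    case True
    have "c n t <= ?c t" using True c[OF t] by (intro member_le_sum) auto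
    then have "c n t * cmod (P n w x) <= ?c t * cmod (P n w x)" by (rule mult_right_mono) simp
    then show ?thesis using le[OF t x, of n] True P_E[OF g[OF t] x, of n k] by simp
   next
    case False
    then show ?thesis using P_E[OF g[OF t] x, of n k] c[OF t] by (simp add: sum_nonneg)
   qed
  qed
  have 2: "nrm (%x. g t x - E k (g t) x) <= 1 * nrm (%x. w x - E k w x)" proof (rule l2_norm_P_le[OF L2_diff[OF g[OF t] E_L2] L2_diff[OF w E_L2]])
   fix n x assume x: "x \<in> C"
   have "cmod (P n (g t) x) <= cmod (P n w x)" using le[OF t x, of n] mult_right_mono[of "c n t" 1 "cmod (P n w x)"] c[OF t, of n] by simp
   then show "cmod (P n (%x. g t x - E k (g t) x) x) <= 1 * cmod (P n (%x. w x - E k w x) x)" by (simp add: P_diff g t w E_L2 x P_E)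
  qed simp
  show ?thesis using l2_norm_le_add_diff[OF g[OF t] E_L2, of k "g t"] 1 2 by simp
 qed
 have "((%t. ?c t * nrm w) \<longlongrightarrow> 0 * nrm w) (at_right 0)" using tendsto_sum[of "{..k}" c "%_. 0"] lim by (intro tendsto_mult_right) simp
 then have "((%t. ?c t * nrm w) \<longlongrightarrow> 0) (at_right 0)" by simp
 from order_tendstoD(2)[OF this, of "\<epsilon> / 2"] e
 have "\<forall>\<^sub>F t in at_right 0. ?c t * nrm w < \<epsilon> / 2" by simp
 then show "\<forall>\<^sub>F t in at_right 0. dist (nrm (g t)) 0 < \<epsilon>" using at_right_pos by eventually_elim (use bd k in fastforce)
qed

lemma c0_semigroup_heat: "c0_semigroup M heat" unfolding c0_semigroup_def proof (intro conjI allI impI ballI)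
 fix t :: real and u w :: "'a => complex" and a b assume t: "0 <= t" and u: "u \<in> L2 M"
 show "heat t u \<in> L2 M" using heat_L2 t u .
 assume w: "w \<in> L2 M"
 show "AE x in M. heat t (%x. a * u x + b * w x) x = a * heat t u x + b * heat t w x" proof (rule P_determines)
  fix n x assume x: "x \<in> C"
  show "P n (heat t (%x. a * u x + b * w x)) x = P n (%x. a * heat t u x + b * heat t w x) x"
   using u w x t by (simp add: P_heat P_add P_scale L2_add L2_scale heat_L2 distrib_left mult.left_commute)
 qed (intro heat_L2 L2_add L2_scale u w t)+
next
 fix t :: real assume t: "0 <= t"
 show "EX B. ALL u:L2 M. nrm (heat t u) <= B * nrm u" proof (intro exI ballI)
  fix u assume u: "u \<in> L2 M"
  show "nrm (heat t u) <= 1 * nrm u" proof (rule l2_norm_P_le[OF heat_L2[OF t u] u])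
   show "cmod (P n (heat t u) x) <= 1 * cmod (P n u x)" if "x \<in> C" for n x unfolding P_heat[OF t u that] norm_mult norm_of_real abs_exp_cancel
    using hm_le_1[OF t, of n] by (rule mult_right_mono) simp
  qed simp
 qed
next
 fix s t :: real and u assume st: "0 <= s" "0 <= t" and u: "u \<in> L2 M"
 show "AE x in M. heat (s + t) u x = heat s (heat t u) x" proof (rule P_determines)
  fix n x assume x: "x \<in> C"
  show "P n (heat (s + t) u) x = P n (heat s (heat t u)) x" using st u x by (simp add: P_heat heat_L2 distrib_right exp_add exp_diff exp_minus field_simps)
 qed (use st u in \<open>auto intro!: heat_L2\<close>)
next
 fix u assume u: "u \<in> L2 M"
 show "AE x in M. heat 0 u x = u x" by (simp add: heat_def)
 show "((%t. nrm (%x. heat t u x - u x)) \<longlongrightarrow> 0) (at_right 0)" proof (rule tendsto_vanish[where c = "%n t. 1 - exp (- (t * \<phi> n))"])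
  fix n
  have "((%t. 1 - exp (- (t * \<phi> n))) \<longlongrightarrow> 1 - exp (- (0 * \<phi> n))) (at_right 0)" by (intro tendsto_intros)
  then show "((%t. 1 - exp (- (t * \<phi> n))) \<longlongrightarrow> 0) (at_right 0)" by simp
 next
  fix t :: real and n x assume t: "0 < t" and x: "x \<in> C"
  then have t': "0 <= t" by simp
  have "P n (%x. heat t u x - u x) x = complex_of_real (exp (- (t * \<phi> n)) - 1) * P n u x"
   using P_diff[OF heat_L2[OF t' u] u x] P_heat[OF t' u x] by (simp add: left_diff_distrib)
  then show "cmod (P n (%x. heat t u x - u x) x) <= (1 - exp (- (t * \<phi> n))) * cmod (P n u x)" using hm_le_1[OF t', of n] by (simp add: norm_mult del: of_real_diff)
 qed (use u hm_le_1 in \<open>auto intro!: L2_diff heat_L2\<close>)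
qed

text \<open>The bounds by 0 and \<open>s\<close> come from \<open>1 - s <= exp (- s)\<close> and
  \<open>exp (- s) <= 1 / (1 + s)\<close>. The quantity is the error of the difference quotient of
  \<open>exp (- s)\<close> at 0; the bound 1 dominates and the bound \<open>s\<close> gives the
  limit in \<open>tendsto_vanish\<close>.\<close>

lemma exp_quotient: assumes "0 < s" shows "0 <= 1 + (exp (- s) - 1) / s" "1 + (exp (- s) - 1) / s <= min 1 (s::real)" proof -
 have 1: "1 - s <= exp (- s)" using exp_ge_add_one_self[of "- s"] by simp
 then have "- 1 <= (exp (- s) - 1) / s" using assms by (simp add: le_divide_eq)
 then show "0 <= 1 + (exp (- s) - 1) / s" by simp
 have "exp (- s) <= 1 / (1 + s)" using exp_ge_add_one_self[of s] assms by (simp add: exp_minus inverse_eq_divide divide_left_mono)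
 then have "(exp (- s) - 1) / s <= (1 / (1 + s) - 1) / s" using assms by (intro divide_right_mono) auto
 also have "... = - 1 / (1 + s)" using assms by (simp add: divide_simps)
 also have "... <= - (1 - s)" using assms by (simp add: divide_simps algebra_simps)
 finally have "1 + (exp (- s) - 1) / s <= s" by simp
 moreover have "(exp (- s) - 1) / s <= 0" using assms by (simp add: divide_le_0_iff)
 ultimately show "1 + (exp (- s) - 1) / s <= min 1 s" by simp
qed

lemma hm_quotient_tendsto:
 "((%t. (hm t n - 1) / complex_of_real t + complex_of_real (\<phi> n)) \<longlongrightarrow> 0) (at_right 0)" proof (cases "n = 0")
 case True
 then show ?thesis by (simp add: \<phi>_0)
next
 case False
 then have pos: "0 < \<phi> n" using \<phi>_pos by simp
 have "((%t. t * (\<phi> n * \<phi> n)) \<longlongrightarrow> 0 * (\<phi> n * \<phi> n)) (at_right 0)" by (intro tendsto_intros)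
 then have lim: "((%t. t * (\<phi> n * \<phi> n)) \<longlongrightarrow> 0) (at_right 0)" by simp
 show ?thesis proof (rule Lim_null_comparison[OF _ lim])
  show "\<forall>\<^sub>F t in at_right 0. norm ((hm t n - 1) / complex_of_real t + complex_of_real (\<phi> n)) <= t * (\<phi> n * \<phi> n)"
   using at_right_pos proof eventually_elim
   fix t :: real assume t: "0 < t"
   have s: "0 < t * \<phi> n" using t pos by simp
   have "(hm t n - 1) / complex_of_real t + complex_of_real (\<phi> n)
     = complex_of_real (\<phi> n * (1 + (exp (- (t * \<phi> n)) - 1) / (t * \<phi> n)))" using t pos by (simp add: field_simps)
   then have "norm ((hm t n - 1) / complex_of_real t + complex_of_real (\<phi> n)) = \<phi> n * (1 + (exp (- (t * \<phi> n)) - 1) / (t * \<phi> n))"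
    using exp_quotient(1)[OF s] pos by (simp only: norm_of_real abs_mult abs_of_nonneg less_imp_le)
   also have "... <= \<phi> n * (t * \<phi> n)" using exp_quotient(2)[OF s] pos by (intro mult_left_mono) auto
   finally show "norm ((hm t n - 1) / complex_of_real t + complex_of_real (\<phi> n)) <= t * (\<phi> n * \<phi> n)" by (simp add: mult.left_commute)
  qed
 qed
qed

lemma P_tendsto:
 fixes g :: "real => 'a => complex" assumes g: "!!t. 0 < t ==> g t \<in> L2 M" and lim: "((%t. nrm (g t)) \<longlongrightarrow> 0) (at_right 0)" and x: "x \<in> C"
 shows "((%t. P n (g t) x) \<longlongrightarrow> 0) (at_right 0)" proof (rule Lim_null_comparison)
 show "\<forall>\<^sub>F t in at_right 0. norm (P n (g t) x) <= 2 * real (N n) * nrm (g t)" using at_right_pos by eventually_elim (intro P_bound g x)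
 show "((%t. 2 * real (N n) * nrm (g t)) \<longlongrightarrow> 0) (at_right 0)" by (rule tendsto_mult_right_zero[OF lim])
qed

text \<open>For one inclusion the components of the difference quotient converge by
  \<open>P_tendsto\<close> and identify the generator. For the other the error of the quotient has
  components \<open>c n t * P n w\<close>, with factors between 0 and 1 that vanish as
  \<open>t\<close> tends to 0.\<close>

lemma generator_heat: "semigroup_generator M heat = {(u, %x. - w x) |u w. (u, w) \<in> A}" proof (intro equalityI subsetI)
 fix z assume "z \<in> semigroup_generator M heat"
 then obtain u w where z: "z = (u, w)" and u: "u \<in> L2 M" and w: "w \<in> L2 M"
  and lim: "((%t. nrm (%x. (heat t u x - u x) / complex_of_real t - w x)) \<longlongrightarrow> 0) (at_right 0)" by (auto simp: semigroup_generator_def)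
 have gL: "(%x. (heat t u x - u x) / complex_of_real t - w x) \<in> L2 M" if "0 < t" for t
  using L2_diff[OF L2_scale[OF L2_diff[OF heat_L2[of t u] u], of "1 / complex_of_real t"] w] that u by simp
 have "(u, %x. - w x) \<in> A" proof (rule A_I[OF u L2_uminus[OF w]])
  fix n x assume x: "x \<in> C"
  have 1: "((%t. P n (%x. (heat t u x - u x) / complex_of_real t - w x) x) \<longlongrightarrow> 0) (at_right 0)" by (rule P_tendsto[OF gL lim x])
  have 2: "P n (%x. (heat t u x - u x) / complex_of_real t - w x) x = (hm t n - 1) / complex_of_real t * P n u x - P n w x" if t: "0 < t" for t proof -
   have h: "heat t u \<in> L2 M" using heat_L2 u t by simp
   have eq: "(%x. (heat t u x - u x) / complex_of_real t - w x) = (%x. 1 / complex_of_real t * (heat t u x - u x) - w x)" by simp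
   have "P n (%x. 1 / complex_of_real t * (heat t u x - u x) - w x) x
     = 1 / complex_of_real t * (P n (heat t u) x - P n u x) - P n w x" using h u w x by (simp add: P_diff P_scale L2_diff L2_scale del: times_divide_eq_left mult_1)
   then show ?thesis unfolding eq using P_heat[OF _ u x, of t n] t by (simp only: less_imp_le) (simp add: left_diff_distrib)
  qed
  have "((%t. ((hm t n - 1) / complex_of_real t + complex_of_real (\<phi> n)) * P n u x - P n (%x. (heat t u x - u x) / complex_of_real t - w x) x)
   \<longlongrightarrow> 0 * P n u x - 0) (at_right 0)" by (intro tendsto_intros hm_quotient_tendsto 1)
  moreover have "\<forall>\<^sub>F t in at_right 0. ((hm t n - 1) / complex_of_real t + complex_of_real (\<phi> n)) * P n u x - P n (%x. (heat t u x - u x) / complex_of_real t - w x) x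
    = complex_of_real (\<phi> n) * P n u x + P n w x" using at_right_pos by eventually_elim (simp add: 2 distrib_right)
  ultimately have "((%t::real. complex_of_real (\<phi> n) * P n u x + P n w x) \<longlongrightarrow> 0) (at_right 0)" by (simp add: tendsto_cong)
  then have "complex_of_real (\<phi> n) * P n u x + P n w x = 0" by (subst (asm) tendsto_const_iff) auto
  then have "- P n w x = complex_of_real (\<phi> n) * P n u x" by (simp add: add_eq_0_iff)
  then show "P n (%x. - w x) x = complex_of_real (\<phi> n) * P n u x" using P_scale[of n "-1" w x] by simp
 qed
 then show "z \<in> {(u, %x. - w x) |u w. (u, w) \<in> A}" unfolding z by force
next
 fix z assume "z \<in> {(u, %x. - w x) |u w. (u, w) \<in> A}"
 then obtain u w where z: "z = (u, %x. - w x)" and uw: "(u, w) \<in> A" by blast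
 note a = A_D[OF uw]
 \<comment> \<open>Substituting \<open>P n u = P n w / \<phi> n\<close> leaves the error estimated
   in \<open>exp_quotient\<close>, with \<open>s = t * \<phi> n\<close>. At level 0 the error is
   zero.\<close>
 define c where "c n t = (if n = 0 then 0 else 1 + (exp (- (t * \<phi> n)) - 1) / (t * \<phi> n))" for n and t :: real
 have c: "0 <= c n t & c n t <= min 1 (t * \<phi> n)" if "0 < t" for n t using exp_quotient[of "t * \<phi> n"] that \<phi>_pos[of n] \<phi>_0 by (auto simp: c_def)
 have "((%t. nrm (%x. (heat t u x - u x) / complex_of_real t - - w x)) \<longlongrightarrow> 0) (at_right 0)" proof (rule tendsto_vanish[where c = c and w = w])
  fix n
  have "((%t. t * \<phi> n) \<longlongrightarrow> 0 * \<phi> n) (at_right 0)" by (intro tendsto_intros)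
  then have lim: "((%t. t * \<phi> n) \<longlongrightarrow> 0) (at_right 0)" by simp
  show "(c n \<longlongrightarrow> 0) (at_right 0)" proof (rule Lim_null_comparison[OF _ lim])
   show "\<forall>\<^sub>F t in at_right 0. norm (c n t) <= t * \<phi> n" using at_right_pos by eventually_elim (use c in force)
  qed
 next
  fix t :: real assume t: "0 < t"
  show "(%x. (heat t u x - u x) / complex_of_real t - - w x) \<in> L2 M"
   using L2_add[OF L2_scale[OF L2_diff[OF heat_L2[of t u] a(1)], of "1 / complex_of_real t"] a(2)] t a(1) by simp
  fix n x assume x: "x \<in> C"
  have h: "heat t u \<in> L2 M" using heat_L2 a(1) t by simp
  have eq: "(%x. (heat t u x - u x) / complex_of_real t - - w x) = (%x. 1 / complex_of_real t * (heat t u x - u x) + w x)" by simp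
  have "P n (%x. 1 / complex_of_real t * (heat t u x - u x) + w x) x
    = 1 / complex_of_real t * (P n (heat t u) x - P n u x) + P n w x" using h a(1,2) x by (simp add: P_diff P_add P_scale L2_diff L2_scale del: times_divide_eq_left mult_1)
  then have 1: "P n (%x. (heat t u x - u x) / complex_of_real t - - w x) x = (hm t n - 1) / complex_of_real t * P n u x + P n w x"
   unfolding eq using P_heat[OF _ a(1) x, of t n] t by (simp only: less_imp_le) (simp add: left_diff_distrib)
  have "... = complex_of_real (c n t) * P n w x" proof (cases "n = 0")
   case True
   then show ?thesis using a(3)[OF x, of 0] by (simp add: \<phi>_0 c_def)
  next
   case False
   have "P n u x = P n w x / complex_of_real (\<phi> n)" using a(3)[OF x, of n] \<phi>_pos[of n] False by simp
   then show ?thesis using False \<phi>_pos[of n] t by (simp add: c_def field_simps)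
  qed
  then show "cmod (P n (%x. (heat t u x - u x) / complex_of_real t - - w x) x) <= c n t * cmod (P n w x)" unfolding 1 using c[OF t, of n] by (simp add: norm_mult)
 qed (use c a(2) in auto)
 then show "z \<in> semigroup_generator M heat" unfolding semigroup_generator_def z using a(1) L2_uminus[OF a(2)] by simp
qed

theorem exp_semigroup_heat: "exp_semigroup M A heat" unfolding exp_semigroup_def using c0_semigroup_heat generator_heat by blast

lemma P_lin_sum: assumes "!!i. i \<in> I ==> f i \<in> L2 M" "x \<in> C" shows "P n (%x. \<Sum>i\<in>I. c i * f i x) x = (\<Sum>i\<in>I. c i * P n (f i) x)" proof -
 have "integrable M (%x. c i * f i x)" if "i \<in> I" for i using assms(1)[OF that] by (intro integrable_mult_right L2_integrable)
 then show ?thesis using assms(2) E_sum[of I "%i x. c i * f i x" x] by (simp add: P_def E_scale sum_subtractf right_diff_distrib)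
qed

context
 fixes T :: "real => ('a => complex) => 'a => complex" assumes T: "exp_semigroup M A T"
begin

lemma T_c0: "c0_semigroup M T" using T by (simp add: exp_semigroup_def)

lemma T_generator: "semigroup_generator M T = {(u, %x. - w x) |u w. (u, w) \<in> A}" using T by (simp add: exp_semigroup_def)

lemmas T_L2 = semigroup_L2[OF T_c0]

lemma P_in_generator: assumes h: "h \<in> L2 M"
 shows "((%s. nrm (%x. (T s (P n h) x - P n h x) / complex_of_real s + complex_of_real (\<phi> n) * P n h x)) \<longlongrightarrow> 0) (at_right 0)" proof -
 have "(P n h, %x. - (complex_of_real (\<phi> n) * P n h x)) \<in> semigroup_generator M T" unfolding T_generator using P_in_A[OF h, of n] 
  by (intro CollectI exI[of _ "P n h"] exI[of _ "%x. complex_of_real (\<phi> n) * P n h x"] conjI refl)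
 then show ?thesis by (simp add: semigroup_generator_def)
qed

text \<open>\<open>T t\<close> commutes with every \<open>T s\<close> and is bounded, so it carries
  the eigenvalue equation of the generator from \<open>P n h\<close> to \<open>T t (P n h)\<close>.
  Hence the range of \<open>P n\<close> is invariant.\<close>

lemma T_eigenspace: assumes h: "h \<in> L2 M" and t: "0 <= t" shows "AE x in M. T t (P n h) x = P n (T t (P n h)) x" proof -
 let ?f = "P n h" and ?c = "complex_of_real (\<phi> n)"
 note f = P_L2[of n h]
 note Tf = T_L2[OF t f]
 obtain B where B: "0 <= B" "ALL u:L2 M. nrm (T t u) <= B * nrm u" by (rule semigroup_bound[OF T_c0 t])
 have le: "nrm (%x. (T s (T t ?f) x - T t ?f x) / complex_of_real s + ?c * T t ?f x)
   <= B * nrm (%x. (T s ?f x - ?f x) / complex_of_real s + ?c * ?f x)" if s: "0 < s" for s proof -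
  have s': "0 <= s" using s by simp
  let ?g = "%x. 1 / complex_of_real s * T s ?f x + (?c - 1 / complex_of_real s) * ?f x"
  have g: "?g \<in> L2 M" by (intro L2_add L2_scale T_L2 s' f)
  have "AE x in M. T s (T t ?f) x = T t (T s ?f) x" using semigroup_plus[OF T_c0 s' t f] semigroup_plus[OF T_c0 t s' f, unfolded add.commute[of t s]]
   by eventually_elim (rule trans[OF sym])
  then have "AE x in M. (T s (T t ?f) x - T t ?f x) / complex_of_real s + ?c * T t ?f x = T t ?g x"
   using semigroup_linear[OF T_c0 t T_L2[OF s' f] f, of "1 / complex_of_real s" "?c - 1 / complex_of_real s"] proof eventually_elim
   fix x
   assume 1: "T s (T t ?f) x = T t (T s ?f) x" and 2: "T t ?g x = 1 / complex_of_real s * T t (T s ?f) x + (?c - 1 / complex_of_real s) * T t ?f x"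
   show "(T s (T t ?f) x - T t ?f x) / complex_of_real s + ?c * T t ?f x = T t ?g x" unfolding 1 2 by (simp add: diff_divide_distrib left_diff_distrib)
  qed
  moreover have "(%x. (T s (T t ?f) x - T t ?f x) / complex_of_real s + ?c * T t ?f x) \<in> L2 M"
   using L2_add[OF L2_scale[OF L2_diff[OF T_L2[OF s' Tf] Tf], of "1 / complex_of_real s"] L2_scale[OF Tf, of ?c]] by simp
  ultimately have "nrm (%x. (T s (T t ?f) x - T t ?f x) / complex_of_real s + ?c * T t ?f x) = nrm (T t ?g)"
   using T_L2[OF t g] by (intro l2_norm_cong_AE) (auto intro: L2_measurable)
  also have "... <= B * nrm ?g" using B(2) g by blast
  also have "?g = (%x. (T s ?f x - ?f x) / complex_of_real s + ?c * ?f x)" by (simp add: algebra_simps diff_divide_distrib)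
  finally show ?thesis .
 qed
 have lim: "((%s. nrm (%x. (T s (T t ?f) x - T t ?f x) / complex_of_real s + ?c * T t ?f x)) \<longlongrightarrow> 0) (at_right 0)" proof (rule Lim_null_comparison)
  show "((%s. B * nrm (%x. (T s ?f x - ?f x) / complex_of_real s + ?c * ?f x)) \<longlongrightarrow> 0) (at_right 0)"
   by (rule tendsto_mult_right_zero[OF P_in_generator[OF h]])
  show "\<forall>\<^sub>F s in at_right 0. norm (nrm (%x. (T s (T t ?f) x - T t ?f x) / complex_of_real s + ?c * T t ?f x))
    <= B * nrm (%x. (T s ?f x - ?f x) / complex_of_real s + ?c * ?f x)" using at_right_pos by eventually_elim (use le in simp)
 qed
 have "(T t ?f, %x. - (?c * T t ?f x)) \<in> semigroup_generator M T" unfolding semigroup_generator_def using Tf L2_uminus[OF L2_scale[OF Tf]] lim by simp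
 then obtain w where w: "(T t ?f, w) \<in> A" "(%x. - (?c * T t ?f x)) = (%x. - w x)" unfolding T_generator by blast
 have "w = (%x. ?c * T t ?f x)" using w(2) by (simp add: fun_eq_iff)
 then have "T t ?f \<in> op_eigenspace M A ?c" unfolding op_eigenspace_def using w(1) by auto
 then show ?thesis by (simp add: eigenspace_iff)
qed

text \<open>A bound, relative to the norm of the vector, for the error of one step
  \<open>T s\<close> against \<open>exp (- (s * \<phi> n))\<close> on the range of
  \<open>P n\<close>. The projected indicators of cosets span this range, and the factor
  \<open>2 * real (N n)\<close> bounds the coefficients through \<open>P_bound\<close>.\<close>

definition \<rho> :: "nat => real => real" where
 "\<rho> n s = (\<Sum>S\<in>cls n. 2 * real (N n) * nrm (%x. T s (P n (indicator S)) x - hm s n * P n (indicator S) x))"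

lemma \<rho>_nonneg: "0 <= \<rho> n s" by (auto simp: \<rho>_def intro!: sum_nonneg)

lemma T_step: assumes h: "h \<in> L2 M" and s: "0 <= s" shows "nrm (%x. T s (P n h) x - hm s n * P n h x) <= \<rho> n s * nrm (P n h)" proof -
 let ?f = "P n h" and ?e = "%S. P n (indicator S)" and ?c = "%S. P n h (rep S)"
 note f = P_L2[of n h]
 have eL: "?e S \<in> L2 M" for S by (rule P_L2)
 have expand: "?f x = (\<Sum>S\<in>cls n. ?c S * ?e S x)" if x: "x \<in> C" for x proof -
  have "?f x = P n ?f x" using P_P[OF h x] by simp
  also have "... = P n (%x. \<Sum>S\<in>cls n. ?c S * indicator S x) x"

   by (rule P_cong) (auto simp: lc_expand[OF P_lc] indicator_def intro!: sum.cong)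
  also have "... = (\<Sum>S\<in>cls n. ?c S * ?e S x)" using indicator_L2[OF cls_sets] x by (intro P_lin_sum) auto
  finally show ?thesis .
 qed
 have sumL: "(%x. \<Sum>S\<in>cls n. ?c S * ?e S x) \<in> L2 M" by (intro L2_sum L2_scale eL)
 have "AE x in M. T s ?f x = T s (%x. \<Sum>S\<in>cls n. ?c S * ?e S x) x" using expand by (intro semigroup_cong[OF T_c0 s f sumL] AE_I2) (simp add: space_M)
 moreover have "AE x in M. T s (%x. \<Sum>S\<in>cls n. ?c S * ?e S x) x = (\<Sum>S\<in>cls n. ?c S * T s (?e S) x)" by (rule semigroup_sum[OF T_c0 s finite_cls eL])
 ultimately have "AE x in M. T s ?f x - hm s n * ?f x = (\<Sum>S\<in>cls n. ?c S * (T s (?e S) x - hm s n * ?e S x))" using AE_space proof eventually_elim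
  fix x assume x: "T s ?f x = T s (%x. \<Sum>S\<in>cls n. ?c S * ?e S x) x"
   "T s (%x. \<Sum>S\<in>cls n. ?c S * ?e S x) x = (\<Sum>S\<in>cls n. ?c S * T s (?e S) x)" "x \<in> space M"
  have "T s ?f x - hm s n * ?f x = (\<Sum>S\<in>cls n. ?c S * T s (?e S) x) - hm s n * (\<Sum>S\<in>cls n. ?c S * ?e S x)" using x expand[of x] by (simp only: space_M)
  then show "T s ?f x - hm s n * ?f x = (\<Sum>S\<in>cls n. ?c S * (T s (?e S) x - hm s n * ?e S x))"
   by (simp only: right_diff_distrib sum_subtractf sum_distrib_left mult.left_commute)
 qed
 moreover have dL: "(%x. T s (?e S) x - hm s n * ?e S x) \<in> L2 M" for S by (intro L2_diff L2_scale T_L2 s eL)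
 moreover have fL: "(%x. T s ?f x - hm s n * ?f x) \<in> L2 M" by (intro L2_diff L2_scale T_L2 s f)
 ultimately have "nrm (%x. T s ?f x - hm s n * ?f x) = nrm (%x. \<Sum>S\<in>cls n. ?c S * (T s (?e S) x - hm s n * ?e S x))"
  by (intro l2_norm_cong_AE L2_measurable L2_sum L2_scale)
 also have "... <= (\<Sum>S\<in>cls n. nrm (%x. ?c S * (T s (?e S) x - hm s n * ?e S x)))" by (intro l2_norm_sum L2_scale dL)
 also have "... <= (\<Sum>S\<in>cls n. 2 * real (N n) * nrm ?f * nrm (%x. T s (?e S) x - hm s n * ?e S x))" proof (rule sum_mono)
  fix S assume "S \<in> cls n"
  then have r: "rep S \<in> C" by (rule rep_cl(2))
  have "cmod (?c S) <= 2 * real (N n) * nrm ?f" using P_bound[OF f r, of n] P_P[OF h r, of n n] by simp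
  then show "nrm (%x. ?c S * (T s (?e S) x - hm s n * ?e S x))
    <= 2 * real (N n) * nrm ?f * nrm (%x. T s (?e S) x - hm s n * ?e S x)" unfolding l2_norm_scale by (rule mult_right_mono) simp
 qed
 also have "... = \<rho> n s * nrm ?f" unfolding \<rho>_def sum_distrib_right by (simp add: mult_ac)
 finally show ?thesis .
qed

text \<open>On each of the finitely many spanning vectors both \<open>T s\<close> and the
  exponential have derivative \<open>- \<phi> n\<close> at 0, so the error of a step is of smaller
  order than its length.\<close>

lemma \<rho>_tendsto: "((%s. \<rho> n s / s) \<longlongrightarrow> 0) (at_right 0)" proof -
 have "((%s. nrm (%x. T s (P n (indicator S)) x - hm s n * P n (indicator S) x) / s) \<longlongrightarrow> 0) (at_right 0)" if "S \<in> cls n" for S proof -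
  let ?e = "P n (indicator S)" and ?q = "%s. (hm s n - 1) / complex_of_real s + complex_of_real (\<phi> n)"
  have i: "indicator S \<in> L2 M" using indicator_L2[OF cls_sets[OF that]] by simp
  have eL: "?e \<in> L2 M" by (rule P_L2)
  show ?thesis proof (rule Lim_null_comparison)
   show "\<forall>\<^sub>F s in at_right 0. norm (nrm (%x. T s ?e x - hm s n * ?e x) / s)
    <= nrm (%x. (T s ?e x - ?e x) / complex_of_real s + complex_of_real (\<phi> n) * ?e x) + cmod (?q s) * nrm ?e" using at_right_pos
   proof eventually_elim
    fix s :: real assume s: "0 < s"
    then have s': "0 <= s" by simp
    let ?g = "%x. (T s ?e x - ?e x) / complex_of_real s + complex_of_real (\<phi> n) * ?e x"
    have g: "?g \<in> L2 M" using L2_add[OF L2_scale[OF L2_diff[OF T_L2[OF s' eL] eL], of "1 / complex_of_real s"] L2_scale[OF eL]] by simp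
    have "norm (nrm (%x. T s ?e x - hm s n * ?e x) / s) = cmod (1 / complex_of_real s) * nrm (%x. T s ?e x - hm s n * ?e x)" using s by (simp add: norm_divide)
    also have "... = nrm (%x. 1 / complex_of_real s * (T s ?e x - hm s n * ?e x))" by (rule l2_norm_scale[symmetric])
    also have "... = nrm (%x. ?g x + (- ?q s) * ?e x)" using s by (intro l2_norm_cong) (simp add: field_simps)
    also have "... <= nrm ?g + nrm (%x. (- ?q s) * ?e x)" by (intro l2_norm_triangle g L2_scale eL)
    finally show "norm (nrm (%x. T s ?e x - hm s n * ?e x) / s) <= nrm ?g + cmod (?q s) * nrm ?e" unfolding l2_norm_scale norm_minus_cancel .
   qed
   have "((%s. nrm (%x. (T s ?e x - ?e x) / complex_of_real s + complex_of_real (\<phi> n) * ?e x) + cmod (?q s) * nrm ?e) \<longlongrightarrow> 0 + 0 * nrm ?e) (at_right 0)"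
    by (intro tendsto_add tendsto_mult tendsto_const P_in_generator[OF i] tendsto_norm_zero hm_quotient_tendsto)
   then show "((%s. nrm (%x. (T s ?e x - ?e x) / complex_of_real s + complex_of_real (\<phi> n) * ?e x) + cmod (?q s) * nrm ?e) \<longlongrightarrow> 0) (at_right 0)" by simp
  qed
 qed
 then have "((%s. \<Sum>S\<in>cls n. 2 * real (N n) * (nrm (%x. T s (P n (indicator S)) x - hm s n * P n (indicator S) x) / s)) \<longlongrightarrow> (\<Sum>S\<in>cls n. 2 * real (N n) * 0)) (at_right 0)"
  by (intro tendsto_sum tendsto_mult tendsto_const)
 then show ?thesis by (simp add: \<rho>_def sum_divide_distrib)
qed

text \<open>Since the range of \<open>P n\<close> is invariant, the one-step estimate applies to the
  vector reached at every stage, and the relative errors accumulate like compound interest.\<close>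

lemma T_iterate: assumes h: "h \<in> L2 M" and s: "0 <= s" shows "nrm (%x. T (real k * s) (P n h) x - hm (real k * s) n * P n h x) <= ((1 + \<rho> n s) ^ k - 1) * nrm (P n h)"
proof (induction k)
 case 0
 note f = P_L2[of n h]
 have "nrm (%x. T 0 (P n h) x - P n h x) = 0" using semigroup_0[OF T_c0 f] L2_diff[OF T_L2[of 0, OF order_refl f] f] by (subst l2_norm_eq_0) (auto elim: eventually_mono)
 then show ?case by simp
next
 case (Suc k)
 let ?f = "P n h" and ?t = "real k * s"
 note f = P_L2[of n h]
 have t: "0 <= ?t" using s by simp
 let ?g = "T ?t ?f"
 note gL = T_L2[OF t f]
 let ?g' = "P n ?g"
 note g'L = P_L2[of n ?g]
 have gg: "AE x in M. ?g x = ?g' x" by (rule T_eigenspace[OF h t])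
 let ?d = "nrm (%x. ?g x - hm ?t n * ?f x)"
 have d: "?d = nrm (%x. ?g' x - hm ?t n * ?f x)" using gg by (intro l2_norm_cong_AE L2_measurable L2_diff L2_scale gL g'L f) (auto elim: eventually_mono)
 have st: "real (Suc k) * s = s + ?t" by (simp add: algebra_simps)
 have hmst: "hm (s + ?t) n = hm s n * hm ?t n" by (simp add: distrib_right exp_diff exp_minus field_simps)
 have 1: "AE x in M. T (s + ?t) ?f x = T s ?g' x" using semigroup_plus[OF T_c0 s t f] semigroup_cong[OF T_c0 s gL g'L gg] by (auto elim: eventually_elim2)
 have aL: "(%x. T s ?g' x - hm s n * ?g' x) \<in> L2 M" by (intro L2_diff L2_scale T_L2 s g'L)
 have bL: "(%x. ?g' x - hm ?t n * ?f x) \<in> L2 M" by (intro L2_diff L2_scale g'L f)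
 have st0: "0 <= s + ?t" using s t by simp
 have cL: "(%x. T (s + ?t) ?f x - hm (s + ?t) n * ?f x) \<in> L2 M" by (intro L2_diff L2_scale T_L2 f st0)
 have alg: "a - s * t * f = (a - s * g) + s * (g - t * f)" for a s t f g :: complex by (simp add: algebra_simps)
 have "nrm (%x. T (s + ?t) ?f x - hm (s + ?t) n * ?f x)
   = nrm (%x. (T s ?g' x - hm s n * ?g' x) + hm s n * (?g' x - hm ?t n * ?f x))"
  by (rule l2_norm_cong_AE[OF L2_measurable[OF cL] L2_measurable[OF L2_add[OF aL L2_scale[OF bL]]]])
   (use 1 in eventually_elim, simp only: hmst, rule alg)
 also have "... <= nrm (%x. T s ?g' x - hm s n * ?g' x) + nrm (%x. hm s n * (?g' x - hm ?t n * ?f x))" by (intro l2_norm_triangle aL L2_scale bL)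
 also have "... <= \<rho> n s * nrm ?g' + 1 * ?d" unfolding l2_norm_scale d using hm_le_1[OF s, of n] by (intro add_mono T_step gL s mult_right_mono) auto
 also have "... <= \<rho> n s * (?d + nrm ?f) + 1 * ?d" proof (intro add_right_mono mult_left_mono \<rho>_nonneg)
  have "nrm ?g' <= nrm (%x. hm ?t n * ?f x) + nrm (%x. ?g' x - hm ?t n * ?f x)" by (intro l2_norm_le_add_diff g'L L2_scale f)
  also have "... <= 1 * nrm ?f + ?d" unfolding l2_norm_scale d using hm_le_1[OF t, of n] by (intro add_mono mult_right_mono) auto
  finally show "nrm ?g' <= ?d + nrm ?f" by simp
 qed
 also have "... = (1 + \<rho> n s) * ?d + \<rho> n s * nrm ?f" by (simp add: algebra_simps)
 also have "... <= (1 + \<rho> n s) * (((1 + \<rho> n s) ^ k - 1) * nrm ?f) + \<rho> n s * nrm ?f"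
  using Suc \<rho>_nonneg[of n s] by (intro add_right_mono mult_left_mono) auto
 also have "... = ((1 + \<rho> n s) ^ Suc k - 1) * nrm ?f" by (simp add: algebra_simps)
 finally show ?case unfolding st .
qed

text \<open>Divide \<open>t\<close> into equal steps of length \<open>s\<close>: the accumulated
  relative error is at most \<open>exp (t * (\<rho> n s / s)) - 1\<close>, which tends to 0 with
  \<open>s\<close> by \<open>\<rho>_tendsto\<close>.\<close>

lemma T_P: assumes h: "h \<in> L2 M" and t: "0 < t" shows "AE x in M. T t (P n h) x = hm t n * P n h x" proof (rule l2_norm_diff_0)
 let ?f = "P n h" and ?s = "%j. t / real (Suc j)"
 have t0: "0 <= t" using t by simp
 show "T t ?f \<in> L2 M" "(%x. hm t n * ?f x) \<in> L2 M" by (intro T_L2 L2_scale P_L2 t0)+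
 let ?d = "nrm (%x. T t ?f x - hm t n * ?f x)"
 have "?d <= (exp (t * (\<rho> n (?s j) / ?s j)) - 1) * nrm ?f" for j proof -
  have s: "0 <= ?s j" "real (Suc j) * ?s j = t" using t by simp_all
  have "(1 + \<rho> n (?s j)) ^ Suc j <= exp (\<rho> n (?s j)) ^ Suc j" using \<rho>_nonneg[of n "?s j"] exp_ge_add_one_self[of "\<rho> n (?s j)"] by (intro power_mono) auto
  also have "... = exp (real (Suc j) * \<rho> n (?s j))" by (simp only: exp_of_nat_mult)
  also have "real (Suc j) * \<rho> n (?s j) = t * (\<rho> n (?s j) / ?s j)" using t by simp
  finally have "((1 + \<rho> n (?s j)) ^ Suc j - 1) * nrm ?f <= (exp (t * (\<rho> n (?s j) / ?s j)) - 1) * nrm ?f" by (intro mult_right_mono) auto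
  then show ?thesis using T_iterate[OF h s(1), of "Suc j" n] unfolding s(2) by linarith
 qed
 moreover have "(%j. (exp (t * (\<rho> n (?s j) / ?s j)) - 1) * nrm ?f) \<longlonglongrightarrow> (exp (t * 0) - 1) * nrm ?f" proof (intro tendsto_intros)
  have "filterlim ?s (at_right 0) sequentially" unfolding filterlim_at using t LIMSEQ_Suc[OF lim_const_over_n[of t]] by auto
  from filterlim_compose[OF \<rho>_tendsto this] show "(%j. \<rho> n (?s j) / ?s j) \<longlonglongrightarrow> 0" .
 qed
 ultimately have "?d <= (exp (t * 0) - 1) * nrm ?f" by (intro LIMSEQ_le_const) auto
 then show "?d = 0" by (simp add: order_antisym)
qed

text \<open>Both semigroups agree on the truncations \<open>E k u\<close>, where they act through
  finitely many exponentials, and boundedness carries the agreement over to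
  \<open>u\<close>.\<close>

theorem exp_semigroup_unique: assumes u: "u \<in> L2 M" and t: "0 < t" shows "AE x in M. T t u x = heat t u x" proof (rule l2_norm_limit_unique)
 have t0: "0 <= t" using t by simp
 show TL: "T t u \<in> L2 M" and HL: "heat t u \<in> L2 M" by (intro T_L2 heat_L2 u t0)+
 let ?s = "%k x. \<Sum>n\<le>k. hm t n * P n u x"
 show sL: "?s k \<in> L2 M" for k by (intro L2_sum L2_scale P_L2)
 have s1: "AE x in M. T t (E k u) x = ?s k x" for k proof -
  have "AE x in M. T t (%x. \<Sum>n\<in>{..k}. 1 * P n u x) x = (\<Sum>n\<in>{..k}. 1 * T t (P n u) x)" by (rule semigroup_sum[OF T_c0 t0]) (auto intro: P_L2)
  moreover have "AE x in M. ALL n:{..k}. T t (P n u) x = hm t n * P n u x" using T_P[OF u t] by (intro AE_finite_allI) auto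
  moreover have "E k u = (%x. \<Sum>n\<in>{..k}. 1 * P n u x)" by (simp add: E_sum_P fun_eq_iff)
  ultimately show ?thesis by (auto elim!: eventually_elim2)
 qed
 have s2: "AE x in M. heat t (E k u) x = ?s k x" for k proof (rule P_determines[OF heat_L2[OF t0 E_L2] sL])
  fix m x assume x: "x \<in> C"
  have "P m (?s k) x = (\<Sum>n\<le>k. hm t n * P m (P n u) x)" by (rule P_lin_sum[OF P_L2 x])
  also have "... = (\<Sum>n\<le>k. if n = m then hm t m * P m u x else 0)" by (intro sum.cong refl) (auto simp: P_P[OF u x])
  also have "... = (if m <= k then hm t m * P m u x else 0)" by (simp add: sum.delta)
  finally show "P m (heat t (E k u)) x = P m (?s k) x" using P_heat[OF t0 E_L2 x, of m k u] P_E[OF u x, of m k] by simp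
 qed
 have lim: "(%k. nrm (%x. R t u x - ?s k x)) \<longlonglongrightarrow> 0" if R: "c0_semigroup M R" and eq: "!!k. AE x in M. R t (E k u) x = ?s k x" for R proof -
  note RL = semigroup_L2[OF R t0]
  obtain B where B: "0 <= B" "ALL u:L2 M. nrm (R t u) <= B * nrm u" by (rule semigroup_bound[OF R t0])
  have "nrm (%x. R t u x - ?s k x) <= B * nrm (%x. u x - E k u x)" for k proof -
   have "nrm (%x. R t u x - ?s k x) = nrm (R t (%x. u x - E k u x))" using semigroup_diff[OF R t0 u E_L2[of k u]] eq[of k]
    by (intro l2_norm_cong_AE L2_measurable L2_diff RL u E_L2 sL) (auto elim!: eventually_elim2)
   then show ?thesis using B(2) L2_diff[OF u E_L2[of k u]] by simp
  qed
  moreover have "(%k. B * nrm (%x. u x - E k u x)) \<longlonglongrightarrow> 0" by (rule tendsto_mult_right_zero[OF E_tendsto[OF u]])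
  ultimately show ?thesis by (intro Lim_null_comparison[of "%k. nrm (%x. R t u x - ?s k x)" "%k. B * nrm (%x. u x - E k u x)" sequentially]
     always_eventually allI) simp_all
 qed
 show "(%k. nrm (%x. T t u x - ?s k x)) \<longlonglongrightarrow> 0" by (rule lim[OF T_c0 s1])
 show "(%k. nrm (%x. heat t u x - ?s k x)) \<longlonglongrightarrow> 0" by (rule lim[OF c0_semigroup_heat s2])
qed

end

subsection \<open>The heat kernel\<close>

lemma singleton_null: assumes x: "x \<in> C" shows "{x} \<in> sets M" "AE y in M. y ~= x" proof -
 have eq: "dv x -` {\<one>} Int space M = {x}" proof -
  have "y = x" if "y \<in> C" "dv x y = \<one>" for y using dv_dv_left[OF x that(1)] that(2) x by simp
  then show ?thesis using x by (auto simp: space_M)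
 qed
 show s: "{x} \<in> sets M" using measurable_sets[OF dv_left(1)[OF x] one_null(1)] eq by simp
 have "emeasure M {x} = emeasure (distr M M (dv x)) {\<one>}" using emeasure_distr[OF dv_left(1)[OF x] one_null(1)] eq by simp
 also have "... = 0" using one_null(2) dv_left(2)[OF x] by (simp add: emeasure_eq_measure)
 finally show "AE y in M. y ~= x" using s by (intro AE_I[of _ _ "{x}"]) auto
qed

text \<open>Values are prescribed off the unit only, so that \<open>G_kernel\<close>, whose level is
  unspecified at the unit, qualifies.\<close>

definition is_heat_kernel :: "(real => 'a => real) => bool" where
 "is_heat_kernel H \<longleftrightarrow> (ALL t l. ALL z:W l - W (Suc l). H t z = (\<Sum>n\<le>l. p t n * real (N n)))"

lemma heat_kernel_pos: assumes "is_heat_kernel H" "0 < t" "z \<in> W l - W (Suc l)" shows "0 < H t z" proof -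
 have "0 < (\<Sum>n\<le>l. p t n * real (N n))" using p_pos[OF assms(2)] by (intro sum_pos mult_pos_pos) (auto simp: N_pos)
 then show ?thesis using assms by (simp add: is_heat_kernel_def)
qed

lemma mem_W_level: "z \<in> W l - W (Suc l) ==> z \<in> W n \<longleftrightarrow> n <= l" using W_antimono[of n l] W_antimono[of "Suc l" n] by (cases "n <= l") auto

text \<open>For \<open>y\<close> different from \<open>x\<close> the kernel is a finite sum of
  multiples of the indicators of the cosets \<open>cl n x\<close>, so its integral against
  \<open>u\<close> is the series of averages that defines \<open>heat\<close>. Premise
  \<open>sx\<close> justifies the interchange of sum and integral; it holds for almost every
  \<open>x\<close>.\<close>

lemma heat_kernel_integral_at: assumes H: "is_heat_kernel H" and t: "0 < t" and ui: "integrable M u" and x: "x \<in> C"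
  and sx: "summable (%n. cmod (complex_of_real (p t n) * E n (%y. complex_of_real (cmod (u y))) x))" shows "integrable M (%y. complex_of_real (H t (dv x y)) * u y)"
  "heat t u x = (\<integral>y. complex_of_real (H t (dv x y)) * u y \<partial>M)" proof -
  let ?b = "%n. complex_of_real (p t n)"
  let ?f = "%n y. ?b n * (of_nat (N n) * (indicator (cl n x) y *\<^sub>R u y))"
  have fi: "integrable M (?f n)" for n by (intro integrable_mult_right integrable_ind ui x)
  have pt: "(%n. ?f n y) sums (complex_of_real (H t (dv x y)) * u y) & summable (%n. norm (?f n y))" if y: "y \<in> C" "y ~= x" for y proof -
   have "dv x y ~= \<one>" proof
   assume "dv x y = \<one>"
   then have "y = x" using dv_dv_left[OF x y(1)] x by simp
   then show False using y(2) by simp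
  qed
   then obtain l where l: "dv x y \<in> W l - W (Suc l)" using level_exists[OF dv_closed[OF x y(1)]] by blast
   have ind: "indicator (cl n x) y = (if n <= l then 1 else 0 :: real)" for n using mem_W_level[OF l, of n] y(1) by (simp add: cl_def indicator_def)
   have z: "?f n y = 0" if "n ~: {..l}" for n using that by (simp add: ind)
   have "(%n. ?f n y) sums (\<Sum>n\<in>{..l}. ?f n y)" using z by (intro sums_finite) auto
   moreover have "(\<Sum>n\<in>{..l}. ?f n y) = complex_of_real (H t (dv x y)) * u y" proof -
    have "H t (dv x y) = (\<Sum>n\<le>l. p t n * real (N n))" using H l by (simp add: is_heat_kernel_def)
    then show ?thesis by (simp add: ind sum_distrib_right mult.assoc)
   qed
   moreover have "summable (%n. norm (?f n y))" using z by (intro summable_finite[of "{..l}"]) auto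
   ultimately show ?thesis by simp
  qed
  have AEy: "AE y in M. y \<in> C & y ~= x" using singleton_null(2)[OF x] AE_space by eventually_elim (simp add: space_M)
  have s1: "AE y in M. summable (%n. norm (?f n y))" by (rule eventually_mono[OF AEy]) (rule conjunct2[OF pt], rule conjunct1, assumption, rule conjunct2, assumption)
  have s2: "summable (%n. \<integral>y. norm (?f n y) \<partial>M)" proof -
   have "(\<integral>y. norm (?f n y) \<partial>M) = cmod (?b n * E n (%y. complex_of_real (cmod (u y))) x)" for n proof -
    have "(\<integral>y. norm (?f n y) \<partial>M) = (\<integral>y. p t n * (real (N n) * (indicator (cl n x) y * cmod (u y))) \<partial>M)"
     by (intro integral_cong_space) (simp_all add: norm_mult p_abs[OF t] indicator_def)
    also have "... = p t n * (real (N n) * (\<integral>y. indicator (cl n x) y * cmod (u y) \<partial>M))" by simp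
    finally show ?thesis unfolding E_pos(2)[OF ui x] norm_mult p_cmod[OF t] norm_of_real
     using Bochner_Integration.integral_nonneg[where M = M and f = "%y. indicator (cl n x) y * cmod (u y)"] by simp
   qed
   then show ?thesis using sx by simp
  qed
  let ?g = "%y. complex_of_real (H t (dv x y)) * u y" and ?S = "%y. \<Sum>n. ?f n y"
  have Si: "integrable M ?S" by (rule integrable_suminf[OF fi s1 s2])
  have gS: "?S y = ?g y" if "y \<in> C" "y ~= x" for y by (rule sums_unique[OF conjunct1[OF pt[OF that]], symmetric])
  \<comment> \<open>The series and the kernel can differ only at \<open>y = x\<close>, a measurable
    point, so measurability passes from the series to the kernel.\<close>
  have gm: "?g \<in> borel_measurable M" proof -
   have "{y \<in> space M. y = x} = {x}" using x by (auto simp: space_M)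
   then have "(%y. if y = x then ?g x else ?S y) \<in> borel_measurable M" using singleton_null(1)[OF x] borel_measurable_integrable[OF Si] 
    by (intro measurable_If[OF borel_measurable_const borel_measurable_integrable[OF Si]]) simp
   moreover have "(if y = x then ?g x else ?S y) = ?g y" if "y \<in> space M" for y
    using gS[of y] that unfolding space_M by (cases "y = x") (simp_all only: if_True if_False simp_thms)
   ultimately show ?thesis using iffD1[OF measurable_cong[of M "%y. if y = x then ?g x else ?S y" ?g borel]] by blast
  qed
  have AEg: "AE y in M. ?S y = ?g y" by (rule eventually_mono[OF AEy]) (rule gS, rule conjunct1, assumption, rule conjunct2, assumption)
  have gi: "integrable M ?g" by (rule iffD1[OF integrable_cong_AE[OF borel_measurable_integrable[OF Si] gm AEg] Si])
  have "(%n. \<integral>y. ?f n y \<partial>M) sums (\<integral>y. ?S y \<partial>M)" by (rule sums_integral[OF fi s1 s2])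
  moreover have "(\<integral>y. ?S y \<partial>M) = (\<integral>y. ?g y \<partial>M)" by (rule integral_cong_AE[OF borel_measurable_integrable[OF Si] gm AEg])
  moreover have "(\<integral>y. ?f n y \<partial>M) = ?b n * E n u x" for n by (simp only: E_def integral_mult_right_zero)
  ultimately have s: "(%n. ?b n * E n u x) sums (\<integral>y. ?g y \<partial>M)" by (simp only:)
  have "heat t u x = (\<Sum>n. ?b n * E n u x)" unfolding heat_def mult_op_def series_def hm_diff using t by simp
  also have "... = (\<integral>y. ?g y \<partial>M)" by (rule sums_unique[OF s, symmetric])
  finally show "heat t u x = (\<integral>y. ?g y \<partial>M)" .
  show "integrable M ?g" by (rule gi)
qed

theorem heat_kernel_integral: assumes H: "is_heat_kernel H" and t: "0 < t" and u: "u \<in> L2 M" shows "AE x in M. integrable M (%y. complex_of_real (H t (dv x y)) * u y) &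
  heat t u x = (\<integral>y. complex_of_real (H t (dv x y)) * u y \<partial>M)" proof -
 have sm: "summable (%n. cmod (complex_of_real (p t n)))" using p_summable[OF t] by (simp add: p_abs[OF t])
 have AU: "AE x in M. summable (%n. cmod (complex_of_real (p t n) * E n (%y. complex_of_real (cmod (u y))) x))" by (rule series_AE_summable[OF sm L2_cmod[OF u]])
 have AC: "AE x in M. x \<in> C" using AE_space[of M] by (simp only: space_M)
 show ?thesis proof (rule eventually_elim2[OF AU AC])
  fix x assume sx: "summable (%n. cmod (complex_of_real (p t n) * E n (%y. complex_of_real (cmod (u y))) x))" and x: "x \<in> C"
  note k = heat_kernel_integral_at[OF H t L2_integrable[OF u] x sx]
  show "integrable M (%y. complex_of_real (H t (dv x y)) * u y) & heat t u x = (\<integral>y. complex_of_real (H t (dv x y)) * u y \<partial>M)" by (rule conjI[OF k])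
 qed
qed

subsection \<open>The transition densities\<close>

text \<open>The transition density with values in \<open>ennreal\<close>: as a sum of indicators it
  is measurable with a definite value everywhere, and for positive times it agrees with the heat
  kernel off the unit.\<close>

definition k :: "real => 'a => ennreal" where
 "k t z = (\<Sum>n. ennreal (p t n * real (N n)) * indicator (W n) z)"

lemma k_measurable [measurable]: "k t \<in> borel_measurable M"
 unfolding k_def[abs_def] using W_sets by (intro borel_measurable_suminf_order borel_measurable_times_ennreal borel_measurable_indicator) auto

lemma k_level: assumes H: "is_heat_kernel H" and t: "0 < t" and l: "z \<in> W l - W (Suc l)" shows "k t z = ennreal (H t z)" proof -
 have "k t z = (\<Sum>n\<in>{..l}. ennreal (p t n * real (N n)) * indicator (W n) z)" unfolding k_def using mem_W_level[OF l] by (intro suminf_finite) auto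
 also have "... = (\<Sum>n\<in>{..l}. ennreal (p t n * real (N n)))" using mem_W_level[OF l] by (intro sum.cong) auto
 also have "... = ennreal (\<Sum>n\<le>l. p t n * real (N n))" using p_pos[OF t] by (intro sum_ennreal) (simp add: less_imp_le)
 also have "(\<Sum>n\<le>l. p t n * real (N n)) = H t z" using H l by (simp add: is_heat_kernel_def)
 finally show ?thesis .
qed

lemma k_heat_kernel: assumes H: "is_heat_kernel H" and t: "0 < t" shows "AE z in M. k t z = ennreal (H t z)" using AE_not_one AE_space proof eventually_elim
 fix z assume z: "z ~= \<one>" "z \<in> space M"
 then obtain l where "z \<in> W l - W (Suc l)" using level_exists[of z] by (auto simp: space_M)
 then show "k t z = ennreal (H t z)" by (rule k_level[OF H t])
qed

lemma N_neq_0: "N n ~= 0" using N_pos[of n] by simp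

lemma emeasure_W: "emeasure M (W n) = ennreal (1 / real (N n))" using prob_W emeasure_eq_measure by simp

lemma W_Int: "W m Int W n = W (max m n)" using W_antimono[of m n] W_antimono[of n m] by (cases "m <= n") (auto simp: max_def)

text \<open>The uniform distributions on the \<open>W n\<close> enter with weights
  \<open>p t n\<close>. Those with \<open>n >= m\<close> are carried by \<open>W m\<close> and have
  total weight \<open>exp (- (t * \<phi> m))\<close>, the lower bound behind stochastic
  continuity.\<close>

lemma integral_k_W: assumes t: "0 < t"
 shows "ennreal (exp (- (t * \<phi> m))) <= (\<integral>\<^sup>+z. k t z * indicator (W m) z \<partial>M)" "(\<integral>\<^sup>+z. k t z \<partial>M) = 1" proof -
 have pn: "0 <= p t n" for n using p_pos[OF t, of n] by simp
 have eq: "(\<integral>\<^sup>+z. k t z * indicator (W m) z \<partial>M) = (\<Sum>n. ennreal (p t n * real (N n)) * ennreal (1 / real (N (max n m))))" for m proof -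
  have "(\<integral>\<^sup>+z. k t z * indicator (W m) z \<partial>M) = (\<integral>\<^sup>+z. (\<Sum>n. ennreal (p t n * real (N n)) * indicator (W (max n m)) z) \<partial>M)"
   unfolding k_def ennreal_suminf_multc[symmetric] by (simp add: mult.assoc indicator_inter_arith[symmetric] W_Int)
  also have "... = (\<Sum>n. \<integral>\<^sup>+z. ennreal (p t n * real (N n)) * indicator (W (max n m)) z \<partial>M)" using W_sets by (intro nn_integral_suminf) auto
  finally show ?thesis using W_sets by (simp add: nn_integral_cmult_indicator emeasure_W)
 qed
 have tail: "(\<Sum>n. ennreal (p t (n + m))) = ennreal (exp (- (t * \<phi> m)))" for m using p_sums[OF t, of m] pn by (simp add: suminf_ennreal2 sums_iff)
 have "(\<Sum>n. ennreal (p t n)) = 1" using tail[of 0] by (simp add: \<phi>_0)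
 moreover have "ennreal (p t n * real (N n)) * ennreal (1 / real (N (max n 0))) = ennreal (p t n)" for n using pn[of n] by (simp add: N_neq_0 flip: ennreal_mult)
 ultimately have "(\<integral>\<^sup>+z. k t z * indicator (W 0) z \<partial>M) = 1" unfolding eq by simp
 moreover have "(\<integral>\<^sup>+z. k t z * indicator (W 0) z \<partial>M) = (\<integral>\<^sup>+z. k t z \<partial>M)" by (intro nn_integral_cong) (simp add: W_0 space_M)
 ultimately show "(\<integral>\<^sup>+z. k t z \<partial>M) = 1" by simp
 have "ennreal (exp (- (t * \<phi> m))) = (\<Sum>n. ennreal (p t (n + m) * real (N (n + m))) * ennreal (1 / real (N (max (n + m) m))))"
  unfolding tail[symmetric] using pn by (intro suminf_cong) (simp add: N_neq_0 flip: ennreal_mult)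
 also have "... <= (\<Sum>n. ennreal (p t n * real (N n)) * ennreal (1 / real (N (max n m))))"
  (is "(\<Sum>n. ?f (n + m)) <= suminf ?f") unfolding suminf_offset[OF summableI, of ?f m] by simp
 finally show "ennreal (exp (- (t * \<phi> m))) <= (\<integral>\<^sup>+z. k t z * indicator (W m) z \<partial>M)" unfolding eq .
qed

text \<open>The integrand is the indicator of the intersection of two cosets. These are nested or
  disjoint, and they meet exactly when \<open>a\<close> and \<open>b\<close> agree modulo the larger
  subgroup \<open>W (min n m)\<close>.\<close>

lemma emeasure_coset_Int: assumes a: "a \<in> C" and b: "b \<in> C" shows "(\<integral>\<^sup>+y. indicator (W n) (dv y a) * indicator (W m) (dv b y) \<partial>M)
  = ennreal (1 / real (N (max n m))) * indicator (W (min n m)) (dv b a)" proof -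
 have ind: "indicator (W n) (dv y a) * indicator (W m) (dv b y) = (indicator (cl n a Int cl m b) y :: ennreal)" if "y \<in> C" for y
  using W_dv_commute[OF that a, of n] that by (simp add: indicator_def cl_def)
 have "(\<integral>\<^sup>+y. indicator (W n) (dv y a) * indicator (W m) (dv b y) \<partial>M) = (\<integral>\<^sup>+y. indicator (cl n a Int cl m b) y \<partial>M)"
  by (intro nn_integral_cong ind) (simp add: space_M)
 also have "... = emeasure M (cl n a Int cl m b)" using cl_sets[OF a, of n] cl_sets[OF b, of m] by simp
 also have "... = ennreal (1 / real (N (max n m))) * indicator (W (min n m)) (dv b a)" proof (cases "cl n a Int cl m b = {}")
  case True
  have "dv b a ~: W (min n m)" proof
   assume w: "dv b a \<in> W (min n m)"
   show False proof (cases "n <= m")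
    case True
    then have "dv b a \<in> W n" using w by (simp add: min_def)
    then have "b \<in> cl n a" unfolding cl_def using b iffD1[OF W_dv_commute[OF b a]] by blast
    then show False using \<open>cl n a Int cl m b = {}\<close> cl_self[OF b, of m] by blast
   next
    case False
    then have "a \<in> cl m b" using w a b by (simp add: cl_def min_def)
    then show False using \<open>cl n a Int cl m b = {}\<close> cl_self[OF a, of n] by blast
   qed
  qed
  then show ?thesis using True by simp
 next
  case False
  then obtain y where y: "y \<in> cl n a" "y \<in> cl m b" by blast
  have yC: "y \<in> C" using y cl_sub by blast
  have e: "cl n y = cl n a" "cl m y = cl m b" by (rule cl_eq[OF a y(1)], rule cl_eq[OF b y(2)])
  have "cl n a Int cl m b = cl (max n m) y" unfolding e[symmetric] using cl_antimono[of n m y] cl_antimono[of m n y] by (cases "n <= m") (auto simp: max_def)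
  moreover have "dv b a \<in> W (min n m)" proof (rule W_dv_trans[OF b yC a])
   show "dv b y \<in> W (min n m)" using y(2) W_antimono[of "min n m" m] by (auto simp: cl_def)
   have "dv y a \<in> W n" using y(1) W_dv_commute[OF a yC] by (simp add: cl_def)
   then show "dv y a \<in> W (min n m)" using W_antimono[of "min n m" n] by auto
  qed
  ultimately show ?thesis using emeasure_cl[OF yC] by simp
 qed
 finally show ?thesis .
qed

lemma suminf_swap_ennreal:
 fixes f :: "nat => nat => ennreal" shows "(\<Sum>n. \<Sum>m. f n m) = (\<Sum>m. \<Sum>n. f n m)" using nn_integral_suminf[of "%m n. f n m" "count_space UNIV"]
 by (simp add: nn_integral_count_space_nat)

text \<open>Sort the pairs by their minimum \<open>r\<close>: either \<open>n = r\<close> and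
  \<open>m >= r\<close>, or \<open>n > r\<close> and \<open>m = r\<close>. The asymmetric split
  counts the diagonal once.\<close>

lemma suminf_min:
 fixes a b g :: "nat => ennreal" shows "(\<Sum>n. \<Sum>m. a n * b m * g (min n m)) = (\<Sum>r. g r * (a r * (\<Sum>m. b (m + r)) + (\<Sum>n. a (n + Suc r)) * b r))" proof -
 define i where "i r n m = (if n = r & r <= m \<or> r < n & m = r then 1 else 0 :: ennreal)" for r n m :: nat
 have "a n * b m * g (min n m) = (\<Sum>r. g r * (a n * b m * i r n m))" for n m proof -
  have "(\<Sum>r. g r * (a n * b m * i r n m)) = (\<Sum>r\<in>{min n m}. g r * (a n * b m * i r n m))" by (rule suminf_finite) (auto simp: i_def min_def split: if_splits)
  then show ?thesis by (simp add: i_def min_def mult.commute)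
 qed
 then have "(\<Sum>n. \<Sum>m. a n * b m * g (min n m)) = (\<Sum>n. \<Sum>m. \<Sum>r. g r * (a n * b m * i r n m))" by simp
 also have "... = (\<Sum>n. \<Sum>r. \<Sum>m. g r * (a n * b m * i r n m))" by (subst suminf_swap_ennreal) (rule refl)
 also have "... = (\<Sum>r. \<Sum>n. \<Sum>m. g r * (a n * b m * i r n m))" by (rule suminf_swap_ennreal)
 also have "... = (\<Sum>r. g r * (\<Sum>n. a n * (\<Sum>m. b m * i r n m)))" by (simp add: mult.assoc)
 also have "... = (\<Sum>r. g r * (a r * (\<Sum>m. b (m + r)) + (\<Sum>n. a (n + Suc r)) * b r))" proof (intro suminf_cong arg_cong2[of _ _ _ _ "(*)"] refl)
  fix r
  let ?h = "%n. a n * (\<Sum>m. b m * i r n m)"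
  have 0: "?h n = 0" if "n < r" for n using that by (simp add: i_def)
  have 1: "(\<Sum>m. b m * i r r m) = (\<Sum>m. b (m + r))" using suminf_offset[OF summableI, of "%m. b m * i r r m" r] by (simp add: i_def)
  have 2: "(\<Sum>m. b m * i r n m) = b r" if "r < n" for n proof -
   have "(\<Sum>m. b m * i r n m) = (\<Sum>m\<in>{r}. b m * i r n m)" using that by (intro suminf_finite) (auto simp: i_def)
   then show ?thesis using that by (simp add: i_def)
  qed
  have "(\<Sum>n. ?h n) = (\<Sum>n. ?h (n + Suc r)) + sum ?h {..<Suc r}" by (rule suminf_offset[OF summableI])
  also have "sum ?h {..<Suc r} = ?h r" using 0 by simp
  also have "(\<Sum>n. ?h (n + Suc r)) = (\<Sum>n. a (n + Suc r) * b r)" using 2 by (intro suminf_cong) simp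
  finally show "(\<Sum>n. ?h n) = a r * (\<Sum>m. b (m + r)) + (\<Sum>n. a (n + Suc r)) * b r" unfolding 1 by (simp add: add.commute)
 qed
 finally show ?thesis .
qed

text \<open>Uniform distributions on \<open>W n\<close> and \<open>W m\<close> convolve to the one
  on the larger group \<open>W (min n m)\<close>. The minimum of independent levels with tails
  \<open>exp (- (s * \<phi> r))\<close> and \<open>exp (- (t * \<phi> r))\<close> has their product
  as its tail, which is the tail for \<open>s + t\<close>.\<close>

lemma chapman_kolmogorov: assumes st: "0 < s" "0 < t" and a: "a \<in> C" and b: "b \<in> C"
 shows "(\<integral>\<^sup>+y. k s (dv y a) * k t (dv b y) \<partial>M) = k (s + t) (dv b a)" proof -
 have pn: "0 <= p r n" if "0 < r" for r n using p_pos[OF that, of n] by simp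
 have ms: "(%y. indicator (W n) (dv y a) :: ennreal) \<in> borel_measurable M" for n by (rule measurable_compose[OF dv_right(1)[OF a]]) (use W_sets in auto)
 have mt: "(%y. indicator (W n) (dv b y) :: ennreal) \<in> borel_measurable M" for n by (rule measurable_compose[OF dv_left(1)[OF b]]) (use W_sets in auto)
 let ?w = "%r n. ennreal (p r n * real (N n))" and ?z = "dv b a"
 let ?I = "%n m y. indicator (W n) (dv y a) * indicator (W m) (dv b y) :: ennreal"
 have "k s (dv y a) * k t (dv b y) = (\<Sum>n. \<Sum>m. ?w s n * ?w t m * ?I n m y)" for y
  unfolding k_def by (simp add: ennreal_suminf_multc[symmetric] ennreal_suminf_cmult[symmetric] mult_ac del: ennreal_suminf_multc ennreal_suminf_cmult)
 then have "(\<integral>\<^sup>+y. k s (dv y a) * k t (dv b y) \<partial>M) = (\<integral>\<^sup>+y. (\<Sum>n. \<Sum>m. ?w s n * ?w t m * ?I n m y) \<partial>M)" by simp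
 also have "... = (\<Sum>n. \<integral>\<^sup>+y. (\<Sum>m. ?w s n * ?w t m * ?I n m y) \<partial>M)"
  using ms mt by (intro nn_integral_suminf borel_measurable_suminf_order borel_measurable_times_ennreal) auto
 also have "... = (\<Sum>n. \<Sum>m. \<integral>\<^sup>+y. ?w s n * ?w t m * ?I n m y \<partial>M)"
  using ms mt by (intro suminf_cong nn_integral_suminf borel_measurable_times_ennreal) auto
 also have "... = (\<Sum>n. \<Sum>m. ?w s n * ?w t m * (ennreal (1 / real (N (max n m))) * indicator (W (min n m)) ?z))" proof (intro suminf_cong)
  fix n m
  have "(\<integral>\<^sup>+y. ?w s n * ?w t m * ?I n m y \<partial>M) = ?w s n * ?w t m * (\<integral>\<^sup>+y. ?I n m y \<partial>M)"
   using ms mt by (intro nn_integral_cmult borel_measurable_times_ennreal)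
  then show "(\<integral>\<^sup>+y. ?w s n * ?w t m * ?I n m y \<partial>M) = ?w s n * ?w t m * (ennreal (1 / real (N (max n m))) * indicator (W (min n m)) ?z)"
   by (simp only: emeasure_coset_Int[OF a b])
 qed
 also have "... = (\<Sum>n. \<Sum>m. ennreal (p s n) * ennreal (p t m) * (ennreal (real (N (min n m))) * indicator (W (min n m)) ?z))" proof (intro suminf_cong)
  fix n m
  have "real (N n) * real (N m) * (1 / real (N (max n m))) = real (N (min n m))" by (cases "n <= m") (auto simp: max_def min_def N_neq_0)
  then have "(p s n * real (N n)) * (p t m * real (N m)) * (1 / real (N (max n m))) = p s n * p t m * real (N (min n m))"
   by (metis (no_types, opaque_lifting) mult.assoc mult.left_commute)
  then have "?w s n * ?w t m * ennreal (1 / real (N (max n m))) = ennreal (p s n) * ennreal (p t m) * ennreal (real (N (min n m)))"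
   using pn[OF st(1), of n] pn[OF st(2), of m] by (simp flip: ennreal_mult)
  then show "?w s n * ?w t m * (ennreal (1 / real (N (max n m))) * indicator (W (min n m)) ?z)
   = ennreal (p s n) * ennreal (p t m) * (ennreal (real (N (min n m))) * indicator (W (min n m)) ?z)" by (simp only: mult.assoc[symmetric])
 qed
 also have "... = (\<Sum>r. ennreal (real (N r)) * indicator (W r) ?z *
   (ennreal (p s r) * (\<Sum>m. ennreal (p t (m + r))) + (\<Sum>n. ennreal (p s (n + Suc r))) * ennreal (p t r)))"
  by (rule suminf_min[of "%n. ennreal (p s n)" "%m. ennreal (p t m)" "%r. ennreal (real (N r)) * indicator (W r) ?z"])
 also have "... = k (s + t) ?z" unfolding k_def proof (intro suminf_cong)
  fix r
  have tail: "(\<Sum>n. ennreal (p u (n + m))) = ennreal (exp (- (u * \<phi> m)))" if "0 < u" for u m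
   using p_sums[OF that, of m] pn[OF that] by (simp add: suminf_ennreal2 sums_iff)
  have "p s r * exp (- (t * \<phi> r)) + exp (- (s * \<phi> (Suc r))) * p t r = p (s + t) r" by (simp add: p_def distrib_right exp_add exp_diff exp_minus field_simps)
  then have "ennreal (p s r) * (\<Sum>m. ennreal (p t (m + r))) + (\<Sum>n. ennreal (p s (n + Suc r))) * ennreal (p t r) = ennreal (p (s + t) r)"
   unfolding tail[OF st(1)] tail[OF st(2)] using pn[OF st(1), of r] pn[OF st(2), of r] by (simp flip: ennreal_mult ennreal_plus)
  then show "ennreal (real (N r)) * indicator (W r) ?z *
   (ennreal (p s r) * (\<Sum>m. ennreal (p t (m + r))) + (\<Sum>n. ennreal (p s (n + Suc r))) * ennreal (p t r))
   = ennreal (p (s + t) r * real (N r)) * indicator (W r) ?z" using pn[of "s + t" r] st by (simp add: ennreal_mult mult_ac)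
 qed
 finally show ?thesis .
qed

subsection \<open>Finite-dimensional distributions\<close>

abbreviation paths :: "real set => (real => 'a) measure" where "paths J \<equiv> PiM J (%_. M)"

text \<open>The preceding time in \<open>J\<close>; the inserted 0 makes the start the predecessor
  of the first time.\<close>

definition pd :: "real set => real => real" where "pd J t = Max (insert 0 {s \<in> J. s < t})"

text \<open>Paths are indexed by positive times only; at time 0 the process sits at the
  unit.\<close>

definition at0 :: "(real => 'a) => real => 'a" where "at0 x s = (if s <= 0 then \<one> else x s)"

definition inc :: "real set => (real => 'a) => real => 'a" where "inc J x t = dv (x t) (at0 x (pd J t))"

definition fd :: "real set => (real => 'a) => ennreal" where
 "fd J x = (\<Prod>t\<in>J. k (t - pd J t) (inc J x t))"

definition PJ :: "real set => (real => 'a) measure" where "PJ J = density (paths J) (fd J)"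

lemma pd_mem: "finite J ==> pd J t = 0 \<or> pd J t \<in> J & pd J t < t" using Max_in[of "insert 0 {s \<in> J. s < t}"] by (auto simp: pd_def)

lemma pd_less: "finite J ==> 0 < t ==> pd J t < t" using pd_mem[of J t] by auto

lemma pd_cong: "{s \<in> J. s < t} = {s \<in> H. s < t'} ==> pd J t = pd H t'" by (simp add: pd_def)

lemma pd_insert: assumes "finite H" "0 < j" shows "pd (insert j H) t = (if j < t then max j (pd H t) else pd H t)" proof (cases "j < t")
 case True
 then have "insert 0 {s \<in> insert j H. s < t} = insert j (insert 0 {s \<in> H. s < t})" by auto
 then show ?thesis using True assms by (simp add: pd_def)
next
 case False
 then have "{s \<in> insert j H. s < t} = {s \<in> H. s < t}" by auto
 then show ?thesis using False by (simp add: pd_def)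
qed

lemma at0_closed: assumes "finite J" "x \<in> space (paths J)" shows "at0 x (pd J t) \<in> C"
 using pd_mem[OF assms(1), of t] assms(2) by (auto simp: at0_def space_PiM space_M)

lemma paths_closed: "x \<in> space (paths J) ==> t \<in> J ==> x t \<in> C" by (auto simp: space_PiM space_M)

lemma inc_measurable: assumes "finite J" "t \<in> J" shows "(%x. inc J x t) \<in> measurable (paths J) M" proof -
 have c: "(%x. x s) \<in> measurable (paths J) M" if "s \<in> J" for s using measurable_component_singleton[OF that, of "%_. M"] by simp
 have "(%x. at0 x (pd J t)) \<in> measurable (paths J) M" proof (cases "pd J t <= 0")
  case True
  then show ?thesis by (simp add: at0_def space_M)
 next
  case False
  then have "pd J t \<in> J" using pd_mem[OF assms(1), of t] by auto
  then show ?thesis using c False by (simp add: at0_def)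
 qed
 from measurable_compose[OF measurable_Pair[OF c[OF assms(2)] this] dv_measurable] show ?thesis by (simp add: inc_def)
qed

lemma inc_comp_measurable: assumes "finite J" "t \<in> J" "(h :: 'a => ennreal) \<in> borel_measurable M" shows "(%x. h (inc J x t)) \<in> borel_measurable (paths J)"
 using measurable_compose[OF inc_measurable[OF assms(1,2)] assms(3)] .

lemma fd_measurable: "finite J ==> fd J \<in> borel_measurable (paths J)" unfolding fd_def[abs_def] by (intro borel_measurable_prod_ennreal inc_comp_measurable k_measurable)

lemma paths_sigma_finite: "product_sigma_finite (%_::real. M)" by (intro product_sigma_finite.intro sigma_finite_measure_axioms)

lemmas paths_insert = product_sigma_finite.product_nn_integral_insert[OF paths_sigma_finite]

lemma nn_integral_dv: assumes "a \<in> C" "(h :: 'a => ennreal) \<in> borel_measurable M"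
 shows "(\<integral>\<^sup>+y. h (dv y a) \<partial>M) = (\<integral>\<^sup>+y. h y \<partial>M)"
 using nn_integral_distr[OF dv_right(1)[OF assms(1)], of h] assms(2) dv_right(2)[OF assms(1)] by simp

lemma upd_in_paths: "x \<in> space (paths H) ==> y \<in> C ==> x(b := y) \<in> space (paths (insert b H))" by (auto simp: space_PiM space_M PiE_iff extensional_def)

lemma upd_measurable: assumes "x \<in> space (paths H)" shows "(%y. x(b := y)) \<in> measurable M (paths (insert b H))" proof (rule measurable_PiM_single')
 fix i assume "i \<in> insert b H"
 then show "(%y. (x(b := y)) i) \<in> measurable M M" using paths_closed[OF assms] by (cases "i = b") (auto simp: space_M)
next
 show "(%y. x(b := y)) \<in> space M \<rightarrow> (\<Pi>\<^sub>E i\<in>insert b H. space M)" using upd_in_paths[OF assms, of _ b] by (auto simp: space_PiM space_M)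
qed

text \<open>Induction on the largest time: the last coordinate occurs only in the last increment,
  and translation invariance removes the preceding position from its integral. This is the source of
  the independence of increments.\<close>

lemma nn_integral_increments: assumes "finite J" "J <= {0<..}" "!!t. t \<in> J ==> h t \<in> borel_measurable M"
 shows "(\<integral>\<^sup>+x. (\<Prod>t\<in>J. h t (inc J x t)) \<partial>paths J) = (\<Prod>t\<in>J. \<integral>\<^sup>+z. h t z \<partial>M)" using assms
proof (induction rule: finite_linorder_max_induct)
 case empty
 show ?case by (simp add: PiM_empty)
next
 case (insert b A)
 have b: "0 < b" "b ~: A" using insert by auto
 have h: "h t \<in> borel_measurable M" if "t \<in> insert b A" for t using insert(5) that by blast
 have pdA: "pd (insert b A) t = pd A t" if "t \<in> insert b A" for t using that insert(1,2) b pd_insert[OF insert(1) b(1), of t] by force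
 have "(\<integral>\<^sup>+x. (\<Prod>t\<in>insert b A. h t (inc (insert b A) x t)) \<partial>paths (insert b A))
   = (\<integral>\<^sup>+x. \<integral>\<^sup>+y. (\<Prod>t\<in>insert b A. h t (inc (insert b A) (x(b := y)) t)) \<partial>M \<partial>paths A)"
  using insert(1) h by (intro paths_insert b insert borel_measurable_prod_ennreal inc_comp_measurable) auto
 also have "... = (\<integral>\<^sup>+x. (\<Prod>t\<in>A. h t (inc A x t)) * (\<integral>\<^sup>+z. h b z \<partial>M) \<partial>paths A)" proof (rule nn_integral_cong)
  fix x assume x: "x \<in> space (paths A)"
  have A: "inc (insert b A) (x(b := y)) t = inc A x t" if t: "t \<in> A" for t y proof -
   have "t ~= b" "pd A t ~= b" using pd_mem[OF insert(1), of t] b t by auto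
   then show ?thesis using t by (simp add: inc_def pdA at0_def)
  qed
  have B: "inc (insert b A) (x(b := y)) b = dv y (at0 x (pd A b))" for y proof -
   have "pd A b ~= b" using pd_less[OF insert(1) b(1)] by simp
   then show ?thesis by (simp add: inc_def pdA at0_def)
  qed
  have "(\<integral>\<^sup>+y. (\<Prod>t\<in>insert b A. h t (inc (insert b A) (x(b := y)) t)) \<partial>M)
    = (\<integral>\<^sup>+y. (\<Prod>t\<in>A. h t (inc A x t)) * h b (dv y (at0 x (pd A b))) \<partial>M)" using insert(1) b(2) by (simp add: A B mult.commute)
  also have "... = (\<Prod>t\<in>A. h t (inc A x t)) * (\<integral>\<^sup>+y. h b (dv y (at0 x (pd A b))) \<partial>M)"
   using h at0_closed[OF insert(1) x] by (intro nn_integral_cmult measurable_compose[OF dv_right(1)]) auto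
  also have "(\<integral>\<^sup>+y. h b (dv y (at0 x (pd A b))) \<partial>M) = (\<integral>\<^sup>+z. h b z \<partial>M)"
   by (rule nn_integral_dv[OF at0_closed[OF insert(1) x] h]) simp
  finally show "(\<integral>\<^sup>+y. (\<Prod>t\<in>insert b A. h t (inc (insert b A) (x(b := y)) t)) \<partial>M)
    = (\<Prod>t\<in>A. h t (inc A x t)) * (\<integral>\<^sup>+z. h b z \<partial>M)" .
 qed
 also have "... = (\<integral>\<^sup>+x. (\<Prod>t\<in>A. h t (inc A x t)) \<partial>paths A) * (\<integral>\<^sup>+z. h b z \<partial>M)"
  using insert(1) h by (intro nn_integral_multc borel_measurable_prod_ennreal inc_comp_measurable) auto
 also have "... = (\<Prod>t\<in>A. \<integral>\<^sup>+z. h t z \<partial>M) * (\<integral>\<^sup>+z. h b z \<partial>M)" using insert.IH insert(4) h by simp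
 finally show ?case using insert(1) b(2) by (simp add: mult.commute)
qed

lemma PJ_increments: assumes J: "finite J" "J <= {0<..}" and B: "!!t. t \<in> J ==> B t \<in> sets M"
 shows "emeasure (PJ J) {x \<in> space (paths J). ALL t:J. inc J x t \<in> B t} = (\<Prod>t\<in>J. \<integral>\<^sup>+z. k (t - pd J t) z * indicator (B t) z \<partial>M)"
proof -
 let ?S = "{x \<in> space (paths J). ALL t:J. inc J x t \<in> B t}"
 have S: "?S \<in> sets (paths J)" proof (rule sets.sets_Collect_finite_All[OF _ J(1)])
  fix t assume t: "t \<in> J"
  have "(%x. inc J x t) -` B t Int space (paths J) = {x \<in> space (paths J). inc J x t \<in> B t}" by auto
  then show "{x \<in> space (paths J). inc J x t \<in> B t} \<in> sets (paths J)" using measurable_sets[OF inc_measurable[OF J(1) t] B[OF t]] by simp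
 qed
 have "emeasure (PJ J) ?S = (\<integral>\<^sup>+x. fd J x * indicator ?S x \<partial>paths J)" unfolding PJ_def by (rule emeasure_density[OF fd_measurable[OF J(1)] S])
 also have "... = (\<integral>\<^sup>+x. (\<Prod>t\<in>J. k (t - pd J t) (inc J x t) * indicator (B t) (inc J x t)) \<partial>paths J)" proof (rule nn_integral_cong)
  fix x assume "x \<in> space (paths J)"
  then have "indicator ?S x = (\<Prod>t\<in>J. indicator (B t) (inc J x t) :: ennreal)" using J(1) by (auto simp: indicator_def prod_eq_1_iff)
  then show "fd J x * indicator ?S x = (\<Prod>t\<in>J. k (t - pd J t) (inc J x t) * indicator (B t) (inc J x t))" by (simp only: fd_def prod.distrib)
 qed
 also have "... = (\<Prod>t\<in>J. \<integral>\<^sup>+z. k (t - pd J t) z * indicator (B t) z \<partial>M)" using B by (intro nn_integral_increments[OF J]) auto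
 finally show ?thesis .
qed

lemma PJ_prob: assumes "finite J" "J <= {0<..}" shows "prob_space (PJ J)" proof
 have "emeasure (PJ J) (space (PJ J)) = (\<integral>\<^sup>+x. fd J x * indicator (space (paths J)) x \<partial>paths J)"
  unfolding PJ_def using emeasure_density[OF fd_measurable[OF assms(1)] sets.top[of "paths J"]] by simp
 also have "... = (\<integral>\<^sup>+x. fd J x \<partial>paths J)" by (intro nn_integral_cong) simp
 also have "... = (\<Prod>t\<in>J. \<integral>\<^sup>+z. k (t - pd J t) z \<partial>M)" unfolding fd_def by (rule nn_integral_increments[OF assms]) simp
 also have "... = 1" using pd_less[OF assms(1)] assms(2) by (intro prod.neutral ballI integral_k_W(2)) auto
 finally show "emeasure (PJ J) (space (PJ J)) = 1" .
qed

text \<open>Kolmogorov consistency for one deleted time. If \<open>j\<close> is the last time, its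
  factor has total mass 1; otherwise \<open>j\<close> lies between its predecessor and the next time
  \<open>s\<close>, and the Chapman-Kolmogorov identity merges the two factors that contain
  \<open>y\<close>.\<close>

lemma fd_marginal: assumes H: "finite H" "insert j H <= {0<..}" "j ~: H" and x: "x \<in> space (paths H)"
 shows "(\<integral>\<^sup>+y. fd (insert j H) (x(j := y)) \<partial>M) = fd H x" proof -
 have j: "0 < j" using H(2) by simp
 let ?J = "insert j H" and ?r = "pd H j"
 have rJ: "pd ?J j = ?r" using pd_insert[OF H(1) j, of j] by simp
 have pdnj: "pd H t ~= j" for t using pd_mem[OF H(1), of t] H(3) j by auto
 have Cx: "at0 x (pd H t) \<in> C" for t by (rule at0_closed[OF H(1) x])
 have incj: "inc ?J (x(j := y)) j = dv y (at0 x ?r)" for y using pdnj[of j] by (simp add: inc_def rJ at0_def)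
 have inct: "inc ?J (x(j := y)) t = inc H x t" if "t \<in> H" "pd ?J t = pd H t" for t y using pdnj[of t] that H(3) by (auto simp: inc_def at0_def)
 have rless: "0 < j - ?r" using pd_less[OF H(1) j] by simp
 show ?thesis proof (cases "EX t:H. j < t")
  case False
  then have eq: "pd ?J t = pd H t" if "t \<in> H" for t using pd_insert[OF H(1) j, of t] that by auto
  have "fd ?J (x(j := y)) = k (j - ?r) (dv y (at0 x ?r)) * fd H x" for y using H(1,3) by (simp add: fd_def incj inct eq rJ)
  then have "(\<integral>\<^sup>+y. fd ?J (x(j := y)) \<partial>M) = (\<integral>\<^sup>+y. k (j - ?r) (dv y (at0 x ?r)) \<partial>M) * fd H x"
   using Cx by (simp add: nn_integral_multc measurable_compose[OF dv_right(1) k_measurable])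
  then show ?thesis using integral_k_W(2)[OF rless] nn_integral_dv[OF Cx k_measurable] by simp
 next
  case True
  define s where "s = Min {t \<in> H. j < t}"
  have "s \<in> {t \<in> H. j < t}" unfolding s_def by (rule Min_in) (use True H(1) in auto)
  then have s: "s \<in> H" "j < s" by auto
  have least: "s <= t" if "t \<in> H" "j < t" for t using that H(1) by (simp add: s_def)
  have "u < s \<longleftrightarrow> u < j" if u: "u \<in> H" for u proof -
   have "u ~= j" using u H(3) by blast
   then show ?thesis using least[OF u] s(2) by (cases "j < u") auto
  qed
  then have "{u \<in> H. u < s} = {u \<in> H. u < j}" by blast
  then have pds: "pd H s = ?r" by (rule pd_cong)
  have pdJs: "pd ?J s = j" using pd_insert[OF H(1) j, of s] s(2) rless by (simp add: pds)
  have eq: "pd ?J t = pd H t" if t: "t \<in> H - {s}" for t proof (cases "j < t")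
   case True
   then have "s < t" using least[of t] t by force
   then have "s <= pd H t" using s(1) H(1) by (simp add: pd_def)
   then show ?thesis using pd_insert[OF H(1) j, of t] True s(2) by simp
  qed (use pd_insert[OF H(1) j, of t] in simp)
  have incs: "inc ?J (x(j := y)) s = dv (x s) y" for y using s(2) j by (simp add: inc_def pdJs at0_def)
  let ?R = "\<Prod>t\<in>H - {s}. k (t - pd H t) (inc H x t)"
  have split: "fd ?J (x(j := y)) = k (j - ?r) (dv y (at0 x ?r)) * k (s - j) (dv (x s) y) * ?R" for y proof -
   have "fd ?J (x(j := y)) = k (j - ?r) (dv y (at0 x ?r)) * (\<Prod>t\<in>H. k (t - pd ?J t) (inc ?J (x(j := y)) t))" using H(1,3) by (simp add: fd_def incj rJ)
   also have "(\<Prod>t\<in>H. k (t - pd ?J t) (inc ?J (x(j := y)) t)) = k (s - j) (dv (x s) y) * (\<Prod>t\<in>H - {s}. k (t - pd ?J t) (inc ?J (x(j := y)) t))"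
    using prod.remove[OF H(1) s(1), of "%t. k (t - pd ?J t) (inc ?J (x(j := y)) t)"] by (simp add: pdJs incs)
   also have "(\<Prod>t\<in>H - {s}. k (t - pd ?J t) (inc ?J (x(j := y)) t)) = ?R" using eq inct by (intro prod.cong) auto
   finally show ?thesis unfolding mult.assoc .
  qed
  have xs: "x s \<in> C" using paths_closed[OF x s(1)] .
  have "(\<integral>\<^sup>+y. fd ?J (x(j := y)) \<partial>M) = (\<integral>\<^sup>+y. k (j - ?r) (dv y (at0 x ?r)) * k (s - j) (dv (x s) y) \<partial>M) * ?R"
   unfolding split using Cx xs
   by (intro nn_integral_multc borel_measurable_times_ennreal measurable_compose[OF dv_right(1) k_measurable] measurable_compose[OF dv_left(1) k_measurable])
  also have "... = k (s - pd H s) (inc H x s) * ?R" using chapman_kolmogorov[OF rless _ Cx xs, of "s - j" j] s(2) by (simp add: pds inc_def)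
  also have "... = fd H x" unfolding fd_def using prod.remove[OF H(1) s(1), of "%t. k (t - pd H t) (inc H x t)"] by simp
  finally show ?thesis .
 qed
qed

lemma sets_PJ [simp]: "sets (PJ J) = sets (paths J)" and space_PJ [simp]: "space (PJ J) = space (paths J)" by (simp_all add: PJ_def)

lemma PJ_insert: assumes H: "finite H" "insert j H <= {0<..}" "j ~: H" shows "PJ H = distr (PJ (insert j H)) (paths H) (%f. restrict f H)" proof (rule measure_eqI)
 fix A assume "A \<in> sets (PJ H)"
 then have A: "A \<in> sets (paths H)" by simp
 let ?J = "insert j H"
 have r: "(%f. restrict f H) \<in> measurable (paths ?J) (paths H)" by (rule measurable_restrict_subset) auto
 have B: "(%f. restrict f H) -` A Int space (paths ?J) \<in> sets (paths ?J)" by (rule measurable_sets[OF r A])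
 have "emeasure (distr (PJ ?J) (paths H) (%f. restrict f H)) A = emeasure (PJ ?J) ((%f. restrict f H) -` A Int space (paths ?J))"
  using r A by (subst emeasure_distr) (auto simp: measurable_def)
 also have "... = (\<integral>\<^sup>+x. fd ?J x * indicator ((%f. restrict f H) -` A Int space (paths ?J)) x \<partial>paths ?J)"
  unfolding PJ_def using H(1) B by (intro emeasure_density fd_measurable) auto
 also have "... = (\<integral>\<^sup>+x. \<integral>\<^sup>+y. fd ?J (x(j := y)) * indicator ((%f. restrict f H) -` A Int space (paths ?J)) (x(j := y)) \<partial>M \<partial>paths H)"
  using H(1,3) B fd_measurable[of ?J] by (intro paths_insert borel_measurable_times_ennreal borel_measurable_indicator) auto
 also have "... = (\<integral>\<^sup>+x. fd H x * indicator A x \<partial>paths H)" proof (rule nn_integral_cong)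
  fix x assume x: "x \<in> space (paths H)"
  have rx: "restrict (x(j := y)) H = x" for y using x H(3) by (auto simp: space_PiM PiE_iff extensional_def fun_eq_iff)
  have "(\<integral>\<^sup>+y. fd ?J (x(j := y)) * indicator ((%f. restrict f H) -` A Int space (paths ?J)) (x(j := y)) \<partial>M)
    = (\<integral>\<^sup>+y. fd ?J (x(j := y)) * indicator A x \<partial>M)" using upd_in_paths[OF x, of _ j] by (intro nn_integral_cong) (simp add: indicator_def rx space_M)
  also have "... = (\<integral>\<^sup>+y. fd ?J (x(j := y)) \<partial>M) * indicator A x"
   using H(1) by (intro nn_integral_multc measurable_compose[OF upd_measurable[OF x] fd_measurable]) auto
  finally show "(\<integral>\<^sup>+y. fd ?J (x(j := y)) * indicator ((%f. restrict f H) -` A Int space (paths ?J)) (x(j := y)) \<partial>M) = fd H x * indicator A x"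
   by (simp only: fd_marginal[OF H x])
 qed
 also have "... = emeasure (PJ H) A" unfolding PJ_def using A H(1) by (intro emeasure_density[symmetric] fd_measurable) auto
 finally show "emeasure (PJ H) A = emeasure (distr (PJ ?J) (paths H) (%f. restrict f H)) A" by simp
qed simp

text \<open>The times outside \<open>J\<close> are removed one after another with
  \<open>PJ_insert\<close>, by induction over their finite set.\<close>

lemma PJ_restrict: assumes "J <= H" "finite H" "H <= {0<..}" shows "PJ J = distr (PJ H) (paths J) (%f. restrict f J)" proof -
 have fJ: "finite J" using assms finite_subset by blast
 have "PJ J = distr (PJ (D Un J)) (paths J) (%f. restrict f J)" if "finite D" "D <= {0<..}" "D Int J = {}" for D using that proof (induction D)
  case empty
  have "distr (PJ J) (paths J) (%f. restrict f J) = distr (PJ J) (PJ J) (%f. f)" by (rule distr_cong) (auto simp: space_PiM PiE_iff extensional_restrict)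
  also have "... = PJ J" by (rule distr_id)
  finally show ?case unfolding Un_empty_left by (rule sym)
 next
  case (insert d D)
  have i: "finite (D Un J)" "insert d (D Un J) <= {0<..}" "d ~: D Un J" using insert assms fJ by auto
  have m1: "(%f. restrict f (D Un J)) \<in> measurable (PJ (insert d (D Un J))) (paths (D Un J))"
   unfolding measurable_cong_sets[OF sets_PJ refl] by (rule measurable_restrict_subset) auto
  have m2: "(%f. restrict f J) \<in> measurable (paths (D Un J)) (paths J)" by (rule measurable_restrict_subset) auto
  have "PJ J = distr (PJ (D Un J)) (paths J) (%f. restrict f J)" by (rule insert.IH) (use insert.prems in auto)
  also have "... = distr (distr (PJ (insert d (D Un J))) (paths (D Un J)) (%f. restrict f (D Un J))) (paths J) (%f. restrict f J)" by (subst PJ_insert[OF i]) (rule refl)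
  also have "... = distr (PJ (insert d (D Un J))) (paths J) ((%f. restrict f J) \<circ> (%f. restrict f (D Un J)))" by (rule distr_distr[OF m2 m1])
  also have "(%f. restrict f J) \<circ> (%f. restrict f (D Un J)) = (%f. restrict f J :: real => 'a)" by (auto simp: fun_eq_iff restrict_def)
  finally show ?case unfolding Un_insert_left .
 qed
 note * = this
 have e: "H - J Un J = H" using assms(1) by blast
 have "PJ J = distr (PJ (H - J Un J)) (paths J) (%f. restrict f J)" by (rule *) (use assms in auto)
 then show ?thesis unfolding e .
qed

end

locale complete_chain = spectral_chain + assumes complete: "(!!n. s n \<in> carrier G) ==> (!!n. s (Suc n) \<otimes> inv s n \<in> W n) ==>
  EX y:carrier G. ALL n. y \<otimes> inv s n \<in> W n"
begin

subsection \<open>Coding by a Polish space\<close>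

definition idx :: "nat => 'a => nat" where "idx n x = to_nat_on (cls n) (cl n x)"

definition code :: "'a => nat => real" where "code x n = real (idx n x)"

text \<open>A code records the number of the coset at every level. Consistency is asked of initial
  segments only, which makes it a Borel condition; completeness turns it into membership in the
  range of \<open>code\<close>.\<close>

definition coded :: "(nat => real) set" where "coded = {f. ALL n. EX x:C. ALL m<=n. f m = code x m}"

definition decode :: "(nat => real) => 'a" where
 "decode f = (if f \<in> coded then SOME x. x \<in> C & code x = f else \<one>)"

lemma code_eq_iff: "x \<in> C ==> y \<in> C ==> code x n = code y n \<longleftrightarrow> cl n x = cl n y"
 using inj_on_to_nat_on[OF countable_finite[OF finite_cls[of n]]] by (auto simp: code_def idx_def inj_on_def)

lemma code_inj: assumes "x \<in> C" "y \<in> C" "code x = code y" shows "x = y" proof -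
 have "dv x y \<in> W n" for n using code_eq_iff[OF assms(1,2), of n] assms cl_eq_iff[OF assms(1,2), of n] by simp
 then have "dv x y = \<one>" by (rule W_separated)
 then show ?thesis using dv_dv_left[OF assms(1,2)] assms by simp
qed

lemma code_coded: "x \<in> C ==> code x \<in> coded" by (auto simp: coded_def)

text \<open>Points realizing longer and longer initial segments form a Cauchy sequence for the
  chain, and its limit realizes the whole sequence.\<close>

lemma coded_range: assumes "f \<in> coded" shows "EX x. x \<in> C & code x = f" proof -
 have "ALL n. EX x. x \<in> C & (ALL m<=n. f m = code x m)" using assms by (auto simp: coded_def)
 from choice[OF this] obtain s where s: "!!n. s n \<in> C" "!!n m. m <= n ==> f m = code (s n) m" by blast
 have "dv (s (Suc n)) (s n) \<in> W n" for n proof -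
  have "code (s (Suc n)) n = code (s n) n" using s(2)[of n n] s(2)[of n "Suc n"] by simp
  then show ?thesis using code_eq_iff[OF s(1) s(1)] cl_eq_iff[OF s(1) s(1)] by simp
 qed
 then obtain y where y: "y \<in> C" "!!n. dv y (s n) \<in> W n" using complete[of s] s(1) by (auto simp: dv_def)
 have "code y n = f n" for n using code_eq_iff[OF y(1) s(1), of n n] cl_eq_iff[OF y(1) s(1), of n n] y(2) s(2)[of n n] by simp
 then show ?thesis using y(1) by (auto simp: fun_eq_iff)
qed

lemma decode_coded: "f \<in> coded ==> decode f \<in> C & code (decode f) = f" using someI_ex[OF coded_range] by (simp add: decode_def)

lemma decode_code: "x \<in> C ==> decode (code x) = x" using decode_coded[OF code_coded] code_inj by blast

lemma decode_closed: "decode f \<in> C" using decode_coded[of f] by (cases "f \<in> coded") (auto simp: decode_def)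

lemma code_measurable: "code \<in> borel_measurable M" proof (rule measurable_coordinatewise_then_product)
 fix n
 have "lc n (%x. complex_of_real (code x n))" unfolding lc_def using code_eq_iff cl_eq_iff by auto
 from measurable_compose[OF lc_measurable[OF this] borel_measurable_Re] show "(%x. code x n) \<in> borel_measurable M" by simp
qed

lemma coded_borel: "coded \<in> sets borel" proof -
 have "{f. EX x:C. ALL m<=n. f m = code x m} = (\<Union>S\<in>cls n. {f. ALL m<=n. f m = code (rep S) m})" for n proof (intro equalityI subsetI)
  fix f assume "f \<in> {f. EX x:C. ALL m<=n. f m = code x m}"
  then obtain x where x: "x \<in> C" "ALL m<=n. f m = code x m" by blast
  have S: "cl n x \<in> cls n" using x by blast
  note r = rep_cl[OF S]
  have d: "dv (rep (cl n x)) x \<in> W n" using cl_eq_iff[OF r(2) x(1), of n] r(3) by blast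
  have "code (rep (cl n x)) m = code x m" if "m <= n" for m using d W_antimono[OF that] code_eq_iff[OF r(2) x(1), of m] cl_eq_iff[OF r(2) x(1), of m] by blast
  then have "ALL m<=n. f m = code (rep (cl n x)) m" using x(2) by simp
  then show "f \<in> (\<Union>S\<in>cls n. {f. ALL m<=n. f m = code (rep S) m})" using S by blast
 next
  fix f assume "f \<in> (\<Union>S\<in>cls n. {f. ALL m<=n. f m = code (rep S) m})"
  then obtain S where S: "S \<in> cls n" "ALL m<=n. f m = code (rep S) m" by blast
  show "f \<in> {f. EX x:C. ALL m<=n. f m = code x m}" by (intro CollectI bexI[of _ "rep S"] S(2) rep_cl(2)[OF S(1)])
 qed
 moreover have "{f. ALL m<=n. f m = code z m} \<in> sets borel" for n z proof -
  have "{f. ALL m<=n. f m = code z m} = (\<Inter>m\<in>{..n}. (%f. f m) -` {code z m} Int space borel)" by auto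
  also have "... \<in> sets borel" by (intro sets.finite_INT measurable_sets[OF measurable_product_coordinates]) auto
  finally show ?thesis .
 qed
 ultimately have "{f. EX x:C. ALL m<=n. f m = code x m} \<in> sets borel" for n using finite_cls by (simp only:) (intro sets.finite_UN, auto)
 then have "(\<Inter>n. {f. EX x:C. ALL m<=n. f m = code x m}) \<in> sets borel" by (intro sets.countable_INT'') auto
 moreover have "coded = (\<Inter>n. {f. EX x:C. ALL m<=n. f m = code x m})" by (auto simp: coded_def)
 ultimately show ?thesis by simp
qed

lemma decode_measurable: "decode \<in> measurable borel M" proof (rule measurable_into)
 fix n x assume x: "x \<in> C"
 let ?A = "coded Int ((%f. f n) -` {code x n} Int space borel)"
 have m: "?A \<in> sets borel" by (intro sets.Int coded_borel measurable_sets[OF measurable_product_coordinates]) auto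
 have d: "decode f \<in> cl n x \<longleftrightarrow> f n = code x n" if "f \<in> coded" for f proof -
  have g: "decode f \<in> C" "code (decode f) = f" using decode_coded[OF that] by auto
  have "f n = code x n \<longleftrightarrow> cl n x = cl n (decode f)" using code_eq_iff[OF g(1) x, of n] g(2) by auto
  then show ?thesis using cl_eq_iff[OF x g(1), of n] g(1) by (simp add: cl_def)
 qed
 have "decode -` cl n x Int space borel = ?A Un (if \<one> \<in> cl n x then - coded else {})" using d by (auto simp: decode_def split: if_splits)
 also have "... \<in> sets borel" using m coded_borel by auto
 finally show "decode -` cl n x Int space borel \<in> sets borel" .
qed (rule decode_closed)

definition QJ :: "real set => (real => nat => real) measure" where
 "QJ J = distr (PJ J) (PiM J (%_. borel)) (%w. \<lambda>j\<in>J. code (w j))"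

lemma code_paths: "(%w. \<lambda>j\<in>J. code (w j)) \<in> measurable (PJ J) (PiM J (%_. borel))" unfolding measurable_cong_sets[OF sets_PJ refl]
proof (rule measurable_restrict)
 fix j assume "j \<in> J"
 from measurable_compose[OF measurable_component_singleton[OF this, of "%_. M"] code_measurable]
 show "(%w. code (w j)) \<in> measurable (paths J) borel" .
qed

lemma projective: "polish_projective {0<..} QJ" proof (intro polish_projective.intro projective_family.intro)
 fix J H :: "real set" assume J: "J <= H" "finite H" "H <= {0<..}"
 have r: "(%f. restrict f J) \<in> measurable (PJ H) (paths J)" unfolding measurable_cong_sets[OF sets_PJ refl] by (rule measurable_restrict_subset[OF J(1)])
 have r': "(%f. restrict f J) \<in> measurable (PiM H (%_. borel)) (PiM J (%_. borel :: (nat => real) measure))" by (rule measurable_restrict_subset[OF J(1)])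
 have "QJ J = distr (distr (PJ H) (paths J) (%f. restrict f J)) (PiM J (%_. borel)) (%w. \<lambda>j\<in>J. code (w j))" unfolding QJ_def using PJ_restrict[OF J] by simp
 also have "... = distr (PJ H) (PiM J (%_. borel)) ((%w. \<lambda>j\<in>J. code (w j)) \<circ> (%f. restrict f J))"
  by (rule distr_distr[OF _ r]) (use code_paths[of J] in \<open>simp add: measurable_cong_sets[OF sets_PJ refl]\<close>)
 also have "(%w. \<lambda>j\<in>J. code (w j)) \<circ> (%f. restrict f J) = (%f. restrict f J) \<circ> (%w. \<lambda>j\<in>H. code (w j))"
  using J(1) by (auto simp: fun_eq_iff restrict_def)
 also have "distr (PJ H) (PiM J (%_. borel)) ((%f. restrict f J) \<circ> (%w. \<lambda>j\<in>H. code (w j)))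
   = distr (QJ H) (PiM J (%_. borel)) (%f. restrict f J)" unfolding QJ_def by (rule distr_distr[OF r' code_paths, symmetric])
 finally show "QJ J = distr (QJ H) (PiM J (%_. borel)) (%f. restrict f J)" .
next
 fix J :: "real set" assume J: "finite J" "J <= {0<..}"
 show "prob_space (QJ J)" unfolding QJ_def by (rule prob_space.prob_space_distr[OF PJ_prob[OF J] code_paths])
qed

text \<open>The finite-dimensional laws are transported to sequences of reals, a Polish space,
  extended there, and brought back by \<open>decode\<close>. Since \<open>decode\<close> inverts
  \<open>code\<close>, the marginals are unchanged.\<close>

lemma kolmogorov: obtains P :: "(real => 'a) measure" where "prob_space P" "sets P = sets (PiM {0<..} (%_. M))"
  "!!J B. finite J ==> J <= {0<..} ==> B \<in> sets (paths J) ==>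
   emeasure P {w \<in> space P. restrict w J \<in> B} = emeasure (PJ J) B" proof -
 let ?I = "{0<..} :: real set"
 interpret Q: polish_projective ?I QJ by (rule projective)
 define P where "P = distr Q.lim (PiM ?I (%_. M)) (%w. \<lambda>i\<in>?I. decode (w i))"
 have dm: "(%w. \<lambda>i\<in>J. decode (w i)) \<in> measurable (PiM J (%_. borel)) (PiM J (%_. M))" for J :: "real set" proof (rule measurable_restrict)
  fix j assume "j \<in> J"
  from measurable_compose[OF measurable_component_singleton[OF this, of "%_. borel"] decode_measurable]
  show "(%w. decode (w j)) \<in> measurable (PiM J (%_. borel)) M" .
 qed
 have dI: "(%w. \<lambda>i\<in>?I. decode (w i)) \<in> measurable Q.lim (PiM ?I (%_. M))" unfolding measurable_cong_sets[OF Q.sets_lim refl] by (rule dm)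
 have "prob_space P" unfolding P_def by (rule Q.P.prob_space_distr[OF dI])
 moreover have sP: "sets P = sets (PiM ?I (%_. M))" by (simp add: P_def)
 moreover have "emeasure P {w \<in> space P. restrict w J \<in> B} = emeasure (PJ J) B" if J: "finite J" "J <= ?I" and B: "B \<in> sets (paths J)" for J B proof -
  let ?X = "(%w. \<lambda>i\<in>J. decode (w i)) -` B Int space (PiM J (%_. borel))"
  have X: "?X \<in> sets (PiM J (%_. borel))" by (rule measurable_sets[OF dm B])
  have spP: "space P = space (PiM ?I (%_. M))" by (simp add: P_def)
  have r: "{w \<in> space P. restrict w J \<in> B} \<in> sets (PiM ?I (%_. M))"
   unfolding spP using measurable_sets[OF measurable_restrict_subset[OF J(2), of "%_. M"] B] by (simp add: vimage_def Int_def conj_commute)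
  have "emeasure P {w \<in> space P. restrict w J \<in> B}
    = emeasure Q.lim ((%w. \<lambda>i\<in>?I. decode (w i)) -` {w \<in> space P. restrict w J \<in> B} Int space Q.lim)"
   unfolding P_def by (rule emeasure_distr[OF dI]) (use r in \<open>simp add: P_def\<close>)
  also have "(%w. \<lambda>i\<in>?I. decode (w i)) -` {w \<in> space P. restrict w J \<in> B} Int space Q.lim = Q.emb ?I J ?X" proof -
   have 1: "restrict (\<lambda>i\<in>?I. decode (w i)) J = (\<lambda>i\<in>J. decode (w i))" for w using J(2) by (auto simp: fun_eq_iff restrict_def)
   have 3: "(\<lambda>i\<in>J. decode (restrict w J i)) = (\<lambda>i\<in>J. decode (w i))" for w by (auto simp: fun_eq_iff restrict_def)
   have 2: "(\<lambda>i\<in>?I. decode (w i)) \<in> space P" for w using decode_closed by (auto simp: spP space_PiM space_M)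
   have 4: "restrict w J \<in> space (PiM J (%_. borel))" for w :: "real => nat => real" by (simp add: space_PiM)
   have 5: "space Q.lim = (\<Pi>\<^sub>E i\<in>?I. space borel)" by (simp add: space_PiM)
   show ?thesis proof (rule Set.set_eqI)
    fix w
    show "w \<in> (%w. \<lambda>i\<in>?I. decode (w i)) -` {w \<in> space P. restrict w J \<in> B} Int space Q.lim \<longleftrightarrow> w \<in> Q.emb ?I J ?X"
     unfolding prod_emb_def Int_iff vimage_eq mem_Collect_eq 1 3 5 using 2 4 by blast
   qed
  qed
  also have "emeasure Q.lim (Q.emb ?I J ?X) = emeasure (QJ J) ?X" by (rule Q.emeasure_lim_emb[OF J(2,1) X])
  also have "... = emeasure (PJ J) ((%w. \<lambda>j\<in>J. code (w j)) -` ?X Int space (PJ J))" unfolding QJ_def by (rule emeasure_distr[OF code_paths X])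
  also have "(%w. \<lambda>j\<in>J. code (w j)) -` ?X Int space (PJ J) = B" proof -
   have "(\<lambda>i\<in>J. decode ((\<lambda>j\<in>J. code (w j)) i)) = w" if "w \<in> space (paths J)" for w
    using that decode_code by (auto simp: space_PiM space_M PiE_iff extensional_def fun_eq_iff)
   then show ?thesis using sets.sets_into_space[OF B] by (auto simp: space_PiM)
  qed
  finally show ?thesis .
 qed
 ultimately show ?thesis using that by blast
qed

end

context spectral_chain
begin

lemma heat_kernel_measurable: assumes H: "is_heat_kernel H" and t: "0 < t" shows "H t \<in> borel_measurable M" proof -
 have "{z \<in> space M. z = \<one>} = {\<one>}" by (auto simp: space_M)
 then have m: "(%z. if z = \<one> then H t \<one> else enn2real (k t z)) \<in> borel_measurable M"
  using one_null(1) by (intro measurable_If[OF borel_measurable_const borel_measurable_enn2real[OF k_measurable]]) (simp only:)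
 have "(if z = \<one> then H t \<one> else enn2real (k t z)) = H t z" if z: "z \<in> space M" for z proof (cases "z = \<one>")
  case False
  then obtain l where l: "z \<in> W l - W (Suc l)" using level_exists[of z] z by (auto simp: space_M)
  show ?thesis using False k_level[OF H t l] heat_kernel_pos[OF H t l] by simp
 qed simp
 then show ?thesis using iffD1[OF measurable_cong[of M "%z. if z = \<one> then H t \<one> else enn2real (k t z)" "H t" borel] m] by blast
qed

lemma density_k: assumes "is_heat_kernel H" "0 < t" shows "density M (k t) = density M (%z. ennreal (H t z))"
 using heat_kernel_measurable[OF assms] k_heat_kernel[OF assms] by (intro density_cong) auto

subsection \<open>Stochastic continuity\<close>

lemma increment_bound: assumes H: "is_heat_kernel H" and t: "0 < t" and P: "prob_space R" and D: "distributed R M Y (%z. ennreal (H t z))"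
 shows "measure R {w \<in> space R. Y w ~: W n} <= 1 - exp (- (t * \<phi> n))" proof -
 interpret R: prob_space R by (rule P)
 have Y: "Y \<in> measurable R M" and d: "distr R M Y = density M (%z. ennreal (H t z))" using D by (auto simp: distributed_def)
 have S: "{w \<in> space R. Y w \<in> W n} \<in> sets R" using measurable_sets[OF Y W_sets[of n]] by (simp add: vimage_def Int_def conj_commute)
 have "emeasure R {w \<in> space R. Y w \<in> W n} = emeasure (distr R M Y) (W n)" using W_sets by (subst emeasure_distr[OF Y]) (auto intro: arg_cong[of _ _ "emeasure R"])
 also have "... = (\<integral>\<^sup>+z. k t z * indicator (W n) z \<partial>M)" unfolding d density_k[OF H t, symmetric] using W_sets by (intro emeasure_density) auto
 finally have "ennreal (exp (- (t * \<phi> n))) <= emeasure R {w \<in> space R. Y w \<in> W n}" using integral_k_W(1)[OF t, of n] by simp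
 then have "exp (- (t * \<phi> n)) <= measure R {w \<in> space R. Y w \<in> W n}" by (simp add: R.emeasure_eq_measure)
 moreover have "measure R {w \<in> space R. Y w ~: W n} = 1 - measure R {w \<in> space R. Y w \<in> W n}" proof -
  have "{w \<in> space R. Y w ~: W n} = space R - {w \<in> space R. Y w \<in> W n}" by blast
  then show ?thesis using R.prob_compl[OF S] by (simp only:)
 qed
 ultimately show ?thesis by simp
qed

text \<open>The quotient of the positions at \<open>s\<close> and \<open>t\<close> is the increment
  from the smaller to the larger time or its inverse, and \<open>W n\<close> is closed under
  inversion; so \<open>increment_bound\<close> applies with time
  \<open>\<bar>s - t\<bar>\<close>.\<close>

lemma stochastic_continuity: assumes H: "is_heat_kernel H" and P: "prob_space R" and m: "!!t. 0 <= t ==> \<xi> t \<in> measurable R M"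
  and D: "!!s t. 0 <= s ==> s < t ==> distributed R M (%w. dv (\<xi> t w) (\<xi> s w)) (%z. ennreal (H (t - s) z))" and t: "0 <= t" and U: "W n <= U"
 shows "((%s. measure R {w \<in> space R. dv (\<xi> s w) (\<xi> t w) ~: U}) \<longlongrightarrow> 0) (at t within {0..})" proof -
 interpret R: prob_space R by (rule P)
 have bd: "measure R {w \<in> space R. dv (\<xi> s w) (\<xi> t w) ~: U} <= 1 - exp (- (\<bar>s - t\<bar> * \<phi> n))" if s: "0 <= s" "s ~= t" for s proof -
  define a b where "a = min s t" and "b = max s t"
  have ab: "0 <= a" "a < b" "b - a = \<bar>s - t\<bar>" using s t by (auto simp: a_def b_def)
  have C: "\<xi> s w \<in> C" "\<xi> t w \<in> C" if "w \<in> space R" for w using measurable_space[OF m that] s t by (auto simp: space_M)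
  have sub: "{w \<in> space R. dv (\<xi> s w) (\<xi> t w) ~: U} <= {w \<in> space R. dv (\<xi> b w) (\<xi> a w) ~: W n}" proof
   fix w assume "w \<in> {w \<in> space R. dv (\<xi> s w) (\<xi> t w) ~: U}"
   then have w: "w \<in> space R" "dv (\<xi> s w) (\<xi> t w) ~: W n" using U by auto
   then show "w \<in> {w \<in> space R. dv (\<xi> b w) (\<xi> a w) ~: W n}" using W_dv_commute[OF C[OF w(1)], of n] by (cases "s < t") (auto simp: a_def b_def)
  qed
  have Y: "(%w. dv (\<xi> b w) (\<xi> a w)) \<in> measurable R M" using D[OF ab(1,2)] by (simp add: distributed_def)
  have "{w \<in> space R. dv (\<xi> b w) (\<xi> a w) ~: W n} = space R - (%w. dv (\<xi> b w) (\<xi> a w)) -` W n Int space R" by auto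
  then have "{w \<in> space R. dv (\<xi> b w) (\<xi> a w) ~: W n} \<in> sets R" using measurable_sets[OF Y W_sets[of n]] by auto
  then have "measure R {w \<in> space R. dv (\<xi> s w) (\<xi> t w) ~: U} <= measure R {w \<in> space R. dv (\<xi> b w) (\<xi> a w) ~: W n}"
   by (rule R.finite_measure_mono[OF sub])
  also have "... <= 1 - exp (- ((b - a) * \<phi> n))" using ab by (intro increment_bound[OF H _ P D]) auto
  finally show ?thesis unfolding ab(3) .
 qed
 have "((%s. 1 - exp (- (\<bar>s - t\<bar> * \<phi> n))) \<longlongrightarrow> 1 - exp (- (\<bar>t - t\<bar> * \<phi> n))) (at t within {0..})" by (intro tendsto_intros)
 then have lim: "((%s. 1 - exp (- (\<bar>s - t\<bar> * \<phi> n))) \<longlongrightarrow> 0) (at t within {0..})" by simp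
 show ?thesis proof (rule Lim_null_comparison[OF _ lim])
  show "\<forall>\<^sub>F s in at t within {0..}. norm (measure R {w \<in> space R. dv (\<xi> s w) (\<xi> t w) ~: U}) <= 1 - exp (- (\<bar>s - t\<bar> * \<phi> n))"
   unfolding eventually_at_filter using bd by simp
 qed
qed

end

context complete_chain
begin

subsection \<open>Existence of the process\<close>

lemma at0_measurable: assumes "sets R = sets (PiM {0<..} (%_. M))" shows "(%w. at0 w t) \<in> measurable R M" proof (cases "t <= 0")
 case False
 then have "(%w. w t) \<in> measurable (PiM {0<..} (%_. M)) M" by (intro measurable_component_singleton) auto
 then show ?thesis using False unfolding measurable_cong_sets[OF assms refl] by (simp add: at0_def)
qed (simp add: at0_def space_M)

definition steps :: "(nat => real) => nat => (real => 'a) => 'a" where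
 "steps \<tau> i w = (if i = 0 then at0 w (\<tau> 0) else dv (at0 w (\<tau> i)) (at0 w (\<tau> (i - 1))))"

text \<open>If the first time is 0 the initial step is deterministic, and its law is the point mass
  at the unit, which has no density; all other laws are given by \<open>k\<close>.\<close>

definition step_law :: "(nat => real) => nat => 'a set => ennreal" where
 "step_law \<tau> i B = (if i = 0 & \<tau> 0 = 0 then indicator B \<one>
  else \<integral>\<^sup>+z. k (\<tau> i - (if i = 0 then 0 else \<tau> (i - 1))) z * indicator B z \<partial>M)"

lemma steps_measurable: assumes "sets R = sets (PiM {0<..} (%_. M))" shows "steps \<tau> i \<in> measurable R M" proof (cases "i = 0")
 case True
 then show ?thesis using at0_measurable[OF assms, of "\<tau> 0"] by (simp add: steps_def[abs_def])
next
 case False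
 from measurable_compose[OF measurable_Pair[OF at0_measurable[OF assms] at0_measurable[OF assms]] dv_measurable]
 show ?thesis using False by (simp add: steps_def[abs_def])
qed

context
 fixes P :: "(real => 'a) measure" and L :: nat and \<tau> :: "nat => real" assumes P: "prob_space P" and sets_P: "sets P = sets (PiM {0<..} (%_. M))"
  and fdd: "!!J B. finite J ==> J <= {0<..} ==> B \<in> sets (paths J) ==>
   emeasure P {w \<in> space P. restrict w J \<in> B} = emeasure (PJ J) B" and \<tau>: "0 <= \<tau> 0" "ALL i<L. \<tau> i < \<tau> (Suc i)"
begin

lemma \<tau>_less: "i < j ==> j <= L ==> \<tau> i < \<tau> j" proof (induction j)
 case (Suc j)
 have "\<tau> j < \<tau> (Suc j)" using \<tau>(2) Suc.prems by simp
 then show ?case using Suc by (cases "i = j") auto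
qed simp

lemma \<tau>_inj: "inj_on \<tau> {..L}" proof (rule inj_onI)
 fix i j assume "i \<in> {..L}" "j \<in> {..L}" "\<tau> i = \<tau> j"
 then show "i = j" using \<tau>_less[of i j] \<tau>_less[of j i] by (cases i j rule: linorder_cases) auto
qed

lemma \<tau>_pos: "i <= L ==> 0 < i ==> 0 < \<tau> i" using \<tau>_less[of 0 i] \<tau>(1) by simp

lemma space_P: "space P = space (PiM {0<..} (%_. M))" by (rule sets_eq_imp_space_eq[OF sets_P])

text \<open>The steps at positive times are the increments along \<open>J\<close>, whose joint law
  is \<open>PJ_increments\<close>; a first time equal to 0 is treated apart, since it is not an
  index of the path space.\<close>

lemma joint_law: assumes B: "!!i. i <= L ==> B i \<in> sets M"
 shows "emeasure P {w \<in> space P. ALL i:{..L}. steps \<tau> i w \<in> B i} = (\<Prod>i\<le>L. step_law \<tau> i (B i))" proof -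
 define I where "I = {i. i <= L & 0 < \<tau> i}"
 define J where "J = \<tau> ` I"
 define D where "D t = B (the_inv_into {..L} \<tau> t)" for t
 have IL: "I <= {..L}" and fI: "finite I" by (auto simp: I_def)
 have J: "finite J" "J <= {0<..}" using fI by (auto simp: J_def I_def)
 have D\<tau>: "D (\<tau> i) = B i" if "i \<in> I" for i using the_inv_into_f_f[OF \<tau>_inj, of i] that IL by (auto simp: D_def)
 have DJ: "D t \<in> sets M" if "t \<in> J" for t using that B IL by (auto simp: J_def D\<tau>)
 \<comment> \<open>The predecessor in \<open>J\<close> is the neighbouring time
   \<open>\<tau> (i - 1)\<close> even when that time is 0 and so absent from \<open>J\<close>: the
   default 0 of \<open>pd\<close> then gives the same number.\<close>
 have prev: "pd J (\<tau> i) = (if i = 0 then 0 else \<tau> (i - 1))" if i: "i \<in> I" for i unfolding pd_def proof (rule Max_eqI)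
  have iL: "i <= L" "i - 1 <= L" using i by (auto simp: I_def)
  show "finite (insert 0 {s \<in> J. s < \<tau> i})" using J(1) by simp
  show "(if i = 0 then 0 else \<tau> (i - 1)) \<in> insert 0 {s \<in> J. s < \<tau> i}" proof (cases "i = 0 \<or> \<tau> (i - 1) <= 0")
   case True
   have "\<tau> (i - 1) = 0" if "i ~= 0" "\<tau> (i - 1) <= 0" using \<tau>_pos[OF iL(2)] \<tau>(1) that by (cases "i - 1 = 0") auto
   then show ?thesis using True by auto
  next
   case False
   then have "i - 1 \<in> I" "\<tau> (i - 1) < \<tau> i" using i \<tau>_less[of "i - 1" i] by (auto simp: I_def)
   then show ?thesis using False by (auto simp: J_def)
  qed
  fix s assume "s \<in> insert 0 {s \<in> J. s < \<tau> i}"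
  then consider "s = 0" | j where "j \<in> I" "s = \<tau> j" "\<tau> j < \<tau> i" by (auto simp: J_def)
  then show "s <= (if i = 0 then 0 else \<tau> (i - 1))" proof cases
   case 1
   then show ?thesis using \<tau>(1) \<tau>_pos[OF iL(2)] by (cases "i - 1 = 0") (auto intro: less_imp_le)
  next
   case (2 j)
   have "j < i" using \<tau>_less[of i j] 2 by (cases i j rule: linorder_cases) (auto simp: I_def)
   then have "j = i - 1 \<or> j < i - 1" by auto
   then show ?thesis using \<tau>_less[OF _ iL(2), of j] 2 \<open>j < i\<close> by (auto intro: less_imp_le)
  qed
 qed
 have incs: "inc J (restrict w J) (\<tau> i) = steps \<tau> i w" if w: "w \<in> space P" and i: "i \<in> I" for w i proof -
  have pos: "0 < \<tau> i" and tJ: "\<tau> i \<in> J" using i by (auto simp: I_def J_def)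
  have a: "at0 (restrict w J) (pd J (\<tau> i)) = at0 w (pd J (\<tau> i))" using pd_mem[OF J(1), of "\<tau> i"] by (auto simp: at0_def)
  have "w (\<tau> i) \<in> C" using w pos by (auto simp: space_P space_PiM space_M)
  then show ?thesis unfolding inc_def a[unfolded prev[OF i]] prev[OF i] using pos tJ by (cases "i = 0") (simp_all add: steps_def at0_def)
 qed
 let ?S = "{x \<in> space (paths J). ALL t:J. inc J x t \<in> D t}"
 have S: "?S \<in> sets (paths J)" proof (rule sets.sets_Collect_finite_All[OF _ J(1)])
  fix t assume t: "t \<in> J"
  have "(%x. inc J x t) -` D t Int space (paths J) = {x \<in> space (paths J). inc J x t \<in> D t}" by auto
  then show "{x \<in> space (paths J). inc J x t \<in> D t} \<in> sets (paths J)" using measurable_sets[OF inc_measurable[OF J(1) t] DJ[OF t]] by simp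
 qed
 have mem: "restrict w J \<in> ?S \<longleftrightarrow> (ALL i:I. steps \<tau> i w \<in> B i)" if w: "w \<in> space P" for w proof -
  have "restrict w J \<in> space (paths J)" using w J(2) by (auto simp: space_P space_PiM)
  then show ?thesis using incs[OF w] D\<tau> by (simp add: J_def)
 qed
 have law: "emeasure P {w \<in> space P. ALL i:I. steps \<tau> i w \<in> B i} = (\<Prod>i\<in>I. step_law \<tau> i (B i))" proof -
  have "{w \<in> space P. ALL i:I. steps \<tau> i w \<in> B i} = {w \<in> space P. restrict w J \<in> ?S}" using mem by blast
  then have "emeasure P {w \<in> space P. ALL i:I. steps \<tau> i w \<in> B i} = emeasure (PJ J) ?S" using fdd[OF J S] by simp
  also have "... = (\<Prod>t\<in>J. \<integral>\<^sup>+z. k (t - pd J t) z * indicator (D t) z \<partial>M)" by (rule PJ_increments[OF J DJ])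
  also have "... = (\<Prod>i\<in>I. \<integral>\<^sup>+z. k (\<tau> i - pd J (\<tau> i)) z * indicator (D (\<tau> i)) z \<partial>M)"
   unfolding J_def by (rule prod.reindex[OF inj_on_subset[OF \<tau>_inj IL], unfolded comp_def])
  also have "... = (\<Prod>i\<in>I. step_law \<tau> i (B i))" by (intro prod.cong refl) (simp add: prev D\<tau> step_law_def, auto simp: I_def)
  finally show ?thesis .
 qed
 show ?thesis proof (cases "\<tau> 0 = 0")
  case False
  have "0 < \<tau> i" if "i <= L" for i using \<tau>_pos[OF that] \<tau>(1) False by (cases "i = 0") auto
  then have "I = {..L}" by (auto simp: I_def)
  then show ?thesis using law by simp
 next
  case True
  then have I: "{..L} = insert 0 I" "0 ~: I" using \<tau>_pos by (auto simp: I_def)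
  have "steps \<tau> 0 w = \<one>" for w using True by (simp add: steps_def at0_def)
  then have "{w \<in> space P. ALL i:{..L}. steps \<tau> i w \<in> B i} = (if \<one> \<in> B 0 then {w \<in> space P. ALL i:I. steps \<tau> i w \<in> B i} else {})"
   unfolding I(1) by auto
  moreover have "step_law \<tau> 0 (B 0) = indicator (B 0) \<one>" using True by (simp add: step_law_def)
  ultimately show ?thesis unfolding I(1) using law fI I(2) by (simp add: indicator_def)
 qed
qed

lemma step_law_C: "i <= L ==> step_law \<tau> i C = 1" proof -
 assume i: "i <= L"
 have "0 < \<tau> i - (if i = 0 then 0 else \<tau> (i - 1))" if "~ (i = 0 & \<tau> 0 = 0)" using \<tau>(1) \<tau>_less[of "i - 1" i] that i by (cases "i = 0") auto
 then have "(\<integral>\<^sup>+z. k (\<tau> i - (if i = 0 then 0 else \<tau> (i - 1))) z \<partial>M) = 1" if "~ (i = 0 & \<tau> 0 = 0)"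
  using that by (intro integral_k_W(2)) blast
 moreover have "(\<integral>\<^sup>+z. k u z * indicator C z \<partial>M) = (\<integral>\<^sup>+z. k u z \<partial>M)" for u by (intro nn_integral_cong) (simp add: space_M)
 ultimately show ?thesis by (simp add: step_law_def)
qed

lemma C_sets: "C \<in> sets M" using sets.top[of M] by (simp add: space_M)

text \<open>Steps without a condition are given the whole group, which has mass 1 under every step
  law.\<close>

lemma joint_law_subset: assumes K: "K <= {..L}" and B: "!!i. i \<in> K ==> B i \<in> sets M"
 shows "emeasure P {w \<in> space P. ALL i:K. steps \<tau> i w \<in> B i} = (\<Prod>i\<in>K. step_law \<tau> i (B i))" proof -
 let ?B = "%i. if i \<in> K then B i else C"
 have sC: "steps \<tau> i w \<in> C" if "w \<in> space P" for i w using measurable_space[OF steps_measurable[OF sets_P] that] by (simp add: space_M)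
 have "{w \<in> space P. ALL i:K. steps \<tau> i w \<in> B i} = {w \<in> space P. ALL i:{..L}. steps \<tau> i w \<in> ?B i}" using K sC by auto
 also have "emeasure P ... = (\<Prod>i\<le>L. step_law \<tau> i (?B i))" using B C_sets by (intro joint_law) auto
 also have "... = (\<Prod>i\<in>K. step_law \<tau> i (?B i))" using K step_law_C by (intro prod.mono_neutral_right) auto
 finally show ?thesis by simp
qed

lemma steps_indep: "prob_space.indep_vars P (%_. M) (steps \<tau>) {..L}" proof -
 interpret P: prob_space P by (rule P)
 let ?F = "%i. {steps \<tau> i -` B Int space P |B. B \<in> sets M}"
 have one: "step_law \<tau> i B = ennreal (measure P (steps \<tau> i -` B Int space P))" if "i <= L" "B \<in> sets M" for i B proof -
  have "{w \<in> space P. ALL j:{i}. steps \<tau> j w \<in> B} = steps \<tau> i -` B Int space P" by auto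
  then show ?thesis using joint_law_subset[of "{i}" "%_. B"] that by (simp add: P.emeasure_eq_measure)
 qed
 have "P.indep_sets ?F {..L}" unfolding P.indep_sets_def proof (intro conjI ballI allI impI)
  fix i assume "i \<in> {..L}"
  show "?F i <= sets P" using measurable_sets[OF steps_measurable[OF sets_P]] by auto
 next
  fix K A assume K: "K <= {..L}" "K ~= {}" "finite K" and A: "A \<in> Pi K ?F"
  then have "ALL i:K. EX B. A i = steps \<tau> i -` B Int space P & B \<in> sets M" by auto
  from bchoice[OF this] obtain B where "ALL i:K. A i = steps \<tau> i -` B i Int space P & B i \<in> sets M" ..
  then have B: "A i = steps \<tau> i -` B i Int space P" "B i \<in> sets M" if "i \<in> K" for i using that by auto
  have "(\<Inter>i\<in>K. A i) = {w \<in> space P. ALL i:K. steps \<tau> i w \<in> B i}" using K(2) B(1) by auto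
  then have "ennreal (measure P (\<Inter>i\<in>K. A i)) = (\<Prod>i\<in>K. step_law \<tau> i (B i))" using joint_law_subset[OF K(1) B(2)] by (simp add: P.emeasure_eq_measure)
  also have "... = (\<Prod>i\<in>K. ennreal (measure P (A i)))" using one K(1) B by (intro prod.cong) auto
  also have "... = ennreal (\<Prod>i\<in>K. measure P (A i))" by (intro prod_ennreal) auto
  finally show "measure P (\<Inter>i\<in>K. A i) = (\<Prod>i\<in>K. measure P (A i))" by (simp add: prod_nonneg)
 qed
 then show ?thesis unfolding P.indep_vars_def2 using steps_measurable[OF sets_P] by simp
qed

lemma step_distributed: assumes H: "is_heat_kernel H" and i: "0 < i" "i <= L" shows "distributed P M (steps \<tau> i) (%z. ennreal (H (\<tau> i - \<tau> (i - 1)) z))"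
 unfolding distributed_def proof (intro conjI)
 let ?t = "\<tau> i - \<tau> (i - 1)"
 have t: "0 < ?t" using \<tau>_less[of "i - 1" i] i by simp
 show m: "steps \<tau> i \<in> measurable P M" by (rule steps_measurable[OF sets_P])
 show "(%z. ennreal (H ?t z)) \<in> borel_measurable M" using heat_kernel_measurable[OF H t] by simp
 have "distr P M (steps \<tau> i) = density M (k ?t)" proof (rule measure_eqI)
  fix B assume "B \<in> sets (distr P M (steps \<tau> i))"
  then have B: "B \<in> sets M" by simp
  have "{w \<in> space P. ALL j:{i}. steps \<tau> j w \<in> B} = steps \<tau> i -` B Int space P" by auto
  then show "emeasure (distr P M (steps \<tau> i)) B = emeasure (density M (k ?t)) B"
   using joint_law_subset[of "{i}" "%_. B"] i B m by (simp add: emeasure_distr emeasure_density step_law_def)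
 qed simp
 then show "distr P M (steps \<tau> i) = density M (%z. ennreal (H ?t z))" by (simp only: density_k[OF H t])
qed

end

theorem process_exists: assumes H: "is_heat_kernel H" shows "EX (P :: (real => 'a) measure) \<xi>. prob_space P & (ALL t>=0. \<xi> t \<in> measurable P M) &
  (ALL L \<tau>. 0 <= \<tau> 0 & (ALL i<L. \<tau> i < \<tau> (Suc i)) --> prob_space.indep_vars P (%_. M)
   (%i w. if i = 0 then \<xi> (\<tau> 0) w else dv (\<xi> (\<tau> i) w) (\<xi> (\<tau> (i - 1)) w)) {..L}) &
  (ALL s t. 0 <= s & s < t --> distributed P M (%w. dv (\<xi> t w) (\<xi> s w)) (%z. ennreal (H (t - s) z))) &
  (ALL w. \<xi> 0 w = \<one>)" proof -
 obtain P :: "(real => 'a) measure" where P: "prob_space P" "sets P = sets (PiM {0<..} (%_. M))"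
  "!!J B. finite J ==> J <= {0<..} ==> B \<in> sets (paths J) ==>
   emeasure P {w \<in> space P. restrict w J \<in> B} = emeasure (PJ J) B" using kolmogorov by blast
 define \<xi> where "\<xi> t w = at0 w t" for t and w :: "real => 'a"
 have steps: "(%i w. if i = 0 then \<xi> (\<tau> 0) w else dv (\<xi> (\<tau> i) w) (\<xi> (\<tau> (i - 1)) w)) = steps \<tau>" for \<tau>
  by (simp add: fun_eq_iff steps_def \<xi>_def)
 have "distributed P M (%w. dv (\<xi> t w) (\<xi> s w)) (%z. ennreal (H (t - s) z))" if st: "0 <= s" "s < t" for s t proof -
  \<comment> \<open>The increment over a single interval is step 1 for a time sequence with two
    points.\<close>
  let ?\<tau> = "%i::nat. if i = 0 then s else t"
  have "steps ?\<tau> 1 = (%w. dv (\<xi> t w) (\<xi> s w))" by (simp add: fun_eq_iff steps_def \<xi>_def)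
  moreover have "distributed P M (steps ?\<tau> 1) (%z. ennreal (H (?\<tau> 1 - ?\<tau> (1 - 1)) z))" by (rule step_distributed[where L = 1, OF P]) (use st H in auto)
  ultimately show ?thesis by simp
 qed
 moreover have "prob_space.indep_vars P (%_. M) (steps \<tau>) {..L}" if "0 <= \<tau> 0 & (ALL i<L. \<tau> i < \<tau> (Suc i))" for \<tau> L
  using that by (intro steps_indep[OF P]) auto
 moreover have "\<xi> t \<in> measurable P M" for t proof -
  have "\<xi> t = (%w. at0 w t)" by (simp add: \<xi>_def fun_eq_iff)
  then show ?thesis using at0_measurable[OF P(2), of t] by (simp only:)
 qed
 moreover have "\<xi> 0 w = \<one>" for w by (simp add: \<xi>_def at0_def)
 ultimately show ?thesis using P(1) by (intro exI[of _ P] exI[of _ \<xi>]) (simp add: steps)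
qed

end

section \<open>Transfer of the abstract results to the tower\<close>

text \<open>\<open>V_div\<close> and the abstract division are identified only for divisors in
  \<open>V\<close>, so notions about processes have to be compared on the sample space, where the
  values lie in \<open>V\<close>.\<close>

lemma indep_vars_cong_space: assumes "prob_space P" "!!i w. i \<in> I ==> w \<in> space P ==> Y i w = Z i w"
 shows "prob_space.indep_vars P M' Y I \<longleftrightarrow> prob_space.indep_vars P M' Z I" proof -
 interpret P: prob_space P by (rule assms(1))
 have v: "Y i -` B Int space P = Z i -` B Int space P" if "i \<in> I" for i B using assms(2)[OF that] by auto
 have m: "Y i \<in> measurable P (M' i) \<longleftrightarrow> Z i \<in> measurable P (M' i)" if "i \<in> I" for i by (rule measurable_cong) (rule assms(2)[OF that])
 have s: "P.indep_sets (%i. {Y i -` B Int space P |B. B \<in> sets (M' i)}) I \<longleftrightarrow> P.indep_sets (%i. {Z i -` B Int space P |B. B \<in> sets (M' i)}) I"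
  by (rule P.indep_sets_cong[OF refl]) (simp add: v)
 show ?thesis unfolding P.indep_vars_def2 s using m by blast
qed

lemma distributed_cong_space: assumes "!!w. w \<in> space P ==> Y w = Z w" shows "distributed P M Y f \<longleftrightarrow> distributed P M Z f" proof -
 have "distr P M Y = distr P M Z" by (rule distr_cong) (use assms in auto)
 moreover have "Y \<in> measurable P M \<longleftrightarrow> Z \<in> measurable P M" by (rule measurable_cong) (rule assms)
 ultimately show ?thesis by (simp add: distributed_def)
qed

context tower
begin

lemma level_eq: assumes "y \<in> W l - W (Suc l)" shows "level K v y = l" unfolding level_def proof (rule the_equality)
 show "y \<in> W l - W (Suc l)" by (rule assms)
 fix k assume k: "y \<in> W k - W (Suc k)"
 have "~ k < l" using W_div_le[of "Suc k" l y] assms k by auto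
 moreover have "~ l < k" using W_div_le[of "Suc l" k y] assms k by auto
 ultimately show "k = l" by simp
qed

lemma n_m_less: "n * m n < Suc n * m (Suc n)" proof (cases "n = 0")
 case False
 then have "n * m n <= n * m (Suc n)" using m_le[of n "Suc n"] by simp
 also have "... < Suc n * m (Suc n)" using m_pos[of "Suc n"] by simp
 finally show ?thesis .
qed (use m_pos[of "Suc 0"] in simp)

end

locale haar_tower = tower +
 fixes \<mu> :: "(nat => 'a) measure" and \<alpha> :: real assumes haar: "normalized_haar K v \<mu>" and \<alpha>: "0 < \<alpha>"
begin

lemma phi_0: "phi K v \<alpha> 0 = 0" and phi_Suc: "phi K v \<alpha> (Suc n) = real q powr (\<alpha> * real (Suc n * m (Suc n)))" by (simp_all add: phi_def)

lemma phi_less: "phi K v \<alpha> n < phi K v \<alpha> (Suc n)" proof (cases n)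
 case 0
 then show ?thesis using q_gt_1 by (simp add: phi_def)
next
 case (Suc k)
 have "\<alpha> * real (n * m n) < \<alpha> * real (Suc n * m (Suc n))" using n_m_less[of n] \<alpha> by (intro mult_strict_left_mono) (simp_all only: of_nat_less_iff)
 then have "real q powr (\<alpha> * real (n * m n)) < real q powr (\<alpha> * real (Suc n * m (Suc n)))" by (rule powr_less_mono[OF _ q_gt_1])
 then show ?thesis using Suc by (simp only: phi_Suc)
qed

text \<open>Every \<open>m (Suc n)\<close> is at least 1, so the reciprocals are dominated by a
  geometric series with ratio \<open>1 / (real q powr \<alpha>)\<close>.\<close>

lemma phi_summable: "summable (%n. 1 / phi K v \<alpha> (Suc n))" proof (rule summable_comparison_test'[of "%n. (1 / (real q powr \<alpha>)) ^ Suc n" 0])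
 have "1 < real q powr \<alpha>" using q_gt_1 \<alpha> by simp
 then have "summable (%n. (1 / (real q powr \<alpha>)) ^ n)" by (intro summable_geometric) (simp add: divide_less_eq)
 then show "summable (%n. (1 / (real q powr \<alpha>)) ^ Suc n)" by (subst summable_Suc_iff)
next
 fix n :: nat
 have "(real q powr \<alpha>) ^ Suc n = real q powr (\<alpha> * real (Suc n))" using q_gt_1 by (simp only: powr_power[of _ "Suc n", symmetric] powr_powr[symmetric] powr_realpow) (simp add: powr_powr powr_realpow[symmetric] del: power_Suc)
 also have "... <= phi K v \<alpha> (Suc n)" proof -
  have "Suc n * 1 <= Suc n * m (Suc n)" using m_pos[of "Suc n"] by (intro mult_le_mono2) simp
  then have "real (Suc n) <= real (Suc n * m (Suc n))" by (simp only: of_nat_le_iff mult_1_right)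
  then show ?thesis unfolding phi_Suc using q_gt_1 \<alpha> by (intro powr_mono mult_left_mono) auto
 qed
 finally have "1 / phi K v \<alpha> (Suc n) <= 1 / (real q powr \<alpha>) ^ Suc n" using q_gt_1 by (intro divide_left_mono mult_pos_pos) (auto simp: phi_Suc)
 then show "norm (1 / phi K v \<alpha> (Suc n)) <= (1 / (real q powr \<alpha>)) ^ Suc n" by (simp add: phi_Suc power_one_over del: power_Suc)
qed

text \<open>The isolated term \<open>- (q powr \<alpha>)\<close> of \<open>F_kernel\<close> is the
  summand for \<open>n = 0\<close>, because \<open>phi\<close> vanishes at 0 and
  \<open>m 1 = 1\<close>.\<close>

lemma F_kernel_level: assumes "y \<in> W l - W (Suc l)" shows "F_kernel K v \<alpha> y = (\<Sum>n\<le>l. (phi K v \<alpha> n - phi K v \<alpha> (Suc n)) * real (q ^ (n * m n)))"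
proof -
 have "{..l} = insert 0 {1..l}" by auto
 then have "(\<Sum>n\<le>l. (phi K v \<alpha> n - phi K v \<alpha> (Suc n)) * real (q ^ (n * m n)))
   = - phi K v \<alpha> (Suc 0) + (\<Sum>n=1..l. (phi K v \<alpha> n - phi K v \<alpha> (Suc n)) * real (q ^ (n * m n)))" by (simp add: phi_0)
 also have "phi K v \<alpha> (Suc 0) = real q powr \<alpha>" using m_1 by (simp add: phi_def One_nat_def)
 also have "(\<Sum>n=1..l. (phi K v \<alpha> n - phi K v \<alpha> (Suc n)) * real (q ^ (n * m n)))
   = (\<Sum>n=1..l. (real q powr (\<alpha> * real (n * m n)) - real q powr (\<alpha> * real (Suc n * m (Suc n)))) * real q ^ (n * m n))"
  by (intro sum.cong refl) (auto simp: phi_def)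
 finally show ?thesis by (simp add: F_kernel_def level_eq[OF assms] Let_def)
qed

sublocale chain: complete_chain \<V> W "%n. q ^ (n * m n)" \<mu> "phi K v \<alpha>" "F_kernel K v \<alpha>"
proof (intro complete_chain.intro spectral_chain.intro subgroup_chain.intro subgroup_chain_axioms.intro
  spectral_chain_axioms.intro complete_chain_axioms.intro)
 show "comm_group \<V>" by (rule V_group)
 show "W 0 = carrier \<V>" by (simp add: W_0)
 show "subgroup (W n) \<V>" for n by (rule W_subgroup)
 show "W (Suc n) <= W n" for n by (rule W_decreasing)
 show "x = \<one>\<^bsub>\<V>\<^esub>" if "!!n. x \<in> W n" for x using W_separated[OF that] by simp
 show "card ((%x. {y \<in> carrier \<V>. x \<otimes>\<^bsub>\<V>\<^esub> inv\<^bsub>\<V>\<^esub> y \<in> W n}) ` carrier \<V>) = q ^ (n * m n)" for n proof -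
  have "{y \<in> carrier \<V>. x \<otimes>\<^bsub>\<V>\<^esub> inv\<^bsub>\<V>\<^esub> y \<in> W n} = {y \<in> VX. V_div x y \<in> W n}" for x
   using V_div_eq[of _ x] by (simp only: \<V>_simps) (rule Collect_cong, auto)
  then show ?thesis using W_index[of n] by simp
 qed
 show "q ^ (n * m n) < q ^ (Suc n * m (Suc n))" for n using q_gt_1 n_m_less[of n] by (intro power_strict_increasing) auto
 show "space \<mu> = carrier \<V>" "emeasure \<mu> (carrier \<V>) = 1" using haar by (auto simp: normalized_haar_def)
 show "sets \<mu> = sigma_sets (carrier \<V>)
   {S. S <= carrier \<V> & (ALL x:S. EX n. ALL y:carrier \<V>. y \<otimes>\<^bsub>\<V>\<^esub> inv\<^bsub>\<V>\<^esub> x \<in> W n --> y \<in> S)}" proof -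
  have "openin (V_top K v) S \<longleftrightarrow> S <= carrier \<V> & (ALL x:S. EX n. ALL y:carrier \<V>. y \<otimes>\<^bsub>\<V>\<^esub> inv\<^bsub>\<V>\<^esub> x \<in> W n --> y \<in> S)" for S
  proof (cases "S <= VX")
   case True
   then have "y \<otimes>\<^bsub>\<V>\<^esub> inv\<^bsub>\<V>\<^esub> x = V_div y x" if "x \<in> S" for x y using that V_div_eq[of x y] by blast
   then show ?thesis unfolding openin_V_top \<V>_simps(1) by simp
  qed (simp add: openin_V_top)
  then show ?thesis using haar by (simp add: normalized_haar_def)
 qed
 show "emeasure \<mu> ((\<otimes>\<^bsub>\<V>\<^esub>) a ` S) = emeasure \<mu> S" if "a \<in> carrier \<V>" "S \<in> sets \<mu>" for a S
  using haar that by (simp add: normalized_haar_def)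
 show "phi K v \<alpha> 0 = 0" by (rule phi_0)
 show "strict_mono (phi K v \<alpha>)" using phi_less by (simp add: strict_mono_Suc_iff)
 show "summable (%n. 1 / phi K v \<alpha> (Suc n))" by (rule phi_summable)
 show "F_kernel K v \<alpha> y = (\<Sum>n\<le>l. (phi K v \<alpha> n - phi K v \<alpha> (Suc n)) * real (q ^ (n * m n)))"
  if "y \<in> W l - W (Suc l)" for y l by (rule F_kernel_level[OF that])
 show "EX y:carrier \<V>. ALL n. y \<otimes>\<^bsub>\<V>\<^esub> inv\<^bsub>\<V>\<^esub> s n \<in> W n"
  if s: "!!n. s n \<in> carrier \<V>" and st: "!!n. s (Suc n) \<otimes>\<^bsub>\<V>\<^esub> inv\<^bsub>\<V>\<^esub> s n \<in> W n" for s proof -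
  have s': "s n \<in> VX" for n using s[of n] by simp
  have st': "V_div (s (Suc n)) (s n) \<in> W n" for n using st[of n] V_div_eq[OF s'] by simp
  obtain y where y: "y \<in> VX" "!!n. V_div y (s n) \<in> W n" using V_complete[of s, OF s' st'] by blast
  then show ?thesis using V_div_eq[OF s'] by auto
 qed
qed

lemma dv_eq: "y \<in> VX ==> chain.dv x y = V_div x y" unfolding chain.dv_def by (rule V_div_eq)

lemma space_eq: "space \<mu> = VX" using chain.space_M by simp

lemma loc_const_iff: "u \<in> loc_const K v \<longleftrightarrow> (EX l. chain.lc l u)" by (simp add: loc_const_def chain.lc_def dv_eq cong: ball_cong)

lemma D_graph_eq: "D_graph K v \<mu> \<alpha> = chain.Dg" proof -
 have "D_op K v \<mu> \<alpha> u x = chain.Dop u x" for u x unfolding D_op_def chain.Dop_def by (intro integral_cong_space) (simp_all add: space_eq dv_eq)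
 then show ?thesis by (simp add: D_graph_def chain.Dg_def loc_const_iff)
qed

text \<open>The point is the continuity of a homomorphism trivial on \<open>W n\<close>: it is
  constant on cosets, which are open.\<close>

lemma V_ann_eq: "V_ann K v n = chain.ann n" proof (intro equalityI subsetI)
 fix \<theta> assume "\<theta> \<in> V_ann K v n"
 then show "\<theta> \<in> chain.ann n" by (simp add: V_ann_def dual_def chain.ann_def)
next
 fix \<theta> assume \<theta>: "\<theta> \<in> chain.ann n"
 have "openin (V_top K v) {x \<in> VX. \<theta> x \<in> U}" for U unfolding openin_V_top proof (intro conjI ballI)
  fix x assume x: "x \<in> {x \<in> VX. \<theta> x \<in> U}"
  have "\<theta> y = \<theta> x" if "y \<in> VX" "V_div y x \<in> W n" for y using chain.lcD[OF chain.ann_lc[OF \<theta>], of y x] that x by (simp add: dv_eq)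
  then show "EX n. ALL y:VX. V_div y x \<in> W n --> y \<in> {x \<in> VX. \<theta> x \<in> U}" using x by (intro exI[of _ n]) auto
 qed auto
 then have "continuous_map (V_top K v) euclidean \<theta>" by (simp add: continuous_map_def V_top_topspace)
 then show "\<theta> \<in> V_ann K v n" using \<theta> by (simp add: V_ann_def dual_def chain.ann_def)
qed

lemma level_chars_eq: "level_chars K v n = chain.new_chars n" by (simp add: level_chars_def chain.new_chars_def V_ann_eq)

lemma G_kernel_heat: "chain.is_heat_kernel (G_kernel K v \<alpha>)" unfolding chain.is_heat_kernel_def proof (intro allI ballI)
 fix t l z assume "z \<in> W l - W (Suc l)"
 then show "G_kernel K v \<alpha> t z = (\<Sum>n\<le>l. chain.p t n * real (q ^ (n * m n)))" by (simp add: G_kernel_def level_eq chain.p_def atLeast0AtMost)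
qed

lemma kernel_integral: assumes T: "exp_semigroup \<mu> chain.A T" and t: "0 < t" and u: "u \<in> L2 \<mu>"
 shows "AE x in \<mu>. integrable \<mu> (%y. complex_of_real (G_kernel K v \<alpha> t (V_div x y)) * u y) &
  T t u x = (\<integral>y. complex_of_real (G_kernel K v \<alpha> t (V_div x y)) * u y \<partial>\<mu>)" proof -
 have i: "integrable \<mu> (%y. complex_of_real (G_kernel K v \<alpha> t (V_div x y)) * u y)
   \<longleftrightarrow> integrable \<mu> (%y. complex_of_real (G_kernel K v \<alpha> t (chain.dv x y)) * u y)" for x
  by (intro Bochner_Integration.integrable_cong refl) (simp add: dv_eq space_eq)
 have e: "(\<integral>y. complex_of_real (G_kernel K v \<alpha> t (V_div x y)) * u y \<partial>\<mu>)
   = (\<integral>y. complex_of_real (G_kernel K v \<alpha> t (chain.dv x y)) * u y \<partial>\<mu>)" for x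
  by (intro integral_cong_space refl) (simp add: dv_eq space_eq)
 note a = chain.exp_semigroup_unique[OF T u t] and b = chain.heat_kernel_integral[OF G_kernel_heat t u]
 show ?thesis unfolding i e by (rule eventually_elim2[OF a b]) (simp only: simp_thms)
qed

lemma process: "EX (P :: (real => nat => 'a) measure) \<xi>.
  indep_increments_process \<mu> (G_kernel K v \<alpha>) P \<xi> & (AE \<omega> in P. \<xi> 0 \<omega> = V_one)" proof -
 obtain P :: "(real => nat => 'a) measure" and \<xi> where P: "prob_space P" and m: "ALL t>=0. \<xi> t \<in> measurable P \<mu>"
  and ind: "ALL L \<tau>. 0 <= \<tau> 0 & (ALL i<L. \<tau> i < \<tau> (Suc i)) --> prob_space.indep_vars P (%_. \<mu>)
   (%i w. if i = 0 then \<xi> (\<tau> 0) w else chain.dv (\<xi> (\<tau> i) w) (\<xi> (\<tau> (i - 1)) w)) {..L}"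
  and dist: "ALL s t. 0 <= s & s < t --> distributed P \<mu> (%w. chain.dv (\<xi> t w) (\<xi> s w)) (%z. ennreal (G_kernel K v \<alpha> (t - s) z))"
  and zero: "ALL w. \<xi> 0 w = \<one>\<^bsub>\<V>\<^esub>" using chain.process_exists[OF G_kernel_heat] by (elim exE conjE) (rule that)
 have in_V: "\<xi> t w \<in> VX" if "0 <= t" "w \<in> space P" for t w using measurable_space[of "\<xi> t" P \<mu> w] m that by (simp add: space_eq)
 have "indep_increments_process \<mu> (G_kernel K v \<alpha>) P \<xi>" unfolding indep_increments_process_def proof (intro conjI allI impI P)
  show "\<xi> t \<in> measurable P \<mu>" if "0 <= t" for t using m that by blast
 next
  fix L :: nat and \<tau> :: "nat => real" assume \<tau>: "0 <= \<tau> 0 & (ALL i<L. \<tau> i < \<tau> (Suc i))"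
  have nn: "0 <= \<tau> i" if "i <= L" for i using that proof (induction i)
   case (Suc i)
   have "\<tau> i < \<tau> (Suc i)" using \<tau> Suc.prems by simp
   then show ?case using Suc by simp
  qed (use \<tau> in simp)
  have eq: "(if i = 0 then \<xi> (\<tau> 0) w else V_div (\<xi> (\<tau> i) w) (\<xi> (\<tau> (i - 1)) w))
    = (if i = 0 then \<xi> (\<tau> 0) w else chain.dv (\<xi> (\<tau> i) w) (\<xi> (\<tau> (i - 1)) w))" if i: "i \<in> {..L}" and w: "w \<in> space P" for i w proof -
   have "\<xi> (\<tau> (i - 1)) w \<in> VX" using i by (intro in_V nn w) simp
   then show ?thesis by (simp only: dv_eq)
  qed
  show "prob_space.indep_vars P (%_. \<mu>) (%i w. if i = 0 then \<xi> (\<tau> 0) w else V_div (\<xi> (\<tau> i) w) (\<xi> (\<tau> (i - 1)) w)) {..L}"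
   by (rule iffD2[OF indep_vars_cong_space[OF P eq] ind[rule_format, OF \<tau>]])
 next
  fix s t :: real assume st: "0 <= s & s < t"
  have eq: "V_div (\<xi> t w) (\<xi> s w) = chain.dv (\<xi> t w) (\<xi> s w)" if "w \<in> space P" for w using in_V[of s w] st that by (simp add: dv_eq)
  show "distributed P \<mu> (%w. V_div (\<xi> t w) (\<xi> s w)) (%z. ennreal (G_kernel K v \<alpha> (t - s) z))"
   by (rule iffD2[OF distributed_cong_space[OF eq] dist[rule_format, OF st]])
 qed
 moreover have "AE \<omega> in P. \<xi> 0 \<omega> = V_one" using zero by simp
 ultimately show ?thesis by blast
qed

text \<open>An open neighbourhood of the unit contains some \<open>W n\<close>, so the abstract
  estimate applies. It rests on the law of the increments alone and therefore holds for every
  process of this kind, whatever its initial distribution.\<close>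

lemma process_continuous: assumes "indep_increments_process \<mu> (G_kernel K v \<alpha>) P \<xi>" shows "stochastically_continuous K v P \<xi>"
 unfolding stochastically_continuous_def proof (intro allI impI)
 fix t :: real and U assume t: "0 <= t" and U: "openin (V_top K v) U & V_one \<in> U"
 have P: "prob_space P" and m: "!!t. 0 <= t ==> \<xi> t \<in> measurable P \<mu>"
  and dist: "!!s t. 0 <= s ==> s < t ==> distributed P \<mu> (%w. V_div (\<xi> t w) (\<xi> s w)) (%z. ennreal (G_kernel K v \<alpha> (t - s) z))"
  using assms by (auto simp: indep_increments_process_def)
 have in_V: "\<xi> t w \<in> VX" if "0 <= t" "w \<in> space P" for t w using measurable_space[OF m] that by (simp add: space_eq)
 have dist': "distributed P \<mu> (%w. chain.dv (\<xi> t w) (\<xi> s w)) (%z. ennreal (G_kernel K v \<alpha> (t - s) z))" if "0 <= s" "s < t" for s t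
 proof (rule iffD1[OF distributed_cong_space dist[OF that]])
  show "V_div (\<xi> t w) (\<xi> s w) = chain.dv (\<xi> t w) (\<xi> s w)" if "w \<in> space P" for w using in_V[OF \<open>0 <= s\<close> that] by (simp add: dv_eq)
 qed
 obtain n where n: "ALL y:VX. V_div y V_one \<in> W n --> y \<in> U" using U unfolding openin_V_top by blast
 have sub: "W n <= U" proof
  fix y assume y: "y \<in> W n"
  have "V_div y V_one = y" using chain.dv_one[of y] W_X[OF y] dv_eq[OF V_one_in, of y] by simp
  then show "y \<in> U" using n y W_X[OF y] by simp
 qed
 have "{w \<in> space P. V_div (\<xi> s w) (\<xi> t w) ~: U} = {w \<in> space P. chain.dv (\<xi> s w) (\<xi> t w) ~: U}" for s using in_V[OF t] dv_eq by auto
 then show "((%s. measure P {w \<in> space P. V_div (\<xi> s w) (\<xi> t w) ~: U}) \<longlongrightarrow> 0) (at t within {0..})"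
  using chain.stochastic_continuity[OF G_kernel_heat P m dist' t sub] by simp
qed

end

theorem theorem1:
  fixes K :: "nat \<Rightarrow> 'a::field set"
    and v :: "nat \<Rightarrow> 'a \<Rightarrow> real"
    and \<mu> :: "(nat \<Rightarrow> 'a) measure"
    and \<alpha> :: real
  assumes "tame_tower K v"
    and "normalized_haar K v \<mu>"
    and "0 < \<alpha>"
  shows
    "essentially_selfadjoint \<mu> (D_graph K v \<mu> \<alpha>) \<and>
     purely_discrete_spectrum \<mu> (op_closure \<mu> (D_graph K v \<mu> \<alpha>)) \<and>
     op_spectrum \<mu> (op_closure \<mu> (D_graph K v \<mu> \<alpha>)) =
       range (\<lambda>n. complex_of_real (phi K v \<alpha> n)) \<and>
     (\<forall>n. op_eigenspace \<mu> (op_closure \<mu> (D_graph K v \<mu> \<alpha>)) (complex_of_real (phi K v \<alpha> n)) =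
       l2_span \<mu> (level_chars K v n)) \<and>
     (\<forall>x\<in>V K v. D_op K v \<mu> \<alpha> (\<lambda>_. 1) x = 0)
     \<and>
     (\<exists>T. exp_semigroup \<mu> (op_closure \<mu> (D_graph K v \<mu> \<alpha>)) T) \<and>
     (\<forall>T. exp_semigroup \<mu> (op_closure \<mu> (D_graph K v \<mu> \<alpha>)) T \<longrightarrow>
       (\<forall>t>0. \<forall>u\<in>L2 \<mu>. AE x in \<mu>.
          integrable \<mu> (\<lambda>y. complex_of_real (G_kernel K v \<alpha> t (V_div x y)) * u y) \<and>
          T t u x = (\<integral>y. complex_of_real (G_kernel K v \<alpha> t (V_div x y)) * u y \<partial>\<mu>))) \<and>
     (\<forall>t>0. \<forall>l. \<forall>z\<in>V_sub K v l - V_sub K v (Suc l). 0 < G_kernel K v \<alpha> t z) \<and>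
     (\<exists>(P :: (real \<Rightarrow> nat \<Rightarrow> 'a) measure) \<xi>.
        indep_increments_process \<mu> (G_kernel K v \<alpha>) P \<xi> \<and> (AE \<omega> in P. \<xi> 0 \<omega> = V_one)) \<and>
     (\<forall>(P :: 'w measure) \<xi>. indep_increments_process \<mu> (G_kernel K v \<alpha>) P \<xi> \<longrightarrow>
        stochastically_continuous K v P \<xi>)"
proof -
 interpret haar_tower K v \<mu> \<alpha> by (intro haar_tower.intro tower.intro haar_tower_axioms.intro assms)
 show ?thesis unfolding D_graph_eq chain.closure_Dg level_chars_eq proof (intro conjI allI impI ballI)
  show "essentially_selfadjoint \<mu> chain.Dg" by (rule chain.essentially_selfadjoint_Dg)
  show "purely_discrete_spectrum \<mu> chain.A" by (rule chain.discrete_A)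
  show "op_spectrum \<mu> chain.A = range (%n. complex_of_real (phi K v \<alpha> n))" by (rule chain.spectrum_A)
  show "op_eigenspace \<mu> chain.A (complex_of_real (phi K v \<alpha> n)) = l2_span \<mu> (chain.new_chars n)" for n by (rule chain.eigenspace_chars)
  show "D_op K v \<mu> \<alpha> (%_. 1) x = 0" for x by (simp add: D_op_def)
  show "EX T. exp_semigroup \<mu> chain.A T" using chain.exp_semigroup_heat by blast
  show "AE x in \<mu>. integrable \<mu> (%y. complex_of_real (G_kernel K v \<alpha> t (V_div x y)) * u y) &
    T t u x = (\<integral>y. complex_of_real (G_kernel K v \<alpha> t (V_div x y)) * u y \<partial>\<mu>)"
   if "exp_semigroup \<mu> chain.A T" "0 < t" "u \<in> L2 \<mu>" for T t u by (rule kernel_integral[OF that])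
  show "0 < G_kernel K v \<alpha> t z" if "0 < t" "z \<in> V_sub K v l - V_sub K v (Suc l)" for t l z by (rule chain.heat_kernel_pos[OF G_kernel_heat that])
  show "EX (P :: (real => nat => 'a) measure) \<xi>.
    indep_increments_process \<mu> (G_kernel K v \<alpha>) P \<xi> & (AE \<omega> in P. \<xi> 0 \<omega> = V_one)" by (rule process)
  show "stochastically_continuous K v P \<xi>" if "indep_increments_process \<mu> (G_kernel K v \<alpha>) P \<xi>"
   for P :: "'w measure" and \<xi> by (rule process_continuous[OF that])
 qed
qed

end
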